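(* Let $\mathcal{O}$ be a complete discrete valuation ring with finite residue field $\mathbb{F}_q$, maximal ideal $\mathfrak{p}$, characteristic zero and residue characteristic two. For $r\ge2$ let $G_r=\mathrm{GL}_2(\mathcal{O}/\mathfrak{p}^r)$ and let $d_r(1)=(q+1)q^{r-1}$, $d_r(2)=(q-1)q^{r-1}$, $d_r(3)=(q^2-1)q^{r-2}$. Then for $i\in\{1,2,3\}$, $$\tilde r_{d_r(i)}(G_r)\ll q^{r}$$ as functions of $r$. Moreover, the abscissa of convergence of the twist zeta function $\tilde{\zeta}_{\mathrm{GL}_2(\mathcal{O})}$ is $1$.
   Context: Representations are continuous and complex. Two representations $\rho,\sigma$ of a group $G$ are twist equivalent if $\rho\cong\sigma\otimes\chi$ for some one-dimensional representation $\chi$ of $G$; equivalence classes are called twist isoclasses, and the dimension of a twist isoclass is that of any of its members. $\tilde r_j(G)$ is the number of twist isoclasses of irreducible representations of $G$ of dimension $j$, and $\tilde\zeta_G(s)=\sum_{j\ge1}\tilde r_j(G)j^{-s}$. The abscissa of convergence is the infimum of the real $s$ for which the series converges. $f(r)\ll g(r)$ means $f(r)=O(g(r))$, i.e. there is a constant (independent of $r$) such that $f(r)$ is at most this constant times $g(r)$. *)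

theory Defs
  imports
    "HOL-Analysis.Analysis"
    "HOL-Algebra.Ideal_Product"
    "HOL-Algebra.QuotRing"
    "HOL-Algebra.Ring_Divisibility"
    "Jordan_Normal_Form.VS_Connect"
begin

section \<open>Complete discrete valuation rings\<close>

abbreviation ideal_pow :: "('a, 'b) ring_scheme \<Rightarrow> 'a set \<Rightarrow> nat \<Rightarrow> 'a set" where
  "ideal_pow R P n \<equiv> P [^]\<^bsub>ideals_set R\<^esub> n"

text \<open>A discrete valuation ring is a local principal ideal domain that is not a field; the
  parameter \<open>P\<close> is its maximal ideal.\<close>

definition dvr :: "('a, 'b) ring_scheme \<Rightarrow> 'a set \<Rightarrow> bool" where
  "dvr R P \<longleftrightarrow> principal_domain R \<and> \<not> field R \<and> (\<forall>M. maximalideal M R \<longleftrightarrow> M = P)"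

text \<open>Completeness refers to the \<open>P\<close>-adic uniform structure. Uniqueness of limits is not
  required here; in a discrete valuation ring it is automatic.\<close>

definition adic_Cauchy :: "('a, 'b) ring_scheme \<Rightarrow> 'a set \<Rightarrow> (nat \<Rightarrow> 'a) \<Rightarrow> bool" where
  "adic_Cauchy R P x \<longleftrightarrow>
     (\<forall>k. \<exists>N. \<forall>m\<ge>N. \<forall>n\<ge>N. x m \<ominus>\<^bsub>R\<^esub> x n \<in> ideal_pow R P k)"

definition adic_lim :: "('a, 'b) ring_scheme \<Rightarrow> 'a set \<Rightarrow> (nat \<Rightarrow> 'a) \<Rightarrow> 'a \<Rightarrow> bool" where
  "adic_lim R P x l \<longleftrightarrow> (\<forall>k. \<exists>N. \<forall>n\<ge>N. x n \<ominus>\<^bsub>R\<^esub> l \<in> ideal_pow R P k)"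

definition complete_dvr :: "('a, 'b) ring_scheme \<Rightarrow> 'a set \<Rightarrow> bool" where
  "complete_dvr R P \<longleftrightarrow> dvr R P \<and>
     (\<forall>x. range x \<subseteq> carrier R \<longrightarrow> adic_Cauchy R P x \<longrightarrow>
        (\<exists>l\<in>carrier R. adic_lim R P x l))"

definition ring_char :: "('a, 'b) ring_scheme \<Rightarrow> nat" where
  "ring_char R =
     (if \<exists>n::nat. n > 0 \<and> [n] \<cdot>\<^bsub>R\<^esub> \<one>\<^bsub>R\<^esub> = \<zero>\<^bsub>R\<^esub>
      then LEAST n::nat. n > 0 \<and> [n] \<cdot>\<^bsub>R\<^esub> \<one>\<^bsub>R\<^esub> = \<zero>\<^bsub>R\<^esub>
      else 0)"

text \<open>The cosets of the powers of \<open>P\<close> form a basis of this topology.\<close>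

definition adic_topology :: "('a, 'b) ring_scheme \<Rightarrow> 'a set \<Rightarrow> 'a topology" where
  "adic_topology R P = topology_generated_by (\<Union>n. a_rcosets\<^bsub>R\<^esub> (ideal_pow R P n))"


section \<open>The group \<open>GL\<^sub>2\<close>\<close>

text \<open>The tuple \<open>(a, b, c, d)\<close> is the matrix with first row \<open>a, b\<close> and second row \<open>c, d\<close>.\<close>

type_synonym 'a mat2 = "'a \<times> 'a \<times> 'a \<times> 'a"

definition mat2_monoid :: "('a, 'b) ring_scheme \<Rightarrow> 'a mat2 monoid" where
  "mat2_monoid R =
     \<lparr>carrier = carrier R \<times> carrier R \<times> carrier R \<times> carrier R,
      mult = (\<lambda>(a, b, c, d) (a', b', c', d').
        (a \<otimes>\<^bsub>R\<^esub> a' \<oplus>\<^bsub>R\<^esub> b \<otimes>\<^bsub>R\<^esub> c', a \<otimes>\<^bsub>R\<^esub> b' \<oplus>\<^bsub>R\<^esub> b \<otimes>\<^bsub>R\<^esub> d',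
         c \<otimes>\<^bsub>R\<^esub> a' \<oplus>\<^bsub>R\<^esub> d \<otimes>\<^bsub>R\<^esub> c', c \<otimes>\<^bsub>R\<^esub> b' \<oplus>\<^bsub>R\<^esub> d \<otimes>\<^bsub>R\<^esub> d')),
      one = (\<one>\<^bsub>R\<^esub>, \<zero>\<^bsub>R\<^esub>, \<zero>\<^bsub>R\<^esub>, \<one>\<^bsub>R\<^esub>)\<rparr>"

definition GL2 :: "('a, 'b) ring_scheme \<Rightarrow> 'a mat2 monoid" where
  "GL2 R = units_of (mat2_monoid R)"

definition GL2_topology :: "('a, 'b) ring_scheme \<Rightarrow> 'a set \<Rightarrow> 'a mat2 topology" where
  "GL2_topology R P =
     subtopology
       (prod_topology (adic_topology R P) (prod_topology (adic_topology R P)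
         (prod_topology (adic_topology R P) (adic_topology R P))))
       (carrier (GL2 R))"

lemma mat2_monoid_is_monoid:
  assumes "ring R"
  shows "monoid (mat2_monoid R)"
proof -
  interpret ring R by fact
  show ?thesis
    by unfold_locales
      (auto simp add: mat2_monoid_def r_distr l_distr m_assoc add.m_ac)
qed

lemma GL2_is_group: "ring R \<Longrightarrow> group (GL2 R)"
  unfolding GL2_def by (intro monoid.units_group mat2_monoid_is_monoid)


section \<open>Continuous complex representations and twist isoclasses\<close>

text \<open>A representation of dimension \<open>n\<close> is a homomorphism into \<open>GL\<^sub>n(\<complex>)\<close>, continuous
  for the given topology \<open>T\<close> on the group; continuity into the group of matrices is
  continuity of all matrix entries. Values outside the carrier are irrelevant, and
  \<open>rep_iso\<close> identifies functions that agree on the carrier.\<close>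

abbreviation GL_complex :: "nat \<Rightarrow> complex mat monoid" where
  "GL_complex n \<equiv> units_of (ring_mat TYPE(complex) n ())"

definition cont_rep ::
    "('g, 'b) monoid_scheme \<Rightarrow> 'g topology \<Rightarrow> nat \<Rightarrow> ('g \<Rightarrow> complex mat) \<Rightarrow> bool" where
  "cont_rep G T n \<rho> \<longleftrightarrow> \<rho> \<in> hom G (GL_complex n) \<and>
     (\<forall>i<n. \<forall>j<n. continuous_map T euclidean (\<lambda>g. \<rho> g $$ (i, j)))"

definition irreducible_rep ::
    "('g, 'b) monoid_scheme \<Rightarrow> 'g topology \<Rightarrow> nat \<Rightarrow> ('g \<Rightarrow> complex mat) \<Rightarrow> bool" where
  "irreducible_rep G T n \<rho> \<longleftrightarrow> cont_rep G T n \<rho> \<and> n > 0 \<and>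
     (\<forall>W. VectorSpace.subspace class_ring W (module_vec TYPE(complex) n) \<longrightarrow>
        (\<forall>g\<in>carrier G. \<forall>w\<in>W. \<rho> g *\<^sub>v w \<in> W) \<longrightarrow>
        W = {0\<^sub>v n} \<or> W = carrier_vec n)"

definition rep_iso ::
    "('g, 'b) monoid_scheme \<Rightarrow> nat \<Rightarrow> ('g \<Rightarrow> complex mat) \<Rightarrow> ('g \<Rightarrow> complex mat) \<Rightarrow> bool" where
  "rep_iso G n \<rho> \<sigma> \<longleftrightarrow>
     (\<exists>A\<in>carrier (GL_complex n). \<forall>g\<in>carrier G. A * \<rho> g = \<sigma> g * A)"

text \<open>For one-dimensional \<open>\<psi>\<close> the space \<open>\<complex>\<^sup>n \<otimes> \<complex>\<close> is \<open>\<complex>\<^sup>n\<close>, on which the tensor product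
  acts by the Kronecker product of \<open>\<sigma> g\<close> with a 1-by-1 matrix.\<close>

definition rep_twist ::
    "('g \<Rightarrow> complex mat) \<Rightarrow> ('g \<Rightarrow> complex mat) \<Rightarrow> ('g \<Rightarrow> complex mat)" where
  "rep_twist \<sigma> \<psi> = (\<lambda>g. (\<psi> g $$ (0, 0)) \<cdot>\<^sub>m \<sigma> g)"

definition twist_equiv ::
    "('g, 'b) monoid_scheme \<Rightarrow> 'g topology \<Rightarrow> nat \<Rightarrow>
     ('g \<Rightarrow> complex mat) \<Rightarrow> ('g \<Rightarrow> complex mat) \<Rightarrow> bool" where
  "twist_equiv G T n \<rho> \<sigma> \<longleftrightarrow>
     (\<exists>\<psi>. cont_rep G T 1 \<psi> \<and> rep_iso G n \<rho> (rep_twist \<sigma> \<psi>))"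

definition twist_isoclasses ::
    "('g, 'b) monoid_scheme \<Rightarrow> 'g topology \<Rightarrow> nat \<Rightarrow> ('g \<Rightarrow> complex mat) set set" where
  "twist_isoclasses G T n =
     {\<rho>. irreducible_rep G T n \<rho>} //
     {(\<rho>, \<sigma>). irreducible_rep G T n \<rho> \<and> irreducible_rep G T n \<sigma> \<and> twist_equiv G T n \<rho> \<sigma>}"

text \<open>Since \<^const>\<open>card\<close> is 0 on infinite sets, this count is meaningful only together with
  finiteness of \<^const>\<open>twist_isoclasses\<close>.\<close>

definition twist_count :: "('g, 'b) monoid_scheme \<Rightarrow> 'g topology \<Rightarrow> nat \<Rightarrow> nat" where
  "twist_count G T n = card (twist_isoclasses G T n)"

definition twist_zeta_converges ::
    "('g, 'b) monoid_scheme \<Rightarrow> 'g topology \<Rightarrow> real \<Rightarrow> bool" where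
  "twist_zeta_converges G T s \<longleftrightarrow>
     (\<forall>j\<ge>1. finite (twist_isoclasses G T j)) \<and>
     summable (\<lambda>j. real (twist_count G T (Suc j)) * real (Suc j) powr (- s))"

text \<open>The infimum is taken in the extended reals, so that it is \<open>\<infinity>\<close> if the series converges
  nowhere and \<open>- \<infinity>\<close> if it converges for all real \<open>s\<close>.\<close>

definition twist_zeta_abscissa :: "('g, 'b) monoid_scheme \<Rightarrow> 'g topology \<Rightarrow> ereal" where
  "twist_zeta_abscissa G T = Inf {ereal s | s. twist_zeta_converges G T s}"


section \<open>The dimensions \<open>d\<^sub>r(i)\<close>\<close>

definition d_dim :: "nat \<Rightarrow> nat \<Rightarrow> nat \<Rightarrow> nat" where
  "d_dim q r i =
     (if i = 1 then (q + 1) * q ^ (r - 1)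
      else if i = 2 then (q - 1) * q ^ (r - 1)
      else (q ^ 2 - 1) * q ^ (r - 2))"

end

theory Submission
  imports Defs "Jordan_Normal_Form.Spectral_Radius"
begin

text \<open>
  Write \<open>S\<^sub>r\<close> for the quotient of the ring \<open>R\<close> by the \<open>r\<close>-th power of its maximal ideal, a finite chain ring
  with \<open>q\<^sup>r\<close> elements. A continuous representation of \<open>GL\<^sub>2(R)\<close> is trivial on a congruence subgroup, since a
  complex general linear group has no small subgroups (\<open>continuous_rep_trivial_on_kernel\<close>). Hence everything
  reduces to the representations of the finite groups \<open>GL\<^sub>2(S\<^sub>r)\<close>. Instead of classifying these, the proof
  bounds the number of their twist classes from both sides.

  Upper bound. The squares of the dimensions of inequivalent irreducible representations of \<open>GL\<^sub>2(S\<^sub>r)\<close> add up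
  to at most the order of the group, hence to at most \<open>q\<^sup>4\<^sup>r\<close> (\<open>sum_dimension_squares_le\<close>). On the scalar matrix
  \<open>z\<close> the determinant is \<open>z\<^sup>2\<close>. Thus, if two characters of the units differ on squares, twisting a representation
  by them through the determinant gives inequivalent representations, told apart by their central characters
  (\<open>twist_family_bound\<close>). The squares of units have index at most \<open>2 q\<^sup>e\<close>, where \<open>2\<close> is a unit times the \<open>e\<close>-th
  power of a uniformiser; here it is essential that \<open>2\<close> is nonzero in \<open>R\<close>. So every twist class has at least of
  order \<open>q\<^sup>r\<close> members. If all dimensions are at least of order \<open>q\<^sup>r\<close>, there are therefore at most of order
  \<open>q\<^sup>4\<^sup>r / (q\<^sup>r q\<^sup>2\<^sup>r) = q\<^sup>r\<close> twist classes, in all these dimensions together (\<open>twist_classes_card_le\<close>). The three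
  dimensions of the theorem are of this size, which proves the first claim.

  Convergence for \<open>s > 1\<close>. Twist an irreducible representation of \<open>GL\<^sub>2(R)\<close> so that it factors through
  \<open>GL\<^sub>2(S\<^sub>r)\<close> with \<open>r\<close> minimal. Then its dimension is at least \<open>q\<^sup>r / (2 q)\<close> (\<open>dimension_ge\<close>). Indeed, it is
  nontrivial on unipotent upper triangular matrices with entry in the minimal ideal (\<open>twist_trivial_on_kernel\<close>), so
  a commutative group of upper triangular congruence matrices has a common eigenvector on which these act
  nontrivially, and conjugation by upper triangular matrices yields many different eigencharacters. By the upper
  bound, at most of order \<open>q\<^sup>r\<close> classes have minimal level \<open>r\<close>. The zeta series is therefore dominated by the sum
  of \<open>q\<^sup>r q\<^sup>-\<^sup>r\<^sup>s\<close> over \<open>r\<close> (\<open>zeta_converges\<close>).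

  Divergence for \<open>s < 1\<close>. Take the characters of the Borel subgroup that are given by a character of the upper
  left entry which is nontrivial on the smallest nontrivial congruence subgroup of the units. The representations
  of \<open>GL\<^sub>2(S\<^sub>r)\<close> induced by them are irreducible (\<open>principal_series_irreducible\<close>). They all have the same
  dimension, at most \<open>2 q\<^sup>r\<close>, and two of them can be twist equivalent only if their characters are equal or
  inverse to each other on the units congruent to \<open>1\<close> modulo the maximal ideal (\<open>principal_series_twist\<close>). So
  at least of order \<open>q\<^sup>r\<close> twist classes share one dimension of order at most \<open>q\<^sup>r\<close> (\<open>twist_count_ge\<close>), and the
  terms of the series are unbounded (\<open>zeta_diverges\<close>).
\<close>

section \<open>Complex matrices\<close>

lemma mat_mult_entry:
  assumes "A \<in> carrier_mat n m" "B \<in> carrier_mat m p" "i < n" "j < p"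
  shows "(A * B) $$ (i, j) = (\<Sum>k<m. A $$ (i, k) * B $$ (k, j))"
  using assms by (auto simp: scalar_prod_def lessThan_atLeast0 intro!: sum.cong)

lemma mat_vec_entry:
  assumes "A \<in> carrier_mat n m" "v \<in> carrier_vec m" "i < n"
  shows "(A *\<^sub>v v) $ i = (\<Sum>k<m. A $$ (i, k) * v $ k)"
  using assms by (auto simp: scalar_prod_def lessThan_atLeast0 intro!: sum.cong)

lemma mat_vec_unit:
  assumes "A \<in> carrier_mat n m" "i < m"
  shows "A *\<^sub>v unit_vec m i = col (A :: complex mat) i"
  using assms by (intro eq_vecI) auto

lemma smult_mat_vec:
  assumes "A \<in> carrier_mat n m" "v \<in> carrier_vec m"
  shows "(c \<cdot>\<^sub>m A) *\<^sub>v v = (c :: complex) \<cdot>\<^sub>v (A *\<^sub>v v)"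
  using assms by (intro eq_vecI) auto

lemma smult_diff_eigen:
  fixes w :: "complex vec"
  assumes w: "w \<in> carrier_vec n"
  shows "e \<cdot>\<^sub>v (t \<cdot>\<^sub>v (a \<cdot>\<^sub>v w) - b \<cdot>\<^sub>v (t \<cdot>\<^sub>v w)) = (e * (a - b) * t) \<cdot>\<^sub>v w"
  using w by (intro eq_vecI) (auto simp: algebra_simps)

text \<open>If \<open>I\<close> were larger than \<open>K\<close>, padding \<open>X\<close> and \<open>Y\<close> by zeros would give square matrices
  inverse to each other, one of them with a zero row. Both the bound on the sum of the squares
  of the dimensions and the lower bound on a single dimension rest on this.\<close>

lemma biorthogonal_card_le:
  fixes X :: "'i \<Rightarrow> 'k \<Rightarrow> complex" and Y :: "'k \<Rightarrow> 'i \<Rightarrow> complex"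
  assumes fI: "finite I" and fK: "finite K"
    and XY: "\<And>i j. i \<in> I \<Longrightarrow> j \<in> I \<Longrightarrow> (\<Sum>k\<in>K. X i k * Y k j) = (if i = j then 1 else 0)"
  shows "card I \<le> card K"
proof (rule ccontr)
  assume less: "\<not> card I \<le> card K"
  define N where "N = card I"
  define m where "m = card K"
  have mN: "m < N" using less by (simp add: N_def m_def)
  obtain f where f: "bij_betw f {..<N} I"
    using ex_bij_betw_nat_finite[OF fI] by (auto simp: N_def lessThan_atLeast0)
  obtain h where h: "bij_betw h {..<m} K"
    using ex_bij_betw_nat_finite[OF fK] by (auto simp: m_def lessThan_atLeast0)
  define A where "A = mat N N (\<lambda>(i, k). if k < m then X (f i) (h k) else 0)"
  define B where "B = mat N N (\<lambda>(k, j). if k < m then Y (h k) (f j) else 0)"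
  have A: "A \<in> carrier_mat N N" and B: "B \<in> carrier_mat N N" by (auto simp: A_def B_def)
  have "A * B = 1\<^sub>m N"
  proof (rule eq_matI)
    fix i j assume "i < dim_row (1\<^sub>m N)" "j < dim_col (1\<^sub>m N)"
    hence ij: "i < N" "j < N" by auto
    have "(A * B) $$ (i, j) = (\<Sum>k<N. A $$ (i, k) * B $$ (k, j))"
      by (rule mat_mult_entry[OF A B ij])
    also have "\<dots> = (\<Sum>k<N. if k < m then X (f i) (h k) * Y (h k) (f j) else 0)"
      using ij by (intro sum.cong) (auto simp: A_def B_def)
    also have "\<dots> = (\<Sum>k<m. X (f i) (h k) * Y (h k) (f j))"
      using mN by (intro sum.mono_neutral_cong_right) auto
    also have "\<dots> = (\<Sum>k\<in>K. X (f i) k * Y k (f j))"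
      by (rule sum.reindex_bij_betw[OF h])
    also have "\<dots> = (if f i = f j then 1 else 0)"
      using ij f by (intro XY) (auto simp: bij_betw_def)
    also have "\<dots> = 1\<^sub>m N $$ (i, j)"
      using ij f by (auto simp: bij_betw_def inj_on_def)
    finally show "(A * B) $$ (i, j) = 1\<^sub>m N $$ (i, j)" .
  qed (use A B in auto)
  hence BA: "B * A = 1\<^sub>m N" by (rule mat_mult_left_right_inverse[OF A B])
  have "(B * A) $$ (m, m) = (\<Sum>k<N. B $$ (m, k) * A $$ (k, m))"
    by (rule mat_mult_entry[OF B A mN mN])
  also have "\<dots> = 0" using mN by (intro sum.neutral) (auto simp: B_def)
  finally show False using mN by (simp add: BA)
qed

lemma subspace_vec_iff:
  "VectorSpace.subspace class_ring W (module_vec TYPE(complex) n) \<longleftrightarrow>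
     W \<subseteq> carrier_vec n \<and> 0\<^sub>v n \<in> W \<and> (\<forall>v\<in>W. \<forall>w\<in>W. v + w \<in> W) \<and> (\<forall>c. \<forall>v\<in>W. c \<cdot>\<^sub>v v \<in> W)"
  using vec_vs[where 'a=complex, of n] vec_module[where 'a=complex, of n]
  by (auto simp: VectorSpace.subspace_def submodule_def module_vec_simps class_ring_simps)

lemma subspace_sum_closed:
  assumes W: "VectorSpace.subspace class_ring W (module_vec TYPE(complex) n)"
    and "finite B" "\<And>b. b \<in> B \<Longrightarrow> f b \<in> W"
  shows "vec n (\<lambda>i. \<Sum>b\<in>B. f b $ i) \<in> W"
  using assms(2,3)
proof (induction B rule: finite_induct)
  case empty
  have "vec n (\<lambda>i. \<Sum>b\<in>{}. f b $ i) = 0\<^sub>v n" by auto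
  thus ?case using W by (simp add: subspace_vec_iff zero_vec_def)
next
  case (insert b B)
  have fb: "f b \<in> carrier_vec n" using insert.prems W by (auto simp: subspace_vec_iff)
  have "vec n (\<lambda>i. \<Sum>b\<in>insert b B. f b $ i) = f b + vec n (\<lambda>i. \<Sum>b\<in>B. f b $ i)"
    using insert.hyps fb by (intro eq_vecI) auto
  moreover have "f b \<in> W" "vec n (\<lambda>i. \<Sum>b\<in>B. f b $ i) \<in> W" using insert by auto
  ultimately show ?case using W by (simp add: subspace_vec_iff)
qed

text \<open>Polynomials in the given matrices project onto each of the eigenvectors and kill the
  others, so the eigenvectors are linearly independent.\<close>

lemma eigenvectors_distinct_characters_card_le:
  fixes M :: "'k \<Rightarrow> complex mat" and v :: "'i \<Rightarrow> complex vec"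
  assumes fI: "finite I" and M: "\<And>k. k \<in> K \<Longrightarrow> M k \<in> carrier_mat n n"
    and v: "\<And>i. i \<in> I \<Longrightarrow> v i \<in> carrier_vec n" "\<And>i. i \<in> I \<Longrightarrow> v i \<noteq> 0\<^sub>v n"
    and ev: "\<And>i k. i \<in> I \<Longrightarrow> k \<in> K \<Longrightarrow> M k *\<^sub>v v i = c i k \<cdot>\<^sub>v v i"
    and sep: "\<And>i j. i \<in> I \<Longrightarrow> j \<in> I \<Longrightarrow> i \<noteq> j \<Longrightarrow> \<exists>k\<in>K. c i k \<noteq> c j k"
  shows "card I \<le> n"
proof -
  have proj: "\<exists>Q \<in> carrier_mat n n. \<exists>s. (\<forall>l\<in>I. Q *\<^sub>v v l = s l \<cdot>\<^sub>v v l) \<and> s i = 1 \<and> (\<forall>j\<in>J. s j = 0)"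
    if i: "i \<in> I" and J: "J \<subseteq> I - {i}" for i J
  proof -
    have "finite J" using J fI finite_subset by blast
    thus ?thesis using J
    proof (induction J rule: finite_induct)
      case empty
      show ?case
        by (rule bexI[of _ "1\<^sub>m n"], rule exI[of _ "\<lambda>_. 1"]) (use v in auto)
    next
      case (insert j J)
      then obtain Q s where Q: "Q \<in> carrier_mat n n" "\<forall>l\<in>I. Q *\<^sub>v v l = s l \<cdot>\<^sub>v v l"
        "s i = 1" "\<forall>j\<in>J. s j = 0" by auto
      have ij: "i \<in> I" "j \<in> I" "i \<noteq> j" using insert.prems i by auto
      obtain k where k: "k \<in> K" "c i k \<noteq> c j k" using sep[OF ij] by blast
      define Q' where "Q' = (1 / (c i k - c j k)) \<cdot>\<^sub>m (M k * Q - c j k \<cdot>\<^sub>m Q)"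
      define s' where "s' l = 1 / (c i k - c j k) * (c l k - c j k) * s l" for l
      have MQ: "M k * Q \<in> carrier_mat n n" using M[OF k(1)] Q(1) by simp
      have D: "M k * Q - c j k \<cdot>\<^sub>m Q \<in> carrier_mat n n"
        using Q(1) by (intro minus_carrier_mat) auto
      have "Q' *\<^sub>v v l = s' l \<cdot>\<^sub>v v l" if l: "l \<in> I" for l
      proof -
        have "(M k * Q) *\<^sub>v v l = M k *\<^sub>v (s l \<cdot>\<^sub>v v l)"
          using M[OF k(1)] Q l v(1) by (subst assoc_mult_mat_vec[of _ n n _ n]) auto
        also have "\<dots> = s l \<cdot>\<^sub>v (c l k \<cdot>\<^sub>v v l)"
          using M[OF k(1)] l v(1) ev[OF l k(1)] by (subst mult_mat_vec[of _ n n]) auto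
        finally have 1: "(M k * Q) *\<^sub>v v l = s l \<cdot>\<^sub>v (c l k \<cdot>\<^sub>v v l)" .
        have 2: "(c j k \<cdot>\<^sub>m Q) *\<^sub>v v l = c j k \<cdot>\<^sub>v (s l \<cdot>\<^sub>v v l)"
          using smult_mat_vec[OF Q(1) v(1)[OF l]] Q(2) l by metis
        have "(M k * Q - c j k \<cdot>\<^sub>m Q) *\<^sub>v v l = s l \<cdot>\<^sub>v (c l k \<cdot>\<^sub>v v l) - c j k \<cdot>\<^sub>v (s l \<cdot>\<^sub>v v l)"
          using MQ Q(1) v(1)[OF l] by (subst minus_mult_distrib_mat_vec[of _ n n]) (auto simp: 1 2)
        hence "Q' *\<^sub>v v l = (1 / (c i k - c j k)) \<cdot>\<^sub>v (s l \<cdot>\<^sub>v (c l k \<cdot>\<^sub>v v l) - c j k \<cdot>\<^sub>v (s l \<cdot>\<^sub>v v l))"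
          unfolding Q'_def by (subst smult_mat_vec[OF D v(1)[OF l]]) simp
        also have "\<dots> = s' l \<cdot>\<^sub>v v l"
          using smult_diff_eigen[OF v(1)[OF l]] unfolding s'_def .
        finally show ?thesis .
      qed
      moreover have "Q' \<in> carrier_mat n n" unfolding Q'_def by (rule smult_carrier_mat[OF D])
      moreover have "s' i = 1" using Q(3) k(2) by (simp add: s'_def)
      moreover have "\<forall>a\<in>insert j J. s' a = 0" using Q(4) by (simp add: s'_def)
      ultimately show ?case by blast
    qed
  qed
  have "\<forall>i\<in>I. \<exists>Q. Q \<in> carrier_mat n n \<and> (\<forall>l\<in>I. Q *\<^sub>v v l = (if l = i then 1 else 0) \<cdot>\<^sub>v v l)"
  proof
    fix i assume i: "i \<in> I"
    from proj[OF i, of "I - {i}"] obtain Q s where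
      *: "Q \<in> carrier_mat n n" "\<forall>l\<in>I. Q *\<^sub>v v l = s l \<cdot>\<^sub>v v l" "s i = 1" "\<forall>j\<in>I - {i}. s j = 0" by auto
    have "Q *\<^sub>v v l = (if l = i then 1 else 0) \<cdot>\<^sub>v v l" if "l \<in> I" for l
      using * that by (cases "l = i") auto
    with *(1) show "\<exists>Q. Q \<in> carrier_mat n n \<and> (\<forall>l\<in>I. Q *\<^sub>v v l = (if l = i then 1 else 0) \<cdot>\<^sub>v v l)" by blast
  qed
  then obtain Q where Q: "\<And>i. i \<in> I \<Longrightarrow> Q i \<in> carrier_mat n n"
    "\<And>i l. i \<in> I \<Longrightarrow> l \<in> I \<Longrightarrow> Q i *\<^sub>v v l = (if l = i then 1 else 0) \<cdot>\<^sub>v v l"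
    by metis
  have "\<exists>p<n. v i $ p \<noteq> 0" if "i \<in> I" for i
  proof (rule ccontr)
    assume "\<not> (\<exists>p<n. v i $ p \<noteq> 0)"
    hence "v i = 0\<^sub>v n" using v(1)[OF that] by (intro eq_vecI) auto
    thus False using v(2)[OF that] by simp
  qed
  then obtain p where p: "\<And>i. i \<in> I \<Longrightarrow> p i < n \<and> v i $ p i \<noteq> 0" by metis
  have "card I \<le> card {..<n}"
  proof (rule biorthogonal_card_le[OF fI])
    fix i j assume ij: "i \<in> I" "j \<in> I"
    have "(\<Sum>k<n. Q i $$ (p i, k) / v i $ p i * v j $ k) = (Q i *\<^sub>v v j) $ p i / v i $ p i"
      using mat_vec_entry[OF Q(1)[OF ij(1)] v(1)[OF ij(2)]] p[OF ij(1)]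
      by (simp add: sum_divide_distrib)
    also have "\<dots> = (if i = j then 1 else 0)"
      using Q(2)[OF ij] p[OF ij(1)] v(1)[OF ij(2)] by auto
    finally show "(\<Sum>k<n. Q i $$ (p i, k) / v i $ p i * v j $ k) = (if i = j then 1 else 0)" .
  qed auto
  thus ?thesis by simp
qed


section \<open>Irreducible representations of a finite group\<close>

text \<open>Irreducibility without a topology. For representations that factor through a finite
  quotient continuity is automatic, so the group theory below uses this notion.\<close>

definition irr_rep :: "('g, 'b) monoid_scheme \<Rightarrow> nat \<Rightarrow> ('g \<Rightarrow> complex mat) \<Rightarrow> bool" where
  "irr_rep G n \<rho> \<longleftrightarrow> \<rho> \<in> hom G (GL_complex n) \<and> n > 0 \<and>
     (\<forall>W. VectorSpace.subspace class_ring W (module_vec TYPE(complex) n) \<longrightarrow>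
        (\<forall>g\<in>carrier G. \<forall>w\<in>W. \<rho> g *\<^sub>v w \<in> W) \<longrightarrow> W = {0\<^sub>v n} \<or> W = carrier_vec n)"

lemma irreducible_rep_iff: "irreducible_rep G T n \<rho> \<longleftrightarrow> cont_rep G T n \<rho> \<and> irr_rep G n \<rho>"
  by (auto simp: irreducible_rep_def irr_rep_def cont_rep_def)

lemma GL_complex_carrier_iff:
  "A \<in> carrier (GL_complex n) \<longleftrightarrow>
     A \<in> carrier_mat n n \<and> (\<exists>B\<in>carrier_mat n n. A * B = 1\<^sub>m n \<and> B * A = 1\<^sub>m n)"
  by (auto simp: units_of_def Units_def ring_mat_simps)

lemma GL_complex_group: "group (GL_complex n)"
proof -
  interpret R: ring "ring_mat TYPE(complex) n ()" by (rule ring_mat)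
  show ?thesis by (rule R.units_group)
qed

lemma GL_complex_mult: "mult (GL_complex n) = (*)" and GL_complex_one: "one (GL_complex n) = 1\<^sub>m n"
  by (auto simp: units_of_def ring_mat_simps)

lemma (in group) rep_iff:
  "\<rho> \<in> hom G (GL_complex n) \<longleftrightarrow>
     (\<forall>g\<in>carrier G. \<rho> g \<in> carrier_mat n n) \<and> \<rho> \<one> = 1\<^sub>m n \<and>
     (\<forall>g\<in>carrier G. \<forall>h\<in>carrier G. \<rho> (g \<otimes> h) = \<rho> g * \<rho> h)" (is "?L \<longleftrightarrow> ?R")
proof
  assume L: ?L
  have "\<rho> \<one> = \<one>\<^bsub>GL_complex n\<^esub>" by (rule hom_one[OF L is_group GL_complex_group])
  thus ?R using L by (auto simp: hom_def GL_complex_mult GL_complex_one GL_complex_carrier_iff Pi_def)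
next
  assume R: ?R
  have "\<rho> g \<in> carrier (GL_complex n)" if g: "g \<in> carrier G" for g
  proof -
    have "\<rho> g * \<rho> (inv g) = 1\<^sub>m n" "\<rho> (inv g) * \<rho> g = 1\<^sub>m n"
      using R g inv_closed r_inv l_inv by metis+
    thus ?thesis using R g by (auto simp: GL_complex_carrier_iff intro!: bexI[of _ "\<rho> (inv g)"])
  qed
  thus ?L using R by (auto simp: hom_def GL_complex_mult)
qed

lemma (in group)
  assumes "\<rho> \<in> hom G (GL_complex n)"
  shows rep_carrier: "g \<in> carrier G \<Longrightarrow> \<rho> g \<in> carrier_mat n n"
    and rep_one: "\<rho> \<one> = 1\<^sub>m n"
    and rep_mult: "g \<in> carrier G \<Longrightarrow> h \<in> carrier G \<Longrightarrow> \<rho> (g \<otimes> h) = \<rho> g * \<rho> h"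
    and rep_inv: "g \<in> carrier G \<Longrightarrow> \<rho> g * \<rho> (inv g) = 1\<^sub>m n" "g \<in> carrier G \<Longrightarrow> \<rho> (inv g) * \<rho> g = 1\<^sub>m n"
proof -
  note R = assms[unfolded rep_iff]
  have m: "\<rho> (g \<otimes> h) = \<rho> g * \<rho> h" if "g \<in> carrier G" "h \<in> carrier G" for g h
    using R that by blast
  show "g \<in> carrier G \<Longrightarrow> \<rho> g \<in> carrier_mat n n" "\<rho> \<one> = 1\<^sub>m n" using R by auto
  show "g \<in> carrier G \<Longrightarrow> h \<in> carrier G \<Longrightarrow> \<rho> (g \<otimes> h) = \<rho> g * \<rho> h" by (rule m)
  assume g: "g \<in> carrier G"
  show "\<rho> g * \<rho> (inv g) = 1\<^sub>m n" "\<rho> (inv g) * \<rho> g = 1\<^sub>m n"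
    using m[OF g inv_closed[OF g]] m[OF inv_closed[OF g] g] R g r_inv l_inv by metis+
qed

lemma irr_repD:
  assumes "irr_rep G n \<rho>"
  shows "\<rho> \<in> hom G (GL_complex n)" "n > 0"
    and "W \<subseteq> carrier_vec n \<Longrightarrow> 0\<^sub>v n \<in> W \<Longrightarrow> (\<And>v w. v \<in> W \<Longrightarrow> w \<in> W \<Longrightarrow> v + w \<in> W) \<Longrightarrow>
      (\<And>c v. v \<in> W \<Longrightarrow> c \<cdot>\<^sub>v v \<in> W) \<Longrightarrow> (\<And>g w. g \<in> carrier G \<Longrightarrow> w \<in> W \<Longrightarrow> \<rho> g *\<^sub>v w \<in> W) \<Longrightarrow>
      W = {0\<^sub>v n} \<or> W = carrier_vec n"
proof -
  show "\<rho> \<in> hom G (GL_complex n)" "n > 0" using assms by (auto simp: irr_rep_def)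
  assume "W \<subseteq> carrier_vec n" "0\<^sub>v n \<in> W" "\<And>v w. v \<in> W \<Longrightarrow> w \<in> W \<Longrightarrow> v + w \<in> W"
      "\<And>c v. v \<in> W \<Longrightarrow> c \<cdot>\<^sub>v v \<in> W" "\<And>g w. g \<in> carrier G \<Longrightarrow> w \<in> W \<Longrightarrow> \<rho> g *\<^sub>v w \<in> W"
  hence "VectorSpace.subspace class_ring W (module_vec TYPE(complex) n)"
    and "\<forall>g\<in>carrier G. \<forall>w\<in>W. \<rho> g *\<^sub>v w \<in> W" unfolding subspace_vec_iff by simp_all
  thus "W = {0\<^sub>v n} \<or> W = carrier_vec n"
    using assms unfolding irr_rep_def by simp
qed

lemma mat_eq_of_unit_vecs:
  assumes A: "A \<in> carrier_mat m n" and B: "B \<in> carrier_mat m n"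
    and "\<And>i. i < n \<Longrightarrow> A *\<^sub>v unit_vec n i = B *\<^sub>v unit_vec n i"
  shows "(A :: complex mat) = B"
proof (rule eq_matI)
  fix i j assume "i < dim_row B" "j < dim_col B"
  hence ij: "i < m" "j < n" using B by auto
  have "col A j = col B j"
    using assms(3)[OF ij(2)] ij(2) by (simp add: mat_vec_unit[OF A] mat_vec_unit[OF B])
  thus "A $$ (i, j) = B $$ (i, j)" using ij A B by (metis carrier_matD index_col)
qed (use A B in auto)

text \<open>Schur's lemma: the kernel and the image of an intertwiner are invariant subspaces.\<close>

lemma (in group) schur_iso:
  assumes \<rho>: "irr_rep G n \<rho>" and \<sigma>: "irr_rep G m \<sigma>" and T: "T \<in> carrier_mat m n"
    and int: "\<And>g. g \<in> carrier G \<Longrightarrow> T * \<rho> g = \<sigma> g * T" and nz: "T \<noteq> 0\<^sub>m m n"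
  shows "n = m \<and> rep_iso G n \<rho> \<sigma>"
proof -
  note rc = rep_carrier[OF irr_repD(1)[OF \<rho>]] and sc = rep_carrier[OF irr_repD(1)[OF \<sigma>]]
  have comm: "T *\<^sub>v (\<rho> g *\<^sub>v v) = \<sigma> g *\<^sub>v (T *\<^sub>v v)" if "g \<in> carrier G" "v \<in> carrier_vec n" for g v
  proof -
    have "T *\<^sub>v (\<rho> g *\<^sub>v v) = (T * \<rho> g) *\<^sub>v v" using that by (intro assoc_mult_mat_vec[OF T, symmetric]) (auto intro: rc)
    also have "\<dots> = \<sigma> g *\<^sub>v (T *\<^sub>v v)"
      using that unfolding int[OF that(1)] by (intro assoc_mult_mat_vec[OF _ T]) (auto intro: sc)
    finally show ?thesis .
  qed
  have ker: "{v \<in> carrier_vec n. T *\<^sub>v v = 0\<^sub>v m} = {0\<^sub>v n}"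
  proof -
    let ?W = "{v \<in> carrier_vec n. T *\<^sub>v v = 0\<^sub>v m}"
    have "?W = {0\<^sub>v n} \<or> ?W = carrier_vec n"
    proof (rule irr_repD(3)[OF \<rho>])
      fix g w assume "g \<in> carrier G" "w \<in> ?W"
      thus "\<rho> g *\<^sub>v w \<in> ?W" using comm[of g w] rc[of g] sc[of g] by auto
    qed (use T in \<open>auto simp: mult_add_distrib_mat_vec[OF T] mult_mat_vec[OF T]\<close>)
    moreover have "?W \<noteq> carrier_vec n"
    proof
      assume W: "?W = carrier_vec n"
      have "T = 0\<^sub>m m n"
      proof (rule mat_eq_of_unit_vecs[OF T])
        fix i assume "i < n"
        have "unit_vec n i \<in> ?W" by (subst W) auto
        thus "T *\<^sub>v unit_vec n i = 0\<^sub>m m n *\<^sub>v unit_vec n i" by auto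
      qed auto
      thus False using nz by simp
    qed
    ultimately show ?thesis by auto
  qed
  have im: "(\<lambda>v. T *\<^sub>v v) ` carrier_vec n = carrier_vec m"
  proof -
    let ?W = "(\<lambda>v. T *\<^sub>v v) ` carrier_vec n"
    have "?W = {0\<^sub>v m} \<or> ?W = carrier_vec m"
    proof (rule irr_repD(3)[OF \<sigma>])
      show "0\<^sub>v m \<in> ?W" using T by (intro image_eqI[of _ _ "0\<^sub>v n"]) auto
    next
      fix g w assume g: "g \<in> carrier G" "w \<in> ?W"
      then obtain v where "v \<in> carrier_vec n" "w = T *\<^sub>v v" by auto
      thus "\<sigma> g *\<^sub>v w \<in> ?W" using comm[OF g(1), of v] rc[OF g(1)] by (intro image_eqI[of _ _ "\<rho> g *\<^sub>v v"]) auto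
    next
      fix v w assume "v \<in> ?W" "w \<in> ?W"
      then obtain a b where "a \<in> carrier_vec n" "b \<in> carrier_vec n" "v = T *\<^sub>v a" "w = T *\<^sub>v b" by auto
      thus "v + w \<in> ?W" by (intro image_eqI[of _ _ "a + b"]) (auto simp: mult_add_distrib_mat_vec[OF T])
    next
      fix c v assume "v \<in> ?W"
      then obtain a where "a \<in> carrier_vec n" "v = T *\<^sub>v a" by auto
      thus "c \<cdot>\<^sub>v v \<in> ?W" by (intro image_eqI[of _ _ "c \<cdot>\<^sub>v a"]) (auto simp: mult_mat_vec[OF T])
    qed (use T in auto)
    moreover have "?W \<noteq> {0\<^sub>v m}"
    proof
      assume "?W = {0\<^sub>v m}"
      hence "\<And>v. v \<in> carrier_vec n \<Longrightarrow> T *\<^sub>v v = 0\<^sub>v m" by auto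
      hence "carrier_vec n \<subseteq> {0\<^sub>v n :: complex vec}" using ker by auto
      moreover have "unit_vec n 0 \<in> (carrier_vec n :: complex vec set)" "unit_vec n 0 \<noteq> (0\<^sub>v n :: complex vec)"
        using irr_repD(2)[OF \<rho>] by auto
      ultimately show False by blast
    qed
    ultimately show ?thesis by auto
  qed
  have "\<forall>i<m. \<exists>v. v \<in> carrier_vec n \<and> T *\<^sub>v v = unit_vec m i"
  proof (intro allI impI)
    fix i assume "i < m"
    have "unit_vec m i \<in> (\<lambda>v. T *\<^sub>v v) ` carrier_vec n" unfolding im by simp
    thus "\<exists>v. v \<in> carrier_vec n \<and> T *\<^sub>v v = unit_vec m i" by auto
  qed
  then obtain s where s: "\<And>i. i < m \<Longrightarrow> s i \<in> carrier_vec n \<and> T *\<^sub>v s i = unit_vec m i" by metis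
  define S where "S = mat n m (\<lambda>(i, j). s j $ i)"
  have S: "S \<in> carrier_mat n m" by (simp add: S_def)
  have colS: "S *\<^sub>v unit_vec m j = s j" if "j < m" for j
    using that s[OF that] S by (subst mat_vec_unit[OF S]) (auto intro!: eq_vecI simp: S_def)
  have TS: "T * S = 1\<^sub>m m"
  proof (rule mat_eq_of_unit_vecs[of _ m m])
    fix j assume j: "j < m"
    show "T * S *\<^sub>v unit_vec m j = 1\<^sub>m m *\<^sub>v unit_vec m j"
      using T S s[OF j] by (subst assoc_mult_mat_vec[OF T S]) (auto simp: colS j)
  qed (use T S in auto)
  have ST: "S * T = 1\<^sub>m n"
  proof (rule mat_eq_of_unit_vecs[of _ n n])
    fix j assume j: "j < n"
    let ?e = "unit_vec n j :: complex vec"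
    let ?d = "S *\<^sub>v (T *\<^sub>v ?e) - ?e"
    have d: "?d \<in> carrier_vec n" using S T by auto
    have "T *\<^sub>v ?d = T *\<^sub>v (S *\<^sub>v (T *\<^sub>v ?e)) - T *\<^sub>v ?e"
      using T S by (intro mult_minus_distrib_mat_vec) auto
    also have "T *\<^sub>v (S *\<^sub>v (T *\<^sub>v ?e)) = (T * S) *\<^sub>v (T *\<^sub>v ?e)"
      using T S by (intro assoc_mult_mat_vec[symmetric]) auto
    also have "\<dots> = T *\<^sub>v ?e" using T unfolding TS by auto
    also have "T *\<^sub>v ?e - T *\<^sub>v ?e = 0\<^sub>v m" using T by auto
    finally have "?d \<in> {v \<in> carrier_vec n. T *\<^sub>v v = 0\<^sub>v m}" using d by simp
    hence d0: "?d = 0\<^sub>v n" unfolding ker by simp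
    have STe: "S *\<^sub>v (T *\<^sub>v ?e) \<in> carrier_vec n" using S T by auto
    have "S *\<^sub>v (T *\<^sub>v ?e) = ?e"
    proof (rule eq_vecI)
      fix i assume "i < dim_vec ?e"
      hence i: "i < n" by simp
      have "?d $ i = 0" using d0 i by simp
      thus "(S *\<^sub>v (T *\<^sub>v ?e)) $ i = ?e $ i" using i by simp
    qed (use S in auto)
    thus "S * T *\<^sub>v ?e = 1\<^sub>m n *\<^sub>v ?e" using S T by (subst assoc_mult_mat_vec[OF S T]) auto
  qed (use T S in auto)
  have "card {..<m} \<le> card {..<n}"
  proof (rule biorthogonal_card_le[where X="\<lambda>i k. T $$ (i, k)" and Y="\<lambda>k j. S $$ (k, j)"])
    fix i j assume "i \<in> {..<m}" "j \<in> {..<m}"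
    thus "(\<Sum>k\<in>{..<n}. T $$ (i, k) * S $$ (k, j)) = (if i = j then 1 else 0)"
      using mat_mult_entry[OF T S, of i j] TS by auto
  qed auto
  moreover have "card {..<n} \<le> card {..<m}"
  proof (rule biorthogonal_card_le[where X="\<lambda>i k. S $$ (i, k)" and Y="\<lambda>k j. T $$ (k, j)"])
    fix i j assume "i \<in> {..<n}" "j \<in> {..<n}"
    thus "(\<Sum>k\<in>{..<m}. S $$ (i, k) * T $$ (k, j)) = (if i = j then 1 else 0)"
      using mat_mult_entry[OF S T, of i j] ST by auto
  qed auto
  ultimately have nm: "n = m" by simp
  have "T \<in> carrier (GL_complex n)" unfolding GL_complex_carrier_iff using T S TS ST nm by auto
  thus ?thesis using nm int unfolding rep_iso_def by auto
qed

lemma (in group) schur_scalar: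
  assumes \<rho>: "irr_rep G n \<rho>" and T: "T \<in> carrier_mat n n"
    and int: "\<And>g. g \<in> carrier G \<Longrightarrow> T * \<rho> g = \<rho> g * T"
  shows "\<exists>c. T = c \<cdot>\<^sub>m 1\<^sub>m n"
proof -
  note rc = rep_carrier[OF irr_repD(1)[OF \<rho>]]
  have "spectrum T \<noteq> {}" by (rule spectrum_non_empty[OF T irr_repD(2)[OF \<rho>]])
  then obtain c v where v: "v \<in> carrier_vec n" "v \<noteq> 0\<^sub>v n" "T *\<^sub>v v = c \<cdot>\<^sub>v v"
    using T by (auto simp: spectrum_def eigenvalue_def eigenvector_def)
  let ?W = "{w \<in> carrier_vec n. T *\<^sub>v w = c \<cdot>\<^sub>v w}"
  have "?W = {0\<^sub>v n} \<or> ?W = carrier_vec n"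
  proof (rule irr_repD(3)[OF \<rho>])
    fix g w assume g: "g \<in> carrier G" and w: "w \<in> ?W"
    have "T *\<^sub>v (\<rho> g *\<^sub>v w) = (T * \<rho> g) *\<^sub>v w" using w by (intro assoc_mult_mat_vec[OF T rc[OF g], symmetric]) auto
    also have "\<dots> = \<rho> g *\<^sub>v (T *\<^sub>v w)"
      using w unfolding int[OF g] by (intro assoc_mult_mat_vec[OF rc[OF g] T]) auto
    also have "\<dots> = c \<cdot>\<^sub>v (\<rho> g *\<^sub>v w)" using w rc[OF g] by (auto simp: mult_mat_vec)
    finally show "\<rho> g *\<^sub>v w \<in> ?W" using rc[OF g] w by auto
  next
    fix v w assume "v \<in> ?W" "w \<in> ?W"
    thus "v + w \<in> ?W" by (auto simp: mult_add_distrib_mat_vec[OF T] smult_add_distrib_vec[of _ n])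
  next
    fix a v assume "v \<in> ?W"
    thus "a \<cdot>\<^sub>v v \<in> ?W" by (auto simp: mult_mat_vec[OF T] smult_smult_assoc mult.commute)
  qed (use T in auto)
  hence W: "?W = carrier_vec n" using v by auto
  have "T = c \<cdot>\<^sub>m 1\<^sub>m n"
  proof (rule mat_eq_of_unit_vecs[OF T])
    fix i assume "i < n"
    have "unit_vec n i \<in> ?W" unfolding W by simp
    hence "T *\<^sub>v unit_vec n i = c \<cdot>\<^sub>v unit_vec n i" by simp
    also have "\<dots> = (c \<cdot>\<^sub>m 1\<^sub>m n) *\<^sub>v unit_vec n i" by (auto intro!: eq_vecI)
    finally show "T *\<^sub>v unit_vec n i = (c \<cdot>\<^sub>m 1\<^sub>m n) *\<^sub>v unit_vec n i" .
  qed auto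
  thus ?thesis by blast
qed

text \<open>This is the sum over the group of \<open>\<sigma> g E\<^bsub>bc\<^esub> \<rho> g\<inverse>\<close>, where \<open>E\<^bsub>bc\<^esub>\<close> has a single nonzero entry
  \<open>1\<close> in row \<open>b\<close> and column \<open>c\<close>. It intertwines \<open>\<rho>\<close> and \<open>\<sigma>\<close>, so Schur's lemma evaluates its
  entries, which are the sums in the orthogonality relations.\<close>

definition intertwiner where
  "intertwiner G m n \<sigma> \<rho> b c =
     mat m n (\<lambda>(a, d). \<Sum>g\<in>carrier G. \<sigma> g $$ (a, b) * (\<rho> (inv\<^bsub>G\<^esub> g) $$ (c, d) :: complex))"

lemma (in group) intertwiner_commutes:
  assumes fin: "finite (carrier G)" and \<rho>: "\<rho> \<in> hom G (GL_complex n)" and \<sigma>: "\<sigma> \<in> hom G (GL_complex m)"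
    and b: "b < m" and c: "c < n" and h: "h \<in> carrier G"
  shows "intertwiner G m n \<sigma> \<rho> b c * \<rho> h = \<sigma> h * intertwiner G m n \<sigma> \<rho> b c" (is "?T * _ = _")
proof (rule eq_matI)
  have T: "?T \<in> carrier_mat m n" by (simp add: intertwiner_def)
  note rc = rep_carrier[OF \<rho>] and sc = rep_carrier[OF \<sigma>]
  fix a d assume "a < dim_row (\<sigma> h * ?T)" "d < dim_col (\<sigma> h * ?T)"
  hence a: "a < m" and d: "d < n" using T sc[OF h] by auto
  define F where "F g = \<sigma> g $$ (a, b) * \<rho> (inv g \<otimes> h) $$ (c, d)" for g
  have "(?T * \<rho> h) $$ (a, d) = (\<Sum>k<n. \<Sum>g\<in>carrier G. \<sigma> g $$ (a, b) * \<rho> (inv g) $$ (c, k) * \<rho> h $$ (k, d))"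
    by (subst mat_mult_entry[OF T rc[OF h] a d]) (use a in \<open>simp add: intertwiner_def sum_distrib_right\<close>)
  also have "\<dots> = (\<Sum>g\<in>carrier G. \<sigma> g $$ (a, b) * (\<Sum>k<n. \<rho> (inv g) $$ (c, k) * \<rho> h $$ (k, d)))"
    by (subst sum.swap) (simp add: sum_distrib_left mult.assoc)
  also have "\<dots> = (\<Sum>g\<in>carrier G. F g)"
  proof (rule sum.cong)
    fix g assume g: "g \<in> carrier G"
    have "(\<Sum>k<n. \<rho> (inv g) $$ (c, k) * \<rho> h $$ (k, d)) = \<rho> (inv g \<otimes> h) $$ (c, d)"
      using mat_mult_entry[OF rc[OF inv_closed[OF g]] rc[OF h] c d] rep_mult[OF \<rho> inv_closed[OF g] h] by simp
    thus "\<sigma> g $$ (a, b) * (\<Sum>k<n. \<rho> (inv g) $$ (c, k) * \<rho> h $$ (k, d)) = F g" by (simp add: F_def)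
  qed simp
  also have "\<dots> = (\<Sum>g\<in>carrier G. F (h \<otimes> g))"
    by (rule sum.reindex_bij_witness[of _ "\<lambda>g. h \<otimes> g" "\<lambda>g. inv h \<otimes> g"]) (use h in \<open>auto simp flip: m_assoc\<close>)
  also have "\<dots> = (\<Sum>g\<in>carrier G. (\<Sum>k<m. \<sigma> h $$ (a, k) * \<sigma> g $$ (k, b)) * \<rho> (inv g) $$ (c, d))"
  proof (rule sum.cong)
    fix g assume g: "g \<in> carrier G"
    have "inv (h \<otimes> g) \<otimes> h = inv g" using g h by (simp add: inv_mult_group m_assoc)
    moreover have "(\<Sum>k<m. \<sigma> h $$ (a, k) * \<sigma> g $$ (k, b)) = \<sigma> (h \<otimes> g) $$ (a, b)"
      using mat_mult_entry[OF sc[OF h] sc[OF g] a b] rep_mult[OF \<sigma> h g] by simp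
    ultimately show "F (h \<otimes> g) = (\<Sum>k<m. \<sigma> h $$ (a, k) * \<sigma> g $$ (k, b)) * \<rho> (inv g) $$ (c, d)"
      by (simp add: F_def)
  qed simp
  also have "\<dots> = (\<Sum>k<m. \<sigma> h $$ (a, k) * (\<Sum>g\<in>carrier G. \<sigma> g $$ (k, b) * \<rho> (inv g) $$ (c, d)))"
    by (simp add: sum_distrib_right sum_distrib_left mult.assoc) (rule sum.swap)
  also have "\<dots> = (\<sigma> h * ?T) $$ (a, d)"
    by (subst mat_mult_entry[OF sc[OF h] T a d]) (use d in \<open>simp add: intertwiner_def\<close>)
  finally show "(?T * \<rho> h) $$ (a, d) = (\<sigma> h * ?T) $$ (a, d)" .
qed (use rep_carrier[OF \<rho> h] rep_carrier[OF \<sigma> h] in \<open>auto simp: intertwiner_def\<close>)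

lemma (in group) coefficient_orthogonality:
  assumes fin: "finite (carrier G)" and \<rho>: "irr_rep G n \<rho>" and \<sigma>: "irr_rep G m \<sigma>"
    and i: "a < m" "b < m" "c < n" "d < n" and non: "n = m \<Longrightarrow> \<not> rep_iso G n \<rho> \<sigma>"
  shows "(\<Sum>g\<in>carrier G. \<sigma> g $$ (a, b) * \<rho> (inv g) $$ (c, d)) = 0"
proof -
  let ?T = "intertwiner G m n \<sigma> \<rho> b c"
  have T: "?T \<in> carrier_mat m n" by (simp add: intertwiner_def)
  have "?T = 0\<^sub>m m n"
    using schur_iso[OF \<rho> \<sigma> T intertwiner_commutes[OF fin irr_repD(1)[OF \<rho>] irr_repD(1)[OF \<sigma>] i(2,3)]] non by blast
  hence "?T $$ (a, d) = 0" using i by simp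
  thus ?thesis using i by (simp add: intertwiner_def)
qed

lemma (in group) coefficient_orthonormality:
  assumes fin: "finite (carrier G)" and \<rho>: "irr_rep G n \<rho>"
    and i: "a < n" "b < n" "c < n" "d < n"
  shows "(\<Sum>g\<in>carrier G. \<rho> g $$ (a, b) * \<rho> (inv g) $$ (c, d)) =
    (if a = d \<and> b = c then of_nat (card (carrier G)) / of_nat n else 0)"
proof -
  let ?T = "intertwiner G n n \<rho> \<rho> b c"
  have T: "?T \<in> carrier_mat n n" by (simp add: intertwiner_def)
  note h = irr_repD(1)[OF \<rho>]
  obtain s where s: "?T = s \<cdot>\<^sub>m 1\<^sub>m n"
    using schur_scalar[OF \<rho> T intertwiner_commutes[OF fin h h i(2,3)]] by blast
  have ent: "(\<Sum>g\<in>carrier G. \<rho> g $$ (p, b) * \<rho> (inv g) $$ (c, r)) = (if p = r then s else 0)"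
    if "p < n" "r < n" for p r
  proof -
    have "?T $$ (p, r) = (if p = r then s else 0)" using that by (simp add: s)
    thus ?thesis using that by (simp add: intertwiner_def)
  qed
  have "of_nat n * s = (\<Sum>p<n. \<Sum>g\<in>carrier G. \<rho> g $$ (p, b) * \<rho> (inv g) $$ (c, p))"
    by (simp add: ent)
  also have "\<dots> = (\<Sum>g\<in>carrier G. \<Sum>p<n. \<rho> (inv g) $$ (c, p) * \<rho> g $$ (p, b))"
    by (subst sum.swap) (simp add: mult.commute)
  also have "\<dots> = (\<Sum>g\<in>carrier G. if b = c then 1 else 0)"
  proof (rule sum.cong)
    fix g assume g: "g \<in> carrier G"
    show "(\<Sum>p<n. \<rho> (inv g) $$ (c, p) * \<rho> g $$ (p, b)) = (if b = c then 1 else 0)"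
      using mat_mult_entry[OF rep_carrier[OF h inv_closed[OF g]] rep_carrier[OF h g] i(3,2)] rep_inv(2)[OF h g] i
      by auto
  qed simp
  also have "\<dots> = (if b = c then of_nat (card (carrier G)) else 0)" by simp
  finally have "s = (if b = c then of_nat (card (carrier G)) / of_nat n else 0)"
    using irr_repD(2)[OF \<rho>] by (auto simp: field_simps split: if_splits)
  thus ?thesis using ent[OF i(1,4)] by auto
qed

text \<open>By the orthogonality relations the matrix coefficients are biorthogonal, up to scalars, to
  the same coefficients at the inverse element; there are as many of them as the left-hand side
  says, and they are functions on \<open>G\<close>.\<close>

lemma (in group) sum_dimension_squares_le:
  assumes fin: "finite (carrier G)" and fI: "finite I"
    and irr: "\<And>i. i \<in> I \<Longrightarrow> irr_rep G (n i) (\<rho> i)"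
    and non: "\<And>i j. i \<in> I \<Longrightarrow> j \<in> I \<Longrightarrow> i \<noteq> j \<Longrightarrow> n i = n j \<Longrightarrow> \<not> rep_iso G (n i) (\<rho> i) (\<rho> j)"
  shows "(\<Sum>i\<in>I. (n i)\<^sup>2) \<le> card (carrier G)"
proof -
  define K where "K = (SIGMA i:I. {..<n i} \<times> {..<n i})"
  define X where "X = (\<lambda>(i, a, b) g. \<rho> i g $$ (a, b))"
  define Y where "Y = (\<lambda>g (i, a, b). of_nat (n i) / of_nat (card (carrier G)) * \<rho> i (inv g) $$ (b, a))"
  have pos: "card (carrier G) > 0" using fin one_closed by (auto simp: card_gt_0_iff)
  have "card K \<le> card (carrier G)"
  proof (rule biorthogonal_card_le[OF _ fin])
    show "finite K" unfolding K_def using fI by auto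
    fix p r assume "p \<in> K" "r \<in> K"
    then obtain i a b j c d where p: "p = (i, a, b)" "i \<in> I" "a < n i" "b < n i"
      and r: "r = (j, c, d)" "j \<in> I" "c < n j" "d < n j" unfolding K_def by force
    have "(\<Sum>g\<in>carrier G. X p g * Y g r) = of_nat (n j) / of_nat (card (carrier G)) *
        (\<Sum>g\<in>carrier G. \<rho> i g $$ (a, b) * \<rho> j (inv g) $$ (d, c))"
      by (simp add: X_def Y_def p(1) r(1) sum_distrib_left mult_ac)
    also have "\<dots> = (if p = r then 1 else 0)"
    proof (cases "i = j")
      case True
      show ?thesis
        using coefficient_orthonormality[OF fin irr[OF p(2)] p(3,4), of d c] r p True pos irr_repD(2)[OF irr[OF p(2)]]
        by (auto simp: field_simps)
    next
      case False
      show ?thesis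
        using coefficient_orthogonality[OF fin irr[OF r(2)] irr[OF p(2)] p(3,4) r(4,3)]
          non[OF r(2) p(2)] False p(1) r(1) by auto
    qed
    finally show "(\<Sum>g\<in>carrier G. X p g * Y g r) = (if p = r then 1 else 0)" .
  qed
  thus ?thesis using fI by (simp add: K_def power2_eq_square)
qed


section \<open>Twists by characters\<close>

text \<open>One-dimensional representations as scalar functions; \<open>cont_char_iff\<close> translates from
  1-by-1 matrices.\<close>

definition is_char :: "('g, 'b) monoid_scheme \<Rightarrow> ('g \<Rightarrow> complex) \<Rightarrow> bool" where
  "is_char G f \<longleftrightarrow> (\<forall>g\<in>carrier G. f g \<noteq> 0) \<and>
     (\<forall>g\<in>carrier G. \<forall>h\<in>carrier G. f (g \<otimes>\<^bsub>G\<^esub> h) = f g * f h)"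

definition twist :: "('g \<Rightarrow> complex) \<Rightarrow> ('g \<Rightarrow> complex mat) \<Rightarrow> 'g \<Rightarrow> complex mat" where
  "twist f \<rho> = (\<lambda>g. f g \<cdot>\<^sub>m \<rho> g)"

lemma is_char_one: "group G \<Longrightarrow> is_char G f \<Longrightarrow> f \<one>\<^bsub>G\<^esub> = 1"
  unfolding is_char_def by (metis group.is_monoid monoid.one_closed monoid.r_one mult_cancel_left2)

lemma is_char_mult: "is_char G f \<Longrightarrow> is_char G h \<Longrightarrow> is_char G (\<lambda>g. f g * h g)"
  and is_char_inverse: "is_char G f \<Longrightarrow> is_char G (\<lambda>g. inverse (f g))"
  and is_char_trivial: "is_char G (\<lambda>_. 1)"
  by (auto simp: is_char_def)

lemma is_char_compose:
  "is_char G f \<Longrightarrow> \<phi> \<in> hom H G \<Longrightarrow> is_char H (\<lambda>h. f (\<phi> h))"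
  by (auto simp: is_char_def hom_def Pi_def)

lemma is_char_cong:
  "is_char G f \<Longrightarrow> group G \<Longrightarrow> (\<And>g. g \<in> carrier G \<Longrightarrow> f g = h g) \<Longrightarrow> is_char G h"
  unfolding is_char_def by (metis group.is_monoid monoid.m_closed)

lemma twist_hom:
  assumes "group G" "is_char G f" "\<rho> \<in> hom G (GL_complex n)"
  shows "twist f \<rho> \<in> hom G (GL_complex n)"
proof -
  interpret group G by fact
  note R = rep_carrier[OF assms(3)] rep_one[OF assms(3)] rep_mult[OF assms(3)]
  have "(f g * f h) \<cdot>\<^sub>m (\<rho> g * \<rho> h) = f g \<cdot>\<^sub>m \<rho> g * (f h \<cdot>\<^sub>m \<rho> h)"
    if "g \<in> carrier G" "h \<in> carrier G" for g h
    using R(1)[OF that(1)] R(1)[OF that(2)] by (intro eq_matI) (auto simp: mult_ac)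
  thus ?thesis unfolding rep_iff
    using assms(2) R by (auto simp: twist_def is_char_one[OF assms(1,2)] is_char_def)
qed

lemma irr_rep_twist:
  assumes "group G" "is_char G f" "irr_rep G n \<rho>"
  shows "irr_rep G n (twist f \<rho>)"
  unfolding irr_rep_def
proof (intro conjI allI impI)
  interpret group G by fact
  note h = irr_repD(1)[OF assms(3)]
  show "twist f \<rho> \<in> hom G (GL_complex n)" by (rule twist_hom[OF assms(1,2) h])
  show "n > 0" by (rule irr_repD(2)[OF assms(3)])
  fix W assume W: "VectorSpace.subspace class_ring W (module_vec TYPE(complex) n)"
    and inv: "\<forall>g\<in>carrier G. \<forall>w\<in>W. twist f \<rho> g *\<^sub>v w \<in> W"
  have "\<rho> g *\<^sub>v w \<in> W" if g: "g \<in> carrier G" and w: "w \<in> W" for g w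
  proof -
    have wc: "w \<in> carrier_vec n" using W w by (auto simp: subspace_vec_iff)
    have "inverse (f g) \<cdot>\<^sub>v (twist f \<rho> g *\<^sub>v w) \<in> W" using inv g w W by (auto simp: subspace_vec_iff)
    moreover have "inverse (f g) \<cdot>\<^sub>v (twist f \<rho> g *\<^sub>v w) = \<rho> g *\<^sub>v w"
      unfolding twist_def using g assms(2)
      by (subst smult_mat_vec[OF rep_carrier[OF h g] wc]) (auto simp: smult_smult_assoc is_char_def)
    ultimately show ?thesis by simp
  qed
  thus "W = {0\<^sub>v n} \<or> W = carrier_vec n" using assms(3) W unfolding irr_rep_def by blast
qed

lemma cont_char_iff:
  assumes "group G"
  shows "(\<exists>\<psi>. cont_rep G T 1 \<psi> \<and> Q (\<lambda>g. \<psi> g $$ (0, 0))) \<longleftrightarrow>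
     (\<exists>f. is_char G f \<and> continuous_map T euclidean f \<and> Q f)"
proof
  interpret group G by fact
  assume "\<exists>\<psi>. cont_rep G T 1 \<psi> \<and> Q (\<lambda>g. \<psi> g $$ (0, 0))"
  then obtain \<psi> where \<psi>: "cont_rep G T 1 \<psi>" and Q: "Q (\<lambda>g. \<psi> g $$ (0, 0))" by blast
  have h: "\<psi> \<in> hom G (GL_complex 1)" using \<psi> by (simp add: cont_rep_def)
  have m: "\<psi> (g \<otimes>\<^bsub>G\<^esub> k) $$ (0, 0) = \<psi> g $$ (0, 0) * \<psi> k $$ (0, 0)" if "g \<in> carrier G" "k \<in> carrier G" for g k
    using mat_mult_entry[OF rep_carrier[OF h that(1)] rep_carrier[OF h that(2)], of 0 0]
    by (simp add: rep_mult[OF h that])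
  have "\<psi> g $$ (0, 0) \<noteq> 0" if "g \<in> carrier G" for g
    using m[OF that inv_closed[OF that]] that by (auto simp: rep_one[OF h])
  hence "is_char G (\<lambda>g. \<psi> g $$ (0, 0))" using m by (auto simp: is_char_def)
  moreover have "continuous_map T euclidean (\<lambda>g. \<psi> g $$ (0, 0))" using \<psi> by (simp add: cont_rep_def)
  ultimately show "\<exists>f. is_char G f \<and> continuous_map T euclidean f \<and> Q f" using Q by blast
next
  interpret group G by fact
  assume "\<exists>f. is_char G f \<and> continuous_map T euclidean f \<and> Q f"
  then obtain f where f: "is_char G f" "continuous_map T euclidean f" "Q f" by blast
  define \<psi> where "\<psi> g = mat 1 1 (\<lambda>_. f g)" for g
  have "\<psi> \<in> hom G (GL_complex 1)"
    unfolding rep_iff using f(1) is_char_one[OF assms f(1)]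
    by (auto simp: \<psi>_def is_char_def scalar_prod_def intro!: eq_matI)
  hence "cont_rep G T 1 \<psi>" using f(2) by (simp add: cont_rep_def \<psi>_def)
  moreover have "(\<lambda>g. \<psi> g $$ (0, 0)) = f" by (simp add: \<psi>_def)
  ultimately show "\<exists>\<psi>. cont_rep G T 1 \<psi> \<and> Q (\<lambda>g. \<psi> g $$ (0, 0))" using f(3) by auto
qed

lemma twist_equiv_iff:
  assumes "group G"
  shows "twist_equiv G T n \<rho> \<sigma> \<longleftrightarrow>
    (\<exists>f. is_char G f \<and> continuous_map T euclidean f \<and> rep_iso G n \<rho> (twist f \<sigma>))"
  using cont_char_iff[OF assms, of T "\<lambda>f. rep_iso G n \<rho> (twist f \<sigma>)"]
  by (simp add: twist_equiv_def rep_twist_def twist_def)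

lemma cont_rep_twist:
  assumes "group G" "is_char G f" "continuous_map T euclidean f" "cont_rep G T n \<rho>"
    and T: "topspace T = carrier G"
  shows "cont_rep G T n (twist f \<rho>)"
  unfolding cont_rep_def
proof (intro conjI allI impI)
  interpret group G by fact
  have h: "\<rho> \<in> hom G (GL_complex n)" using assms(4) by (simp add: cont_rep_def)
  show "twist f \<rho> \<in> hom G (GL_complex n)" by (rule twist_hom[OF assms(1,2) h])
  fix i j assume ij: "i < n" "j < n"
  have "continuous_map T euclidean (\<lambda>g. f g * \<rho> g $$ (i, j))"
    using assms(3,4) ij unfolding cont_rep_def by (simp add: continuous_map_atin tendsto_mult)
  thus "continuous_map T euclidean (\<lambda>g. twist f \<rho> g $$ (i, j))"
  proof (rule continuous_map_eq)
    fix g assume "g \<in> topspace T"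
    hence "\<rho> g \<in> carrier_mat n n" using rep_carrier[OF h] T by simp
    thus "f g * \<rho> g $$ (i, j) = twist f \<rho> g $$ (i, j)" using ij by (simp add: twist_def)
  qed
qed

lemma twist_equiv_refl:
  assumes "group G" "\<rho> \<in> hom G (GL_complex n)"
  shows "twist_equiv G T n \<rho> \<rho>"
  unfolding twist_equiv_iff[OF assms(1)]
proof (intro exI conjI)
  interpret group G by fact
  show "is_char G (\<lambda>_. 1)" by (rule is_char_trivial)
  show "continuous_map T euclidean (\<lambda>_. 1 :: complex)" by simp
  have "1\<^sub>m n \<in> carrier (GL_complex n)" by (auto simp: GL_complex_carrier_iff intro!: bexI[of _ "1\<^sub>m n"])
  moreover have "1\<^sub>m n * \<rho> g = twist (\<lambda>_. 1) \<rho> g * 1\<^sub>m n" if "g \<in> carrier G" for g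
    using rep_carrier[OF assms(2) that] by (auto simp: twist_def intro!: eq_matI)
  ultimately show "rep_iso G n \<rho> (twist (\<lambda>_. 1) \<rho>)" unfolding rep_iso_def by blast
qed

lemma twist_equiv_sym:
  assumes "group G" "\<rho> \<in> hom G (GL_complex n)" "\<sigma> \<in> hom G (GL_complex n)" and T: "topspace T = carrier G"
    and "twist_equiv G T n \<rho> \<sigma>"
  shows "twist_equiv G T n \<sigma> \<rho>"
proof -
  interpret group G by fact
  obtain f A where f: "is_char G f" "continuous_map T euclidean f" and A: "A \<in> carrier (GL_complex n)"
    and eq: "\<And>g. g \<in> carrier G \<Longrightarrow> A * \<rho> g = twist f \<sigma> g * A"
    using assms(5) unfolding twist_equiv_iff[OF assms(1)] rep_iso_def by blast
  obtain B where B: "B \<in> carrier_mat n n" "A * B = 1\<^sub>m n" "B * A = 1\<^sub>m n" and Ac: "A \<in> carrier_mat n n"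
    using A by (auto simp: GL_complex_carrier_iff)
  have "B * \<sigma> g = twist (\<lambda>g. inverse (f g)) \<rho> g * B" if g: "g \<in> carrier G" for g
  proof -
    note [simp] = rep_carrier[OF assms(2) g] rep_carrier[OF assms(3) g] Ac B(1) mult_carrier_mat[of _ n n _ n]
    have f0: "f g \<noteq> 0" using f(1) g by (simp add: is_char_def)
    have "\<rho> g * B = B * A * \<rho> g * B" by (simp add: B left_mult_one_mat[of _ n n])
    also have "\<dots> = B * (A * \<rho> g) * B" by (simp add: assoc_mult_mat[of _ n n _ n _ n])
    also have "\<dots> = B * ((f g \<cdot>\<^sub>m \<sigma> g) * A) * B" by (simp add: eq g twist_def)
    also have "\<dots> = B * (f g \<cdot>\<^sub>m \<sigma> g) * (A * B)" by (simp add: assoc_mult_mat[of _ n n _ n _ n])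
    also have "\<dots> = f g \<cdot>\<^sub>m (B * \<sigma> g)" by (simp add: B mult_smult_distrib[of _ n n _ n] right_mult_one_mat[of _ n n])
    finally have 1: "\<rho> g * B = f g \<cdot>\<^sub>m (B * \<sigma> g)" .
    have "twist (\<lambda>g. inverse (f g)) \<rho> g * B = inverse (f g) \<cdot>\<^sub>m (\<rho> g * B)"
      by (simp add: twist_def mult_smult_assoc_mat[of _ n n _ n])
    also have "\<dots> = B * \<sigma> g" using f0 by (simp add: 1) (auto intro!: eq_matI)
    finally show ?thesis by simp
  qed
  moreover have "B \<in> carrier (GL_complex n)" using B Ac by (auto simp: GL_complex_carrier_iff)
  ultimately have "rep_iso G n \<sigma> (twist (\<lambda>g. inverse (f g)) \<rho>)" unfolding rep_iso_def by blast
  moreover have "continuous_map T euclidean (\<lambda>g. inverse (f g))"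
    using f T by (auto simp: continuous_map_atin is_char_def intro!: tendsto_inverse)
  ultimately show ?thesis using is_char_inverse[OF f(1)] unfolding twist_equiv_iff[OF assms(1)] by blast
qed

lemma twist_equiv_trans:
  assumes "group G" "\<rho> \<in> hom G (GL_complex n)" "\<sigma> \<in> hom G (GL_complex n)" "\<tau> \<in> hom G (GL_complex n)"
    and "twist_equiv G T n \<rho> \<sigma>" "twist_equiv G T n \<sigma> \<tau>"
  shows "twist_equiv G T n \<rho> \<tau>"
proof -
  interpret group G by fact
  obtain f A where f: "is_char G f" "continuous_map T euclidean f" and A: "A \<in> carrier (GL_complex n)"
    and eq: "\<And>g. g \<in> carrier G \<Longrightarrow> A * \<rho> g = twist f \<sigma> g * A"
    using assms(5) unfolding twist_equiv_iff[OF assms(1)] rep_iso_def by blast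
  obtain f' A' where f': "is_char G f'" "continuous_map T euclidean f'" and A': "A' \<in> carrier (GL_complex n)"
    and eq': "\<And>g. g \<in> carrier G \<Longrightarrow> A' * \<sigma> g = twist f' \<tau> g * A'"
    using assms(6) unfolding twist_equiv_iff[OF assms(1)] rep_iso_def by blast
  have Ac: "A \<in> carrier_mat n n" "A' \<in> carrier_mat n n" using A A' by (auto simp: GL_complex_carrier_iff)
  have "(A' * A) * \<rho> g = twist (\<lambda>g. f g * f' g) \<tau> g * (A' * A)" if g: "g \<in> carrier G" for g
  proof -
    note [simp] = rep_carrier[OF assms(2) g] rep_carrier[OF assms(3) g] rep_carrier[OF assms(4) g] Ac mult_carrier_mat[of _ n n _ n]
    have "(A' * A) * \<rho> g = A' * (A * \<rho> g)" by (simp add: assoc_mult_mat[of _ n n _ n _ n])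
    also have "\<dots> = A' * (f g \<cdot>\<^sub>m \<sigma> g) * A"
      by (simp add: eq g twist_def assoc_mult_mat[of _ n n _ n _ n])
    also have "\<dots> = f g \<cdot>\<^sub>m (A' * \<sigma> g) * A" by (simp add: mult_smult_distrib[of _ n n _ n])
    also have "\<dots> = f g \<cdot>\<^sub>m (f' g \<cdot>\<^sub>m \<tau> g * A') * A" by (simp add: eq' g twist_def)
    also have "\<dots> = twist (\<lambda>g. f g * f' g) \<tau> g * (A' * A)"
      by (simp add: twist_def assoc_mult_mat[of _ n n _ n _ n] mult_smult_assoc_mat[of _ n n _ n])
         (auto simp: mat_eq_iff mult_ac)
    finally show ?thesis .
  qed
  moreover have "A' * A \<in> carrier (GL_complex n)"
    using group.is_monoid[OF GL_complex_group, THEN monoid.m_closed, OF A' A] by (simp add: GL_complex_mult)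
  ultimately have "rep_iso G n \<rho> (twist (\<lambda>g. f g * f' g) \<tau>)" unfolding rep_iso_def by blast
  moreover have "continuous_map T euclidean (\<lambda>g. f g * f' g)"
    using f f' by (simp add: continuous_map_atin tendsto_mult)
  ultimately show ?thesis using is_char_mult[OF f(1) f'(1)] unfolding twist_equiv_iff[OF assms(1)] by blast
qed

lemma equiv_twist_equiv:
  assumes "group G" "topspace T = carrier G"
  shows "equiv {\<rho>. irreducible_rep G T n \<rho>}
    {(\<rho>, \<sigma>). irreducible_rep G T n \<rho> \<and> irreducible_rep G T n \<sigma> \<and> twist_equiv G T n \<rho> \<sigma>}"
proof (rule equivI)
  have h: "\<rho> \<in> hom G (GL_complex n)" if "irreducible_rep G T n \<rho>" for \<rho>
    using that by (simp add: irreducible_rep_def cont_rep_def)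
  show "refl_on {\<rho>. irreducible_rep G T n \<rho>}
    {(\<rho>, \<sigma>). irreducible_rep G T n \<rho> \<and> irreducible_rep G T n \<sigma> \<and> twist_equiv G T n \<rho> \<sigma>}"
    using twist_equiv_refl[OF assms(1) h] by (auto simp: refl_on_def)
  show "sym {(\<rho>, \<sigma>). irreducible_rep G T n \<rho> \<and> irreducible_rep G T n \<sigma> \<and> twist_equiv G T n \<rho> \<sigma>}"
    using twist_equiv_sym[OF assms(1) h h assms(2)] by (auto simp: sym_def)
  show "trans {(\<rho>, \<sigma>). irreducible_rep G T n \<rho> \<and> irreducible_rep G T n \<sigma> \<and> twist_equiv G T n \<rho> \<sigma>}"
    using twist_equiv_trans[OF assms(1) h h h] by (auto simp: trans_def)
qed auto

lemma twist_isoclass_representatives: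
  assumes "group G" "topspace T = carrier G"
  obtains rep where "\<And>c. c \<in> twist_isoclasses G T n \<Longrightarrow> rep c \<in> c \<and> irreducible_rep G T n (rep c)"
    and "\<And>c d. c \<in> twist_isoclasses G T n \<Longrightarrow> d \<in> twist_isoclasses G T n \<Longrightarrow>
      twist_equiv G T n (rep c) (rep d) \<Longrightarrow> c = d"
proof -
  let ?A = "{\<rho>. irreducible_rep G T n \<rho>}"
  let ?r = "{(\<rho>, \<sigma>). irreducible_rep G T n \<rho> \<and> irreducible_rep G T n \<sigma> \<and> twist_equiv G T n \<rho> \<sigma>}"
  have eq: "equiv ?A ?r" by (rule equiv_twist_equiv[OF assms])
  define rep where "rep c = (SOME \<rho>. \<rho> \<in> c)" for c :: "('a \<Rightarrow> complex mat) set"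
  have rep: "rep c \<in> c" if "c \<in> ?A // ?r" for c
    using in_quotient_imp_non_empty[OF eq that] unfolding rep_def by (simp add: some_in_eq)
  have irr: "rep c \<in> ?A" if "c \<in> ?A // ?r" for c
    using in_quotient_imp_subset[OF eq that] rep[OF that] by blast
  show ?thesis
  proof (rule that[of rep])
    fix c assume "c \<in> twist_isoclasses G T n"
    thus "rep c \<in> c \<and> irreducible_rep G T n (rep c)" using rep irr unfolding twist_isoclasses_def by blast
  next
    fix c d assume c: "c \<in> twist_isoclasses G T n" "d \<in> twist_isoclasses G T n"
      and "twist_equiv G T n (rep c) (rep d)"
    hence "(rep c, rep d) \<in> ?r" using irr unfolding twist_isoclasses_def by blast
    thus "c = d" using quotient_eq_iff[OF eq _ _ rep rep] c unfolding twist_isoclasses_def by blast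
  qed
qed

text \<open>Twisting a family of twist inequivalent representations by characters that are told apart by
  the centre gives pairwise inequivalent representations: on the centre each representation is
  scalar, so it determines the character by which it was twisted.\<close>

lemma (in group) twist_family_bound:
  assumes fin: "finite (carrier G)" and fI: "finite I" and fX: "finite X"
    and irr: "\<And>i. i \<in> I \<Longrightarrow> irr_rep G (n i) (\<rho> i)"
    and non: "\<And>i j f. i \<in> I \<Longrightarrow> j \<in> I \<Longrightarrow> i \<noteq> j \<Longrightarrow> n i = n j \<Longrightarrow> is_char G f \<Longrightarrow>
      \<not> rep_iso G (n i) (\<rho> i) (twist f (\<rho> j))"
    and X: "\<And>x. x \<in> X \<Longrightarrow> is_char G (\<theta> x)"
    and sep: "\<And>x y. x \<in> X \<Longrightarrow> y \<in> X \<Longrightarrow> x \<noteq> y \<Longrightarrow>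
      \<exists>z\<in>carrier G. (\<forall>g\<in>carrier G. z \<otimes> g = g \<otimes> z) \<and> \<theta> x z \<noteq> \<theta> y z"
  shows "card X * (\<Sum>i\<in>I. (n i)\<^sup>2) \<le> card (carrier G)"
proof -
  define \<tau> where "\<tau> = (\<lambda>(x, i). twist (\<theta> x) (\<rho> i))"
  have "(\<Sum>p\<in>X \<times> I. (n (snd p))\<^sup>2) \<le> card (carrier G)"
  proof (rule sum_dimension_squares_le[OF fin, where \<rho>=\<tau>])
    show "finite (X \<times> I)" using fX fI by simp
    fix p assume "p \<in> X \<times> I"
    thus "irr_rep G (n (snd p)) (\<tau> p)" using irr X irr_rep_twist[OF is_group] by (auto simp: \<tau>_def)
  next
    fix p r assume "p \<in> X \<times> I" "r \<in> X \<times> I" and pr: "p \<noteq> r" and nn: "n (snd p) = n (snd r)"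
    then obtain x i y j where p: "p = (x, i)" "x \<in> X" "i \<in> I" and r: "r = (y, j)" "y \<in> X" "j \<in> I" by auto
    note h = irr_repD(1)[OF irr[OF p(3)]] irr_repD(1)[OF irr[OF r(3)]]
    show "\<not> rep_iso G (n (snd p)) (\<tau> p) (\<tau> r)"
    proof
      assume "rep_iso G (n (snd p)) (\<tau> p) (\<tau> r)"
      then obtain A where A: "A \<in> carrier (GL_complex (n i))"
        and eq: "\<And>g. g \<in> carrier G \<Longrightarrow> A * twist (\<theta> x) (\<rho> i) g = twist (\<theta> y) (\<rho> j) g * A"
        unfolding rep_iso_def \<tau>_def p r by auto
      have Ac: "A \<in> carrier_mat (n i) (n i)" using A by (simp add: GL_complex_carrier_iff)
      have nn': "n j = n i" using nn p r by simp
      show False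
      proof (cases "i = j")
        case False
        have "A * \<rho> i g = twist (\<lambda>g. inverse (\<theta> x g) * \<theta> y g) (\<rho> j) g * A" if g: "g \<in> carrier G" for g
        proof -
          note [simp] = Ac rep_carrier[OF h(1) g] rep_carrier[OF h(2) g, unfolded nn']
          have c0: "\<theta> x g \<noteq> 0" using X[OF p(2)] g by (simp add: is_char_def)
          have "A * \<rho> i g = inverse (\<theta> x g) \<cdot>\<^sub>m (A * twist (\<theta> x) (\<rho> i) g)"
            using c0 by (simp add: twist_def mult_smult_distrib[of _ "n i" "n i" _ "n i"]) (auto intro!: eq_matI)
          also have "\<dots> = inverse (\<theta> x g) \<cdot>\<^sub>m (\<theta> y g \<cdot>\<^sub>m (\<rho> j g * A))"
            by (simp add: eq g) (simp add: twist_def mult_smult_assoc_mat[of _ "n i" "n i" _ "n i"])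
          also have "\<dots> = twist (\<lambda>g. inverse (\<theta> x g) * \<theta> y g) (\<rho> j) g * A"
            by (simp add: twist_def mult_smult_assoc_mat[of _ "n i" "n i" _ "n i"]) (auto intro!: eq_matI)
          finally show ?thesis .
        qed
        hence "rep_iso G (n i) (\<rho> i) (twist (\<lambda>g. inverse (\<theta> x g) * \<theta> y g) (\<rho> j))"
          unfolding rep_iso_def using A by blast
        moreover have "is_char G (\<lambda>g. inverse (\<theta> x g) * \<theta> y g)"
          using X p r by (intro is_char_mult is_char_inverse) auto
        ultimately show False using non[OF p(3) r(3) False] nn' by simp
      next
        case True
        hence "x \<noteq> y" using pr p r by auto
        then obtain z where z: "z \<in> carrier G" "\<forall>g\<in>carrier G. z \<otimes> g = g \<otimes> z" "\<theta> x z \<noteq> \<theta> y z"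
          using sep p r by blast
        note zc = rep_carrier[OF h(1) z(1)]
        have "\<exists>c. \<rho> i z = c \<cdot>\<^sub>m 1\<^sub>m (n i)"
        proof (rule schur_scalar[OF irr[OF p(3)] zc])
          fix g assume g: "g \<in> carrier G"
          show "\<rho> i z * \<rho> i g = \<rho> i g * \<rho> i z"
            using z g rep_mult[OF h(1) z(1) g] rep_mult[OF h(1) g z(1)] by simp
        qed
        then obtain c where c: "\<rho> i z = c \<cdot>\<^sub>m 1\<^sub>m (n i)" by blast
        have n0: "n i > 0" by (rule irr_repD(2)[OF irr[OF p(3)]])
        have "c \<noteq> 0"
        proof
          assume "c = 0"
          hence "\<rho> i z = 0\<^sub>m (n i) (n i)" using c by auto
          hence "1\<^sub>m (n i) = (0\<^sub>m (n i) (n i) :: complex mat)"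
            using rep_inv(1)[OF h(1) z(1)] rep_carrier[OF h(1) inv_closed[OF z(1)]] by simp
          hence "(1\<^sub>m (n i) :: complex mat) $$ (0, 0) = 0" using n0 by (metis index_zero_mat(1))
          thus False using n0 by simp
        qed
        obtain B where B: "B \<in> carrier_mat (n i) (n i)" "A * B = 1\<^sub>m (n i)"
          using A by (auto simp: GL_complex_carrier_iff)
        have "(\<theta> x z * c) \<cdot>\<^sub>m A = (\<theta> y z * c) \<cdot>\<^sub>m A"
          using eq[OF z(1)] Ac unfolding twist_def True[symmetric] c
          by (simp add: mult_smult_distrib[of _ "n i" "n i" _ "n i"] mult_smult_assoc_mat[of _ "n i" "n i" _ "n i"])
             (auto simp: mat_eq_iff mult_ac)
        hence "((\<theta> x z * c) \<cdot>\<^sub>m A) * B = ((\<theta> y z * c) \<cdot>\<^sub>m A) * B" by simp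
        hence "(\<theta> x z * c) \<cdot>\<^sub>m 1\<^sub>m (n i) = (\<theta> y z * c) \<cdot>\<^sub>m 1\<^sub>m (n i)"
          using Ac B by (simp add: mult_smult_assoc_mat[of _ "n i" "n i" _ "n i"])
        hence "((\<theta> x z * c) \<cdot>\<^sub>m 1\<^sub>m (n i)) $$ (0, 0) = ((\<theta> y z * c) \<cdot>\<^sub>m 1\<^sub>m (n i)) $$ (0, 0)" by simp
        thus False using n0 z(3) \<open>c \<noteq> 0\<close> by simp
      qed
    qed
  qed
  moreover have "(\<Sum>p\<in>X \<times> I. (n (snd p))\<^sup>2) = card X * (\<Sum>i\<in>I. (n i)\<^sup>2)"
    using sum.cartesian_product[of "\<lambda>x i. (n i)\<^sup>2" I X] by (simp add: case_prod_beta)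
  ultimately show ?thesis by simp
qed

section \<open>Characters of finite abelian groups\<close>

text \<open>The subgroup \<open>H'\<close> arises by adjoining \<open>x\<close> to \<open>H\<close>. If \<open>k\<close> is the least positive exponent
  with \<open>x\<^sup>k \<in> H\<close>, the value of an extension at \<open>x\<close> may be any \<open>k\<close>-th root of \<open>\<phi> (x\<^sup>k)\<close>; these
  roots form \<open>Z\<close>.\<close>

lemma (in comm_group) character_extension_step:
  assumes fin: "finite (carrier G)" and H: "subgroup H G" and x: "x \<in> carrier G"
    and \<phi>0: "\<And>h. h \<in> H \<Longrightarrow> \<phi> h \<noteq> 0" and \<phi>m: "\<And>h h'. h \<in> H \<Longrightarrow> h' \<in> H \<Longrightarrow> \<phi> (h \<otimes> h') = \<phi> h * \<phi> h'"
  obtains H' k Z \<psi> where "subgroup H' G" "H \<subseteq> H'" "x \<in> H'" "k > 0" "card H' \<le> k * card H"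
    "finite Z" "card Z = k"
    "\<forall>z\<in>Z. \<forall>h\<in>H'. \<psi> z h \<noteq> (0::complex)"
    "\<forall>z\<in>Z. \<forall>h\<in>H'. \<forall>h'\<in>H'. \<psi> z (h \<otimes> h') = \<psi> z h * \<psi> z h'"
    "\<forall>z\<in>Z. \<forall>h\<in>H. \<psi> z h = \<phi> h" "\<forall>z\<in>Z. \<psi> z x = z"
proof -
  interpret H: subgroup H G by fact
  have Hc: "h \<in> carrier G" if "h \<in> H" for h using that H.subset by blast
  define N where "N = order G"
  have N: "N > 0" using fin one_closed by (auto simp: N_def order_def card_gt_0_iff)
  have xN: "x [^] N = \<one>" using pow_order_eq_1[OF x] by (simp add: N_def)
  define k :: nat where "k = (LEAST k. k > 0 \<and> x [^] k \<in> H)"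
  have "k > 0 \<and> x [^] k \<in> H"
    unfolding k_def by (rule LeastI[of "\<lambda>k. k > 0 \<and> x [^] k \<in> H" N]) (use N xN in simp)
  hence k: "k > 0" "x [^] k \<in> H" by auto
  have kmin: "k \<le> j" if "j > 0" "x [^] j \<in> H" for j :: nat
    unfolding k_def by (rule Least_le) (use that in simp)
  have \<phi>1: "\<phi> \<one> = 1" using \<phi>m[of \<one> \<one>] \<phi>0[of \<one>] by simp
  have \<phi>pow: "\<phi> (h [^] (n::nat)) = \<phi> h ^ n" "h [^] (n::nat) \<in> H" if "h \<in> H" for h n
    using that by (induction n) (simp_all add: \<phi>1 \<phi>m mult.commute)
  have kdvd: "k dvd d" if d: "x [^] d \<in> H" for d :: nat
  proof (rule ccontr)
    assume "\<not> k dvd d"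
    hence r: "d mod k > 0" by (simp add: dvd_eq_mod_eq_0)
    have "x [^] d = (x [^] k) [^] (d div k) \<otimes> x [^] (d mod k)"
      using x by (simp add: nat_pow_pow nat_pow_mult)
    hence "x [^] (d mod k) = inv ((x [^] k) [^] (d div k)) \<otimes> x [^] d"
      using x by (simp add: m_assoc[symmetric])
    also have "\<dots> \<in> H" using \<phi>pow(2)[OF k(2)] d by auto
    finally show False using kmin[OF r] mod_less_divisor[OF k(1), of d] by simp
  qed
  define H' where "H' = {h \<otimes> x [^] (i::nat) | h i. h \<in> H}"
  have H'I: "h \<otimes> x [^] (i::nat) \<in> H'" if "h \<in> H" for h i using that by (auto simp: H'_def)
  have mul: "(h \<otimes> x [^] (i::nat)) \<otimes> (h' \<otimes> x [^] (j::nat)) = (h \<otimes> h') \<otimes> x [^] (i + j)"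
    if "h \<in> H" "h' \<in> H" for h h' i j
    using Hc[OF that(1)] Hc[OF that(2)] x by (simp add: nat_pow_mult[symmetric] m_ac)
  have sub: "subgroup H' G"
  proof
    show "H' \<subseteq> carrier G" using x Hc by (auto simp: H'_def)
    show "\<one> \<in> H'" using H'I[of \<one> 0] by simp
    fix y y' assume "y \<in> H'" "y' \<in> H'"
    thus "y \<otimes> y' \<in> H'" using mul H'I by (auto simp: H'_def)
  next
    fix y assume "y \<in> H'"
    then obtain h i where y: "y = h \<otimes> x [^] (i::nat)" "h \<in> H" by (auto simp: H'_def)
    have "(inv h \<otimes> x [^] ((N - 1) * i)) \<otimes> y = (inv h \<otimes> h) \<otimes> x [^] ((N - 1) * i + i)"
      unfolding y(1) by (rule mul) (use y in auto)
    also have "(N - 1) * i + i = N * i" using N by (cases N) auto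
    also have "(inv h \<otimes> h) \<otimes> x [^] (N * i) = \<one>"
      using Hc[OF y(2)] x xN by (simp add: nat_pow_pow[symmetric])
    finally have "inv y = inv h \<otimes> x [^] ((N - 1) * i)"
      using Hc[OF y(2)] x y(1) by (intro inv_equality) auto
    thus "inv y \<in> H'" using H'I[of "inv h"] y(2) by simp
  qed
  have card': "card H' \<le> k * card H"
  proof -
    have fH: "finite H" using fin H.subset finite_subset by blast
    have "H' \<subseteq> (\<lambda>(h, i). h \<otimes> x [^] i) ` (H \<times> {..<k})"
    proof
      fix y assume "y \<in> H'"
      then obtain h i where y: "y = h \<otimes> x [^] (i::nat)" "h \<in> H" by (auto simp: H'_def)
      have "x [^] i = (x [^] k) [^] (i div k) \<otimes> x [^] (i mod k)"
        using x by (simp add: nat_pow_pow nat_pow_mult)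
      hence "y = (h \<otimes> (x [^] k) [^] (i div k)) \<otimes> x [^] (i mod k)"
        using y x Hc by (simp add: m_assoc)
      moreover have "h \<otimes> (x [^] k) [^] (i div k) \<in> H" using \<phi>pow(2)[OF k(2)] y by auto
      ultimately show "y \<in> (\<lambda>(h, i). h \<otimes> x [^] i) ` (H \<times> {..<k})"
        using k(1) by (intro image_eqI[of _ _ "(h \<otimes> (x [^] k) [^] (i div k), i mod k)"]) auto
    qed
    hence "card H' \<le> card (H \<times> {..<k})" using fH by (intro surj_card_le) auto
    thus ?thesis by (metis card_cartesian_product card_lessThan mult.commute)
  qed
  define Z where "Z = {z. z ^ k = \<phi> (x [^] k)}"
  have cZ: "card Z = k" unfolding Z_def by (rule card_nth_roots) (use k \<phi>0 in auto)
  have Zfin: "finite Z" using cZ k(1) by (meson card_gt_0_iff)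
  have well: "\<phi> h * z ^ i = \<phi> h' * z ^ j" if z: "z \<in> Z" and h: "h \<in> H" "h' \<in> H"
    and eq: "h \<otimes> x [^] i = h' \<otimes> x [^] j" for z h h' and i j :: nat
  proof -
    have main: "\<phi> h * z ^ i = \<phi> h' * z ^ j" if h: "h \<in> H" "h' \<in> H"
      and eq: "h \<otimes> x [^] i = h' \<otimes> x [^] j" and ji: "j \<le> i" for h h' and i j :: nat
    proof -
      define d where "d = i - j"
      have i: "i = d + j" using ji by (simp add: d_def)
      have "(h \<otimes> x [^] d) \<otimes> x [^] j = h' \<otimes> x [^] j"
        using eq Hc[OF h(1)] x by (simp add: i nat_pow_mult[symmetric] m_assoc)
      hence hd: "h \<otimes> x [^] d = h'" using Hc[OF h(1)] Hc[OF h(2)] x by simp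
      have "x [^] d = inv h \<otimes> h'" using Hc[OF h(1)] x by (simp add: hd[symmetric] m_assoc[symmetric])
      hence dH: "x [^] d \<in> H" using h by simp
      obtain m where m: "d = k * m" using kdvd[OF dH] by blast
      have "\<phi> (x [^] d) = \<phi> (x [^] k) ^ m" using \<phi>pow(1)[OF k(2), of m] x by (simp add: m nat_pow_pow)
      also have "\<dots> = z ^ d" using z by (simp add: Z_def m power_mult)
      finally have "\<phi> h' = \<phi> h * z ^ d" using \<phi>m[OF h(1) dH] by (simp add: hd)
      thus ?thesis by (simp add: i power_add mult_ac)
    qed
    show ?thesis
    proof (cases "j \<le> i")
      case True thus ?thesis using main[OF h eq] by simp
    next
      case False thus ?thesis using main[OF h(2,1) eq[symmetric]] by simp
    qed
  qed
  define \<psi> where "\<psi> z y = (SOME c. \<exists>h\<in>H. \<exists>i::nat. y = h \<otimes> x [^] i \<and> c = \<phi> h * z ^ i)" for z y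
  have \<psi>: "\<psi> z (h \<otimes> x [^] i) = \<phi> h * z ^ i" if z: "z \<in> Z" and h: "h \<in> H" for z h and i :: nat
  proof -
    have "\<exists>h'\<in>H. \<exists>j::nat. h \<otimes> x [^] i = h' \<otimes> x [^] j \<and> \<psi> z (h \<otimes> x [^] i) = \<phi> h' * z ^ j"
      unfolding \<psi>_def by (rule someI[of _ "\<phi> h * z ^ i"]) (use h in blast)
    thus ?thesis using well[OF z] h by metis
  qed
  show ?thesis
  proof (rule that[OF sub _ _ k(1) card' Zfin cZ, of \<psi>])
    show "H \<subseteq> H'" using H'I[of _ 0] Hc by auto
    show "x \<in> H'" using H'I[of \<one> 1] x by simp
    have z0: "z \<noteq> 0" if "z \<in> Z" for z
    proof
      assume "z = 0"
      hence "z ^ k = 0" using k(1) by (simp add: zero_power)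
      moreover have "z ^ k = \<phi> (x [^] k)" using that by (simp add: Z_def)
      ultimately show False using \<phi>0[OF k(2)] by simp
    qed
    show "\<forall>z\<in>Z. \<forall>h\<in>H. \<psi> z h = \<phi> h" using \<psi>[of _ _ 0] Hc by simp
    show "\<forall>z\<in>Z. \<psi> z x = z" using \<psi>[OF _ H.one_closed, of _ 1] x \<phi>1 by simp
    show "\<forall>z\<in>Z. \<forall>h\<in>H'. \<psi> z h \<noteq> 0"
      using \<psi> \<phi>0 z0 by (auto simp: H'_def)
    show "\<forall>z\<in>Z. \<forall>h\<in>H'. \<forall>h'\<in>H'. \<psi> z (h \<otimes> h') = \<psi> z h * \<psi> z h'"
      using \<psi> mul \<phi>m by (auto simp: H'_def power_add)
  qed
qed

text \<open>Adjoining one element at a time, every step multiplies the number of extensions by at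
  least the factor by which the subgroup grows, since extensions with different values at the
  new element stay different.\<close>

lemma (in comm_group) character_extensions:
  assumes fin: "finite (carrier G)" and H: "subgroup H G"
    and \<phi>: "\<And>h. h \<in> H \<Longrightarrow> \<phi> h \<noteq> 0" "\<And>h h'. h \<in> H \<Longrightarrow> h' \<in> H \<Longrightarrow> \<phi> (h \<otimes> h') = \<phi> h * \<phi> h'"
  shows "\<exists>F. finite F \<and> (\<forall>f\<in>F. is_char G f \<and> (\<forall>h\<in>H. f h = \<phi> h)) \<and>
    (\<forall>f\<in>F. \<forall>f'\<in>F. (\<forall>g\<in>carrier G. f g = f' g) \<longrightarrow> f = f') \<and> card (carrier G) \<le> card H * card F"
  using H \<phi>
proof (induction "card (carrier G) - card H" arbitrary: H \<phi> rule: less_induct)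
  case less
  have HG: "H \<subseteq> carrier G" using less.prems(1) by (rule subgroup.subset)
  show ?case
  proof (cases "H = carrier G")
    case True
    show ?thesis
      by (rule exI[of _ "{\<phi>}"]) (use less.prems True in \<open>auto simp: is_char_def\<close>)
  next
    case False
    then obtain x where x: "x \<in> carrier G" "x \<notin> H" using HG by blast
    obtain H' k Z \<psi> where s: "subgroup H' G" "H \<subseteq> H'" "x \<in> H'" "k > 0" "card H' \<le> k * card H"
      "finite Z" "card Z = k"
      and \<psi>': "\<forall>z\<in>Z. \<forall>h\<in>H'. \<psi> z h \<noteq> (0::complex)"
      "\<forall>z\<in>Z. \<forall>h\<in>H'. \<forall>h'\<in>H'. \<psi> z (h \<otimes> h') = \<psi> z h * \<psi> z h'"
      "\<forall>z\<in>Z. \<forall>h\<in>H. \<psi> z h = \<phi> h" "\<forall>z\<in>Z. \<psi> z x = z"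
      by (rule character_extension_step[OF fin less.prems(1) x(1) less.prems(2,3)])
    note \<psi> = \<psi>'[rule_format]
    have H'G: "H' \<subseteq> carrier G" using s(1) by (rule subgroup.subset)
    have "finite H'" using H'G fin finite_subset by blast
    hence lt: "card H < card H'" using s(2,3) x(2) by (intro psubset_card_mono) auto
    have le: "card H' \<le> card (carrier G)" using H'G fin card_mono by blast
    have dec: "card (carrier G) - card H' < card (carrier G) - card H" using lt le by linarith
    have "\<forall>z\<in>Z. \<exists>F. finite F \<and> (\<forall>f\<in>F. is_char G f \<and> (\<forall>h\<in>H'. f h = \<psi> z h)) \<and>
      (\<forall>f\<in>F. \<forall>f'\<in>F. (\<forall>g\<in>carrier G. f g = f' g) \<longrightarrow> f = f') \<and> card (carrier G) \<le> card H' * card F"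
    proof
      fix z assume z: "z \<in> Z"
      show "\<exists>F. finite F \<and> (\<forall>f\<in>F. is_char G f \<and> (\<forall>h\<in>H'. f h = \<psi> z h)) \<and>
        (\<forall>f\<in>F. \<forall>f'\<in>F. (\<forall>g\<in>carrier G. f g = f' g) \<longrightarrow> f = f') \<and> card (carrier G) \<le> card H' * card F"
        using less.hyps[OF dec s(1), of "\<psi> z"] \<psi>(1,2)[OF z] by blast
    qed
    then obtain F where F': "\<forall>z\<in>Z. finite (F z) \<and> (\<forall>f\<in>F z. is_char G f \<and> (\<forall>h\<in>H'. f h = \<psi> z h)) \<and>
      (\<forall>f\<in>F z. \<forall>f'\<in>F z. (\<forall>g\<in>carrier G. f g = f' g) \<longrightarrow> f = f') \<and> card (carrier G) \<le> card H' * card (F z)"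
      by (auto dest: bchoice)
    have F: "\<And>z. z \<in> Z \<Longrightarrow> finite (F z)"
      "\<And>z f. z \<in> Z \<Longrightarrow> f \<in> F z \<Longrightarrow> is_char G f \<and> (\<forall>h\<in>H'. f h = \<psi> z h)"
      "\<And>z f f'. z \<in> Z \<Longrightarrow> f \<in> F z \<Longrightarrow> f' \<in> F z \<Longrightarrow> (\<forall>g\<in>carrier G. f g = f' g) \<Longrightarrow> f = f'"
      "\<And>z. z \<in> Z \<Longrightarrow> card (carrier G) \<le> card H' * card (F z)"
      using F' by blast+
    have at_x: "f x = z" if "z \<in> Z" "f \<in> F z" for z f using F(2)[OF that] \<psi>(4)[OF that(1)] s(3) by simp
    have cU: "card (\<Union>z\<in>Z. F z) = (\<Sum>z\<in>Z. card (F z))"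
      by (rule card_UN_disjoint) (use s(6) F(1) at_x in blast)+
    have "k * card (carrier G) \<le> (\<Sum>z\<in>Z. card H' * card (F z))"
      using sum_mono[of Z "\<lambda>_. card (carrier G)" "\<lambda>z. card H' * card (F z)"] F(4) s(7) by simp
    also have "\<dots> = card H' * card (\<Union>z\<in>Z. F z)" by (simp add: cU sum_distrib_left)
    also have "\<dots> \<le> k * (card H * card (\<Union>z\<in>Z. F z))" using s(5) by (metis mult.assoc mult_le_mono1)
    finally have card: "card (carrier G) \<le> card H * card (\<Union>z\<in>Z. F z)" using s(4) by simp
    show ?thesis
    proof (intro exI[of _ "\<Union>z\<in>Z. F z"] conjI ballI impI)
      show "finite (\<Union>z\<in>Z. F z)" using s(6) F(1) by blast
      show "card (carrier G) \<le> card H * card (\<Union>z\<in>Z. F z)" by (rule card)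
    next
      fix f assume "f \<in> (\<Union>z\<in>Z. F z)"
      then obtain z where z: "z \<in> Z" "f \<in> F z" by blast
      show "is_char G f" using F(2)[OF z] by blast
      fix h assume "h \<in> H"
      thus "f h = \<phi> h" using F(2)[OF z] s(2) \<psi>(3)[OF z(1)] by auto
    next
      fix f f' assume "f \<in> (\<Union>z\<in>Z. F z)" "f' \<in> (\<Union>z\<in>Z. F z)" and eq: "\<forall>g\<in>carrier G. f g = f' g"
      then obtain z z' where z: "z \<in> Z" "f \<in> F z" "z' \<in> Z" "f' \<in> F z'" by blast
      have "z = z'" using at_x[OF z(1,2)] at_x[OF z(3,4)] eq x(1) by auto
      thus "f = f'" using F(3)[OF z(1,2)] z(4) eq by blast
    qed
  qed
qed

lemma (in comm_group) character_extends:
  assumes fin: "finite (carrier G)" and H: "subgroup H G"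
    and \<phi>: "\<And>h. h \<in> H \<Longrightarrow> \<phi> h \<noteq> 0" "\<And>h h'. h \<in> H \<Longrightarrow> h' \<in> H \<Longrightarrow> \<phi> (h \<otimes> h') = \<phi> h * \<phi> h'"
  obtains f where "is_char G f" "\<And>h. h \<in> H \<Longrightarrow> f h = \<phi> h"
proof -
  obtain F where F: "\<forall>f\<in>F. is_char G f \<and> (\<forall>h\<in>H. f h = \<phi> h)" "card (carrier G) \<le> card H * card F"
    using character_extensions[OF assms] by blast
  have "card (carrier G) > 0" using fin one_closed by (auto simp: card_gt_0_iff)
  hence "F \<noteq> {}" using F(2) by auto
  thus ?thesis using F(1) that by blast
qed

text \<open>There are at least \<open>[H : M]\<close> characters of \<open>H\<close> with prescribed restriction to \<open>M\<close>, and
  each of them extends to \<open>G\<close>. In the applications \<open>H\<close> is the group of squares of units or the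
  group \<open>1 + (p)\<close>, on which the characters have to stay different.\<close>

lemma (in comm_group) characters_distinct_on_subgroup:
  assumes fin: "finite (carrier G)" and H: "subgroup H G" and M: "subgroup M G" "M \<subseteq> H"
    and \<phi>: "\<And>h. h \<in> M \<Longrightarrow> \<phi> h \<noteq> 0" "\<And>h h'. h \<in> M \<Longrightarrow> h' \<in> M \<Longrightarrow> \<phi> (h \<otimes> h') = \<phi> h * \<phi> h'"
  shows "\<exists>F. finite F \<and> (\<forall>f\<in>F. is_char G f \<and> (\<forall>h\<in>M. f h = \<phi> h)) \<and>
    (\<forall>f\<in>F. \<forall>f'\<in>F. (\<forall>h\<in>H. f h = f' h) \<longrightarrow> f = f') \<and> card H \<le> card M * card F"
proof -
  interpret Hg: comm_group "G\<lparr>carrier := H\<rparr>" 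
    using H by (intro group.group_comm_groupI subgroup_imp_group) (auto dest: subgroup.mem_carrier intro: m_comm)
  have HG: "H \<subseteq> carrier G" using H by (rule subgroup.subset)
  have finH: "finite (carrier (G\<lparr>carrier := H\<rparr>))" using HG fin finite_subset by auto
  have MH: "subgroup M (G\<lparr>carrier := H\<rparr>)" by (rule subgroup_incl[OF M(1) H M(2)])
  have "\<exists>F. finite F \<and> (\<forall>f\<in>F. is_char (G\<lparr>carrier := H\<rparr>) f \<and> (\<forall>h\<in>M. f h = \<phi> h)) \<and>
    (\<forall>f\<in>F. \<forall>f'\<in>F. (\<forall>g\<in>carrier (G\<lparr>carrier := H\<rparr>). f g = f' g) \<longrightarrow> f = f') \<and>
    card (carrier (G\<lparr>carrier := H\<rparr>)) \<le> card M * card F"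
    by (rule Hg.character_extensions[OF finH MH]) (simp_all add: \<phi>)
  then obtain F where F': "finite F" "\<forall>f\<in>F. is_char (G\<lparr>carrier := H\<rparr>) f \<and> (\<forall>h\<in>M. f h = \<phi> h)"
    "\<forall>f\<in>F. \<forall>f'\<in>F. (\<forall>g\<in>carrier (G\<lparr>carrier := H\<rparr>). f g = f' g) \<longrightarrow> f = f'"
    "card (carrier (G\<lparr>carrier := H\<rparr>)) \<le> card M * card F"
    by blast
  have cH: "carrier (G\<lparr>carrier := H\<rparr>) = H" by simp
  have F: "finite F" "\<And>f. f \<in> F \<Longrightarrow> is_char (G\<lparr>carrier := H\<rparr>) f \<and> (\<forall>h\<in>M. f h = \<phi> h)"
    "\<And>f f'. f \<in> F \<Longrightarrow> f' \<in> F \<Longrightarrow> (\<forall>g\<in>H. f g = f' g) \<Longrightarrow> f = f'" "card H \<le> card M * card F"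
    using F' unfolding cH by blast+
  have "\<exists>f'. is_char G f' \<and> (\<forall>h\<in>H. f' h = f h)" if f: "f \<in> F" for f
  proof -
    have fc: "is_char (G\<lparr>carrier := H\<rparr>) f" using F(2)[OF f] by simp
    obtain f' where "is_char G f'" "\<And>h. h \<in> H \<Longrightarrow> f' h = f h"
      by (rule character_extends[OF fin H, of f]) (use fc in \<open>auto simp: is_char_def\<close>)
    thus ?thesis by blast
  qed
  then obtain e where e: "\<And>f. f \<in> F \<Longrightarrow> is_char G (e f)" "\<And>f h. f \<in> F \<Longrightarrow> h \<in> H \<Longrightarrow> e f h = f h" by metis
  have inj: "inj_on e F" using F(3) e(2) by (intro inj_onI) metis
  show ?thesis
  proof (intro exI[of _ "e ` F"] conjI ballI impI)
    show "finite (e ` F)" using F(1) by simp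
    show "card H \<le> card M * card (e ` F)" using F(4) by (simp add: card_image[OF inj])
  next
    fix f assume "f \<in> e ` F"
    then obtain f0 where f0: "f0 \<in> F" "f = e f0" by blast
    show "is_char G f" using e(1) f0 by blast
    fix h assume "h \<in> M"
    thus "f h = \<phi> h" using F(2)[OF f0(1)] e(2)[OF f0(1)] f0(2) M(2) by auto
  next
    fix f f' assume "f \<in> e ` F" "f' \<in> e ` F" and eq: "\<forall>h\<in>H. f h = f' h"
    then obtain a b where ab: "a \<in> F" "b \<in> F" "f = e a" "f' = e b" by blast
    have "a = b" using F(3)[OF ab(1,2)] eq ab e(2) by auto
    thus "f = f'" using ab by simp
  qed
qed


section \<open>Monomial representations\<close>

text \<open>The trivial coset comes first, so that the first basis vector of an induced representation
  is an eigenvector of \<open>B\<close>. The set \<open>Y\<close>, which meets every coset, serves to bound their number.\<close>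

lemma (in group) exists_transversal:
  assumes fin: "finite (carrier G)" and B: "subgroup B G"
    and Y: "finite Y" "Y \<subseteq> carrier G" "\<And>g. g \<in> carrier G \<Longrightarrow> \<exists>y\<in>Y. g \<otimes> inv y \<in> B"
  obtains N x where "N > (0::nat)" "N \<le> card Y" "x 0 = \<one>" "\<And>i. i < N \<Longrightarrow> x i \<in> carrier G"
    "\<And>g. g \<in> carrier G \<Longrightarrow> \<exists>!i. i < N \<and> g \<otimes> inv (x i) \<in> B"
proof -
  interpret B: subgroup B G by fact
  let ?C = "rcosets B"
  have Cfin: "finite ?C" using fin by (auto simp: RCOSETS_def)
  have BC: "B \<in> ?C" using B.subset by (auto simp: RCOSETS_def intro!: bexI[of _ \<one>])
  define M where "M = card (?C - {B})"
  obtain e where e: "bij_betw e {..<M} (?C - {B})"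
    using ex_bij_betw_nat_finite[of "?C - {B}"] Cfin by (auto simp: M_def lessThan_atLeast0)
  define c where "c i = (if i = 0 then B else e (i - 1))" for i
  have c: "bij_betw c {..<Suc M} ?C"
  proof (rule bij_betw_imageI)
    have e_mem: "e i \<in> ?C - {B}" if "i < M" for i using e that by (auto simp: bij_betw_def)
    show "inj_on c {..<Suc M}"
    proof (rule inj_onI)
      fix i j assume ij: "i \<in> {..<Suc M}" "j \<in> {..<Suc M}" "c i = c j"
      show "i = j"
      proof (cases "i = 0 \<or> j = 0")
        case True
        have "c l \<noteq> B" if "l \<in> {..<Suc M}" "l \<noteq> 0" for l
        proof -
          have "l - 1 < M" using that by auto
          thus ?thesis using e_mem[of "l - 1"] that by (simp add: c_def)
        qed
        moreover have "c 0 = B" by (simp add: c_def)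
        ultimately show ?thesis using True ij by metis
      next
        case False
        hence "i - 1 = j - 1" using ij e by (auto simp: c_def bij_betw_def inj_on_def)
        thus ?thesis using False by linarith
      qed
    qed
    show "c ` {..<Suc M} = ?C"
    proof
      show "c ` {..<Suc M} \<subseteq> ?C" using e_mem BC by (auto simp: c_def)
      show "?C \<subseteq> c ` {..<Suc M}"
      proof
        fix K assume K: "K \<in> ?C"
        show "K \<in> c ` {..<Suc M}"
        proof (cases "K = B")
          case True thus ?thesis by (intro image_eqI[of _ _ 0]) (auto simp: c_def)
        next
          case False
          then obtain i where "i < M" "K = e i" using K e by (auto simp: bij_betw_def)
          thus ?thesis by (intro image_eqI[of _ _ "Suc i"]) (auto simp: c_def)
        qed
      qed
    qed
  qed
  define x where "x i = (if i = 0 then \<one> else SOME y. y \<in> carrier G \<and> c i = B #> y)" for i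
  have x: "x i \<in> carrier G \<and> c i = B #> x i" if "i < Suc M" for i
  proof (cases "i = 0")
    case True thus ?thesis using B.subset by (simp add: x_def c_def)
  next
    case False
    have "c i \<in> ?C" using c that by (auto simp: bij_betw_def)
    hence "\<exists>y. y \<in> carrier G \<and> c i = B #> y" by (auto simp: RCOSETS_def)
    thus ?thesis using someI_ex[of "\<lambda>y. y \<in> carrier G \<and> c i = B #> y"] False by (simp add: x_def)
  qed
  have coset_iff: "g \<otimes> inv y \<in> B \<longleftrightarrow> B #> g = B #> y" if "g \<in> carrier G" "y \<in> carrier G" for g y
    using B.rcos_module[OF is_group that(2,1)] repr_independence[OF _ that(2) B] rcos_self[OF that(1) B]
    by metis
  show ?thesis
  proof (rule that[of "Suc M" x])
    show "Suc M \<le> card Y"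
    proof -
      have "?C \<subseteq> (\<lambda>y. B #> y) ` Y"
      proof
        fix K assume "K \<in> ?C"
        then obtain g where g: "g \<in> carrier G" "K = B #> g" by (auto simp: RCOSETS_def)
        then obtain y where "y \<in> Y" "g \<otimes> inv y \<in> B" using Y(3) by blast
        thus "K \<in> (\<lambda>y. B #> y) ` Y" using coset_iff[OF g(1), of y] g(2) Y(2) by auto
      qed
      hence "card ?C \<le> card Y" using Y(1) by (rule surj_card_le[rotated])
      moreover have "card ?C = Suc M" using bij_betw_same_card[OF c] by simp
      ultimately show ?thesis by simp
    qed
    show "x 0 = \<one>" by (simp add: x_def)
    show "x i \<in> carrier G" if "i < Suc M" for i using x that by blast
    fix g assume g: "g \<in> carrier G"
    have "B #> g \<in> ?C" using g by (auto simp: RCOSETS_def)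
    hence "B #> g \<in> c ` {..<Suc M}" using c by (simp only: bij_betw_def)
    then obtain i where i: "i < Suc M" "c i = B #> g" by auto
    show "\<exists>!i. i < Suc M \<and> g \<otimes> inv (x i) \<in> B"
    proof (rule ex1I[of _ i])
      show "i < Suc M \<and> g \<otimes> inv (x i) \<in> B" using i x[of i] coset_iff[OF g, of "x i"] by auto
      fix j assume j: "j < Suc M \<and> g \<otimes> inv (x j) \<in> B"
      hence "c j = c i" using i x[of j] coset_iff[OF g, of "x j"] by auto
      thus "j = i" using c j i by (auto simp: bij_betw_def inj_on_def)
    qed
  qed simp
qed

locale transversal = group G for G (structure) +
  fixes B and N :: nat and x :: "nat \<Rightarrow> 'a"
  assumes finite_G: "finite (carrier G)" and subgroup_B: "subgroup B G"
    and N_pos: "N > 0" and x_0: "x 0 = \<one>" and x_closed: "\<And>i. i < N \<Longrightarrow> x i \<in> carrier G"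
    and x_unique: "\<And>g. g \<in> carrier G \<Longrightarrow> \<exists>!i. i < N \<and> g \<otimes> inv (x i) \<in> B"

definition extend0 :: "'g set \<Rightarrow> ('g \<Rightarrow> complex) \<Rightarrow> 'g \<Rightarrow> complex" where
  "extend0 B \<kappa> g = (if g \<in> B then \<kappa> g else 0)"

context transversal
begin

definition B_char :: "('a \<Rightarrow> complex) \<Rightarrow> bool" where
  "B_char \<kappa> \<longleftrightarrow> is_char (G\<lparr>carrier := B\<rparr>) \<kappa>"

text \<open>The representation induced from \<open>\<kappa>\<close>, acting by right translation on the functions \<open>F\<close> with
  \<open>F (b g) = \<kappa> b F g\<close>, in the basis of functions supported on a single coset. The function of a
  coordinate vector \<open>v\<close> is \<open>coset_fun \<kappa> v\<close>.\<close>

definition induced :: "('a \<Rightarrow> complex) \<Rightarrow> 'a \<Rightarrow> complex mat" where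
  "induced \<kappa> g = mat N N (\<lambda>(i, j). extend0 B \<kappa> (x i \<otimes> g \<otimes> inv (x j)))"

definition coset_fun :: "('a \<Rightarrow> complex) \<Rightarrow> complex vec \<Rightarrow> 'a \<Rightarrow> complex" where
  "coset_fun \<kappa> v g = (\<Sum>j<N. extend0 B \<kappa> (g \<otimes> inv (x j)) * v $ j)"

lemma B_carrier: "b \<in> B \<Longrightarrow> b \<in> carrier G"
  using subgroup.subset[OF subgroup_B] by blast

lemma B_charD:
  assumes "B_char \<kappa>"
  shows "b \<in> B \<Longrightarrow> \<kappa> b \<noteq> 0" "b \<in> B \<Longrightarrow> b' \<in> B \<Longrightarrow> \<kappa> (b \<otimes> b') = \<kappa> b * \<kappa> b'" "\<kappa> \<one> = 1"
    "b \<in> B \<Longrightarrow> \<kappa> (inv b) = inverse (\<kappa> b)"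
proof -
  interpret B: subgroup B G by (rule subgroup_B)
  show 1: "b \<in> B \<Longrightarrow> \<kappa> b \<noteq> 0" and m: "b \<in> B \<Longrightarrow> b' \<in> B \<Longrightarrow> \<kappa> (b \<otimes> b') = \<kappa> b * \<kappa> b'" for b b'
    using assms by (auto simp: B_char_def is_char_def)
  show one: "\<kappa> \<one> = 1" using m[of \<one> \<one>] 1[of \<one>] by simp
  assume b: "b \<in> B"
  hence "\<kappa> (inv b) * \<kappa> b = 1" using m[of "inv b" b] one B_carrier[OF b] by simp
  thus "\<kappa> (inv b) = inverse (\<kappa> b)" by (metis inverse_unique mult.commute)
qed

lemma extend0_left:
  assumes "B_char \<kappa>" "b \<in> B" "g \<in> carrier G"
  shows "extend0 B \<kappa> (b \<otimes> g) = \<kappa> b * extend0 B \<kappa> g"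
proof -
  interpret B: subgroup B G by (rule subgroup_B)
  have "b \<otimes> g \<in> B \<longleftrightarrow> g \<in> B"
  proof
    assume "b \<otimes> g \<in> B"
    hence "inv b \<otimes> (b \<otimes> g) \<in> B" using assms(2) by auto
    thus "g \<in> B" using assms(3) B_carrier[OF assms(2)] by (simp add: m_assoc[symmetric])
  qed (use assms(2) in auto)
  thus ?thesis using B_charD(2)[OF assms(1,2)] by (auto simp: extend0_def)
qed

lemma x_x: "i < N \<Longrightarrow> j < N \<Longrightarrow> x i \<otimes> inv (x j) \<in> B \<longleftrightarrow> i = j"
proof -
  interpret B: subgroup B G by (rule subgroup_B)
  assume "i < N" "j < N"
  thus ?thesis using x_unique[OF x_closed, of i] x_closed[of i] B.one_closed r_inv by metis
qed

lemma extend0_x_x: "B_char \<kappa> \<Longrightarrow> i < N \<Longrightarrow> j < N \<Longrightarrow> extend0 B \<kappa> (x i \<otimes> inv (x j)) = (if i = j then 1 else 0)"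
  using x_x[of i j] x_closed[of i] B_charD(3) by (auto simp: extend0_def)

lemma extend0_convolution:
  assumes "B_char \<kappa>" and g: "g \<in> carrier G" and h: "h \<in> carrier G"
  shows "(\<Sum>k<N. extend0 B \<kappa> (g \<otimes> inv (x k)) * extend0 B \<kappa> (x k \<otimes> h)) = extend0 B \<kappa> (g \<otimes> h)"
proof -
  obtain k where k: "k < N" "g \<otimes> inv (x k) \<in> B" and uniq: "\<And>j. j < N \<Longrightarrow> g \<otimes> inv (x j) \<in> B \<Longrightarrow> j = k"
    using x_unique[OF g] by metis
  have xk: "x k \<in> carrier G" by (rule x_closed[OF k(1)])
  have "(\<Sum>j<N. extend0 B \<kappa> (g \<otimes> inv (x j)) * extend0 B \<kappa> (x j \<otimes> h)) =
      (\<Sum>j<N. if j = k then extend0 B \<kappa> (g \<otimes> inv (x k)) * extend0 B \<kappa> (x k \<otimes> h) else 0)"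
  proof (rule sum.cong)
    fix j assume "j \<in> {..<N}"
    hence "j = k \<or> g \<otimes> inv (x j) \<notin> B" using uniq by blast
    thus "extend0 B \<kappa> (g \<otimes> inv (x j)) * extend0 B \<kappa> (x j \<otimes> h) =
        (if j = k then extend0 B \<kappa> (g \<otimes> inv (x k)) * extend0 B \<kappa> (x k \<otimes> h) else 0)"
      by (auto simp: extend0_def)
  qed simp
  also have "\<dots> = \<kappa> (g \<otimes> inv (x k)) * extend0 B \<kappa> (x k \<otimes> h)"
    using k by (simp add: extend0_def)
  also have "\<dots> = extend0 B \<kappa> ((g \<otimes> inv (x k)) \<otimes> (x k \<otimes> h))"
    using extend0_left[OF assms(1) k(2), of "x k \<otimes> h"] xk h by simp
  also have "(g \<otimes> inv (x k)) \<otimes> (x k \<otimes> h) = g \<otimes> h"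
    using g h xk by (metis inv_closed inv_solve_right m_assoc m_closed)
  finally show ?thesis .
qed

lemma induced_carrier: "induced \<kappa> g \<in> carrier_mat N N" by (simp add: induced_def)

lemma induced_hom:
  assumes "B_char \<kappa>"
  shows "induced \<kappa> \<in> hom G (GL_complex N)"
  unfolding rep_iff
proof (intro conjI ballI)
  fix g h assume g: "g \<in> carrier G" and h: "h \<in> carrier G"
  show "induced \<kappa> (g \<otimes> h) = induced \<kappa> g * induced \<kappa> h"
  proof (rule eq_matI)
    fix i j assume "i < dim_row (induced \<kappa> g * induced \<kappa> h)" "j < dim_col (induced \<kappa> g * induced \<kappa> h)"
    hence ij: "i < N" "j < N" by (auto simp: induced_def)
    have "(induced \<kappa> g * induced \<kappa> h) $$ (i, j) = (\<Sum>k<N. induced \<kappa> g $$ (i, k) * induced \<kappa> h $$ (k, j))"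
      by (rule mat_mult_entry[OF induced_carrier induced_carrier ij])
    also have "\<dots> = (\<Sum>k<N. extend0 B \<kappa> ((x i \<otimes> g) \<otimes> inv (x k)) * extend0 B \<kappa> (x k \<otimes> (h \<otimes> inv (x j))))"
      using ij h x_closed by (intro sum.cong) (auto simp: induced_def m_assoc)
    also have "\<dots> = extend0 B \<kappa> ((x i \<otimes> g) \<otimes> (h \<otimes> inv (x j)))"
      using ij g h x_closed by (intro extend0_convolution[OF assms]) auto
    also have "\<dots> = induced \<kappa> (g \<otimes> h) $$ (i, j)"
      using ij g h x_closed by (simp add: induced_def m_assoc)
    finally show "induced \<kappa> (g \<otimes> h) $$ (i, j) = (induced \<kappa> g * induced \<kappa> h) $$ (i, j)" by simp
  qed (auto simp: induced_def)
next
  show "induced \<kappa> \<one> = 1\<^sub>m N"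
    using x_closed extend0_x_x[OF assms] by (intro eq_matI) (auto simp: induced_def)
qed (rule induced_carrier)

lemma coset_fun_left:
  assumes "B_char \<kappa>" "b \<in> B" "g \<in> carrier G"
  shows "coset_fun \<kappa> v (b \<otimes> g) = \<kappa> b * coset_fun \<kappa> v g"
  unfolding coset_fun_def sum_distrib_left
proof (rule sum.cong)
  fix j assume "j \<in> {..<N}"
  hence xj: "x j \<in> carrier G" using x_closed by simp
  have "b \<otimes> g \<otimes> inv (x j) = b \<otimes> (g \<otimes> inv (x j))" using assms(3) xj B_carrier[OF assms(2)] by (simp add: m_assoc)
  thus "extend0 B \<kappa> (b \<otimes> g \<otimes> inv (x j)) * v $ j = \<kappa> b * (extend0 B \<kappa> (g \<otimes> inv (x j)) * v $ j)"
    using extend0_left[OF assms(1,2), of "g \<otimes> inv (x j)"] assms(3) xj by simp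
qed simp

lemma coset_fun_smult:
  "v \<in> carrier_vec N \<Longrightarrow> coset_fun \<kappa> (a \<cdot>\<^sub>v v) g = a * coset_fun \<kappa> v g"
  unfolding coset_fun_def sum_distrib_left by (intro sum.cong) auto

lemma coset_fun_x:
  assumes "B_char \<kappa>" "i < N"
  shows "coset_fun \<kappa> v (x i) = v $ i"
proof -
  have "coset_fun \<kappa> v (x i) = (\<Sum>j<N. if i = j then v $ j else 0)"
    unfolding coset_fun_def using assms by (intro sum.cong) (auto simp: extend0_x_x)
  thus ?thesis using assms(2) by simp
qed

lemma coset_fun_translate:
  assumes "B_char \<kappa>" "g \<in> carrier G" "h \<in> carrier G" "v \<in> carrier_vec N"
  shows "coset_fun \<kappa> (induced \<kappa> h *\<^sub>v v) g = coset_fun \<kappa> v (g \<otimes> h)"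
proof -
  have "coset_fun \<kappa> (induced \<kappa> h *\<^sub>v v) g =
      (\<Sum>j<N. extend0 B \<kappa> (g \<otimes> inv (x j)) * (\<Sum>k<N. extend0 B \<kappa> (x j \<otimes> h \<otimes> inv (x k)) * v $ k))"
    unfolding coset_fun_def
    by (intro sum.cong refl arg_cong2[where f="(*)"], subst mat_vec_entry[OF induced_carrier assms(4)])
      (auto simp: induced_def)
  also have "\<dots> = (\<Sum>k<N. (\<Sum>j<N. extend0 B \<kappa> (g \<otimes> inv (x j)) * extend0 B \<kappa> (x j \<otimes> (h \<otimes> inv (x k)))) * v $ k)"
    unfolding sum_distrib_left sum_distrib_right
    by (subst sum.swap) (use assms(3) x_closed in \<open>auto simp: m_assoc intro!: sum.cong\<close>)
  also have "\<dots> = coset_fun \<kappa> v (g \<otimes> h)"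
    unfolding coset_fun_def using assms x_closed
    by (intro sum.cong) (auto simp: extend0_convolution m_assoc)
  finally show ?thesis .
qed

text \<open>A nonzero vector of an invariant subspace can be translated so that its function does not
  vanish at \<open>1\<close>. Averaging it against \<open>\<kappa>\<close> then gives a nonzero function that transforms under
  \<open>B\<close> on both sides. If such functions live on \<open>B\<close> only, this is a multiple of the first basis
  vector, and translates of that one are all the basis vectors.\<close>

lemma induced_irreducible:
  assumes \<kappa>: "B_char \<kappa>"
    and mackey: "\<And>F g. (\<And>b g b'. b \<in> B \<Longrightarrow> g \<in> carrier G \<Longrightarrow> b' \<in> B \<Longrightarrow> F (b \<otimes> g \<otimes> b') = \<kappa> b * F g * \<kappa> b')
      \<Longrightarrow> g \<in> carrier G \<Longrightarrow> g \<notin> B \<Longrightarrow> F g = (0::complex)"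
  shows "irr_rep G N (induced \<kappa>)"
  unfolding irr_rep_def
proof (intro conjI allI impI)
  interpret B: subgroup B G by (rule subgroup_B)
  note ind = induced_hom[OF \<kappa>]
  show "induced \<kappa> \<in> hom G (GL_complex N)" by (rule ind)
  show "N > 0" by (rule N_pos)
  fix W assume W: "VectorSpace.subspace class_ring W (module_vec TYPE(complex) N)"
    and inv: "\<forall>g\<in>carrier G. \<forall>w\<in>W. induced \<kappa> g *\<^sub>v w \<in> W"
  have Wc: "W \<subseteq> carrier_vec N" and W0: "0\<^sub>v N \<in> W" and Ws: "\<And>c v. v \<in> W \<Longrightarrow> c \<cdot>\<^sub>v v \<in> W"
    using W by (auto simp: subspace_vec_iff)
  show "W = {0\<^sub>v N} \<or> W = carrier_vec N"
  proof (rule disjCI)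
    assume "W \<noteq> carrier_vec N"
    show "W = {0\<^sub>v N}"
    proof (rule ccontr)
      assume "W \<noteq> {0\<^sub>v N}"
      then obtain v where v: "v \<in> W" "v \<noteq> 0\<^sub>v N" using W0 by blast
      have vc: "v \<in> carrier_vec N" using v Wc by blast
      obtain i where i: "i < N" "v $ i \<noteq> 0"
      proof (rule ccontr)
        assume "\<not> thesis"
        hence "v = 0\<^sub>v N" using that vc by (intro eq_vecI) auto
        thus False using v by simp
      qed
      define v' where "v' = induced \<kappa> (x i) *\<^sub>v v"
      have v': "v' \<in> W" using inv v x_closed[OF i(1)] by (simp add: v'_def)
      have v'c: "v' \<in> carrier_vec N" using v' Wc by blast
      have v'1: "coset_fun \<kappa> v' \<one> = v $ i"
        using coset_fun_translate[OF \<kappa> one_closed x_closed[OF i(1)] vc] coset_fun_x[OF \<kappa> i(1)] x_closed[OF i(1)]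
        by (simp add: v'_def)
      define f where "f b = \<kappa> (inv b) \<cdot>\<^sub>v (induced \<kappa> b *\<^sub>v v')" for b
      define u where "u = vec N (\<lambda>k. \<Sum>b\<in>B. f b $ k)"
      have finB: "finite B" using B.subset finite_G finite_subset by blast
      have fb: "f b \<in> W" if "b \<in> B" for b using that inv v' Ws B_carrier by (simp add: f_def)
      have u: "u \<in> W" unfolding u_def by (rule subspace_sum_closed[OF W finB fb])
      have Fu: "coset_fun \<kappa> u g = (\<Sum>b\<in>B. \<kappa> (inv b) * coset_fun \<kappa> v' (g \<otimes> b))" if g: "g \<in> carrier G" for g
      proof -
        have "coset_fun \<kappa> u g = (\<Sum>j<N. \<Sum>b\<in>B. extend0 B \<kappa> (g \<otimes> inv (x j)) * f b $ j)"
          unfolding coset_fun_def u_def by (simp add: sum_distrib_left)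
        also have "\<dots> = (\<Sum>b\<in>B. \<Sum>j<N. extend0 B \<kappa> (g \<otimes> inv (x j)) * f b $ j)" by (rule sum.swap)
        also have "\<dots> = (\<Sum>b\<in>B. \<kappa> (inv b) * coset_fun \<kappa> (induced \<kappa> b *\<^sub>v v') g)"
          unfolding coset_fun_def sum_distrib_left
          by (intro sum.cong refl) (auto simp: f_def induced_def)
        finally show ?thesis using coset_fun_translate[OF \<kappa> g _ v'c] B_carrier by simp
      qed
      have right: "coset_fun \<kappa> u (g \<otimes> b') = coset_fun \<kappa> u g * \<kappa> b'" if g: "g \<in> carrier G" and b': "b' \<in> B" for g b'
      proof -
        have "coset_fun \<kappa> u (g \<otimes> b') = (\<Sum>b\<in>B. \<kappa> (inv b) * coset_fun \<kappa> v' (g \<otimes> b' \<otimes> b))"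
          using Fu g b' B_carrier by simp
        also have "\<dots> = (\<Sum>b\<in>B. \<kappa> (inv (inv b' \<otimes> b)) * coset_fun \<kappa> v' (g \<otimes> b' \<otimes> (inv b' \<otimes> b)))"
          by (rule sum.reindex_bij_witness[of _ "\<lambda>b. inv b' \<otimes> b" "\<lambda>b. b' \<otimes> b"])
            (use b' B_carrier in \<open>auto simp: m_assoc[symmetric]\<close>)
        also have "\<dots> = (\<Sum>b\<in>B. \<kappa> b' * (\<kappa> (inv b) * coset_fun \<kappa> v' (g \<otimes> b)))"
        proof (rule sum.cong)
          fix b assume b: "b \<in> B"
          note c = B_carrier[OF b] B_carrier[OF b']
          have "inv (inv b' \<otimes> b) = inv b \<otimes> b'" using c by (simp add: inv_mult_group)
          moreover have "g \<otimes> b' \<otimes> (inv b' \<otimes> b) = g \<otimes> b"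
            using c g by (metis inv_closed inv_solve_right m_assoc m_closed)
          ultimately show "\<kappa> (inv (inv b' \<otimes> b)) * coset_fun \<kappa> v' (g \<otimes> b' \<otimes> (inv b' \<otimes> b)) =
              \<kappa> b' * (\<kappa> (inv b) * coset_fun \<kappa> v' (g \<otimes> b))"
            using B_charD(2)[OF \<kappa>, of "inv b" b'] b b' by simp
        qed simp
        also have "\<dots> = coset_fun \<kappa> u g * \<kappa> b'" using Fu[OF g] by (simp add: sum_distrib_left mult.commute)
        finally show ?thesis .
      qed
      have off: "coset_fun \<kappa> u g = 0" if "g \<in> carrier G" "g \<notin> B" for g
      proof (rule mackey[OF _ that])
        fix b g b' assume "b \<in> B" "g \<in> carrier G" "b' \<in> B"
        thus "coset_fun \<kappa> u (b \<otimes> g \<otimes> b') = \<kappa> b * coset_fun \<kappa> u g * \<kappa> b'"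
          using right[of "b \<otimes> g" b'] coset_fun_left[OF \<kappa>] B_carrier by simp
      qed
      have at1: "coset_fun \<kappa> u \<one> = of_nat (card B) * v $ i"
      proof -
        have "coset_fun \<kappa> u \<one> = (\<Sum>b\<in>B. v $ i)"
          unfolding Fu[OF one_closed]
        proof (rule sum.cong)
          fix b assume b: "b \<in> B"
          show "\<kappa> (inv b) * coset_fun \<kappa> v' (\<one> \<otimes> b) = v $ i"
            using coset_fun_left[OF \<kappa> b one_closed, of v'] v'1 B_charD(1,4)[OF \<kappa> b] B_carrier[OF b] by simp
        qed simp
        thus ?thesis by simp
      qed
      have cB: "card B > 0" using finB B.one_closed by (metis card_gt_0_iff empty_iff)
      have u_eq: "u = (of_nat (card B) * v $ i) \<cdot>\<^sub>v unit_vec N 0"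
      proof (rule eq_vecI)
        fix j assume "j < dim_vec ((of_nat (card B) * v $ i) \<cdot>\<^sub>v unit_vec N 0)"
        hence j: "j < N" by simp
        show "u $ j = ((of_nat (card B) * v $ i) \<cdot>\<^sub>v unit_vec N 0) $ j"
        proof (cases "j = 0")
          case True
          thus ?thesis using coset_fun_x[OF \<kappa> j, of u] at1 x_0 j by simp
        next
          case False
          hence "x j \<notin> B" using x_x[OF j N_pos] x_0 x_closed[OF j] by simp
          thus ?thesis using coset_fun_x[OF \<kappa> j, of u] off[OF x_closed[OF j]] False j by simp
        qed
      qed (simp add: u_def)
      have "inverse (of_nat (card B) * v $ i) \<cdot>\<^sub>v u \<in> W" using u by (rule Ws)
      moreover have "inverse (of_nat (card B) * v $ i) * (of_nat (card B) * v $ i) = 1"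
        by (rule left_inverse) (use cB i(2) in simp)
      ultimately have e0: "unit_vec N 0 \<in> W" unfolding u_eq smult_smult_assoc by (metis one_smult_vec)
      have ej: "unit_vec N j \<in> W" if j: "j < N" for j
      proof -
        have "induced \<kappa> (inv (x j)) *\<^sub>v unit_vec N 0 = unit_vec N j"
        proof (rule eq_vecI)
          fix k assume "k < dim_vec (unit_vec N j :: complex vec)"
          hence k: "k < N" by simp
          show "(induced \<kappa> (inv (x j)) *\<^sub>v unit_vec N 0) $ k = unit_vec N j $ k"
            using mat_vec_unit[OF induced_carrier N_pos, of \<kappa> "inv (x j)"] k j N_pos x_0 x_closed[OF k] x_closed[OF j]
              extend0_x_x[OF \<kappa> k j] by (auto simp: induced_def)
        qed (simp add: induced_def)
        thus ?thesis using inv e0 x_closed[OF j] by (metis inv_closed)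
      qed
      have "carrier_vec N \<subseteq> W"
      proof
        fix w :: "complex vec" assume w: "w \<in> carrier_vec N"
        have "vec N (\<lambda>k. \<Sum>j\<in>{..<N}. (w $ j \<cdot>\<^sub>v unit_vec N j) $ k) \<in> W"
          by (rule subspace_sum_closed[OF W]) (auto intro: Ws ej)
        moreover have "vec N (\<lambda>k. \<Sum>j\<in>{..<N}. (w $ j \<cdot>\<^sub>v unit_vec N j) $ k) = w"
        proof (rule eq_vecI)
          fix k assume "k < dim_vec w"
          hence k: "k < N" using w by simp
          have "(\<Sum>j<N. (w $ j \<cdot>\<^sub>v unit_vec N j) $ k) = (\<Sum>j<N. if k = j then w $ j else 0)"
            using k by (intro sum.cong) auto
          thus "vec N (\<lambda>k. \<Sum>j\<in>{..<N}. (w $ j \<cdot>\<^sub>v unit_vec N j) $ k) $ k = w $ k" using k by simp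
        qed (use w in simp)
        ultimately show "w \<in> W" by simp
      qed
      thus False using Wc \<open>W \<noteq> carrier_vec N\<close> by blast
    qed
  qed
qed

text \<open>The first basis vector is an eigenvector of \<open>B\<close> with character \<open>\<kappa>\<close>, hence so is its image
  under an isomorphism. Regarded as a function on \<open>G\<close>, this image transforms under \<open>B\<close> on both
  sides.\<close>

lemma induced_iso_twist:
  assumes \<kappa>: "B_char \<kappa>" and \<kappa>': "B_char \<kappa>'" and f: "is_char G f"
    and iso: "rep_iso G N (induced \<kappa>) (twist f (induced \<kappa>'))"
  obtains F g where "\<And>b g b'. b \<in> B \<Longrightarrow> g \<in> carrier G \<Longrightarrow> b' \<in> B \<Longrightarrow> F (b \<otimes> g \<otimes> b') = f b * \<kappa>' b * F g * \<kappa> b'"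
    "g \<in> carrier G" "F g \<noteq> (0::complex)"
proof -
  interpret B: subgroup B G by (rule subgroup_B)
  obtain A where A: "A \<in> carrier (GL_complex N)"
    and eq: "\<And>g. g \<in> carrier G \<Longrightarrow> A * induced \<kappa> g = twist f (induced \<kappa>') g * A"
    using iso unfolding rep_iso_def by blast
  obtain C where C: "C \<in> carrier_mat N N" "C * A = 1\<^sub>m N" and Ac: "A \<in> carrier_mat N N"
    using A by (auto simp: GL_complex_carrier_iff)
  let ?e = "unit_vec N 0 :: complex vec"
  define v where "v = A *\<^sub>v ?e"
  have vc: "v \<in> carrier_vec N" using Ac by (simp add: v_def)
  have "v \<noteq> 0\<^sub>v N"
  proof
    assume v0: "v = 0\<^sub>v N"
    have "?e = C * A *\<^sub>v ?e" by (simp add: C(2))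
    also have "\<dots> = C *\<^sub>v v" unfolding v_def by (rule assoc_mult_mat_vec[OF C(1) Ac]) simp
    also have "\<dots> = 0\<^sub>v N" using C(1) by (auto simp: v0)
    finally show False using N_pos by simp
  qed
  then obtain i where i: "i < N" "v $ i \<noteq> 0"
    using vc by (metis carrier_vecD eq_vecI index_zero_vec(1) index_zero_vec(2))
  have eig: "f b \<cdot>\<^sub>v (induced \<kappa>' b *\<^sub>v v) = \<kappa> b \<cdot>\<^sub>v v" if b: "b \<in> B" for b
  proof -
    note bc = B_carrier[OF b]
    have "induced \<kappa> b *\<^sub>v ?e = \<kappa> b \<cdot>\<^sub>v ?e"
    proof (rule eq_vecI)
      fix k assume "k < dim_vec (\<kappa> b \<cdot>\<^sub>v ?e)"
      hence k: "k < N" by simp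
      have "x k \<otimes> b \<in> B \<longleftrightarrow> k = 0"
      proof
        assume *: "x k \<otimes> b \<in> B"
        have "x k = (x k \<otimes> b) \<otimes> inv b" using bc x_closed[OF k] by (simp add: m_assoc)
        hence "x k \<in> B" using * b by (metis B.m_closed B.m_inv_closed)
        thus "k = 0" using x_x[OF k N_pos] x_0 x_closed[OF k] by simp
      qed (use x_0 b bc in simp)
      hence "extend0 B \<kappa> (x k \<otimes> b) = (if k = 0 then \<kappa> b else 0)"
        using x_0 bc by (auto simp: extend0_def)
      thus "(induced \<kappa> b *\<^sub>v ?e) $ k = (\<kappa> b \<cdot>\<^sub>v ?e) $ k"
        using mat_vec_unit[OF induced_carrier N_pos, of \<kappa> b] k N_pos x_0 x_closed[OF k] bc
        by (auto simp: induced_def)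
    qed (simp add: induced_def)
    hence "\<kappa> b \<cdot>\<^sub>v v = A *\<^sub>v (induced \<kappa> b *\<^sub>v ?e)"
      unfolding v_def using mult_mat_vec[OF Ac, of ?e "\<kappa> b"] by simp
    also have "\<dots> = (A * induced \<kappa> b) *\<^sub>v ?e" by (rule assoc_mult_mat_vec[OF Ac induced_carrier, symmetric]) simp
    also have "\<dots> = twist f (induced \<kappa>') b *\<^sub>v v"
      unfolding eq[OF bc] v_def by (rule assoc_mult_mat_vec[OF _ Ac, where n\<^sub>1=N]) (auto simp: twist_def induced_carrier)
    also have "\<dots> = f b \<cdot>\<^sub>v (induced \<kappa>' b *\<^sub>v v)"
      unfolding twist_def by (rule smult_mat_vec[OF induced_carrier vc])
    finally show ?thesis by simp
  qed
  define F where "F g = f g * coset_fun \<kappa>' v g" for g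
  show ?thesis
  proof (rule that[of F "x i"])
    show "x i \<in> carrier G" by (rule x_closed[OF i(1)])
    show "F (x i) \<noteq> 0" using coset_fun_x[OF \<kappa>' i(1)] i(2) f x_closed[OF i(1)] by (simp add: F_def is_char_def)
    fix b g b' assume b: "b \<in> B" and g: "g \<in> carrier G" and b': "b' \<in> B"
    note c = B_carrier[OF b] B_carrier[OF b'] g
    have "f b' * coset_fun \<kappa>' v (g \<otimes> b') = coset_fun \<kappa>' (f b' \<cdot>\<^sub>v (induced \<kappa>' b' *\<^sub>v v)) g"
      using coset_fun_translate[OF \<kappa>' g c(2) vc] coset_fun_smult[of "induced \<kappa>' b' *\<^sub>v v"]
        mult_mat_vec_carrier[OF induced_carrier vc] by simp
    also have "\<dots> = coset_fun \<kappa>' v g * \<kappa> b'"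
      unfolding eig[OF b'] coset_fun_smult[OF vc] by simp
    finally have r: "f b' * coset_fun \<kappa>' v (g \<otimes> b') = coset_fun \<kappa>' v g * \<kappa> b'" .
    have "F (b \<otimes> g \<otimes> b') = f b * f g * f b' * (\<kappa>' b * coset_fun \<kappa>' v (g \<otimes> b'))"
      using f c coset_fun_left[OF \<kappa>' b, of "g \<otimes> b'"] by (simp add: F_def is_char_def m_assoc)
    also have "\<dots> = f b * \<kappa>' b * f g * (f b' * coset_fun \<kappa>' v (g \<otimes> b'))" by simp
    also have "\<dots> = f b * \<kappa>' b * F g * \<kappa> b'" unfolding r by (simp add: F_def)
    finally show "F (b \<otimes> g \<otimes> b') = f b * \<kappa>' b * F g * \<kappa> b'" .
  qed
qed

end

section \<open>The group \<open>GL\<^sub>2\<close> of a commutative ring\<close>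

definition det2 :: "('a, 'b) ring_scheme \<Rightarrow> 'a mat2 \<Rightarrow> 'a" where
  "det2 R = (\<lambda>(a, b, c, d). a \<otimes>\<^bsub>R\<^esub> d \<ominus>\<^bsub>R\<^esub> b \<otimes>\<^bsub>R\<^esub> c)"

lemma GL2_mult [simp]:
  "(a, b, c, d) \<otimes>\<^bsub>GL2 R\<^esub> (a', b', c', d') =
    (a \<otimes>\<^bsub>R\<^esub> a' \<oplus>\<^bsub>R\<^esub> b \<otimes>\<^bsub>R\<^esub> c', a \<otimes>\<^bsub>R\<^esub> b' \<oplus>\<^bsub>R\<^esub> b \<otimes>\<^bsub>R\<^esub> d',
     c \<otimes>\<^bsub>R\<^esub> a' \<oplus>\<^bsub>R\<^esub> d \<otimes>\<^bsub>R\<^esub> c', c \<otimes>\<^bsub>R\<^esub> b' \<oplus>\<^bsub>R\<^esub> d \<otimes>\<^bsub>R\<^esub> d')"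
  by (simp add: GL2_def mat2_monoid_def units_of_def)

lemma GL2_one: "\<one>\<^bsub>GL2 R\<^esub> = (\<one>\<^bsub>R\<^esub>, \<zero>\<^bsub>R\<^esub>, \<zero>\<^bsub>R\<^esub>, \<one>\<^bsub>R\<^esub>)"
  by (simp add: GL2_def mat2_monoid_def units_of_def)

context cring
begin

lemma group_GL2: "group (GL2 R)"
  by (rule GL2_is_group) (rule ring_axioms)

lemma det2_mult:
  assumes "a \<in> carrier R" "b \<in> carrier R" "c \<in> carrier R" "d \<in> carrier R"
    "a' \<in> carrier R" "b' \<in> carrier R" "c' \<in> carrier R" "d' \<in> carrier R"
  shows "(a \<otimes> a' \<oplus> b \<otimes> c') \<otimes> (c \<otimes> b' \<oplus> d \<otimes> d') \<ominus> (a \<otimes> b' \<oplus> b \<otimes> d') \<otimes> (c \<otimes> a' \<oplus> d \<otimes> c') =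
    (a \<otimes> d \<ominus> b \<otimes> c) \<otimes> (a' \<otimes> d' \<ominus> b' \<otimes> c')"
  using assms by algebra

lemma GL2_mem_iff:
  "(a, b, c, d) \<in> carrier (GL2 R) \<longleftrightarrow>
    a \<in> carrier R \<and> b \<in> carrier R \<and> c \<in> carrier R \<and> d \<in> carrier R \<and> a \<otimes> d \<ominus> b \<otimes> c \<in> Units R"
  (is "?L \<longleftrightarrow> ?R")
proof
  assume ?L
  then obtain a' b' c' d' where c: "a \<in> carrier R" "b \<in> carrier R" "c \<in> carrier R" "d \<in> carrier R"
    "a' \<in> carrier R" "b' \<in> carrier R" "c' \<in> carrier R" "d' \<in> carrier R"
    and e: "a \<otimes> a' \<oplus> b \<otimes> c' = \<one>" "a \<otimes> b' \<oplus> b \<otimes> d' = \<zero>" "c \<otimes> a' \<oplus> d \<otimes> c' = \<zero>" "c \<otimes> b' \<oplus> d \<otimes> d' = \<one>"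
    by (auto simp: GL2_def units_of_def Units_def mat2_monoid_def)
  have "(a \<otimes> d \<ominus> b \<otimes> c) \<otimes> (a' \<otimes> d' \<ominus> b' \<otimes> c') = \<one> \<otimes> \<one> \<ominus> \<zero> \<otimes> \<zero>"
    using det2_mult[OF c] unfolding e by simp
  also have "\<dots> = \<one>" by (simp add: minus_eq)
  finally have 1: "(a \<otimes> d \<ominus> b \<otimes> c) \<otimes> (a' \<otimes> d' \<ominus> b' \<otimes> c') = \<one>" .
  hence 2: "(a' \<otimes> d' \<ominus> b' \<otimes> c') \<otimes> (a \<otimes> d \<ominus> b \<otimes> c) = \<one>" using c by (simp add: m_comm)
  have "a \<otimes> d \<ominus> b \<otimes> c \<in> Units R"
    unfolding Units_def using c 1 2 by (auto intro!: bexI[of _ "a' \<otimes> d' \<ominus> b' \<otimes> c'"])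
  thus ?R using c by simp
next
  assume R: ?R
  then obtain \<delta> where \<delta>: "\<delta> \<in> carrier R" "(a \<otimes> d \<ominus> b \<otimes> c) \<otimes> \<delta> = \<one>"
    using Units_inv_closed Units_r_inv by blast
  let ?N = "(d \<otimes> \<delta>, \<ominus> b \<otimes> \<delta>, \<ominus> c \<otimes> \<delta>, a \<otimes> \<delta>)"
  have c: "a \<in> carrier R" "b \<in> carrier R" "c \<in> carrier R" "d \<in> carrier R" using R by auto
  have 1: "a \<otimes> (d \<otimes> \<delta>) \<oplus> b \<otimes> (\<ominus> c \<otimes> \<delta>) = \<one>" "a \<otimes> (\<ominus> b \<otimes> \<delta>) \<oplus> b \<otimes> (a \<otimes> \<delta>) = \<zero>"
    "c \<otimes> (d \<otimes> \<delta>) \<oplus> d \<otimes> (\<ominus> c \<otimes> \<delta>) = \<zero>" "c \<otimes> (\<ominus> b \<otimes> \<delta>) \<oplus> d \<otimes> (a \<otimes> \<delta>) = \<one>"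
    unfolding \<delta>(2)[symmetric] using c \<delta>(1) by algebra+
  have 2: "d \<otimes> \<delta> \<otimes> a \<oplus> \<ominus> b \<otimes> \<delta> \<otimes> c = \<one>" "d \<otimes> \<delta> \<otimes> b \<oplus> \<ominus> b \<otimes> \<delta> \<otimes> d = \<zero>"
    "\<ominus> c \<otimes> \<delta> \<otimes> a \<oplus> a \<otimes> \<delta> \<otimes> c = \<zero>" "\<ominus> c \<otimes> \<delta> \<otimes> b \<oplus> a \<otimes> \<delta> \<otimes> d = \<one>"
    unfolding \<delta>(2)[symmetric] using c \<delta>(1) by algebra+
  have "(a, b, c, d) \<in> Units (mat2_monoid R)"
    unfolding Units_def
    by (intro CollectI conjI bexI[of _ ?N]) (use c \<delta>(1) in \<open>simp_all add: mat2_monoid_def 1 2\<close>)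
  thus ?L by (simp add: GL2_def units_of_def)
qed

lemma GL2_E:
  assumes "g \<in> carrier (GL2 R)"
  obtains a b c d where "g = (a, b, c, d)" "a \<in> carrier R" "b \<in> carrier R" "c \<in> carrier R" "d \<in> carrier R"
    "a \<otimes> d \<ominus> b \<otimes> c \<in> Units R"
  using assms by (cases g) (auto simp: GL2_mem_iff)

lemma det2_hom: "det2 R \<in> hom (GL2 R) (units_of R)"
proof -
  have "det2 R (g \<otimes>\<^bsub>GL2 R\<^esub> h) = det2 R g \<otimes> det2 R h" if "g \<in> carrier (GL2 R)" "h \<in> carrier (GL2 R)" for g h
    using that by (elim GL2_E) (simp add: det2_def det2_mult)
  moreover have "det2 R g \<in> Units R" if "g \<in> carrier (GL2 R)" for g
    using that by (elim GL2_E) (simp add: det2_def)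
  ultimately show ?thesis by (auto simp: hom_def units_of_def)
qed

lemma det2_char: "is_char (units_of R) f \<Longrightarrow> is_char (GL2 R) (\<lambda>g. f (det2 R g))"
  by (rule is_char_compose[OF _ det2_hom])

lemma scalar_GL2:
  assumes z: "z \<in> Units R"
  shows "(z, \<zero>, \<zero>, z) \<in> carrier (GL2 R)" "det2 R (z, \<zero>, \<zero>, z) = z \<otimes> z"
    "g \<in> carrier (GL2 R) \<Longrightarrow> (z, \<zero>, \<zero>, z) \<otimes>\<^bsub>GL2 R\<^esub> g = g \<otimes>\<^bsub>GL2 R\<^esub> (z, \<zero>, \<zero>, z)"
proof -
  have c: "z \<in> carrier R" using z by auto
  show "(z, \<zero>, \<zero>, z) \<in> carrier (GL2 R)" "det2 R (z, \<zero>, \<zero>, z) = z \<otimes> z"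
    using z c by (auto simp: GL2_mem_iff det2_def minus_eq)
  show "g \<in> carrier (GL2 R) \<Longrightarrow> (z, \<zero>, \<zero>, z) \<otimes>\<^bsub>GL2 R\<^esub> g = g \<otimes>\<^bsub>GL2 R\<^esub> (z, \<zero>, \<zero>, z)"
    using c by (elim GL2_E) (simp add: m_comm)
qed

end


section \<open>Finite chain rings\<close>

text \<open>The ring modelled on the quotient of a discrete valuation ring with residue field of size \<open>q\<close>
  by the \<open>r\<close>-th power of its maximal ideal; \<open>p\<close> is the image of a uniformiser. For \<open>r = 0\<close> it is the
  zero ring.\<close>

locale chain_ring = cring R for R (structure) +
  fixes p :: 'a and r q :: nat
  assumes finite_carrier: "finite (carrier R)" and p_closed [simp]: "p \<in> carrier R" and q_ge: "q \<ge> 2"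
    and unit_power: "x \<in> carrier R \<Longrightarrow> \<exists>u\<in>Units R. \<exists>k\<le>r. x = u \<otimes> p [^] k"
    and p_pow_r: "p [^] r = \<zero>"
    and card_pow_ideal: "k \<le> r \<Longrightarrow> card ((\<lambda>x. p [^] k \<otimes> x) ` carrier R) = q ^ (r - k)"
begin

definition I :: "nat \<Rightarrow> 'a set" where
  "I k = (\<lambda>x. p [^] k \<otimes> x) ` carrier R"

definition U :: "nat \<Rightarrow> 'a set" where
  "U k = (\<lambda>x. \<one> \<oplus> x) ` I k"

abbreviation \<G> where "\<G> \<equiv> GL2 R"

lemma unit_powerE:
  assumes "x \<in> carrier R"
  obtains u k where "u \<in> Units R" "k \<le> r" "x = u \<otimes> p [^] k"
  using unit_power[OF assms] by metis

lemma card_I: "k \<le> r \<Longrightarrow> card (I k) = q ^ (r - k)"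
  by (simp add: I_def card_pow_ideal)

lemma I_closed [simp]: "x \<in> I k \<Longrightarrow> x \<in> carrier R" by (auto simp: I_def)

lemma finite_I: "finite (I k)" using finite_carrier by (simp add: I_def)

lemma I_0: "I 0 = carrier R" by (auto simp: I_def)

lemma card_carrier: "card (carrier R) = q ^ r" using card_I[of 0] by (simp add: I_0)

lemma I_I: "x \<in> carrier R \<Longrightarrow> p [^] k \<otimes> x \<in> I k" by (simp add: I_def)

lemma I_zero [simp]: "\<zero> \<in> I k" using I_I[of \<zero> k] by simp

lemma I_mult: "x \<in> I k \<Longrightarrow> y \<in> carrier R \<Longrightarrow> x \<otimes> y \<in> I k" "x \<in> I k \<Longrightarrow> y \<in> carrier R \<Longrightarrow> y \<otimes> x \<in> I k"
proof -
  show "x \<otimes> y \<in> I k" if x: "x \<in> I k" and y: "y \<in> carrier R" for x y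
  proof -
    obtain z where z: "z \<in> carrier R" "x = p [^] k \<otimes> z" using x by (auto simp: I_def)
    hence "x \<otimes> y = p [^] k \<otimes> (z \<otimes> y)" using y by (simp add: m_assoc)
    thus ?thesis using z y I_I by simp
  qed
  thus "x \<in> I k \<Longrightarrow> y \<in> carrier R \<Longrightarrow> y \<otimes> x \<in> I k" by (simp add: m_comm)
qed

lemma I_add: "x \<in> I k \<Longrightarrow> y \<in> I k \<Longrightarrow> x \<oplus> y \<in> I k"
proof -
  assume "x \<in> I k" "y \<in> I k"
  then obtain a b where ab: "a \<in> carrier R" "b \<in> carrier R" "x = p [^] k \<otimes> a" "y = p [^] k \<otimes> b" by (auto simp: I_def)
  hence "x \<oplus> y = p [^] k \<otimes> (a \<oplus> b)" by (simp add: r_distr)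
  thus ?thesis using ab I_I by simp
qed

lemma I_uminus: "x \<in> I k \<Longrightarrow> \<ominus> x \<in> I k"
  using I_mult(1)[of x k "\<ominus> \<one>"] by (simp add: r_minus)

lemma I_minus: "x \<in> I k \<Longrightarrow> y \<in> I k \<Longrightarrow> x \<ominus> y \<in> I k"
  using I_add I_uminus by (simp add: minus_eq)

lemma I_I_mult: "x \<in> I k \<Longrightarrow> y \<in> I l \<Longrightarrow> x \<otimes> y \<in> I (k + l)"
proof -
  assume "x \<in> I k" "y \<in> I l"
  then obtain a b where ab: "a \<in> carrier R" "b \<in> carrier R" "x = p [^] k \<otimes> a" "y = p [^] l \<otimes> b" by (auto simp: I_def)
  hence "x \<otimes> y = p [^] (k + l) \<otimes> (a \<otimes> b)" by (simp add: nat_pow_mult[symmetric] m_ac)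
  thus ?thesis using ab I_I by simp
qed

lemma I_antimono: "k \<le> l \<Longrightarrow> I l \<subseteq> I k"
proof
  fix x assume "k \<le> l" "x \<in> I l"
  then obtain a where a: "a \<in> carrier R" "x = p [^] l \<otimes> a" by (auto simp: I_def)
  have "p [^] l = p [^] k \<otimes> p [^] (l - k)" using \<open>k \<le> l\<close> by (simp add: nat_pow_mult)
  thus "x \<in> I k" using a I_I[of "p [^] (l - k) \<otimes> a" k] by (simp add: m_assoc)
qed

lemma I_ge_r: "k \<ge> r \<Longrightarrow> I k = {\<zero>}"
proof -
  assume k: "k \<ge> r"
  have "I r = {\<zero>}" using p_pow_r by (auto simp: I_def)
  thus "I k = {\<zero>}" using I_antimono[OF k] I_zero[of k] by blast
qed

lemma p_pow_mem: "p [^] k \<in> I k" using I_I[of \<one> k] by simp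

lemma p_pow_eq_0_iff: "p [^] k = \<zero> \<longleftrightarrow> k \<ge> r"
proof
  assume 0: "p [^] k = \<zero>"
  show "k \<ge> r"
  proof (rule ccontr)
    assume "\<not> r \<le> k"
    hence "card (I k) = q ^ (r - k)" "r - k > 0" by (auto simp: card_I)
    moreover have "I k = {\<zero>}" using 0 by (auto simp: I_def)
    moreover have "1 < q ^ (r - k)" using q_ge \<open>r - k > 0\<close> by (intro one_less_power) auto
    ultimately show False by simp
  qed
next
  assume "k \<ge> r"
  thus "p [^] k = \<zero>" using I_ge_r p_pow_mem[of k] by auto
qed

lemma I_mult_zero: "x \<in> I k \<Longrightarrow> y \<in> I l \<Longrightarrow> k + l \<ge> r \<Longrightarrow> x \<otimes> y = \<zero>"
  using I_I_mult[of x k y l] I_ge_r[of "k + l"] by auto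

lemma unit_not_I: "r \<ge> 1 \<Longrightarrow> x \<in> Units R \<Longrightarrow> x \<notin> I 1"
proof
  assume r: "r \<ge> 1" and u: "x \<in> Units R" and x: "x \<in> I 1"
  have "\<one> \<in> I 1" using I_mult(1)[OF x, of "inv x"] u by simp
  hence "carrier R \<subseteq> I 1" using I_mult(2)[of \<one> 1] by auto
  hence "card (carrier R) \<le> card (I 1)" by (rule card_mono[OF finite_I])
  moreover have "q ^ (r - 1) < q ^ r" using r q_ge by (intro power_strict_increasing) auto
  ultimately show False using r by (simp add: card_carrier card_I)
qed

lemma not_I_unit: "x \<in> carrier R \<Longrightarrow> x \<notin> I 1 \<Longrightarrow> x \<in> Units R"
proof -
  assume x: "x \<in> carrier R" "x \<notin> I 1"
  obtain u k where uk: "u \<in> Units R" "k \<le> r" "x = u \<otimes> p [^] k" by (rule unit_powerE[OF x(1)])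
  have "k = 0"
  proof (rule ccontr)
    assume "k \<noteq> 0"
    hence "p [^] k \<in> I 1" using I_antimono[of 1 k] p_pow_mem[of k] by auto
    thus False using x(2) uk I_mult(2) by auto
  qed
  thus ?thesis using uk by simp
qed

lemma add_unit: "r \<ge> 1 \<Longrightarrow> u \<in> Units R \<Longrightarrow> x \<in> I 1 \<Longrightarrow> u \<oplus> x \<in> Units R"
proof (rule not_I_unit)
  assume a: "r \<ge> 1" "u \<in> Units R" "x \<in> I 1"
  show "u \<oplus> x \<in> carrier R" using a by auto
  show "u \<oplus> x \<notin> I 1"
  proof
    assume "u \<oplus> x \<in> I 1"
    hence "u \<oplus> x \<ominus> x \<in> I 1" using a(3) I_minus by blast
    moreover have "u \<oplus> x \<ominus> x = u" using I_closed[OF a(3)] Units_closed[OF a(2)] by algebra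
    ultimately show False using unit_not_I[OF a(1,2)] by simp
  qed
qed

lemma unit_mult_eq_zero:
  assumes "t \<in> Units R" "y \<in> carrier R" "t \<otimes> y = \<zero>"
  shows "y = \<zero>"
proof -
  have "y = inv t \<otimes> (t \<otimes> y)" using assms(1,2) by (simp add: m_assoc[symmetric] Units_closed)
  thus ?thesis using assms(1,3) by simp
qed

lemma divides_socle:
  assumes "x \<in> carrier R" "x \<noteq> \<zero>" "z \<in> I (r - 1)"
  obtains y where "y \<in> carrier R" "x \<otimes> y = z"
proof -
  obtain u k where uk: "u \<in> Units R" "k \<le> r" "x = u \<otimes> p [^] k" by (rule unit_powerE[OF assms(1)])
  have "k \<noteq> r" using uk assms(2) p_pow_r by auto
  hence k: "r - 1 = k + (r - 1 - k)" using uk(2) by simp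
  obtain a where a: "a \<in> carrier R" "z = p [^] (r - 1) \<otimes> a" using assms(3) by (auto simp: I_def)
  have "p [^] (r - 1) = p [^] k \<otimes> p [^] (r - 1 - k)" by (subst k) (simp add: nat_pow_mult)
  hence z: "z = p [^] k \<otimes> p [^] (r - 1 - k) \<otimes> a" using a by simp
  have "x \<otimes> (inv u \<otimes> (p [^] (r - 1 - k) \<otimes> a)) = (u \<otimes> inv u) \<otimes> (p [^] k \<otimes> p [^] (r - 1 - k) \<otimes> a)"
    
    unfolding uk(3) using a Units_closed[OF uk(1)] Units_inv_closed[OF uk(1)] by (simp add: m_ac del: Units_r_inv Units_l_inv)
  also have "\<dots> = z" using z uk(1) a by simp
  finally have "x \<otimes> (inv u \<otimes> (p [^] (r - 1 - k) \<otimes> a)) = z" .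
  thus ?thesis by (rule that[rotated]) (use uk(1) a in auto)
qed

lemma Units_eq: "r \<ge> 1 \<Longrightarrow> Units R = carrier R - I 1"
  using unit_not_I not_I_unit by auto

lemma finite_Units: "finite (Units R)" using finite_carrier by (auto simp: Units_def)

lemma card_Units: "r \<ge> 1 \<Longrightarrow> card (Units R) = q ^ r - q ^ (r - 1)"
proof -
  assume r: "r \<ge> 1"
  have "card (carrier R - I 1) = card (carrier R) - card (I 1)"
    by (rule card_Diff_subset) (auto intro: finite_I)
  thus ?thesis using r by (simp add: Units_eq card_carrier card_I)
qed

lemma card_Units_ge: "q ^ r \<le> 2 * card (Units R)"
proof (cases "r = 0")
  case True
  have "\<one> \<in> Units R" by simp
  hence "card (Units R) > 0" using finite_Units by (auto simp: card_gt_0_iff)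
  thus ?thesis using True by simp
next
  case False
  have "2 * q ^ (r - 1) \<le> q * q ^ (r - 1)" using q_ge by simp
  also have "\<dots> = q ^ r" using False by (simp flip: power_Suc)
  finally show ?thesis using False by (simp add: card_Units)
qed

lemma units_group: "comm_group (units_of R)" by (rule units_comm_group)

lemma units_of_simps: "carrier (units_of R) = Units R" "x \<otimes>\<^bsub>units_of R\<^esub> y = x \<otimes> y" "\<one>\<^bsub>units_of R\<^esub> = \<one>"
  by (auto simp: units_of_def)

lemma subgroup_units_I:
  assumes "H \<subseteq> Units R" "\<one> \<in> H" "\<And>x y. x \<in> H \<Longrightarrow> y \<in> H \<Longrightarrow> x \<otimes> y \<in> H" "\<And>x. x \<in> H \<Longrightarrow> inv x \<in> H"
  shows "subgroup H (units_of R)"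
proof -
  have "inv\<^bsub>units_of R\<^esub> x = inv x" if "x \<in> H" for x using units_of_inv that assms(1) by blast
  thus ?thesis using assms by (intro subgroup.intro) (auto simp: units_of_simps)
qed

lemma U_I: "x \<in> I k \<Longrightarrow> \<one> \<oplus> x \<in> U k" by (simp add: U_def)

lemma U_Units: "r \<ge> 1 \<Longrightarrow> k \<ge> 1 \<Longrightarrow> U k \<subseteq> Units R"
  using add_unit[of \<one>] I_antimono[of 1 k] by (auto simp: U_def)

lemma U_antimono: "k \<le> l \<Longrightarrow> U l \<subseteq> U k"
  using I_antimono[of k l] by (auto simp: U_def)

lemma subgroup_U:
  assumes r: "r \<ge> 1" and k: "k \<ge> 1"
  shows "subgroup (U k) (units_of R)"
proof (rule subgroup_units_I)
  show sub: "U k \<subseteq> Units R" by (rule U_Units[OF r k])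
  show "\<one> \<in> U k" using U_I[of \<zero> k] by simp
  fix x y assume "x \<in> U k" "y \<in> U k"
  then obtain a b where ab: "a \<in> I k" "b \<in> I k" "x = \<one> \<oplus> a" "y = \<one> \<oplus> b" by (auto simp: U_def)
  note c = I_closed[OF ab(1)] I_closed[OF ab(2)]
  have "x \<otimes> y = \<one> \<oplus> (a \<oplus> b \<oplus> a \<otimes> b)" unfolding ab using c by algebra
  thus "x \<otimes> y \<in> U k" using U_I[OF I_add[OF I_add[OF ab(1,2)] I_mult(1)[OF ab(1) c(2)]]] by simp
next
  fix x assume x: "x \<in> U k"
  then obtain a where a: "a \<in> I k" "x = \<one> \<oplus> a" by (auto simp: U_def)
  have u: "x \<in> Units R" using x U_Units[OF r k] by blast
  hence ic: "inv x \<in> carrier R" by simp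
  have "inv x = inv x \<otimes> (x \<ominus> a)"
  proof -
    have "x \<ominus> a = \<one>" unfolding a(2) using I_closed[OF a(1)] by algebra
    thus ?thesis using ic by simp
  qed
  also have "\<dots> = inv x \<otimes> x \<ominus> inv x \<otimes> a" using ic u I_closed[OF a(1)] Units_closed[OF u] by algebra
  also have "\<dots> = \<one> \<oplus> (\<ominus> (inv x \<otimes> a))" using u by (simp add: minus_eq)
  finally show "inv x \<in> U k" using U_I[OF I_uminus[OF I_mult(2)[OF a(1) ic]]] by simp
qed

lemma card_U: "k \<le> r \<Longrightarrow> card (U k) = q ^ (r - k)"
proof -
  assume k: "k \<le> r"
  have "inj_on (\<lambda>x. \<one> \<oplus> x) (I k)" by (intro inj_onI) simp
  thus ?thesis using card_I[OF k] by (simp add: U_def card_image)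
qed

text \<open>If \<open>2 = u p\<^sup>e\<close> with a unit \<open>u\<close>, then \<open>z - 1\<close> and \<open>z + 1\<close> cannot both be divisible by more than
  \<open>p\<^sup>e\<close>; so \<open>z\<^sup>2 = 1\<close> forces \<open>z\<close> to be \<open>1\<close> or \<open>-1\<close> up to \<open>p\<^sup>r\<^sup>-\<^sup>e\<close>.\<close>

lemma card_square_roots_of_one:
  assumes u: "u \<in> Units R" and two: "\<one> \<oplus> \<one> = u \<otimes> p [^] (e::nat)"
  shows "card {z \<in> carrier R. z \<otimes> z = \<one>} \<le> 2 * q ^ e"
proof (cases "r \<le> e")
  case True
  have "card {z \<in> carrier R. z \<otimes> z = \<one>} \<le> card (carrier R)" by (intro card_mono finite_carrier) auto
  also have "\<dots> \<le> q ^ e" using True q_ge by (simp add: card_carrier power_increasing)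
  finally show ?thesis by simp
next
  case False
  let ?A = "(\<lambda>x. \<one> \<oplus> x) ` I (r - e)" and ?B = "(\<lambda>x. \<ominus> \<one> \<oplus> x) ` I (r - e)"
  have "{z \<in> carrier R. z \<otimes> z = \<one>} \<subseteq> ?A \<union> ?B"
  proof
    fix z assume "z \<in> {z \<in> carrier R. z \<otimes> z = \<one>}"
    hence z: "z \<in> carrier R" "z \<otimes> z = \<one>" by auto
    have prod: "(z \<ominus> \<one>) \<otimes> (z \<oplus> \<one>) = \<zero>"
    proof -
      have "(z \<ominus> \<one>) \<otimes> (z \<oplus> \<one>) = z \<otimes> z \<ominus> \<one>" using z(1) by algebra
      thus ?thesis using z by (simp add: minus_eq r_neg)
    qed
    obtain v k where v: "v \<in> Units R" "k \<le> r" "z \<ominus> \<one> = v \<otimes> p [^] k" 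
      using z by (elim unit_powerE[of "z \<ominus> \<one>", rotated]) auto
    have vc: "v \<in> carrier R" "u \<in> carrier R" using v u by auto
    have zA: "z = \<one> \<oplus> (z \<ominus> \<one>)" and zB: "z = \<ominus> \<one> \<oplus> (z \<oplus> \<one>)" using z(1) by algebra+
    show "z \<in> ?A \<union> ?B"
    proof (cases "k \<le> e")
      \<comment> \<open>\<open>z - 1\<close> has valuation at most \<open>e\<close>, which leaves at least \<open>r - e\<close> for \<open>z + 1\<close>\<close>
      case k: True
      obtain w l where w: "w \<in> Units R" "l \<le> r" "z \<oplus> \<one> = w \<otimes> p [^] l" 
        using z by (elim unit_powerE[of "z \<oplus> \<one>", rotated]) auto
      have wc: "w \<in> carrier R" using w by auto
      have "(v \<otimes> w) \<otimes> p [^] (k + l) = \<zero>"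
        using prod vc wc unfolding v(3) w(3) by (simp add: nat_pow_mult[symmetric] m_ac)
      hence "p [^] (k + l) = \<zero>" using v(1) w(1) by (intro unit_mult_eq_zero[of "v \<otimes> w" "p [^] (k + l)"] Units_m_closed) simp_all
      hence "k + l \<ge> r" by (simp add: p_pow_eq_0_iff)
      hence "r - e \<le> l" using k by linarith
      hence "p [^] l \<in> I (r - e)" using I_antimono[of "r - e" l] p_pow_mem[of l] by blast
      hence "z \<oplus> \<one> \<in> I (r - e)" unfolding w(3) using I_mult(2) wc by blast
      thus ?thesis using zB by blast
    next
      \<comment> \<open>\<open>z + 1 = 2 + (z - 1)\<close> has valuation exactly \<open>e\<close>, which leaves at least \<open>r - e\<close> for \<open>z - 1\<close>\<close>
      case k: False
      define y where "y = v \<otimes> p [^] (k - e)"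
      have y: "y \<in> I 1"
      proof -
        have "1 \<le> k - e" using k by linarith
        hence "p [^] (k - e) \<in> I 1" using I_antimono[of 1 "k - e"] p_pow_mem[of "k - e"] by blast
        thus ?thesis using I_mult(2) vc(1) by (simp add: y_def)
      qed
      have "z \<oplus> \<one> = (\<one> \<oplus> \<one>) \<oplus> (z \<ominus> \<one>)" using z(1) by algebra
      also have "\<dots> = (u \<oplus> y) \<otimes> p [^] e"
      proof -
        have "p [^] k = p [^] (k - e) \<otimes> p [^] e" using k by (simp add: nat_pow_mult)
        hence "z \<ominus> \<one> = y \<otimes> p [^] e" using vc by (simp add: v(3) y_def m_assoc)
        thus ?thesis using two vc y by (simp add: l_distr)
      qed
      finally have zp: "z \<oplus> \<one> = (u \<oplus> y) \<otimes> p [^] e" .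
      have uy: "u \<oplus> y \<in> Units R" by (rule add_unit[OF _ u y]) (use False in simp)
      hence uyc: "u \<oplus> y \<in> carrier R" by auto
      have "(v \<otimes> (u \<oplus> y)) \<otimes> p [^] (k + e) = \<zero>"
        using prod vc uyc unfolding v(3) zp by (simp add: nat_pow_mult[symmetric] m_ac)
      hence "p [^] (k + e) = \<zero>" using v(1) uy by (intro unit_mult_eq_zero[of "v \<otimes> (u \<oplus> y)" "p [^] (k + e)"] Units_m_closed) simp_all
      hence "k + e \<ge> r" by (simp add: p_pow_eq_0_iff)
      hence "r - e \<le> k" by linarith
      hence "p [^] k \<in> I (r - e)" using I_antimono[of "r - e" k] p_pow_mem[of k] by blast
      hence "z \<ominus> \<one> \<in> I (r - e)" unfolding v(3) using I_mult(2) vc(1) by blast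
      thus ?thesis using zA by blast
    qed
  qed
  hence "card {z \<in> carrier R. z \<otimes> z = \<one>} \<le> card (?A \<union> ?B)"
    by (rule card_mono[rotated]) (simp add: finite_I)
  also have "\<dots> \<le> card ?A + card ?B" by (rule card_Un_le)
  also have "\<dots> \<le> card (I (r - e)) + card (I (r - e))" by (intro add_mono card_image_le finite_I)
  also have "\<dots> = 2 * q ^ e" using False by (simp add: card_I)
  finally show ?thesis .
qed

definition squares :: "'a set" where
  "squares = (\<lambda>z. z \<otimes> z) ` Units R"

lemma subgroup_squares: "subgroup squares (units_of R)"
proof (rule subgroup_units_I)
  show "squares \<subseteq> Units R" by (auto simp: squares_def)
  show "\<one> \<in> squares" unfolding squares_def by (rule image_eqI[of _ _ \<one>]) auto
  fix x y assume "x \<in> squares" "y \<in> squares"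
  then obtain a b where "a \<in> Units R" "b \<in> Units R" "x = a \<otimes> a" "y = b \<otimes> b" by (auto simp: squares_def)
  thus "x \<otimes> y \<in> squares" unfolding squares_def
    by (intro image_eqI[of _ _ "a \<otimes> b"]) (auto simp: m_ac Units_closed)
next
  fix x assume "x \<in> squares"
  then obtain a where a: "a \<in> Units R" "x = a \<otimes> a" by (auto simp: squares_def)
  have "inv x = inv a \<otimes> inv a"
  proof (rule inv_unique'[symmetric])
    have ac: "a \<in> carrier R" "inv a \<in> carrier R" using a by auto
    have "x \<otimes> (inv a \<otimes> inv a) = (a \<otimes> inv a) \<otimes> (a \<otimes> inv a)" unfolding a(2) using ac by (simp add: m_ac)
    thus "x \<otimes> (inv a \<otimes> inv a) = \<one>" using a(1) by simp
    thus "inv a \<otimes> inv a \<otimes> x = \<one>" using ac a(2) by (simp add: m_comm)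
  qed (use a in auto)
  thus "inv x \<in> squares" unfolding squares_def using a(1) by (intro image_eqI[of _ _ "inv a"]) auto
qed

text \<open>Multiplication by one square root of a unit maps the square roots of \<open>1\<close> onto those of the
  unit.\<close>

lemma card_squares_ge:
  assumes "u \<in> Units R" "\<one> \<oplus> \<one> = u \<otimes> p [^] (e::nat)"
  shows "card (Units R) \<le> card squares * (2 * q ^ e)"
proof -
  have "Units R = (\<Union>s\<in>squares. {z \<in> Units R. z \<otimes> z = s})" by (auto simp: squares_def)
  hence "card (Units R) \<le> (\<Sum>s\<in>squares. card {z \<in> Units R. z \<otimes> z = s})"
    using card_UN_le[of squares "\<lambda>s. {z \<in> Units R. z \<otimes> z = s}"] finite_Units by (simp add: squares_def)
  also have "\<dots> \<le> (\<Sum>s\<in>squares. 2 * q ^ e)"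
  proof (rule sum_mono)
    fix s assume "s \<in> squares"
    then obtain a where a: "a \<in> Units R" "s = a \<otimes> a" by (auto simp: squares_def)
    have ac: "a \<in> carrier R" "inv a \<in> carrier R" using a by auto
    have "{z \<in> Units R. z \<otimes> z = s} \<subseteq> (\<lambda>y. a \<otimes> y) ` {z \<in> carrier R. z \<otimes> z = \<one>}"
    proof
      fix z assume "z \<in> {z \<in> Units R. z \<otimes> z = s}"
      hence z: "z \<in> carrier R" "z \<otimes> z = a \<otimes> a" using a by auto
      have "(inv a \<otimes> z) \<otimes> (inv a \<otimes> z) = inv a \<otimes> inv a \<otimes> (z \<otimes> z)" using ac z(1) by (simp add: m_ac)
      also have "\<dots> = (inv a \<otimes> a) \<otimes> (inv a \<otimes> a)" unfolding z(2) using ac by (simp add: m_ac)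
      also have "\<dots> = \<one>" using a by simp
      finally have "(inv a \<otimes> z) \<otimes> (inv a \<otimes> z) = \<one>" .
      moreover have "z = a \<otimes> (inv a \<otimes> z)" using ac z a by (simp add: m_assoc[symmetric])
      ultimately show "z \<in> (\<lambda>y. a \<otimes> y) ` {z \<in> carrier R. z \<otimes> z = \<one>}" using ac z by (intro image_eqI) auto
    qed
    hence "card {z \<in> Units R. z \<otimes> z = s} \<le> card {z \<in> carrier R. z \<otimes> z = \<one>}"
      using finite_carrier by (intro surj_card_le) auto
    thus "card {z \<in> Units R. z \<otimes> z = s} \<le> 2 * q ^ e" using card_square_roots_of_one[OF assms] by linarith
  qed
  also have "\<dots> = card squares * (2 * q ^ e)" by simp
  finally show ?thesis .
qed

lemma finite_GL2: "finite (carrier \<G>)" and card_GL2_le: "card (carrier \<G>) \<le> q ^ (4 * r)"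
proof -
  let ?C = "carrier R"
  have sub: "carrier \<G> \<subseteq> ?C \<times> ?C \<times> ?C \<times> ?C" using GL2_mem_iff by auto
  have fin: "finite (?C \<times> ?C \<times> ?C \<times> ?C)" using finite_carrier by simp
  show "finite (carrier \<G>)" using sub fin finite_subset by blast
  have "4 * r = r + (r + (r + r))" by simp
  hence q4: "q ^ (4 * r) = q ^ r * (q ^ r * (q ^ r * q ^ r))" by (simp only: power_add)
  have "card (carrier \<G>) \<le> card (?C \<times> ?C \<times> ?C \<times> ?C)" by (rule card_mono[OF fin sub])
  also have "\<dots> = q ^ (4 * r)" by (simp add: card_carrier card_cartesian_product q4)
  finally show "card (carrier \<G>) \<le> q ^ (4 * r)" .
qed

text \<open>The group has order at most \<open>q\<^sup>4\<^sup>r\<close>, and inequivalent representations have dimensions whose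
  squares add up to at most this order. Each twist class contributes one such square, of order
  at least \<open>q\<^sup>2\<^sup>r\<close>, for each of its members. A scalar matrix \<open>z\<close> has determinant \<open>z\<^sup>2\<close>, so
  characters of the determinant that differ on squares of units lead to different members; there
  are at least of order \<open>q\<^sup>r\<close> of these, because the squares have bounded index in the units. This
  leaves room for at most of order \<open>q\<^sup>r\<close> classes.\<close>

lemma twist_classes_card_le:
  assumes fI: "finite J" and u: "u \<in> Units R" and two: "\<one> \<oplus> \<one> = u \<otimes> p [^] (e::nat)"
    and irr: "\<And>i. i \<in> J \<Longrightarrow> irr_rep \<G> (n i) (\<rho> i)"
    and dim: "\<And>i. i \<in> J \<Longrightarrow> q ^ r \<le> 2 * q * n i"
    and non: "\<And>i j f. i \<in> J \<Longrightarrow> j \<in> J \<Longrightarrow> i \<noteq> j \<Longrightarrow> n i = n j \<Longrightarrow> is_char \<G> f \<Longrightarrow>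
      \<not> rep_iso \<G> (n i) (\<rho> i) (twist f (\<rho> j))"
  shows "card J \<le> 16 * q ^ (e + 2) * q ^ r"
proof -
  interpret A: comm_group "units_of R" by (rule units_group)
  interpret GG: group \<G> by (rule group_GL2)
  have triv: "subgroup {\<one>} (units_of R)" using A.triv_subgroup by (simp add: units_of_simps)
  obtain F where F: "finite F" "\<And>f. f \<in> F \<Longrightarrow> is_char (units_of R) f"
    "\<And>f f'. f \<in> F \<Longrightarrow> f' \<in> F \<Longrightarrow> (\<forall>h\<in>squares. f h = f' h) \<Longrightarrow> f = f'" "card squares \<le> card F"
  proof -
    have fin: "finite (carrier (units_of R))" by (simp add: units_of_simps finite_Units)
    have "{\<one>} \<subseteq> squares" using subgroup.one_closed[OF subgroup_squares] by (simp add: units_of_simps)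
    from A.characters_distinct_on_subgroup[OF fin subgroup_squares triv this, of "\<lambda>_. 1"]
    show ?thesis using that by force
  qed
  have "card F * (\<Sum>i\<in>J. (n i)\<^sup>2) \<le> card (carrier \<G>)"
  proof (rule GG.twist_family_bound[OF finite_GL2 fI F(1) irr non])
    fix f assume "f \<in> F"
    thus "is_char \<G> (\<lambda>g. f (det2 R g))" by (intro det2_char F(2))
  next
    fix f f' assume ff: "f \<in> F" "f' \<in> F" "f \<noteq> f'"
    obtain h where h: "h \<in> squares" "f h \<noteq> f' h" using F(3)[OF ff(1,2)] ff(3) by blast
    then obtain z where z: "z \<in> Units R" "h = z \<otimes> z" by (auto simp: squares_def)
    show "\<exists>z\<in>carrier \<G>. (\<forall>g\<in>carrier \<G>. z \<otimes>\<^bsub>\<G>\<^esub> g = g \<otimes>\<^bsub>\<G>\<^esub> z) \<and> f (det2 R z) \<noteq> f' (det2 R z)"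
      by (rule bexI[of _ "(z, \<zero>, \<zero>, z)"]) (use scalar_GL2[OF z(1)] h z in auto)
  qed
  also have "\<dots> \<le> q ^ (4 * r)" by (rule card_GL2_le)
  finally have b1: "card F * (\<Sum>i\<in>J. (n i)\<^sup>2) \<le> q ^ (4 * r)" .
  have b2: "card J * (q ^ r)\<^sup>2 \<le> 4 * q\<^sup>2 * (\<Sum>i\<in>J. (n i)\<^sup>2)"
  proof -
    have "card J * (q ^ r)\<^sup>2 = (\<Sum>i\<in>J. (q ^ r)\<^sup>2)" by simp
    also have "\<dots> \<le> (\<Sum>i\<in>J. (2 * q * n i)\<^sup>2)" by (intro sum_mono power_mono dim) auto
    also have "\<dots> = 4 * q\<^sup>2 * (\<Sum>i\<in>J. (n i)\<^sup>2)" by (simp add: power_mult_distrib sum_distrib_left)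
    finally show ?thesis .
  qed
  have b3: "q ^ r \<le> 4 * q ^ e * card F"
  proof -
    have "q ^ r \<le> 2 * card (Units R)" by (rule card_Units_ge)
    also have "\<dots> \<le> 2 * (card squares * (2 * q ^ e))" using card_squares_ge[OF u two] by simp
    also have "\<dots> \<le> 2 * (card F * (2 * q ^ e))" using F(4) by (intro mult_left_mono mult_right_mono) auto
    finally show ?thesis by (simp add: mult_ac)
  qed
  have "3 * r = r + (r + r)" by simp
  hence "q ^ (3 * r) = q ^ r * (q ^ r)\<^sup>2" by (simp only: power_add power2_eq_square)
  hence "(card J * q ^ (3 * r)) = q ^ r * (card J * (q ^ r)\<^sup>2)" by simp
  also have "\<dots> \<le> (4 * q ^ e * card F) * (4 * q\<^sup>2 * (\<Sum>i\<in>J. (n i)\<^sup>2))" by (intro mult_mono b2 b3) auto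
  also have "\<dots> = 16 * q ^ (e + 2) * (card F * (\<Sum>i\<in>J. (n i)\<^sup>2))" by (simp add: power_add power2_eq_square)
  also have "\<dots> \<le> 16 * q ^ (e + 2) * q ^ (4 * r)" by (intro mult_left_mono b1) auto
  also have "\<dots> = (16 * q ^ (e + 2) * q ^ r) * q ^ (3 * r)" 
  proof -
    have "4 * r = r + 3 * r" by simp
    hence "q ^ (4 * r) = q ^ r * q ^ (3 * r)" by (simp only: power_add)
    thus ?thesis by simp
  qed
  finally show ?thesis using q_ge by simp
qed

end

section \<open>Common eigenvectors\<close>

lemma mat_vec_sum:
  assumes A: "A \<in> carrier_mat n n" and u: "\<And>i. i \<in> S \<Longrightarrow> u i \<in> carrier_vec n"
  shows "A *\<^sub>v vec n (\<lambda>a. \<Sum>i\<in>S. s i * u i $ a) = vec n (\<lambda>a. \<Sum>i\<in>S. s i * ((A *\<^sub>v u i) $ a :: complex))"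
proof (rule eq_vecI)
  fix a assume "a < dim_vec (vec n (\<lambda>a. \<Sum>i\<in>S. s i * ((A *\<^sub>v u i) $ a)))"
  hence a: "a < n" by simp
  have "(A *\<^sub>v vec n (\<lambda>a. \<Sum>i\<in>S. s i * u i $ a)) $ a = (\<Sum>k<n. A $$ (a, k) * (\<Sum>i\<in>S. s i * u i $ k))"
    by (subst mat_vec_entry[OF A _ a]) auto
  also have "\<dots> = (\<Sum>i\<in>S. \<Sum>k<n. s i * (A $$ (a, k) * u i $ k))"
    unfolding sum_distrib_left by (subst sum.swap) (simp add: mult_ac)
  also have "\<dots> = (\<Sum>i\<in>S. s i * ((A *\<^sub>v u i) $ a))"
    by (intro sum.cong refl) (simp add: mat_vec_entry[OF A u a] sum_distrib_left)
  finally show "(A *\<^sub>v vec n (\<lambda>a. \<Sum>i\<in>S. s i * u i $ a)) $ a = vec n (\<lambda>a. \<Sum>i\<in>S. s i * ((A *\<^sub>v u i) $ a)) $ a"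
    using a by simp
qed (use A in simp)

lemma sum_roots_of_unity_powers:
  fixes N :: nat
  defines "\<omega> \<equiv> inverse (cis (2 * pi / real N))"
  assumes i: "i < N"
  shows "(\<Sum>j<N. \<omega> ^ (j * i)) = (if i = 0 then of_nat N else 0)"
proof (cases "i = 0")
  case False
  have \<omega>i: "\<omega> ^ i = inverse (cis (2 * pi * real i / real N))"
    by (simp add: \<omega>_def power_inverse Complex.DeMoivre mult.commute)
  have bij: "bij_betw (\<lambda>k. cis (2 * pi * real k / real N)) {..<N} {z. z ^ N = 1}"
    by (rule Complex.bij_betw_roots_unity) (use i in simp)
  have "\<omega> ^ i \<noteq> 1"
  proof
    assume "\<omega> ^ i = 1"
    hence "cis (2 * pi * real i / real N) = 1" unfolding \<omega>i by (metis inverse_inverse_eq inverse_1)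
    hence "cis (2 * pi * real i / real N) = cis (2 * pi * real 0 / real N)" by simp
    hence "i = 0" using bij i by (auto simp: bij_betw_def inj_on_def)
    thus False using False by simp
  qed
  moreover have "(\<omega> ^ i) ^ N = 1"
  proof -
    have "cis (2 * pi * real i / real N) ^ N = 1" using bij i by (auto simp: bij_betw_def)
    thus ?thesis unfolding \<omega>i by (simp only: power_inverse inverse_1)
  qed
  moreover have "(\<Sum>j<N. \<omega> ^ (j * i)) = (\<Sum>j<N. (\<omega> ^ i) ^ j)" by (simp add: power_mult[symmetric] mult.commute)
  ultimately show ?thesis using False by (simp add: geometric_sum)
qed simp

text \<open>The component of \<open>v\<close> in the eigenspace of \<open>\<rho> g\<close> for the eigenvalue \<open>exp (2\<pi>ij/N)\<close>,
  multiplied by the order \<open>N\<close> of the group.\<close>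

definition (in group) eigen_component :: "nat \<Rightarrow> ('a \<Rightarrow> complex mat) \<Rightarrow> 'a \<Rightarrow> complex vec \<Rightarrow> nat \<Rightarrow> complex vec" where
  "eigen_component n \<rho> g v j =
     vec n (\<lambda>a. \<Sum>i<order G. inverse (cis (2 * pi / real (order G))) ^ (j * i) * (\<rho> (g [^] i) *\<^sub>v v) $ a)"

lemma (in group) eigen_component_eigenvector:
  assumes fin: "finite (carrier G)" and \<rho>: "\<rho> \<in> hom G (GL_complex n)"
    and g: "g \<in> carrier G" and v: "v \<in> carrier_vec n"
  shows "\<rho> g *\<^sub>v eigen_component n \<rho> g v j = cis (2 * pi / real (order G)) ^ j \<cdot>\<^sub>v eigen_component n \<rho> g v j"
proof -
  define N where "N = order G"
  define w where "w = cis (2 * pi / real N)"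
  have N: "N > 0" using fin one_closed by (auto simp: N_def order_def card_gt_0_iff)
  have w0: "w \<noteq> 0" by (simp add: w_def)
  have "w ^ N = 1" using N by (simp add: w_def Complex.DeMoivre)
  hence wN: "inverse w ^ (j * N) = 1" by (simp add: power_inverse mult.commute[of j] power_mult)
  have step: "\<rho> g *\<^sub>v (\<rho> (g [^] i) *\<^sub>v v) = \<rho> (g [^] Suc i) *\<^sub>v v" for i :: nat
  proof -
    have "\<rho> (g [^] Suc i) = \<rho> g * \<rho> (g [^] i)"
      using rep_mult[OF \<rho> g nat_pow_closed[OF g]] nat_pow_Suc2[OF g] by metis
    thus ?thesis using assoc_mult_mat_vec[OF rep_carrier[OF \<rho> g] rep_carrier[OF \<rho> nat_pow_closed[OF g]] v] by simp
  qed
  have uc: "\<rho> (g [^] i) *\<^sub>v v \<in> carrier_vec n" for i :: nat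
    using rep_carrier[OF \<rho> nat_pow_closed[OF g]] by (rule mult_mat_vec_carrier[OF _ v])
  have "\<rho> g *\<^sub>v eigen_component n \<rho> g v j =
      vec n (\<lambda>a. \<Sum>i<N. inverse w ^ (j * i) * (\<rho> (g [^] Suc i) *\<^sub>v v) $ a)"
    unfolding eigen_component_def N_def[symmetric] w_def[symmetric]
    by (subst mat_vec_sum[OF rep_carrier[OF \<rho> g]]) (simp_all add: uc step)
  also have "\<dots> = w ^ j \<cdot>\<^sub>v eigen_component n \<rho> g v j"
  proof (rule eq_vecI)
    fix a assume "a < dim_vec (w ^ j \<cdot>\<^sub>v eigen_component n \<rho> g v j)"
    hence a: "a < n" by (simp add: eigen_component_def)
    define f where "f i = inverse w ^ (j * i) * (\<rho> (g [^] i) *\<^sub>v v) $ a" for i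
    have fN: "f N = f 0" using wN pow_order_eq_1[OF g] by (simp add: f_def N_def)
    have "(\<Sum>i<N. inverse w ^ (j * i) * (\<rho> (g [^] Suc i) *\<^sub>v v) $ a) = (\<Sum>i<N. w ^ j * f (Suc i))"
    proof (rule sum.cong)
      fix i
      have "w ^ j * inverse w ^ (j * Suc i) = (w * inverse w) ^ j * inverse w ^ (j * i)"
        by (simp only: power_mult_distrib mult_Suc_right power_add mult_ac)
      hence "w ^ j * inverse w ^ (j * Suc i) = inverse w ^ (j * i)" using w0 by simp
      thus "inverse w ^ (j * i) * (\<rho> (g [^] Suc i) *\<^sub>v v) $ a = w ^ j * f (Suc i)"
        unfolding f_def by (simp only: mult.assoc[symmetric])
    qed simp
    also have "\<dots> = w ^ j * ((\<Sum>i<Suc N. f i) - f 0)" by (simp add: sum_distrib_left sum.lessThan_Suc_shift del: sum.lessThan_Suc)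
    also have "\<dots> = w ^ j * (\<Sum>i<N. f i)" by (simp add: fN)
    finally show "vec n (\<lambda>a. \<Sum>i<N. inverse w ^ (j * i) * (\<rho> (g [^] Suc i) *\<^sub>v v) $ a) $ a =
        (w ^ j \<cdot>\<^sub>v eigen_component n \<rho> g v j) $ a"
      using a by (simp add: eigen_component_def f_def N_def w_def)
  qed (simp add: eigen_component_def)
  finally show ?thesis by (simp add: w_def N_def)
qed

lemma (in group) eigen_component_other:
  assumes fin: "finite (carrier G)" and \<rho>: "\<rho> \<in> hom G (GL_complex n)"
    and g: "g \<in> carrier G" and h: "h \<in> carrier G" and comm: "g \<otimes> h = h \<otimes> g"
    and v: "v \<in> carrier_vec n" and ev: "\<rho> h *\<^sub>v v = d \<cdot>\<^sub>v v"
  shows "\<rho> h *\<^sub>v eigen_component n \<rho> g v j = d \<cdot>\<^sub>v eigen_component n \<rho> g v j"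
proof -
  have step: "\<rho> h *\<^sub>v (\<rho> (g [^] i) *\<^sub>v v) = d \<cdot>\<^sub>v (\<rho> (g [^] i) *\<^sub>v v)" for i :: nat
  proof -
    note gi = nat_pow_closed[OF g, of i]
    have "g [^] i \<otimes> h = h \<otimes> g [^] i" by (rule group_commutes_pow[OF comm g h])
    hence "\<rho> h * \<rho> (g [^] i) = \<rho> (g [^] i) * \<rho> h" using rep_mult[OF \<rho> gi h] rep_mult[OF \<rho> h gi] by simp
    hence "\<rho> h *\<^sub>v (\<rho> (g [^] i) *\<^sub>v v) = \<rho> (g [^] i) *\<^sub>v (d \<cdot>\<^sub>v v)"
      using assoc_mult_mat_vec[OF rep_carrier[OF \<rho> h] rep_carrier[OF \<rho> gi] v]
        assoc_mult_mat_vec[OF rep_carrier[OF \<rho> gi] rep_carrier[OF \<rho> h] v] ev by simp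
    thus ?thesis using mult_mat_vec[OF rep_carrier[OF \<rho> gi] v] by simp
  qed
  have uc: "\<rho> (g [^] i) *\<^sub>v v \<in> carrier_vec n" for i :: nat
    using rep_carrier[OF \<rho> nat_pow_closed[OF g]] by (rule mult_mat_vec_carrier[OF _ v])
  show ?thesis
    unfolding eigen_component_def
    by (subst mat_vec_sum[OF rep_carrier[OF \<rho> h]])
       (use uc in \<open>auto intro!: eq_vecI simp: step sum_distrib_left mult_ac carrier_matD(1)[OF rep_carrier[OF \<rho> nat_pow_closed[OF g]]]\<close>)
qed

lemma (in group) sum_eigen_components:
  assumes fin: "finite (carrier G)" and \<rho>: "\<rho> \<in> hom G (GL_complex n)"
    and g: "g \<in> carrier G" and v: "v \<in> carrier_vec n" and a: "a < n"
  shows "(\<Sum>j<order G. eigen_component n \<rho> g v j $ a) = of_nat (order G) * v $ a"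
proof -
  define N where "N = order G"
  have N: "N > 0" using fin one_closed by (auto simp: N_def order_def card_gt_0_iff)
  have "(\<Sum>j<N. eigen_component n \<rho> g v j $ a) =
      (\<Sum>j<N. \<Sum>i<N. inverse (cis (2 * pi / real N)) ^ (j * i) * (\<rho> (g [^] i) *\<^sub>v v) $ a)"
    using a by (simp add: eigen_component_def N_def)
  also have "\<dots> = (\<Sum>i<N. (\<Sum>j<N. inverse (cis (2 * pi / real N)) ^ (j * i)) * (\<rho> (g [^] i) *\<^sub>v v) $ a)"
    by (subst sum.swap) (simp add: sum_distrib_right)
  also have "\<dots> = (\<Sum>i<N. if i = 0 then of_nat N * (\<rho> (g [^] i) *\<^sub>v v) $ a else 0)"
    by (intro sum.cong refl, subst sum_roots_of_unity_powers) auto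
  also have "\<dots> = of_nat N * v $ a" using N a v by (simp add: rep_one[OF \<rho>])
  finally show ?thesis by (simp add: N_def)
qed

text \<open>Commuting operators of finite order preserve each other's eigenspaces. The vector is found
  by starting with an eigenvector of \<open>\<rho> u\<close> for an eigenvalue other than \<open>1\<close> and passing, for
  each element of \<open>A\<close> in turn, to a nonzero component in one of its eigenspaces; the eigenvalues
  obtained before are kept.\<close>

lemma (in group) common_eigenvector:
  assumes fin: "finite (carrier G)" and \<rho>: "\<rho> \<in> hom G (GL_complex n)"
    and A: "finite A" "A \<subseteq> carrier G" and comm: "\<And>g h. g \<in> A \<Longrightarrow> h \<in> A \<Longrightarrow> g \<otimes> h = h \<otimes> g"
    and u: "u \<in> A" "\<rho> u \<noteq> 1\<^sub>m n"
  obtains v where "v \<in> carrier_vec n" "v \<noteq> 0\<^sub>v n" "\<And>g. g \<in> A \<Longrightarrow> \<exists>d. \<rho> g *\<^sub>v v = d \<cdot>\<^sub>v v"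
    "\<rho> u *\<^sub>v v \<noteq> v"
proof -
  have N: "order G > 0" using fin one_closed by (auto simp: order_def card_gt_0_iff)
  have uG: "u \<in> carrier G" using u A by blast
  have cc: "eigen_component n \<rho> g v j \<in> carrier_vec n" for g v j by (simp add: eigen_component_def)
  have w1: "cis (2 * pi / real (order G)) ^ j \<noteq> 1" if "0 < j" "j < order G" for j
  proof
    assume 1: "cis (2 * pi / real (order G)) ^ j = 1"
    have bij: "bij_betw (\<lambda>k. cis (2 * pi * real k / real (order G))) {..<order G} {z. z ^ order G = 1}"
      by (rule Complex.bij_betw_roots_unity[OF N])
    have "cis (2 * pi * real j / real (order G)) = cis (2 * pi * real 0 / real (order G))"
      using 1 by (simp add: Complex.DeMoivre mult.commute)
    hence "j = 0" using bij that N unfolding bij_betw_def inj_on_def by blast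
    thus False using that by simp
  qed
  have base: "\<exists>v c. v \<in> carrier_vec n \<and> v \<noteq> 0\<^sub>v n \<and> \<rho> u *\<^sub>v v = c \<cdot>\<^sub>v v \<and> c \<noteq> 1"
  proof (rule ccontr)
    assume no: "\<nexists>v c. v \<in> carrier_vec n \<and> v \<noteq> 0\<^sub>v n \<and> \<rho> u *\<^sub>v v = c \<cdot>\<^sub>v v \<and> c \<noteq> 1"
    have "\<rho> u = 1\<^sub>m n"
    proof (rule mat_eq_of_unit_vecs[OF rep_carrier[OF \<rho> uG]])
      fix i assume i: "i < n"
      let ?v = "unit_vec n i :: complex vec"
      have vc: "?v \<in> carrier_vec n" by simp
      have z: "eigen_component n \<rho> u ?v j = 0\<^sub>v n" if "0 < j" "j < order G" for j
        using no cc[of u ?v j] eigen_component_eigenvector[OF fin \<rho> uG vc, of j] w1[OF that] by blast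
      have v0: "eigen_component n \<rho> u ?v 0 = of_nat (order G) \<cdot>\<^sub>v ?v"
      proof (rule eq_vecI)
        fix a assume "a < dim_vec (of_nat (order G) \<cdot>\<^sub>v ?v)"
        hence a: "a < n" by simp
        have "(\<Sum>j<order G. eigen_component n \<rho> u ?v j $ a) =
            (\<Sum>j<order G. if j = 0 then eigen_component n \<rho> u ?v 0 $ a else 0)"
          using z a by (intro sum.cong) auto
        thus "eigen_component n \<rho> u ?v 0 $ a = (of_nat (order G) \<cdot>\<^sub>v ?v) $ a"
          using sum_eigen_components[OF fin \<rho> uG vc a] N a by simp
      qed (simp add: eigen_component_def)
      have "\<rho> u *\<^sub>v (of_nat (order G) \<cdot>\<^sub>v ?v) = of_nat (order G) \<cdot>\<^sub>v ?v"
        using eigen_component_eigenvector[OF fin \<rho> uG vc, of 0] unfolding v0 by simp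
      hence e: "of_nat (order G) \<cdot>\<^sub>v (\<rho> u *\<^sub>v ?v) = of_nat (order G) \<cdot>\<^sub>v ?v"
        using mult_mat_vec[OF rep_carrier[OF \<rho> uG] vc] by simp
      show "\<rho> u *\<^sub>v ?v = 1\<^sub>m n *\<^sub>v ?v"
      proof (rule eq_vecI)
        fix a assume "a < dim_vec (1\<^sub>m n *\<^sub>v ?v)"
        hence a: "a < n" by simp
        have "(of_nat (order G) \<cdot>\<^sub>v (\<rho> u *\<^sub>v ?v)) $ a = (of_nat (order G) \<cdot>\<^sub>v ?v) $ a" by (simp only: e)
        thus "(\<rho> u *\<^sub>v ?v) $ a = (1\<^sub>m n *\<^sub>v ?v) $ a" using a N rep_carrier[OF \<rho> uG] by simp
      qed (use rep_carrier[OF \<rho> uG] in simp)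
    qed auto
    thus False using u(2) by simp
  qed
  have "\<exists>v c. v \<in> carrier_vec n \<and> v \<noteq> 0\<^sub>v n \<and> \<rho> u *\<^sub>v v = c \<cdot>\<^sub>v v \<and> c \<noteq> 1 \<and>
      (\<forall>g\<in>A'. \<exists>d. \<rho> g *\<^sub>v v = d \<cdot>\<^sub>v v)" if "A' \<subseteq> A" for A'
    using finite_subset[OF that A(1)] that
  proof (induction A' rule: finite_induct)
    case empty thus ?case using base by simp
  next
    case (insert g A')
    then obtain v c where v: "v \<in> carrier_vec n" "v \<noteq> 0\<^sub>v n" "\<rho> u *\<^sub>v v = c \<cdot>\<^sub>v v" "c \<noteq> 1"
      "\<forall>g\<in>A'. \<exists>d. \<rho> g *\<^sub>v v = d \<cdot>\<^sub>v v" by auto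
    have g: "g \<in> A" "g \<in> carrier G" using insert.prems A by auto
    have "\<exists>j<order G. eigen_component n \<rho> g v j \<noteq> 0\<^sub>v n"
    proof (rule ccontr)
      assume "\<not> (\<exists>j<order G. eigen_component n \<rho> g v j \<noteq> 0\<^sub>v n)"
      hence "(\<Sum>j<order G. eigen_component n \<rho> g v j $ a) = 0" if "a < n" for a
        using that by (intro sum.neutral) auto
      hence "v $ a = 0" if "a < n" for a
        using sum_eigen_components[OF fin \<rho> g(2) v(1) that] N that by simp
      hence "v = 0\<^sub>v n" using v(1) by (intro eq_vecI) auto
      thus False using v(2) by simp
    qed
    then obtain j where j: "eigen_component n \<rho> g v j \<noteq> 0\<^sub>v n" by blast
    let ?v = "eigen_component n \<rho> g v j"
    have "\<rho> u *\<^sub>v ?v = c \<cdot>\<^sub>v ?v"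
      by (rule eigen_component_other[OF fin \<rho> g(2) uG comm[OF g(1) u(1)] v(1,3)])
    moreover have "\<exists>d. \<rho> h *\<^sub>v ?v = d \<cdot>\<^sub>v ?v" if h: "h \<in> A'" for h
    proof -
      have hA: "h \<in> A" "h \<in> carrier G" using h insert.prems A by auto
      obtain d where "\<rho> h *\<^sub>v v = d \<cdot>\<^sub>v v" using v(5) h by blast
      thus ?thesis using eigen_component_other[OF fin \<rho> g(2) hA(2) comm[OF g(1) hA(1)] v(1)] by blast
    qed
    moreover have "\<rho> g *\<^sub>v ?v = cis (2 * pi / real (order G)) ^ j \<cdot>\<^sub>v ?v"
      by (rule eigen_component_eigenvector[OF fin \<rho> g(2) v(1)])
    ultimately show ?case using j cc v(4) by blast
  qed
  from this[OF subset_refl] obtain v c where v: "v \<in> carrier_vec n" "v \<noteq> 0\<^sub>v n" "\<rho> u *\<^sub>v v = c \<cdot>\<^sub>v v" "c \<noteq> 1"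
    "\<forall>g\<in>A. \<exists>d. \<rho> g *\<^sub>v v = d \<cdot>\<^sub>v v" by blast
  obtain a where a: "a < n" "v $ a \<noteq> 0"
    using v(1,2) by (metis carrier_vecD eq_vecI index_zero_vec(1) index_zero_vec(2))
  have "\<rho> u *\<^sub>v v \<noteq> v"
  proof
    assume "\<rho> u *\<^sub>v v = v"
    hence "(c \<cdot>\<^sub>v v) $ a = v $ a" using v(3) by simp
    thus False using a v(1,4) by simp
  qed
  thus ?thesis using that v by blast
qed


section \<open>A lower bound for the dimension\<close>

context chain_ring
begin

definition E :: "'a \<Rightarrow> 'a mat2" where "E x = (\<one>, x, \<zero>, \<one>)"
definition L :: "'a \<Rightarrow> 'a mat2" where "L x = (\<one>, \<zero>, x, \<one>)"
definition D :: "'a \<Rightarrow> 'a mat2" where "D t = (t, \<zero>, \<zero>, \<one>)"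
definition w :: "'a mat2" where "w = (\<zero>, \<one>, \<one>, \<zero>)"

text \<open>With entries in the minimal ideal \<open>I (r - 1)\<close> these are the elements of the kernel of
  reduction modulo \<open>p\<^sup>r\<^sup>-\<^sup>1\<close>.\<close>

definition kernel_elem :: "'a \<Rightarrow> 'a \<Rightarrow> 'a \<Rightarrow> 'a \<Rightarrow> 'a mat2" where
  "kernel_elem a b c d = (\<one> \<oplus> a, b, c, \<one> \<oplus> d)"

lemma neg_one_unit: "\<ominus> \<one> \<in> Units R"
  unfolding Units_def by (auto intro!: bexI[of _ "\<ominus> \<one>"] simp: l_minus r_minus)

lemma E_closed [simp]: "x \<in> carrier R \<Longrightarrow> E x \<in> carrier \<G>"
  and L_closed [simp]: "x \<in> carrier R \<Longrightarrow> L x \<in> carrier \<G>"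
  and D_closed [simp]: "t \<in> Units R \<Longrightarrow> D t \<in> carrier \<G>"
  and w_closed [simp]: "w \<in> carrier \<G>"
  using neg_one_unit by (auto simp: E_def L_def D_def w_def GL2_mem_iff minus_eq Units_closed)

lemma E_E: "x \<in> carrier R \<Longrightarrow> y \<in> carrier R \<Longrightarrow> E x \<otimes>\<^bsub>\<G>\<^esub> E y = E (x \<oplus> y)"
  by (simp add: E_def a_comm)

lemma D_D: "s \<in> carrier R \<Longrightarrow> t \<in> carrier R \<Longrightarrow> D s \<otimes>\<^bsub>\<G>\<^esub> D t = D (s \<otimes> t)"
  by (simp add: D_def)

lemma (in group) rep_trivial_conjugate:
  assumes \<rho>: "\<rho> \<in> hom G (GL_complex n)" and c: "h \<in> carrier G" "k \<in> carrier G" "k' \<in> carrier G"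
    and e: "h \<otimes> k = k' \<otimes> h"
  shows "\<rho> k = 1\<^sub>m n \<Longrightarrow> \<rho> k' = 1\<^sub>m n"
proof -
  assume 1: "\<rho> k = 1\<^sub>m n"
  have "k' = h \<otimes> k \<otimes> inv h" unfolding e using c by (simp add: m_assoc)
  hence "\<rho> k' = \<rho> h * 1\<^sub>m n * \<rho> (inv h)" using rep_mult[OF \<rho>] c 1 by simp
  also have "\<dots> = 1\<^sub>m n" using rep_carrier[OF \<rho> c(1)] rep_inv(1)[OF \<rho> c(1)] by (simp add: right_mult_one_mat[of _ n n])
  finally show ?thesis .
qed

lemma socle_square_zero: "r \<ge> 2 \<Longrightarrow> x \<in> I (r - 1) \<Longrightarrow> y \<in> I (r - 1) \<Longrightarrow> x \<otimes> y = \<zero>"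
  by (rule I_mult_zero) auto

lemma socle_U: "r \<ge> 2 \<Longrightarrow> x \<in> I (r - 1) \<Longrightarrow> \<one> \<oplus> x \<in> Units R"
proof -
  assume "r \<ge> 2" "x \<in> I (r - 1)"
  moreover from this have "r \<ge> 1" "r - 1 \<ge> 1" by auto
  ultimately show ?thesis using U_Units[of "r - 1"] U_I[of x "r - 1"] by blast
qed

lemma kernel_elem_closed:
  assumes r: "r \<ge> 2" and i: "a \<in> I (r - 1)" "b \<in> I (r - 1)" "c \<in> I (r - 1)" "d \<in> I (r - 1)"
  shows "kernel_elem a b c d \<in> carrier \<G>" "det2 R (kernel_elem a b c d) = \<one> \<oplus> (a \<oplus> d)"
proof -
  note ic = i[THEN I_closed]
  have "(\<one> \<oplus> a) \<otimes> (\<one> \<oplus> d) \<ominus> b \<otimes> c = \<one> \<oplus> (a \<oplus> d) \<oplus> a \<otimes> d \<ominus> b \<otimes> c" using ic by algebra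
  hence d: "(\<one> \<oplus> a) \<otimes> (\<one> \<oplus> d) \<ominus> b \<otimes> c = \<one> \<oplus> (a \<oplus> d)"
    using socle_square_zero[OF r i(1,4)] socle_square_zero[OF r i(2,3)] ic by (simp add: minus_eq)
  show "kernel_elem a b c d \<in> carrier \<G>"
    unfolding kernel_elem_def GL2_mem_iff d using socle_U[OF r I_add[OF i(1,4)]] ic by simp
  show "det2 R (kernel_elem a b c d) = \<one> \<oplus> (a \<oplus> d)" by (simp add: det2_def kernel_elem_def d)
qed

lemma kernel_elem_mult:
  assumes r: "r \<ge> 2" and i: "a \<in> I (r - 1)" "b \<in> I (r - 1)" "c \<in> I (r - 1)" "d \<in> I (r - 1)"
    "a' \<in> I (r - 1)" "b' \<in> I (r - 1)" "c' \<in> I (r - 1)" "d' \<in> I (r - 1)"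
  shows "kernel_elem a b c d \<otimes>\<^bsub>\<G>\<^esub> kernel_elem a' b' c' d' = kernel_elem (a \<oplus> a') (b \<oplus> b') (c \<oplus> c') (d \<oplus> d')"
proof -
  note ic = i[THEN I_closed]
  note z = socle_square_zero[OF r]
  show ?thesis
    unfolding kernel_elem_def
    using ic z[OF i(1,5)] z[OF i(1,6)] z[OF i(2,7)] z[OF i(2,8)] z[OF i(3,5)] z[OF i(3,6)] z[OF i(4,7)] z[OF i(4,8)]
    by (simp add: l_distr r_distr a_ac)
qed

text \<open>If the elementary matrices with entries in the minimal ideal act trivially, so do all of their
  conjugates, and with them the kernel elements of trace zero. The kernel then acts through the
  trace, which is invariant under conjugation; so by Schur's lemma it acts by scalars, and a
  character of the determinant undoes this action.\<close>

lemma twist_trivial_on_kernel: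
  assumes r: "r \<ge> 2" and irr: "irr_rep \<G> n \<rho>" and triv: "\<And>z. z \<in> I (r - 1) \<Longrightarrow> \<rho> (E z) = 1\<^sub>m n"
  obtains f where "is_char \<G> f"
    "\<And>a b c d. a \<in> I (r - 1) \<Longrightarrow> b \<in> I (r - 1) \<Longrightarrow> c \<in> I (r - 1) \<Longrightarrow> d \<in> I (r - 1) \<Longrightarrow>
      twist f \<rho> (kernel_elem a b c d) = 1\<^sub>m n"
proof -
  interpret GG: group \<G> by (rule group_GL2)
  interpret A: comm_group "units_of R" by (rule units_group)
  note \<rho> = irr_repD(1)[OF irr]
  note conj = GG.rep_trivial_conjugate[OF \<rho>]
  let ?J = "I (r - 1)"
  have J0: "\<zero> \<in> ?J" by simp
  \<comment> \<open>the matrices \<open>E z\<close> and their conjugates by \<open>w\<close> and \<open>L 1\<close> generate the kernel elements of trace zero\<close>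
  have trivL: "\<rho> (L z) = 1\<^sub>m n" if z: "z \<in> ?J" for z
  proof (rule conj[OF w_closed _ _ _ triv[OF z]])
    show "w \<otimes>\<^bsub>\<G>\<^esub> E z = L z \<otimes>\<^bsub>\<G>\<^esub> w" using z by (simp add: w_def E_def L_def)
  qed (use z in auto)
  have trivK: "\<rho> (kernel_elem (\<ominus> z) z (\<ominus> z) z) = 1\<^sub>m n" if z: "z \<in> ?J" for z
  proof (rule conj[OF L_closed[of \<one>] _ _ _ triv[OF z]])
    have zc: "z \<in> carrier R" using z by simp
    have e1: "(\<one> \<oplus> \<ominus> z) \<oplus> z = \<one>" "\<ominus> z \<oplus> (z \<oplus> \<one>) = \<one>" using zc by algebra+
    show "L \<one> \<otimes>\<^bsub>\<G>\<^esub> E z = kernel_elem (\<ominus> z) z (\<ominus> z) z \<otimes>\<^bsub>\<G>\<^esub> L \<one>"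
      using zc by (simp add: L_def E_def kernel_elem_def e1 a_comm)
    show "kernel_elem (\<ominus> z) z (\<ominus> z) z \<in> carrier \<G>" by (rule kernel_elem_closed[OF r]) (use z I_uminus in auto)
    show "E z \<in> carrier \<G>" using zc by simp
  qed simp
  have kE: "kernel_elem \<zero> b \<zero> \<zero> = E b" and kL: "kernel_elem \<zero> \<zero> b \<zero> = L b" for b
    by (simp_all add: kernel_elem_def E_def L_def)
  have mul: "\<rho> (kernel_elem (a \<oplus> a') (b \<oplus> b') (c \<oplus> c') (d \<oplus> d')) = \<rho> (kernel_elem a b c d) * \<rho> (kernel_elem a' b' c' d')"
    if i: "a \<in> ?J" "b \<in> ?J" "c \<in> ?J" "d \<in> ?J" "a' \<in> ?J" "b' \<in> ?J" "c' \<in> ?J" "d' \<in> ?J" for a b c d a' b' c' d'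
    using GG.rep_mult[OF \<rho> kernel_elem_closed(1)[OF r i(1-4)] kernel_elem_closed(1)[OF r i(5-8)]]
    by (simp add: kernel_elem_mult[OF r i])
  have offd: "\<rho> (kernel_elem \<zero> b c \<zero>) = 1\<^sub>m n" if "b \<in> ?J" "c \<in> ?J" for b c
    using mul[OF J0 that(1) J0 J0 J0 J0 that(2) J0] triv[OF that(1)] trivL[OF that(2)] that
    by (simp add: kE kL)
  have diag: "\<rho> (kernel_elem (\<ominus> z) \<zero> \<zero> z) = 1\<^sub>m n" if z: "z \<in> ?J" for z
  proof -
    have "\<rho> (kernel_elem (\<ominus> z \<oplus> \<zero>) (z \<oplus> \<ominus> z) (\<ominus> z \<oplus> z) (z \<oplus> \<zero>)) =
        \<rho> (kernel_elem (\<ominus> z) z (\<ominus> z) z) * \<rho> (kernel_elem \<zero> (\<ominus> z) z \<zero>)"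
      using z I_uminus[OF z] by (intro mul) auto
    also have "\<dots> = 1\<^sub>m n" using trivK[OF z] offd[OF I_uminus[OF z] z] by simp
    finally show ?thesis using z by (simp add: r_neg l_neg)
  qed
  have D_eq: "D (\<one> \<oplus> z) = kernel_elem z \<zero> \<zero> \<zero>" for z by (simp add: D_def kernel_elem_def)
  have trace: "\<rho> (kernel_elem a b c d) = \<rho> (D (\<one> \<oplus> (a \<oplus> d)))"
    if i: "a \<in> ?J" "b \<in> ?J" "c \<in> ?J" "d \<in> ?J" for a b c d
  proof -
    note ic = i[THEN I_closed]
    have "a = (a \<oplus> d) \<oplus> \<ominus> d" using ic by algebra
    hence "\<rho> (kernel_elem a b c d) = \<rho> (kernel_elem ((a \<oplus> d) \<oplus> \<ominus> d) (\<zero> \<oplus> b) (\<zero> \<oplus> c) (\<zero> \<oplus> d))"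
      using ic by simp
    also have "\<dots> = \<rho> (kernel_elem (a \<oplus> d) \<zero> \<zero> \<zero>) * \<rho> (kernel_elem (\<ominus> d \<oplus> \<zero>) (\<zero> \<oplus> b) (\<zero> \<oplus> c) (d \<oplus> \<zero>))"
      using i I_uminus[OF i(4)] I_add[OF i(1,4)] ic by (subst mul) simp_all
    also have "\<rho> (kernel_elem (\<ominus> d \<oplus> \<zero>) (\<zero> \<oplus> b) (\<zero> \<oplus> c) (d \<oplus> \<zero>)) = 1\<^sub>m n"
      using i I_uminus[OF i(4)] diag[OF i(4)] offd[OF i(2,3)] by (subst mul) simp_all
    also have "\<rho> (kernel_elem (a \<oplus> d) \<zero> \<zero> \<zero>) * 1\<^sub>m n = \<rho> (D (\<one> \<oplus> (a \<oplus> d)))"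
      using GG.rep_carrier[OF \<rho> kernel_elem_closed(1)[OF r I_add[OF i(1,4)] J0 J0 J0]] by (simp add: D_eq right_mult_one_mat[of _ n n])
    finally show ?thesis .
  qed
  have scal: "\<exists>c. \<rho> (D (\<one> \<oplus> z)) = c \<cdot>\<^sub>m 1\<^sub>m n" if z: "z \<in> ?J" for z
  proof (rule GG.schur_scalar[OF irr])
    note zc = I_closed[OF z]
    have Dc: "D (\<one> \<oplus> z) \<in> carrier \<G>" using socle_U[OF r z] by simp
    show "\<rho> (D (\<one> \<oplus> z)) \<in> carrier_mat n n" by (rule GG.rep_carrier[OF \<rho> Dc])
    fix g assume g: "g \<in> carrier \<G>"
    then obtain a b c d where abcd: "g = (a, b, c, d)" "a \<in> carrier R" "b \<in> carrier R" "c \<in> carrier R" "d \<in> carrier R"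
      "a \<otimes> d \<ominus> b \<otimes> c \<in> Units R" by (rule GL2_E)
    define t where "t = z \<otimes> inv (a \<otimes> d \<ominus> b \<otimes> c)"
    have tJ: "t \<in> ?J" unfolding t_def using I_mult(1)[OF z] abcd(6) by simp
    note tc = I_closed[OF tJ]
    have t: "t \<otimes> (a \<otimes> d \<ominus> b \<otimes> c) = z" unfolding t_def using zc abcd(6) by (simp add: m_assoc Units_closed)
    \<comment> \<open>the conjugate of \<open>D (1 + z)\<close> by \<open>g\<close>; it has the same trace\<close>
    let ?k = "kernel_elem (t \<otimes> (a \<otimes> d)) (\<ominus> (t \<otimes> (a \<otimes> b))) (t \<otimes> (c \<otimes> d)) (\<ominus> (t \<otimes> (b \<otimes> c)))"
    have kJ: "t \<otimes> (a \<otimes> d) \<in> ?J" "\<ominus> (t \<otimes> (a \<otimes> b)) \<in> ?J" "t \<otimes> (c \<otimes> d) \<in> ?J" "\<ominus> (t \<otimes> (b \<otimes> c)) \<in> ?J"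
      by (intro I_uminus I_mult(1)[OF tJ] m_closed abcd(2-5))+
    have tr: "t \<otimes> (a \<otimes> d) \<oplus> \<ominus> (t \<otimes> (b \<otimes> c)) = z" unfolding t[symmetric] using tc abcd by algebra
    have e: "(\<one> \<oplus> t \<otimes> (a \<otimes> d)) \<otimes> a \<oplus> \<ominus> (t \<otimes> (a \<otimes> b)) \<otimes> c = a \<otimes> (\<one> \<oplus> z)"
      "(\<one> \<oplus> t \<otimes> (a \<otimes> d)) \<otimes> b \<oplus> \<ominus> (t \<otimes> (a \<otimes> b)) \<otimes> d = b"
      "t \<otimes> (c \<otimes> d) \<otimes> a \<oplus> (\<one> \<oplus> \<ominus> (t \<otimes> (b \<otimes> c))) \<otimes> c = c \<otimes> (\<one> \<oplus> z)"
      "t \<otimes> (c \<otimes> d) \<otimes> b \<oplus> (\<one> \<oplus> \<ominus> (t \<otimes> (b \<otimes> c))) \<otimes> d = d"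
      unfolding t[symmetric] using tc abcd by algebra+
    have "g \<otimes>\<^bsub>\<G>\<^esub> D (\<one> \<oplus> z) = ?k \<otimes>\<^bsub>\<G>\<^esub> g"
      unfolding abcd(1) kernel_elem_def D_def GL2_mult e using abcd zc by simp
    hence "\<rho> g * \<rho> (D (\<one> \<oplus> z)) = \<rho> ?k * \<rho> g"
      using GG.rep_mult[OF \<rho> g Dc] GG.rep_mult[OF \<rho> kernel_elem_closed(1)[OF r kJ] g] by simp
    also have "\<rho> ?k = \<rho> (D (\<one> \<oplus> z))" using trace[OF kJ] by (simp add: tr)
    finally show "\<rho> (D (\<one> \<oplus> z)) * \<rho> g = \<rho> g * \<rho> (D (\<one> \<oplus> z))" by simp
  qed
  define \<phi> where "\<phi> t = \<rho> (D t) $$ (0, 0)" for t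
  have n0: "n > 0" by (rule irr_repD(2)[OF irr])
  have \<phi>: "\<rho> (D t) = \<phi> t \<cdot>\<^sub>m 1\<^sub>m n" if t: "t \<in> U (r - 1)" for t
  proof -
    obtain z where z: "z \<in> ?J" "t = \<one> \<oplus> z" using t unfolding U_def by blast
    obtain c where c: "\<rho> (D t) = c \<cdot>\<^sub>m 1\<^sub>m n" using scal[OF z(1)] z(2) by blast
    hence "\<phi> t = c" using n0 by (simp add: \<phi>_def)
    thus ?thesis using c by simp
  qed
  have Us: "U (r - 1) \<subseteq> Units R" using r by (intro U_Units) auto
  have \<phi>m: "\<phi> (s \<otimes> t) = \<phi> s * \<phi> t" if "s \<in> U (r - 1)" "t \<in> U (r - 1)" for s t
  proof -
    have st: "s \<in> Units R" "t \<in> Units R" using that Us by auto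
    have "\<rho> (D (s \<otimes> t)) = \<rho> (D s) * \<rho> (D t)"
      using GG.rep_mult[OF \<rho> D_closed[OF st(1)] D_closed[OF st(2)]] st by (simp add: D_D Units_closed)
    also have "\<dots> = (\<phi> s \<cdot>\<^sub>m 1\<^sub>m n) * (\<phi> t \<cdot>\<^sub>m 1\<^sub>m n)" using \<phi> that by simp
    also have "\<dots> = (\<phi> s * \<phi> t) \<cdot>\<^sub>m 1\<^sub>m n"
      by (simp add: mult_smult_assoc_mat[of _ n n _ n]) (auto intro!: eq_matI)
    finally have "\<rho> (D (s \<otimes> t)) $$ (0, 0) = ((\<phi> s * \<phi> t) \<cdot>\<^sub>m 1\<^sub>m n) $$ (0, 0)" by simp
    thus ?thesis using n0 by (simp add: \<phi>_def)
  qed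
  have sg: "subgroup (U (r - 1)) (units_of R)" using r by (intro subgroup_U) auto
  have \<phi>0: "\<phi> t \<noteq> 0" if t: "t \<in> U (r - 1)" for t
  proof
    assume z: "\<phi> t = 0"
    have tu: "t \<in> Units R" using t Us by blast
    have "\<rho> (D t) = 0\<^sub>m n n" using \<phi>[OF t] z by auto
    hence "1\<^sub>m n = (0\<^sub>m n n :: complex mat)"
      using GG.rep_inv(1)[OF \<rho> D_closed[OF tu]] GG.rep_carrier[OF \<rho> GG.inv_closed[OF D_closed[OF tu]]] by simp
    hence "(1\<^sub>m n :: complex mat) $$ (0, 0) = 0" using n0 by (metis index_zero_mat(1))
    thus False using n0 by simp
  qed
  obtain f where f: "is_char (units_of R) f" "\<And>t. t \<in> U (r - 1) \<Longrightarrow> f t = \<phi> t"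
    by (rule A.character_extends[OF _ sg \<phi>0]) (auto simp: units_of_simps finite_Units \<phi>m)
  show ?thesis
  proof (rule that)
    show "is_char \<G> (\<lambda>g. inverse (f (det2 R g)))" by (intro is_char_inverse det2_char f(1))
    fix a b c d assume i: "a \<in> ?J" "b \<in> ?J" "c \<in> ?J" "d \<in> ?J"
    have U: "\<one> \<oplus> (a \<oplus> d) \<in> U (r - 1)" by (rule U_I[OF I_add[OF i(1,4)]])
    show "twist (\<lambda>g. inverse (f (det2 R g))) \<rho> (kernel_elem a b c d) = 1\<^sub>m n"
      unfolding twist_def kernel_elem_closed(2)[OF r i] trace[OF i] \<phi>[OF U] f(2)[OF U]
      using \<phi>0[OF U] by (auto intro!: eq_matI)
  qed
qed

text \<open>Choose a common eigenvector of the commuting elements \<open>E b\<close> and \<open>D (1 + a)\<close> with \<open>a, b\<close> in the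
  ideal \<open>I l\<close> of square zero, where \<open>l\<close> is half of \<open>r\<close> rounded up. Conjugation by upper triangular matrices with rows \<open>(t, x)\<close> and
  \<open>(0, 1)\<close> moves it to eigenvectors whose eigencharacters determine \<open>t\<close> and \<open>x\<close> modulo \<open>p\<^sup>r\<^sup>-\<^sup>l\<close>,
  because the eigencharacter is nontrivial on the minimal ideal.\<close>

lemma dimension_ge:
  assumes r: "r \<ge> 2" and irr: "irr_rep \<G> n \<rho>"
    and prim: "\<And>f. is_char \<G> f \<Longrightarrow> \<exists>a\<in>I (r - 1). \<exists>b\<in>I (r - 1). \<exists>c\<in>I (r - 1). \<exists>d\<in>I (r - 1).
      twist f \<rho> (kernel_elem a b c d) \<noteq> 1\<^sub>m n"
  shows "q ^ r \<le> 2 * q * n"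
proof -
  interpret GG: group \<G> by (rule group_GL2)
  note \<rho> = irr_repD(1)[OF irr]
  \<comment> \<open>\<open>l\<close> is the least exponent for which \<open>I l\<close> has square zero\<close>
  define m where "m = r div 2"
  define l where "l = r - m"
  have ml: "m \<ge> 1" "l \<ge> 1" "l \<le> r - 1" "2 * l \<ge> r" "r - l = m" "r \<le> 2 * m + 1" using r by (auto simp: m_def l_def)
  obtain z0 where z0: "z0 \<in> I (r - 1)" "\<rho> (E z0) \<noteq> 1\<^sub>m n"
    using twist_trivial_on_kernel[OF r irr] prim by metis
  have z0l: "z0 \<in> I l" using z0(1) I_antimono[OF ml(3)] by blast
  have zz: "x \<otimes> y = \<zero>" if "x \<in> I l" "y \<in> I l" for x y
    by (rule I_mult_zero[OF that]) (use ml in simp)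
  define A where "A = E ` I l \<union> (\<lambda>a. D (\<one> \<oplus> a)) ` I l"
  have Du: "\<one> \<oplus> a \<in> Units R" if "a \<in> I l" for a using U_Units[of l] U_I[OF that] ml r by auto
  have AG: "A \<subseteq> carrier \<G>" using Du by (auto simp: A_def)
  have ED: "E b \<otimes>\<^bsub>\<G>\<^esub> D (\<one> \<oplus> a) = D (\<one> \<oplus> a) \<otimes>\<^bsub>\<G>\<^esub> E b" if "a \<in> I l" "b \<in> I l" for a b
    using that zz[OF that] I_closed[OF that(1)] I_closed[OF that(2)] by (simp add: E_def D_def l_distr)
  have EE: "E b \<otimes>\<^bsub>\<G>\<^esub> E b' = E b' \<otimes>\<^bsub>\<G>\<^esub> E b" if "b \<in> I l" "b' \<in> I l" for b b'
    using that by (simp add: E_E a_comm)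
  have DD: "D (\<one> \<oplus> a) \<otimes>\<^bsub>\<G>\<^esub> D (\<one> \<oplus> a') = D (\<one> \<oplus> a') \<otimes>\<^bsub>\<G>\<^esub> D (\<one> \<oplus> a)" if "a \<in> I l" "a' \<in> I l" for a a'
    using that by (simp add: D_D m_comm)
  have comm: "g \<otimes>\<^bsub>\<G>\<^esub> h = h \<otimes>\<^bsub>\<G>\<^esub> g" if "g \<in> A" "h \<in> A" for g h
    using that ED EE DD by (auto simp: A_def)
  have Afin: "finite A" by (simp add: A_def finite_I)
  have z0A: "E z0 \<in> A" using z0l by (simp add: A_def)
  obtain v where v: "v \<in> carrier_vec n" "v \<noteq> 0\<^sub>v n" "\<And>g. g \<in> A \<Longrightarrow> \<exists>d. \<rho> g *\<^sub>v v = d \<cdot>\<^sub>v v" "\<rho> (E z0) *\<^sub>v v \<noteq> v"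
    using GG.common_eigenvector[OF finite_GL2 \<rho> Afin AG comm z0A z0(2)] by metis
  obtain ev where ev: "\<And>g. g \<in> A \<Longrightarrow> \<rho> g *\<^sub>v v = ev g \<cdot>\<^sub>v v" using v(3) by metis
  obtain i0 where i0: "i0 < n" "v $ i0 \<noteq> 0"
    using v(1,2) by (metis carrier_vecD eq_vecI index_zero_vec(1) index_zero_vec(2))
  have evm: "ev (g \<otimes>\<^bsub>\<G>\<^esub> h) = ev g * ev h" if "g \<in> A" "h \<in> A" "g \<otimes>\<^bsub>\<G>\<^esub> h \<in> A" for g h
  proof -
    have gh: "g \<in> carrier \<G>" "h \<in> carrier \<G>" using that AG by auto
    have "ev (g \<otimes>\<^bsub>\<G>\<^esub> h) \<cdot>\<^sub>v v = (\<rho> g * \<rho> h) *\<^sub>v v" using ev[OF that(3)] GG.rep_mult[OF \<rho> gh] by simp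
    also have "\<dots> = \<rho> g *\<^sub>v (ev h \<cdot>\<^sub>v v)"
      using assoc_mult_mat_vec[OF GG.rep_carrier[OF \<rho> gh(1)] GG.rep_carrier[OF \<rho> gh(2)] v(1)] ev[OF that(2)] by simp
    also have "\<dots> = ev h \<cdot>\<^sub>v (ev g \<cdot>\<^sub>v v)" using mult_mat_vec[OF GG.rep_carrier[OF \<rho> gh(1)] v(1)] ev[OF that(1)] by simp
    finally have "(ev (g \<otimes>\<^bsub>\<G>\<^esub> h) \<cdot>\<^sub>v v) $ i0 = (ev h \<cdot>\<^sub>v (ev g \<cdot>\<^sub>v v)) $ i0" by simp
    thus ?thesis using i0 v(1) by simp
  qed
  define th where "th b = ev (E b)" for b
  have EA: "E b \<in> A" and DA: "D (\<one> \<oplus> b) \<in> A" if "b \<in> I l" for b using that by (auto simp: A_def)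
  have th_add: "th (b \<oplus> b') = th b * th b'" if "b \<in> I l" "b' \<in> I l" for b b'
    using evm[OF EA[OF that(1)] EA[OF that(2)]] EA[OF I_add[OF that]] that by (simp add: th_def E_E)
  have th_z0: "th z0 \<noteq> 1"
  proof
    assume "th z0 = 1"
    hence "\<rho> (E z0) *\<^sub>v v = v" using ev[OF z0A] by (simp add: th_def)
    thus False using v(4) by simp
  qed
  have ev1: "ev (E \<zero>) = 1"
  proof -
    have "E \<zero> = \<one>\<^bsub>\<G>\<^esub>" by (simp add: E_def GL2_one)
    hence "v = ev (E \<zero>) \<cdot>\<^sub>v v" using ev[OF EA[OF I_zero]] GG.rep_one[OF \<rho>] v(1) by simp
    hence "v $ i0 = (ev (E \<zero>) \<cdot>\<^sub>v v) $ i0" by simp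
    thus ?thesis using i0 v(1) by simp
  qed
  have th0: "th b \<noteq> 0" if "b \<in> I l" for b
  proof -
    have "th (b \<oplus> \<ominus> b) = th b * th (\<ominus> b)" by (rule th_add[OF that I_uminus[OF that]])
    thus ?thesis using ev1 that by (auto simp: th_def r_neg)
  qed
  have evD0: "ev (D (\<one> \<oplus> a)) \<noteq> 0" if "a \<in> I l" for a
  proof
    assume 0: "ev (D (\<one> \<oplus> a)) = 0"
    have Dc: "D (\<one> \<oplus> a) \<in> carrier \<G>" using AG DA[OF that] by blast
    have "v = (\<rho> (inv\<^bsub>\<G>\<^esub> D (\<one> \<oplus> a)) * \<rho> (D (\<one> \<oplus> a))) *\<^sub>v v" using GG.rep_inv(2)[OF \<rho> Dc] v(1) by simp
    also have "\<dots> = \<rho> (inv\<^bsub>\<G>\<^esub> D (\<one> \<oplus> a)) *\<^sub>v (\<rho> (D (\<one> \<oplus> a)) *\<^sub>v v)"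
      by (rule assoc_mult_mat_vec[OF GG.rep_carrier[OF \<rho> GG.inv_closed[OF Dc]] GG.rep_carrier[OF \<rho> Dc] v(1)])
    also have "\<dots> = 0\<^sub>v n"
    proof -
      have "\<rho> (D (\<one> \<oplus> a)) *\<^sub>v v = 0\<^sub>v n" using ev[OF DA[OF that]] 0 v(1) by (auto intro!: eq_vecI)
      thus ?thesis using GG.rep_carrier[OF \<rho> GG.inv_closed[OF Dc]] by auto
    qed
    finally show False using v(2) by simp
  qed
  \<comment> \<open>a unit \<open>t\<close> and an element \<open>x\<close> for each pair \<open>(p\<^sup>l t, p\<^sup>l x)\<close>\<close>
  define X where "X = (I l - I (l + 1)) \<times> I l"
  have lift: "\<exists>t x. t \<in> Units R \<and> x \<in> carrier R \<and> fst sy = p [^] l \<otimes> t \<and> snd sy = p [^] l \<otimes> x"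
    if "sy \<in> X" for sy
  proof -
    have no: "fst sy \<notin> I (l + 1)" and mem: "fst sy \<in> I l" "snd sy \<in> I l" using that by (auto simp: X_def)
    obtain t x where tx: "t \<in> carrier R" "x \<in> carrier R" "fst sy = p [^] l \<otimes> t" "snd sy = p [^] l \<otimes> x"
      using mem unfolding I_def by blast
    have "t \<notin> I 1" using no tx(3) I_I_mult[OF p_pow_mem[of l], of t 1] by auto
    thus ?thesis using tx not_I_unit by blast
  qed
  obtain t x where tx: "\<And>sy. sy \<in> X \<Longrightarrow> t sy \<in> Units R \<and> x sy \<in> carrier R \<and>
      fst sy = p [^] l \<otimes> t sy \<and> snd sy = p [^] l \<otimes> x sy"
    using lift by metis
  \<comment> \<open>conjugating by \<open>h\<close> multiplies the argument of \<open>E\<close> by \<open>t\<close>, and \<open>D (1 + a)\<close> by \<open>E (- a x)\<close>\<close>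
  define h where "h sy = (t sy, x sy, \<zero>, \<one>)" for sy
  have hG: "h sy \<in> carrier \<G>" if "sy \<in> X" for sy
    using tx[OF that] by (auto simp: h_def GL2_mem_iff minus_eq Units_closed)
  define vv where "vv sy = \<rho> (inv\<^bsub>\<G>\<^esub> h sy) *\<^sub>v v" for sy
  have conj_ev: "\<rho> k *\<^sub>v vv sy = ev k' \<cdot>\<^sub>v vv sy"
    if sy: "sy \<in> X" and k: "k \<in> A" "k' \<in> A" and e: "h sy \<otimes>\<^bsub>\<G>\<^esub> k = k' \<otimes>\<^bsub>\<G>\<^esub> h sy" for sy k k'
  proof -
    note hg = hG[OF sy] and ih = GG.inv_closed[OF hG[OF sy]]
    have kc: "k \<in> carrier \<G>" "k' \<in> carrier \<G>" using k AG by auto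
    have "k \<otimes>\<^bsub>\<G>\<^esub> inv\<^bsub>\<G>\<^esub> h sy = inv\<^bsub>\<G>\<^esub> h sy \<otimes>\<^bsub>\<G>\<^esub> (h sy \<otimes>\<^bsub>\<G>\<^esub> k) \<otimes>\<^bsub>\<G>\<^esub> inv\<^bsub>\<G>\<^esub> h sy"
      using hg kc by (simp add: GG.m_assoc[symmetric])
    also have "\<dots> = inv\<^bsub>\<G>\<^esub> h sy \<otimes>\<^bsub>\<G>\<^esub> k'" unfolding e using hg kc by (simp add: GG.m_assoc)
    finally have "\<rho> k * \<rho> (inv\<^bsub>\<G>\<^esub> h sy) = \<rho> (inv\<^bsub>\<G>\<^esub> h sy) * \<rho> k'"
      using GG.rep_mult[OF \<rho> kc(1) ih] GG.rep_mult[OF \<rho> ih kc(2)] by simp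
    hence "\<rho> k *\<^sub>v vv sy = \<rho> (inv\<^bsub>\<G>\<^esub> h sy) *\<^sub>v (\<rho> k' *\<^sub>v v)"
      unfolding vv_def
      using assoc_mult_mat_vec[OF GG.rep_carrier[OF \<rho> kc(1)] GG.rep_carrier[OF \<rho> ih] v(1)]
        assoc_mult_mat_vec[OF GG.rep_carrier[OF \<rho> ih] GG.rep_carrier[OF \<rho> kc(2)] v(1)] by simp
    thus ?thesis
      using mult_mat_vec[OF GG.rep_carrier[OF \<rho> ih] v(1)] ev[OF k(2)] by (simp add: vv_def)
  qed
  have conjE: "\<rho> (E (p [^] l \<otimes> b)) *\<^sub>v vv sy = th (fst sy \<otimes> b) \<cdot>\<^sub>v vv sy"
    if sy: "sy \<in> X" and b: "b \<in> carrier R" for sy b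
    unfolding th_def
  proof (rule conj_ev[OF sy])
    show "E (p [^] l \<otimes> b) \<in> A" using b I_I by (intro EA) auto
    have f: "fst sy \<in> I l" using sy by (auto simp: X_def)
    show "E (fst sy \<otimes> b) \<in> A" by (intro EA I_mult(1) f b)
    have c: "t sy \<in> carrier R" "x sy \<in> carrier R" using tx[OF sy] by auto
    have "fst sy = p [^] l \<otimes> t sy" using tx[OF sy] by blast
    thus "h sy \<otimes>\<^bsub>\<G>\<^esub> E (p [^] l \<otimes> b) = E (fst sy \<otimes> b) \<otimes>\<^bsub>\<G>\<^esub> h sy"
      using c b by (simp add: h_def E_def m_ac a_comm)
  qed
  have conjD: "\<rho> (D (\<one> \<oplus> p [^] l \<otimes> a)) *\<^sub>v vv sy = (ev (D (\<one> \<oplus> p [^] l \<otimes> a)) * th (\<ominus> (snd sy \<otimes> a))) \<cdot>\<^sub>v vv sy"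
    if sy: "sy \<in> X" and a: "a \<in> carrier R" for sy a
  proof -
    let ?a = "p [^] l \<otimes> a" and ?z = "\<ominus> (snd sy \<otimes> a)"
    have aI: "?a \<in> I l" using a by (rule I_I)
    have sI: "snd sy \<in> I l" using sy by (auto simp: X_def)
    have zI: "?z \<in> I l" by (intro I_uminus I_mult(1) sI a)
    have c: "t sy \<in> carrier R" "x sy \<in> carrier R" using tx[OF sy] by auto
    have xs: "snd sy = p [^] l \<otimes> x sy" using tx[OF sy] by blast
    have prod: "D (\<one> \<oplus> ?a) \<otimes>\<^bsub>\<G>\<^esub> E ?z = (\<one> \<oplus> ?a, ?z, \<zero>, \<one>)"
      using zz[OF aI zI] I_closed[OF aI] I_closed[OF zI] by (simp add: D_def E_def l_distr)
    have xa: "?z = \<ominus> (?a \<otimes> x sy)" unfolding xs using a c by (simp add: m_ac)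
    let ?k = "(\<one> \<oplus> ?a, ?z, \<zero>, \<one>)"
    have kG: "?k \<in> carrier \<G>"
      using Du[OF aI] I_closed[OF aI] I_closed[OF zI] by (simp add: GL2_mem_iff minus_eq Units_closed)
    have evk: "\<rho> ?k *\<^sub>v v = (ev (D (\<one> \<oplus> ?a)) * th ?z) \<cdot>\<^sub>v v"
    proof -
      have gh: "D (\<one> \<oplus> ?a) \<in> carrier \<G>" "E ?z \<in> carrier \<G>" using DA[OF aI] EA[OF zI] AG by auto
      have "\<rho> ?k *\<^sub>v v = (\<rho> (D (\<one> \<oplus> ?a)) * \<rho> (E ?z)) *\<^sub>v v"
        unfolding prod[symmetric] using GG.rep_mult[OF \<rho> gh] by simp
      also have "\<dots> = \<rho> (D (\<one> \<oplus> ?a)) *\<^sub>v (th ?z \<cdot>\<^sub>v v)"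
        using assoc_mult_mat_vec[OF GG.rep_carrier[OF \<rho> gh(1)] GG.rep_carrier[OF \<rho> gh(2)] v(1)] ev[OF EA[OF zI]] by (simp add: th_def)
      also have "\<dots> = th ?z \<cdot>\<^sub>v (ev (D (\<one> \<oplus> ?a)) \<cdot>\<^sub>v v)"
        using mult_mat_vec[OF GG.rep_carrier[OF \<rho> gh(1)] v(1)] ev[OF DA[OF aI]] by simp
      finally show ?thesis by (simp add: smult_smult_assoc mult.commute)
    qed
    have e: "h sy \<otimes>\<^bsub>\<G>\<^esub> D (\<one> \<oplus> ?a) = ?k \<otimes>\<^bsub>\<G>\<^esub> h sy"
    proof -
      have ac: "?a \<in> carrier R" using aI by simp
      have "(\<one> \<oplus> ?a) \<otimes> x sy \<oplus> ?z = x sy" unfolding xa using ac c by algebra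
      thus ?thesis using ac c I_closed[OF zI] by (simp add: h_def D_def m_comm)
    qed
    note hg = hG[OF sy] and ih = GG.inv_closed[OF hG[OF sy]]
    have kc: "D (\<one> \<oplus> ?a) \<in> carrier \<G>" using DA[OF aI] AG by auto
    have "D (\<one> \<oplus> ?a) \<otimes>\<^bsub>\<G>\<^esub> inv\<^bsub>\<G>\<^esub> h sy = inv\<^bsub>\<G>\<^esub> h sy \<otimes>\<^bsub>\<G>\<^esub> (h sy \<otimes>\<^bsub>\<G>\<^esub> D (\<one> \<oplus> ?a)) \<otimes>\<^bsub>\<G>\<^esub> inv\<^bsub>\<G>\<^esub> h sy"
      using hg kc by (simp add: GG.m_assoc[symmetric])
    also have "\<dots> = inv\<^bsub>\<G>\<^esub> h sy \<otimes>\<^bsub>\<G>\<^esub> ?k" unfolding e using hg kG by (simp add: GG.m_assoc del: GL2_mult)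
    finally have "\<rho> (D (\<one> \<oplus> ?a)) * \<rho> (inv\<^bsub>\<G>\<^esub> h sy) = \<rho> (inv\<^bsub>\<G>\<^esub> h sy) * \<rho> ?k"
      using GG.rep_mult[OF \<rho> kc ih] GG.rep_mult[OF \<rho> ih kG] by simp
    hence "\<rho> (D (\<one> \<oplus> ?a)) *\<^sub>v vv sy = \<rho> (inv\<^bsub>\<G>\<^esub> h sy) *\<^sub>v (\<rho> ?k *\<^sub>v v)"
      unfolding vv_def
      using assoc_mult_mat_vec[OF GG.rep_carrier[OF \<rho> kc] GG.rep_carrier[OF \<rho> ih] v(1)]
        assoc_mult_mat_vec[OF GG.rep_carrier[OF \<rho> ih] GG.rep_carrier[OF \<rho> kG] v(1)] by simp
    thus ?thesis
      unfolding evk using mult_mat_vec[OF GG.rep_carrier[OF \<rho> ih] v(1)] by (simp add: vv_def)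
  qed
  define M where "M = (\<lambda>(ty, b). \<rho> (if ty then E (p [^] l \<otimes> b) else D (\<one> \<oplus> p [^] l \<otimes> b)))"
  define c where "c = (\<lambda>sy (ty, b). if ty then th (fst sy \<otimes> b) else ev (D (\<one> \<oplus> p [^] l \<otimes> b)) * th (\<ominus> (snd sy \<otimes> b)))"
  have "card X \<le> n"
  proof (rule eigenvectors_distinct_characters_card_le[where M=M and v=vv and c=c and K="UNIV \<times> carrier R"])
    show "finite X" by (simp add: X_def finite_I)
    fix k :: "bool \<times> 'a" assume k: "k \<in> UNIV \<times> carrier R"
    then obtain ty b where kb: "k = (ty, b)" "b \<in> carrier R" by auto
    have "E (p [^] l \<otimes> b) \<in> carrier \<G>" "D (\<one> \<oplus> p [^] l \<otimes> b) \<in> carrier \<G>" using EA DA AG I_I kb(2) by blast+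
    thus "M k \<in> carrier_mat n n" using GG.rep_carrier[OF \<rho>] by (simp add: M_def kb(1))
    fix sy assume "sy \<in> X"
    thus "M k *\<^sub>v vv sy = c sy k \<cdot>\<^sub>v vv sy" using conjE conjD kb by (simp add: M_def c_def)
  next
    fix sy assume sy: "sy \<in> X"
    note hg = hG[OF sy] and ih = GG.inv_closed[OF hG[OF sy]]
    show "vv sy \<in> carrier_vec n" unfolding vv_def by (rule mult_mat_vec_carrier[OF GG.rep_carrier[OF \<rho> ih] v(1)])
    show "vv sy \<noteq> 0\<^sub>v n"
    proof
      assume 0: "vv sy = 0\<^sub>v n"
      have "v = (\<rho> (h sy) * \<rho> (inv\<^bsub>\<G>\<^esub> h sy)) *\<^sub>v v" using GG.rep_inv(1)[OF \<rho> hg] v(1) by simp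
      also have "\<dots> = \<rho> (h sy) *\<^sub>v vv sy"
        unfolding vv_def by (rule assoc_mult_mat_vec[OF GG.rep_carrier[OF \<rho> hg] GG.rep_carrier[OF \<rho> ih] v(1)])
      also have "\<dots> = 0\<^sub>v n" using GG.rep_carrier[OF \<rho> hg] by (auto simp: 0)
      finally show False using v(2) by simp
    qed
  next
    fix sy sy' assume s: "sy \<in> X" "sy' \<in> X" "sy \<noteq> sy'"
    have fI: "fst sy \<in> I l" "fst sy' \<in> I l" "snd sy \<in> I l" "snd sy' \<in> I l" using s by (auto simp: X_def)
    note fc = fI[THEN I_closed]
    show "\<exists>k\<in>UNIV \<times> carrier R. c sy k \<noteq> c sy' k"
    proof (cases "fst sy = fst sy'")
      case False
      have "fst sy \<ominus> fst sy' \<noteq> \<zero>" using False fc by simp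
      then obtain b where b: "b \<in> carrier R" "(fst sy \<ominus> fst sy') \<otimes> b = z0"
        using divides_socle[OF _ _ z0(1), of "fst sy \<ominus> fst sy'"] fc by auto
      have "fst sy \<otimes> b = z0 \<oplus> fst sy' \<otimes> b" unfolding b(2)[symmetric] using fc b(1) by algebra
      hence "th (fst sy \<otimes> b) = th z0 * th (fst sy' \<otimes> b)" using th_add[OF z0l I_mult(1)[OF fI(2) b(1)]] by simp
      hence "th (fst sy \<otimes> b) \<noteq> th (fst sy' \<otimes> b)" using th_z0 th0[OF I_mult(1)[OF fI(2) b(1)]] by simp
      thus ?thesis using b(1) by (intro bexI[of _ "(True, b)"]) (auto simp: c_def)
    next
      case True
      hence "snd sy \<noteq> snd sy'" using s(3) by (auto simp: prod_eq_iff)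
      hence "snd sy' \<ominus> snd sy \<noteq> \<zero>" using fc by simp
      then obtain b where b: "b \<in> carrier R" "(snd sy' \<ominus> snd sy) \<otimes> b = z0"
        using divides_socle[OF _ _ z0(1), of "snd sy' \<ominus> snd sy"] fc by auto
      have nI: "\<ominus> (snd sy' \<otimes> b) \<in> I l" by (intro I_uminus I_mult(1) fI b)
      have "\<ominus> (snd sy \<otimes> b) = z0 \<oplus> \<ominus> (snd sy' \<otimes> b)" unfolding b(2)[symmetric] using fc b(1) by algebra
      hence "th (\<ominus> (snd sy \<otimes> b)) = th z0 * th (\<ominus> (snd sy' \<otimes> b))" using th_add[OF z0l nI] by simp
      hence "th (\<ominus> (snd sy \<otimes> b)) \<noteq> th (\<ominus> (snd sy' \<otimes> b))" using th_z0 th0[OF nI] by simp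
      thus ?thesis using b(1) evD0[OF I_I[OF b(1)]] by (intro bexI[of _ "(False, b)"]) (auto simp: c_def)
    qed
  qed
  moreover have "card X = (q ^ m - q ^ (m - 1)) * q ^ m"
  proof -
    have "card (I l - I (l + 1)) = card (I l) - card (I (l + 1))"
      by (rule card_Diff_subset) (use I_antimono[of l "l + 1"] in \<open>simp_all add: finite_I\<close>)
    moreover have "r - (l + 1) = m - 1" "l + 1 \<le> r" "l \<le> r" using ml by linarith+
    ultimately show ?thesis using ml(5) by (simp only: X_def card_I card_cartesian_product)
  qed
  ultimately have X: "(q ^ m - q ^ (m - 1)) * q ^ m \<le> n" by simp
  \<comment> \<open>\<open>card X\<close> is at least half of \<open>q\<^sup>2\<^sup>m\<close>, and \<open>2 m \<ge> r - 1\<close>\<close>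
  have "2 * q ^ (m - 1) \<le> q * q ^ (m - 1)" using q_ge by simp
  also have "\<dots> = q ^ m" using ml(1) by (simp flip: power_Suc)
  finally have "q ^ m \<le> 2 * (q ^ m - q ^ (m - 1))" by simp
  hence "q ^ m * q ^ m \<le> 2 * ((q ^ m - q ^ (m - 1)) * q ^ m)" by (metis mult.assoc mult_le_mono1)
  also have "\<dots> \<le> 2 * n" using X by simp
  finally have "q ^ (2 * m) \<le> 2 * n" by (simp add: mult_2 power_add)
  hence "q * q ^ (2 * m) \<le> q * (2 * n)" by (rule mult_le_mono2)
  moreover have "q ^ r \<le> q ^ (2 * m + 1)" using q_ge ml by (intro power_increasing) auto
  ultimately show ?thesis by (simp only: power_add power_one_right mult_ac)
qed

end

section \<open>Principal series\<close>

context chain_ring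
begin

definition borel :: "'a mat2 set" where
  "borel = {(a, b, c, d). a \<in> Units R \<and> b \<in> carrier R \<and> c = \<zero> \<and> d \<in> Units R}"

text \<open>A character of the Borel subgroup is a pair of characters of the diagonal entries.
  Twisting by a character of the determinant makes the second one trivial, which leaves these.\<close>

definition borel_char :: "('a \<Rightarrow> complex) \<Rightarrow> 'a mat2 \<Rightarrow> complex" where
  "borel_char \<theta> = (\<lambda>(a, b, c, d). \<theta> a)"

lemma borel_mem [simp]:
  "(a, b, c, d) \<in> borel \<longleftrightarrow> a \<in> Units R \<and> b \<in> carrier R \<and> c = \<zero> \<and> d \<in> Units R"
  by (simp add: borel_def)

lemma borel_closed: "borel \<subseteq> carrier \<G>"
  by (auto simp: borel_def GL2_mem_iff minus_eq Units_closed)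

lemma subgroup_borel: "subgroup borel \<G>"
proof -
  interpret GG: group \<G> by (rule group_GL2)
  have mult: "g \<otimes>\<^bsub>\<G>\<^esub> h \<in> borel" if "g \<in> borel" "h \<in> borel" for g h
    using that by (cases g; cases h) (simp add: Units_closed)
  show ?thesis
  proof (rule subgroup.intro)
    show "borel \<subseteq> carrier \<G>" by (rule borel_closed)
    show "\<one>\<^bsub>\<G>\<^esub> \<in> borel" by (simp add: GL2_one)
    show "g \<otimes>\<^bsub>\<G>\<^esub> h \<in> borel" if "g \<in> borel" "h \<in> borel" for g h using mult that .
    fix g assume g: "g \<in> borel"
    then obtain a b d where abd: "g = (a, b, \<zero>, d)" "a \<in> Units R" "b \<in> carrier R" "d \<in> Units R"
      by (cases g) auto
    note c = Units_closed[OF abd(2)] Units_closed[OF abd(4)] Units_inv_closed[OF abd(2)] Units_inv_closed[OF abd(4)]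
    let ?h = "(inv a, \<ominus> (inv a \<otimes> b \<otimes> inv d), \<zero>, inv d)"
    have h: "?h \<in> borel" using abd c by simp
    have "inv a \<otimes> b \<oplus> \<ominus> (inv a \<otimes> b \<otimes> inv d) \<otimes> d = inv a \<otimes> b \<oplus> \<ominus> (inv a \<otimes> b \<otimes> (inv d \<otimes> d))"
      using c abd(3) by algebra
    also have "\<dots> = \<zero>" using c abd by (simp add: r_neg)
    finally have "?h \<otimes>\<^bsub>\<G>\<^esub> g = \<one>\<^bsub>\<G>\<^esub>" using abd c by (simp add: GL2_one)
    hence "inv\<^bsub>\<G>\<^esub> g = ?h" using h g borel_closed by (intro GG.inv_equality) auto
    thus "inv\<^bsub>\<G>\<^esub> g \<in> borel" using h by simp
  qed
qed

text \<open>Bruhat decomposition over a local ring: the bottom row of \<open>g\<close>, up to a unit, is \<open>(c, 1)\<close> with \<open>c\<close>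
  in the maximal ideal, or \<open>(1, x)\<close>.\<close>

lemma borel_decomposition:
  assumes r: "r \<ge> 1" and g: "g \<in> carrier \<G>"
  shows "(\<exists>b\<in>borel. \<exists>c\<in>I 1. g = b \<otimes>\<^bsub>\<G>\<^esub> L c) \<or> (\<exists>b\<in>borel. \<exists>x\<in>carrier R. g = b \<otimes>\<^bsub>\<G>\<^esub> (w \<otimes>\<^bsub>\<G>\<^esub> E x))"
proof -
  obtain a b c d where abcd: "g = (a, b, c, d)" "a \<in> carrier R" "b \<in> carrier R" "c \<in> carrier R" "d \<in> carrier R"
    and u: "a \<otimes> d \<ominus> b \<otimes> c \<in> Units R" using g by (rule GL2_E)
  show ?thesis
  proof (cases "c \<in> I 1")
    case cI: True
    have d: "d \<in> Units R"
    proof (rule not_I_unit[OF abcd(5)])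
      show "d \<notin> I 1"
      proof
        assume "d \<in> I 1"
        hence "a \<otimes> d \<ominus> b \<otimes> c \<in> I 1" using cI abcd by (intro I_minus I_mult(2))
        thus False using unit_not_I[OF r u] by simp
      qed
    qed
    define x where "x = c \<otimes> inv d"
    have dc: "inv d \<in> carrier R" using d by simp
    have x: "x \<in> I 1" "x \<in> carrier R" "x \<otimes> d = c"
      using I_mult(1)[OF cI dc] d abcd by (auto simp: x_def m_assoc)
    have "(a \<ominus> b \<otimes> x) \<otimes> d = a \<otimes> d \<ominus> b \<otimes> c" unfolding x(3)[symmetric] using x(2) abcd by algebra
    hence "(a \<ominus> b \<otimes> x) \<otimes> d \<in> Units R" using u by simp
    hence au: "a \<ominus> b \<otimes> x \<in> Units R" using abcd x(2) d by (auto intro: unit_factor)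
    have "a = (a \<ominus> b \<otimes> x) \<oplus> b \<otimes> x" using abcd x(2) by algebra
    hence "g = (a \<ominus> b \<otimes> x, b, \<zero>, d) \<otimes>\<^bsub>\<G>\<^esub> L x" using abcd x by (simp add: L_def m_comm)
    moreover have "(a \<ominus> b \<otimes> x, b, \<zero>, d) \<in> borel" using au d abcd by simp
    ultimately show ?thesis using x(1) by blast
  next
    case False
    hence c: "c \<in> Units R" using not_I_unit abcd by blast
    define x where "x = inv c \<otimes> d"
    have x: "x \<in> carrier R" "c \<otimes> x = d" using c abcd by (auto simp: x_def m_assoc[symmetric])
    have "c \<otimes> \<ominus> (b \<ominus> a \<otimes> x) = a \<otimes> d \<ominus> b \<otimes> c" unfolding x(2)[symmetric] using x(1) abcd by algebra
    hence "c \<otimes> \<ominus> (b \<ominus> a \<otimes> x) \<in> Units R" using u by simp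
    hence "\<ominus> (b \<ominus> a \<otimes> x) \<in> Units R"
      using abcd x(1) c by (metis a_inv_closed m_closed m_comm minus_closed unit_factor)
    hence "\<ominus> \<one> \<otimes> \<ominus> (b \<ominus> a \<otimes> x) \<in> Units R" using neg_one_unit by blast
    moreover have "\<ominus> \<one> \<otimes> \<ominus> (b \<ominus> a \<otimes> x) = b \<ominus> a \<otimes> x" using abcd x(1) by algebra
    ultimately have bu: "b \<ominus> a \<otimes> x \<in> Units R" by simp
    have "b = (b \<ominus> a \<otimes> x) \<oplus> a \<otimes> x" using abcd x(1) by algebra
    hence "g = (b \<ominus> a \<otimes> x, a, \<zero>, c) \<otimes>\<^bsub>\<G>\<^esub> (w \<otimes>\<^bsub>\<G>\<^esub> E x)" using abcd x by (simp add: E_def w_def)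
    moreover have "(b \<ominus> a \<otimes> x, a, \<zero>, c) \<in> borel" using bu c abcd by simp
    ultimately show ?thesis using x(1) by blast
  qed
qed

lemma borel_transversal:
  assumes r: "r \<ge> 1"
  obtains N x where "transversal \<G> borel N x" "N \<le> 2 * q ^ r"
proof -
  interpret GG: group \<G> by (rule group_GL2)
  let ?Y = "L ` I 1 \<union> (\<lambda>x. w \<otimes>\<^bsub>\<G>\<^esub> E x) ` carrier R"
  have Yf: "finite ?Y" using finite_carrier by (simp add: finite_I)
  have Yc: "?Y \<subseteq> carrier \<G>" by (auto intro!: GG.m_closed)
  have cov: "\<exists>y\<in>?Y. g \<otimes>\<^bsub>\<G>\<^esub> inv\<^bsub>\<G>\<^esub> y \<in> borel" if g: "g \<in> carrier \<G>" for g
  proof -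
    obtain b y where bY: "b \<in> borel" "y \<in> ?Y" "g = b \<otimes>\<^bsub>\<G>\<^esub> y" using borel_decomposition[OF r g] by blast
    have "b \<in> carrier \<G>" "y \<in> carrier \<G>" using bY Yc borel_closed by blast+
    hence "g \<otimes>\<^bsub>\<G>\<^esub> inv\<^bsub>\<G>\<^esub> y = b" unfolding bY(3) by (simp add: GG.m_assoc)
    thus ?thesis using bY by metis
  qed
  obtain N x where Nx: "N > (0::nat)" "N \<le> card ?Y" "x 0 = \<one>\<^bsub>\<G>\<^esub>" "\<And>i. i < N \<Longrightarrow> x i \<in> carrier \<G>"
    "\<And>g. g \<in> carrier \<G> \<Longrightarrow> \<exists>!i. i < N \<and> g \<otimes>\<^bsub>\<G>\<^esub> inv\<^bsub>\<G>\<^esub> (x i) \<in> borel"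
    using GG.exists_transversal[OF finite_GL2 subgroup_borel Yf Yc cov] by blast
  have "card ?Y \<le> card (L ` I 1) + card ((\<lambda>x. w \<otimes>\<^bsub>\<G>\<^esub> E x) ` carrier R)" by (rule card_Un_le)
  also have "\<dots> \<le> card (I 1) + card (carrier R)" by (intro add_mono card_image_le finite_I finite_carrier)
  also have "\<dots> \<le> q ^ r + q ^ r" using r q_ge by (simp add: card_I card_carrier power_increasing)
  finally have "N \<le> 2 * q ^ r" using Nx(2) by simp
  moreover have "transversal \<G> borel N x"
    by (intro transversal.intro group_GL2 transversal_axioms.intro finite_GL2 subgroup_borel Nx)
  ultimately show ?thesis using that by blast
qed

lemma borel_char_is_char:
  assumes "is_char (units_of R) \<theta>"
  shows "is_char (\<G>\<lparr>carrier := borel\<rparr>) (borel_char \<theta>)"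
proof -
  have "borel_char \<theta> (g \<otimes>\<^bsub>\<G>\<^esub> h) = borel_char \<theta> g * borel_char \<theta> h" if "g \<in> borel" "h \<in> borel" for g h
    using that assms by (cases g; cases h) (simp add: borel_char_def is_char_def units_of_simps Units_closed)
  moreover have "borel_char \<theta> g \<noteq> 0" if "g \<in> borel" for g
    using that assms by (cases g) (simp add: borel_char_def is_char_def units_of_simps)
  ultimately show ?thesis by (auto simp: is_char_def)
qed

text \<open>By the decomposition above, a function with two-sided transformation behaviour under the Borel
  subgroup is determined by its values at \<open>w\<close> and at the matrices \<open>L c\<close> with \<open>c\<close> in the maximal
  ideal.\<close>

lemma biequivariant_support:
  assumes r: "r \<ge> 1" and F': "\<forall>b\<in>borel. \<forall>g\<in>carrier \<G>. \<forall>b'\<in>borel. F (b \<otimes>\<^bsub>\<G>\<^esub> g \<otimes>\<^bsub>\<G>\<^esub> b') = \<kappa> b * F g * \<kappa>' b'"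
    and \<kappa>': "\<kappa>' \<one>\<^bsub>\<G>\<^esub> = (1 :: complex)"
    and g: "g \<in> carrier \<G>" "F g \<noteq> (0 :: complex)"
  shows "F w \<noteq> 0 \<or> (\<exists>b\<in>borel. \<exists>c\<in>I 1. g = b \<otimes>\<^bsub>\<G>\<^esub> L c \<and> F (L c) \<noteq> 0)"
proof -
  interpret GG: group \<G> by (rule group_GL2)
  interpret B: subgroup borel \<G> by (rule subgroup_borel)
  note F = F'[rule_format]
  consider b c where "b \<in> borel" "c \<in> I 1" "g = b \<otimes>\<^bsub>\<G>\<^esub> L c"
    | b x where "b \<in> borel" "x \<in> carrier R" "g = b \<otimes>\<^bsub>\<G>\<^esub> (w \<otimes>\<^bsub>\<G>\<^esub> E x)"
    using borel_decomposition[OF r g(1)] by blast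
  thus ?thesis
  proof cases
    case 1
    have "b \<otimes>\<^bsub>\<G>\<^esub> L c \<otimes>\<^bsub>\<G>\<^esub> \<one>\<^bsub>\<G>\<^esub> = g" using g(1) 1 by simp
    hence "F g = \<kappa> b * F (L c)" using F[OF 1(1) L_closed[OF I_closed[OF 1(2)]] B.one_closed] \<kappa>' by simp
    hence "F (L c) \<noteq> 0" using g(2) by auto
    thus ?thesis using 1 by blast
  next
    case 2
    have Eb: "E x \<in> borel" using 2 by (simp add: E_def)
    have "b \<in> carrier \<G>" using 2 borel_closed by blast
    hence "b \<otimes>\<^bsub>\<G>\<^esub> w \<otimes>\<^bsub>\<G>\<^esub> E x = g" unfolding 2(3) using 2(2) by (intro GG.m_assoc) auto
    hence "F g = \<kappa> b * F w * \<kappa>' (E x)" using F[OF 2(1) w_closed Eb] by simp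
    thus ?thesis using g(2) by auto
  qed
qed

text \<open>Identities \<open>b L c = L c b'\<close> with upper triangular \<open>b\<close> and \<open>b'\<close>. A biequivariant function
  that does not vanish at \<open>L c\<close> can exist only if the two characters agree at \<open>b\<close> and \<open>b'\<close>.\<close>

lemma borel_L_comm:
  assumes "x \<in> carrier R" "c \<in> carrier R"
  shows "(\<one> \<ominus> x \<otimes> c, x, \<zero>, \<one>) \<otimes>\<^bsub>\<G>\<^esub> L c = L c \<otimes>\<^bsub>\<G>\<^esub> (\<one>, x, \<zero>, \<one> \<ominus> x \<otimes> c)"
proof -
  have "\<one> \<ominus> x \<otimes> c \<oplus> x \<otimes> c = \<one>" "c \<otimes> x \<oplus> (\<one> \<ominus> x \<otimes> c) = \<one>" using assms by algebra+
  thus ?thesis using assms by (simp add: L_def)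
qed

lemma diag_L_comm:
  assumes "s \<in> carrier R" "t \<in> carrier R" "c \<in> carrier R" "s \<otimes> c = c" "t \<otimes> c = c"
  shows "(s, \<zero>, \<zero>, t) \<otimes>\<^bsub>\<G>\<^esub> L c = L c \<otimes>\<^bsub>\<G>\<^esub> (s, \<zero>, \<zero>, t)"
  using assms m_comm[of c s] by (simp add: L_def)

lemma equivariant_comm:
  assumes F': "\<forall>b\<in>borel. \<forall>g\<in>carrier \<G>. \<forall>b'\<in>borel. F (b \<otimes>\<^bsub>\<G>\<^esub> g \<otimes>\<^bsub>\<G>\<^esub> b') = \<kappa> b * F g * \<kappa>' b'"
    and one: "\<kappa> \<one>\<^bsub>\<G>\<^esub> = 1" "\<kappa>' \<one>\<^bsub>\<G>\<^esub> = (1 :: complex)"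
    and g: "g \<in> carrier \<G>" "F g \<noteq> 0" and b: "b \<in> borel" "b' \<in> borel" "b \<otimes>\<^bsub>\<G>\<^esub> g = g \<otimes>\<^bsub>\<G>\<^esub> b'"
  shows "\<kappa> b = \<kappa>' b'"
proof -
  interpret GG: group \<G> by (rule group_GL2)
  interpret B: subgroup borel \<G> by (rule subgroup_borel)
  note F = F'[rule_format]
  have bc: "b \<in> carrier \<G>" "b' \<in> carrier \<G>" using b borel_closed by auto
  have "\<kappa> b * F g = F (b \<otimes>\<^bsub>\<G>\<^esub> g)" using F[OF b(1) g(1) B.one_closed] one g(1) bc by simp
  also have "\<dots> = F g * \<kappa>' b'" unfolding b(3) using F[OF B.one_closed g(1) b(2)] one g(1) bc by simp
  finally show ?thesis using g(2) by simp
qed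

lemma char_units_one: "is_char (units_of R) \<theta> \<Longrightarrow> \<theta> \<one> = 1"
  using is_char_one[OF units_group[THEN comm_group.axioms(2)]] by (simp add: units_of_simps)

lemma borel_char_one: "is_char (units_of R) \<theta> \<Longrightarrow> borel_char \<theta> \<one>\<^bsub>\<G>\<^esub> = 1"
  by (simp add: borel_char_def GL2_one char_units_one)

text \<open>Mackey's criterion. At \<open>w\<close>, which interchanges the diagonal entries, the two
  transformation laws would force \<open>\<theta> (1 + z) = 1\<close>. At \<open>L c\<close> with \<open>c \<noteq> 0\<close> they would do so as
  well, because \<open>z\<close> is a multiple of \<open>c\<close> and an upper triangular matrix with diagonal
  \<open>(1 + z, 1)\<close> can be moved past \<open>L c\<close> at the price of interchanging its diagonal entries.\<close>

lemma principal_series_irreducible: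
  assumes r: "r \<ge> 2" and T: "transversal \<G> borel N x" and \<theta>: "is_char (units_of R) \<theta>"
    and z: "z \<in> I (r - 1)" "\<theta> (\<one> \<oplus> z) \<noteq> 1"
  shows "irr_rep \<G> N (transversal.induced \<G> borel N x (borel_char \<theta>))"
proof -
  interpret T: transversal \<G> borel N x by (rule T)
  have Bc: "T.B_char (borel_char \<theta>)" unfolding T.B_char_def by (rule borel_char_is_char[OF \<theta>])
  note one = borel_char_one[OF \<theta>]
  have zu: "\<one> \<oplus> z \<in> Units R" by (rule socle_U[OF r z(1)])
  have zc: "z \<in> carrier R" using z by simp
  have r1: "r \<ge> 1" using r by simp
  show ?thesis
  proof (rule T.induced_irreducible[OF Bc])
    fix F :: "'a mat2 \<Rightarrow> complex" and g
    assume F: "\<And>b g b'. b \<in> borel \<Longrightarrow> g \<in> carrier \<G> \<Longrightarrow> b' \<in> borel \<Longrightarrow>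
        F (b \<otimes>\<^bsub>\<G>\<^esub> g \<otimes>\<^bsub>\<G>\<^esub> b') = borel_char \<theta> b * F g * borel_char \<theta> b'"
      and g: "g \<in> carrier \<G>" "g \<notin> borel"
    have F': "\<forall>b\<in>borel. \<forall>g\<in>carrier \<G>. \<forall>b'\<in>borel.
        F (b \<otimes>\<^bsub>\<G>\<^esub> g \<otimes>\<^bsub>\<G>\<^esub> b') = borel_char \<theta> b * F g * borel_char \<theta> b'"
      using F by blast
    note comm = equivariant_comm[OF F' one one]
    show "F g = 0"
    proof (rule ccontr)
      assume Fg: "F g \<noteq> 0"
      from biequivariant_support[OF r1 F' one g(1) Fg]
      consider "F w \<noteq> 0" | b c where "b \<in> borel" "c \<in> I 1" "g = b \<otimes>\<^bsub>\<G>\<^esub> L c" "F (L c) \<noteq> 0" by blast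
      thus False
      proof cases
        case 1
        have "borel_char \<theta> (\<one> \<oplus> z, \<zero>, \<zero>, \<one>) = borel_char \<theta> (\<one>, \<zero>, \<zero>, \<one> \<oplus> z)"
          by (rule comm[OF w_closed 1]) (use zu zc in \<open>auto simp: w_def\<close>)
        thus False using z(2) char_units_one[OF \<theta>] by (simp add: borel_char_def)
      next
        case 2
        have "c \<noteq> \<zero>"
        proof
          assume "c = \<zero>"
          hence "L c = \<one>\<^bsub>\<G>\<^esub>" by (simp add: L_def GL2_one)
          hence "g = b" using 2 borel_closed by auto
          thus False using g 2 by simp
        qed
        then obtain y where y: "y \<in> carrier R" "c \<otimes> y = \<ominus> z"
          using divides_socle[OF I_closed[OF 2(2)] _ I_uminus[OF z(1)]] by metis
        have e: "\<one> \<ominus> y \<otimes> c = \<one> \<oplus> z" using y 2(2) zc by (simp add: m_comm minus_eq)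
        have "borel_char \<theta> (\<one> \<ominus> y \<otimes> c, y, \<zero>, \<one>) = borel_char \<theta> (\<one>, y, \<zero>, \<one> \<ominus> y \<otimes> c)"
          by (rule comm[OF L_closed[OF I_closed[OF 2(2)]] 2(4) _ _ borel_L_comm[OF y(1) I_closed[OF 2(2)]]])
            (use zu y in \<open>auto simp: e\<close>)
        thus False using z(2) char_units_one[OF \<theta>] by (simp add: borel_char_def e)
      qed
    qed
  qed
qed

text \<open>If \<open>x = p y\<close>, then \<open>E x\<close> is the commutator of \<open>D (1 + p)\<close> and \<open>E y\<close>.\<close>

lemma char_E_trivial:
  assumes r: "r \<ge> 1" and f: "is_char \<G> f" and x: "x \<in> I 1"
  shows "f (E x) = 1"
proof -
  interpret GG: group \<G> by (rule group_GL2)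
  obtain y where y: "y \<in> carrier R" "x = p \<otimes> y" using x by (auto simp: I_def)
  have pI: "p \<in> I 1" using p_pow_mem[of 1] by simp
  have tu: "\<one> \<oplus> p \<in> Units R" by (rule add_unit[OF r _ pI]) simp
  have Dc: "D (\<one> \<oplus> p) \<in> carrier \<G>" using tu by simp
  have fm: "f (g \<otimes>\<^bsub>\<G>\<^esub> h) = f g * f h" and f0: "f g \<noteq> 0" if "g \<in> carrier \<G>" "h \<in> carrier \<G>" for g h
    using f that by (auto simp: is_char_def)
  have "D (\<one> \<oplus> p) \<otimes>\<^bsub>\<G>\<^esub> E y = E (y \<oplus> x) \<otimes>\<^bsub>\<G>\<^esub> D (\<one> \<oplus> p)"
    unfolding y(2) using y(1) by (simp add: D_def E_def l_distr)
  moreover have "E (y \<oplus> x) = E y \<otimes>\<^bsub>\<G>\<^esub> E x" using y x by (simp add: E_E)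
  ultimately have "f (D (\<one> \<oplus> p) \<otimes>\<^bsub>\<G>\<^esub> E y) = f (E y \<otimes>\<^bsub>\<G>\<^esub> E x \<otimes>\<^bsub>\<G>\<^esub> D (\<one> \<oplus> p))" by simp
  hence "f (D (\<one> \<oplus> p)) * f (E y) = f (E y) * f (E x) * f (D (\<one> \<oplus> p))"
    using fm Dc y(1) I_closed[OF x] by simp
  thus ?thesis using f0[OF Dc Dc] f0[of "E y" "E y"] y(1) by simp
qed

text \<open>An isomorphism yields a biequivariant function that is nonzero at \<open>w\<close> or at some \<open>L c\<close>. As \<open>w\<close>
  swaps the diagonal entries, the former makes the characters inverse to each other. The latter is
  compatible with a character that is nontrivial on \<open>1 + I (r - 1)\<close> only if \<open>c\<close> is killed by the
  maximal ideal; then diagonal matrices with entries in \<open>1 + (p)\<close> commute with \<open>L c\<close>, which makes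
  the characters agree.\<close>

lemma principal_series_twist:
  assumes r: "r \<ge> 2" and T: "transversal \<G> borel N x"
    and \<theta>: "is_char (units_of R) \<theta>" and \<theta>': "is_char (units_of R) \<theta>'" and f: "is_char \<G> f"
    and z: "z \<in> I (r - 1)" "\<theta> (\<one> \<oplus> z) \<noteq> 1"
    and iso: "rep_iso \<G> N (transversal.induced \<G> borel N x (borel_char \<theta>))
      (twist f (transversal.induced \<G> borel N x (borel_char \<theta>')))"
  shows "(\<forall>t\<in>U 1. \<theta>' t = \<theta> t) \<or> (\<forall>t\<in>U 1. \<theta>' t * \<theta> t = 1)"
proof -
  interpret GG: group \<G> by (rule group_GL2)
  interpret T: transversal \<G> borel N x by (rule T)
  have Bc: "T.B_char (borel_char \<theta>)" "T.B_char (borel_char \<theta>')"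
    unfolding T.B_char_def by (intro borel_char_is_char \<theta> \<theta>')+
  have r1: "r \<ge> 1" using r by simp
  have one: "f \<one>\<^bsub>\<G>\<^esub> * borel_char \<theta>' \<one>\<^bsub>\<G>\<^esub> = 1" "borel_char \<theta> \<one>\<^bsub>\<G>\<^esub> = 1"
    using is_char_one[OF group_GL2 f] borel_char_one \<theta> \<theta>' by auto
  obtain F g where F: "\<And>b g b'. b \<in> borel \<Longrightarrow> g \<in> carrier \<G> \<Longrightarrow> b' \<in> borel \<Longrightarrow>
      F (b \<otimes>\<^bsub>\<G>\<^esub> g \<otimes>\<^bsub>\<G>\<^esub> b') = f b * borel_char \<theta>' b * F g * borel_char \<theta> b'"
    and g: "g \<in> carrier \<G>" "F g \<noteq> (0::complex)"
    using T.induced_iso_twist[OF Bc f iso] by blast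
  have F': "\<forall>b\<in>borel. \<forall>g\<in>carrier \<G>. \<forall>b'\<in>borel. F (b \<otimes>\<^bsub>\<G>\<^esub> g \<otimes>\<^bsub>\<G>\<^esub> b') =
      (\<lambda>b. f b * borel_char \<theta>' b) b * F g * borel_char \<theta> b'"
    using F by blast
  note comm = equivariant_comm[OF F' one]
  have fm: "f (g \<otimes>\<^bsub>\<G>\<^esub> h) = f g * f h" and f0: "f g \<noteq> 0" if "g \<in> carrier \<G>" "h \<in> carrier \<G>" for g h
    using f that by (auto simp: is_char_def)
  define D' :: "'a \<Rightarrow> 'a mat2" where "D' t = (\<one>, \<zero>, \<zero>, t)" for t
  have D'c: "D' t \<in> carrier \<G>" if "t \<in> Units R" for t
    using that by (simp add: D'_def GL2_mem_iff minus_eq Units_closed)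
  have fD': "f (D' t) = f (D t)" if t: "t \<in> Units R" for t
  proof -
    have "w \<otimes>\<^bsub>\<G>\<^esub> D t = D' t \<otimes>\<^bsub>\<G>\<^esub> w" using t by (simp add: w_def D_def D'_def Units_closed)
    hence "f (w \<otimes>\<^bsub>\<G>\<^esub> D t) = f (D' t \<otimes>\<^bsub>\<G>\<^esub> w)" by simp
    hence "f w * f (D t) = f (D' t) * f w"
      unfolding fm[OF w_closed D_closed[OF t]] fm[OF D'c[OF t] w_closed] .
    thus ?thesis using f0[OF w_closed w_closed] by auto
  qed
  have U1: "t \<in> Units R" if "t \<in> U 1" for t using U_Units[OF r1, of 1] that by auto
  from biequivariant_support[OF r1 F' one(2) g]
  consider "F w \<noteq> 0" | c where "c \<in> I 1" "F (L c) \<noteq> 0" by blast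
  thus ?thesis
  proof cases
    case 1
    have "\<theta>' t * \<theta> t = 1" if "t \<in> U 1" for t
    proof -
      note tu = U1[OF that]
      have "f (D t) * borel_char \<theta>' (D t) = borel_char \<theta> (D' t)"
        by (rule comm[OF w_closed 1]) (use tu in \<open>auto simp: w_def D_def D'_def Units_closed\<close>)
      moreover have "f (D' t) * borel_char \<theta>' (D' t) = borel_char \<theta> (D t)"
        by (rule comm[OF w_closed 1]) (use tu in \<open>auto simp: w_def D_def D'_def Units_closed\<close>)
      ultimately show ?thesis
        using fD'[OF tu] char_units_one[OF \<theta>] char_units_one[OF \<theta>'] by (simp add: borel_char_def D_def D'_def mult.commute)
    qed
    thus ?thesis by blast
  next
    case 2
    note cc = I_closed[OF 2(1)] and Lc = L_closed[OF I_closed[OF 2(1)]]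
    \<comment> \<open>diagonal matrices that act trivially on \<open>c\<close> commute with \<open>L c\<close>\<close>
    have diag: "\<theta>' t = \<theta> t \<and> f (D t) = 1" if t: "t \<in> Units R" "t \<otimes> c = c" for t
    proof -
      have "f (D t) * borel_char \<theta>' (D t) = borel_char \<theta> (D t)"
        unfolding D_def
        by (rule comm[OF Lc 2(2) _ _ diag_L_comm[OF _ _ cc]]) (use t cc in \<open>auto simp: Units_closed\<close>)
      moreover have "f (D' t) * borel_char \<theta>' (D' t) = borel_char \<theta> (D' t)"
        unfolding D'_def
        by (rule comm[OF Lc 2(2) _ _ diag_L_comm[OF _ _ cc]]) (use t cc in \<open>auto simp: Units_closed\<close>)
      ultimately show ?thesis
        using fD'[OF t(1)] char_units_one[OF \<theta>] char_units_one[OF \<theta>'] by (simp add: borel_char_def D_def D'_def)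
    qed
    have kill: "(\<one> \<oplus> a) \<otimes> c = c" if "a \<in> I k" "c \<in> I l" "k + l \<ge> r" for a k l
      using I_mult_zero[OF that] I_closed[OF that(1)] cc by (simp add: l_distr)
    show ?thesis
    proof (cases "c \<in> I (r - 1)")
      case True
      have "\<theta>' t = \<theta> t" if tU: "t \<in> U 1" for t
      proof -
        obtain a where a: "a \<in> I 1" "t = \<one> \<oplus> a" using tU unfolding U_def by blast
        show ?thesis using diag[OF U1[OF tU]] kill[OF a(1) True] a(2) by simp
      qed
      thus ?thesis by blast
    next
      case False
      obtain u k where uk: "u \<in> Units R" "k \<le> r" "c = u \<otimes> p [^] k" by (rule unit_powerE[OF cc])
      have k: "k < r - 1"
      proof (rule ccontr)
        assume "\<not> k < r - 1"
        hence "p [^] k \<in> I (r - 1)" using p_pow_mem[of k] I_antimono[of "r - 1" k] by auto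
        thus False using False uk I_mult(2) by (simp add: Units_closed)
      qed
      obtain y where y: "y \<in> carrier R" "z = p [^] (r - 1) \<otimes> y" using z(1) unfolding I_def by blast
      \<comment> \<open>chosen so that \<open>s c = - z\<close>; as \<open>s\<close> is in the maximal ideal, \<open>f\<close> is trivial at \<open>E s\<close>\<close>
      define s where "s = \<ominus> (inv u \<otimes> (p [^] (r - 1 - k) \<otimes> y))"
      have "p [^] (r - 1 - k) \<otimes> y \<in> I (r - 1 - k)" by (rule I_I[OF y(1)])
      moreover have "1 \<le> r - 1 - k" using k by linarith
      ultimately have "p [^] (r - 1 - k) \<otimes> y \<in> I 1" using I_antimono by blast
      from I_uminus[OF I_mult(2)[OF this Units_inv_closed[OF uk(1)]]] have sI: "s \<in> I 1" by (simp only: s_def)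
      note sc = I_closed[OF sI]
      have "r - 1 = (r - 1 - k) + k" using k by simp
      hence pp: "p [^] (r - 1) = p [^] (r - 1 - k) \<otimes> p [^] k" by (metis nat_pow_mult p_closed)
      have uc: "u \<in> carrier R" "inv u \<in> carrier R" using uk by auto
      have rearr: "\<ominus> (i \<otimes> (a \<otimes> y)) \<otimes> (v \<otimes> b) = \<ominus> ((i \<otimes> v) \<otimes> (a \<otimes> b \<otimes> y))"
        if "i \<in> carrier R" "a \<in> carrier R" "y \<in> carrier R" "v \<in> carrier R" "b \<in> carrier R" for i a y v b
        using that by algebra
      have "s \<otimes> c = \<ominus> ((inv u \<otimes> u) \<otimes> (p [^] (r - 1 - k) \<otimes> p [^] k \<otimes> y))"
        unfolding s_def uk(3) using uc y(1) by (intro rearr) auto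
      also have "\<dots> = \<ominus> z" using uk(1) y pp by simp
      finally have scz: "s \<otimes> c = \<ominus> z" .
      have zc: "z \<in> carrier R" using z by simp
      have e: "\<one> \<ominus> s \<otimes> c = \<one> \<oplus> z" unfolding scz using zc by (simp add: minus_eq)
      have zu: "\<one> \<oplus> z \<in> Units R" by (rule socle_U[OF r z(1)])
      have "f (\<one> \<ominus> s \<otimes> c, s, \<zero>, \<one>) * borel_char \<theta>' (\<one> \<ominus> s \<otimes> c, s, \<zero>, \<one>) = borel_char \<theta> (\<one>, s, \<zero>, \<one> \<ominus> s \<otimes> c)"
        by (rule comm[OF Lc 2(2) _ _ borel_L_comm[OF sc cc]]) (use zu sc in \<open>auto simp: e\<close>)
      hence h1: "f (\<one> \<oplus> z, s, \<zero>, \<one>) * \<theta>' (\<one> \<oplus> z) = 1"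
        using char_units_one[OF \<theta>] by (simp add: borel_char_def e)
      have "(\<one> \<oplus> z, s, \<zero>, \<one>) = E s \<otimes>\<^bsub>\<G>\<^esub> D (\<one> \<oplus> z)" using sc zc by (simp add: E_def D_def)
      hence h2: "f (\<one> \<oplus> z, s, \<zero>, \<one>) = f (D (\<one> \<oplus> z))"
        using fm[OF E_closed[OF sc] D_closed[OF zu]] char_E_trivial[OF r1 f sI] by simp
      have "\<theta>' (\<one> \<oplus> z) = \<theta> (\<one> \<oplus> z) \<and> f (D (\<one> \<oplus> z)) = 1"
        using diag[OF zu] kill[OF z(1) 2(1)] r by simp
      hence False using h1 h2 z(2) by simp
      thus ?thesis ..
    qed
  qed
qed

text \<open>The set \<open>Q\<close> consists of characters of the units that agree with a fixed nontrivial
  character on \<open>1 + I (r - 1)\<close> and differ on \<open>1 + (p)\<close>. The former makes the induced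
  representations irreducible; by the latter, the twist class of \<open>s\<close> contains besides \<open>s\<close> at
  most one character, which is inverse to \<open>s\<close> on \<open>1 + (p)\<close>.\<close>

lemma principal_series_family:
  assumes r: "r \<ge> 2"
  obtains N Q \<rho> where "N > 0" "N \<le> 2 * q ^ r" "finite Q" "q ^ (r - 2) \<le> card Q"
    "\<And>s::'a \<Rightarrow> complex. s \<in> Q \<Longrightarrow> irr_rep \<G> N (\<rho> s)"
    "\<And>s. s \<in> Q \<Longrightarrow> card {s' \<in> Q. \<exists>f. is_char \<G> f \<and> rep_iso \<G> N (\<rho> s) (twist f (\<rho> s'))} \<le> 2"
proof -
  interpret A: comm_group "units_of R" by (rule units_group)
  have r1: "r \<ge> 1" "r - 1 \<ge> 1" using r by auto
  have fin: "finite (carrier (units_of R))" by (simp add: units_of_simps finite_Units)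
  have triv: "subgroup {\<one>} (units_of R)" using A.triv_subgroup by (simp add: units_of_simps)
  have sU: "subgroup (U (r - 1)) (units_of R)" "subgroup (U 1) (units_of R)" using r1 by (auto intro!: subgroup_U)
  have "{\<one>} \<subseteq> U (r - 1)" using subgroup.one_closed[OF sU(1)] by (simp add: units_of_simps)
  from A.characters_distinct_on_subgroup[OF fin sU(1) triv this, of "\<lambda>_. 1"]
  obtain F0 where F0: "finite F0" "\<And>f. f \<in> F0 \<Longrightarrow> is_char (units_of R) f"
    "\<And>f f'. f \<in> F0 \<Longrightarrow> f' \<in> F0 \<Longrightarrow> (\<forall>h\<in>U (r - 1). f h = f' h) \<Longrightarrow> f = f'" "card (U (r - 1)) \<le> card F0"
    by force
  have "card (U (r - 1)) = q" using r card_U[of "r - 1"] by simp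
  hence "card F0 \<ge> 2" using F0(4) q_ge by simp
  then obtain f1 f2 where f12: "f1 \<in> F0" "f2 \<in> F0" "f1 \<noteq> f2"
    by (metis card_2_iff' card_le_Suc0_iff_eq F0(1) not_less_eq_eq numeral_2_eq_2)
  \<comment> \<open>two characters that differ on \<open>1 + I (r - 1)\<close> cannot both be trivial there\<close>
  have "\<exists>\<phi>\<in>F0. \<exists>t\<in>U (r - 1). \<phi> t \<noteq> 1"
  proof (rule ccontr)
    assume "\<not> ?thesis"
    hence "\<forall>h\<in>U (r - 1). f1 h = f2 h" using f12(1,2) by metis
    thus False using F0(3)[OF f12(1,2)] f12(3) by simp
  qed
  then obtain \<phi> t where \<phi>: "\<phi> \<in> F0" "t \<in> U (r - 1)" "\<phi> t \<noteq> 1" by blast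
  have Us: "U (r - 1) \<subseteq> Units R" "U 1 \<subseteq> Units R" using U_Units[OF r1] U_Units[OF r1(1), of 1] by simp_all
  have \<phi>c: "\<phi> h \<noteq> 0" "\<phi> (h \<otimes>\<^bsub>units_of R\<^esub> h') = \<phi> h * \<phi> h'" if "h \<in> U (r - 1)" "h' \<in> U (r - 1)" for h h'
    using F0(2)[OF \<phi>(1)] subsetD[OF Us(1) that(1)] subsetD[OF Us(1) that(2)]
    by (simp_all add: is_char_def units_of_simps)
  have sub: "U (r - 1) \<subseteq> U 1" by (rule U_antimono[OF r1(2)])
  obtain Q where Q': "finite Q" "\<forall>f\<in>Q. is_char (units_of R) f \<and> (\<forall>h\<in>U (r - 1). f h = \<phi> h)"
    "\<forall>f\<in>Q. \<forall>f'\<in>Q. (\<forall>h\<in>U 1. f h = f' h) \<longrightarrow> f = f'" "card (U 1) \<le> card (U (r - 1)) * card Q"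
  proof -
    have "\<exists>Q. finite Q \<and> (\<forall>f\<in>Q. is_char (units_of R) f \<and> (\<forall>h\<in>U (r - 1). f h = \<phi> h)) \<and>
      (\<forall>f\<in>Q. \<forall>f'\<in>Q. (\<forall>h\<in>U 1. f h = f' h) \<longrightarrow> f = f') \<and> card (U 1) \<le> card (U (r - 1)) * card Q"
      by (rule A.characters_distinct_on_subgroup[OF fin sU(2,1) sub]) (fact \<phi>c(1)[OF _ \<phi>(2)] \<phi>c(2))+
    thus ?thesis using that by blast
  qed
  note Q = Q'(1) Q'(2)[rule_format] Q'(3)[rule_format] Q'(4)
  obtain z where z: "z \<in> I (r - 1)" "t = \<one> \<oplus> z" using \<phi>(2) unfolding U_def by blast
  have prim: "s (\<one> \<oplus> z) \<noteq> 1" if "s \<in> Q" for s using Q(2)[OF that] \<phi>(2,3) z(2) by simp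
  obtain N x where T: "transversal \<G> borel N x" and N: "N \<le> 2 * q ^ r" by (rule borel_transversal[OF r1(1)])
  interpret T: transversal \<G> borel N x by (rule T)
  define \<rho> where "\<rho> s = T.induced (borel_char s)" for s
  show ?thesis
  proof (rule that[of N Q \<rho>])
    show "N > 0" by (rule T.N_pos)
    show "N \<le> 2 * q ^ r" by (rule N)
    show "finite Q" by (rule Q(1))
    have "q ^ (r - 1) \<le> q * card Q" using Q(4) r1 r card_U[of 1] card_U[of "r - 1"] by simp
    moreover have "q ^ (r - 1) = q * q ^ (r - 2)" using r by (metis Suc_1 Suc_diff_le diff_Suc_Suc power_Suc)
    ultimately show "q ^ (r - 2) \<le> card Q" using q_ge by simp
    fix s assume s: "s \<in> Q"
    show "irr_rep \<G> N (\<rho> s)" unfolding \<rho>_def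
      by (rule principal_series_irreducible[OF r T conjunct1[OF Q(2)[OF s]] z(1) prim[OF s]])
    let ?S = "{s' \<in> Q. \<exists>f. is_char \<G> f \<and> rep_iso \<G> N (\<rho> s) (twist f (\<rho> s'))}"
    have key: "s' = s \<or> (\<forall>t\<in>U 1. s' t * s t = 1)" if s'S: "s' \<in> ?S" for s'
    proof -
      obtain f where f: "is_char \<G> f" "rep_iso \<G> N (\<rho> s) (twist f (\<rho> s'))" and s': "s' \<in> Q" using s'S by blast
      have "(\<forall>t\<in>U 1. s' t = s t) \<or> (\<forall>t\<in>U 1. s' t * s t = 1)"
        by (rule principal_series_twist[OF r T conjunct1[OF Q(2)[OF s]] conjunct1[OF Q(2)[OF s']] f(1) z(1)
            prim[OF s] f(2)[unfolded \<rho>_def]])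
      thus ?thesis using Q(3)[OF s' s] by metis
    qed
    have uniq: "a = b" if "a \<in> ?S - {s}" "b \<in> ?S - {s}" for a b
    proof (rule Q(3))
      show "a \<in> Q" "b \<in> Q" using that by auto
      fix t assume t: "t \<in> U 1"
      have "a t * s t = 1" "b t * s t = 1" using key[of a] key[of b] that t by blast+
      thus "a t = b t" by (metis mult_cancel_right zero_neq_one mult_zero_right)
    qed
    have fS: "finite (?S - {s})" using Q(1) by simp
    have "card (?S - {s}) \<le> Suc 0" using card_le_Suc0_iff_eq[OF fS] uniq by blast
    moreover have "card ?S \<le> card (insert s (?S - {s}))" by (rule card_mono) (use fS in auto)
    moreover have "card (insert s (?S - {s})) \<le> Suc (card (?S - {s}))" 
      by (subst card.insert[OF fS]) simp_all
    ultimately show "card ?S \<le> 2" by simp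
  qed
qed

end

section \<open>Inflation of representations\<close>

text \<open>Composition with \<open>\<pi>\<close> identifies the representations of \<open>H\<close> with those representations of
  \<open>G\<close> that are trivial on the kernel of \<open>\<pi>\<close>.\<close>

locale group_surjection = G: group G + H: group H for G (structure) and H (structure) +
  fixes \<pi> :: "'a \<Rightarrow> 'c"
  assumes hom: "\<pi> \<in> hom G H" and surj: "\<pi> ` carrier G = carrier H"
begin

lemma closed: "g \<in> carrier G \<Longrightarrow> \<pi> g \<in> carrier H" using surj by blast

lemma mult: "g \<in> carrier G \<Longrightarrow> h \<in> carrier G \<Longrightarrow> \<pi> (g \<otimes>\<^bsub>G\<^esub> h) = \<pi> g \<otimes>\<^bsub>H\<^esub> \<pi> h"
  using hom by (simp add: hom_def)

lemma one: "\<pi> \<one>\<^bsub>G\<^esub> = \<one>\<^bsub>H\<^esub>" by (rule hom_one[OF hom G.is_group H.is_group])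

lemma all_image_iff: "(\<forall>h\<in>carrier H. Q h) \<longleftrightarrow> (\<forall>g\<in>carrier G. Q (\<pi> g))"
  using surj by (metis (no_types, lifting) closed image_iff)

lemma rep_iso_inflate: "rep_iso G n (\<lambda>g. \<rho> (\<pi> g)) (\<lambda>g. \<sigma> (\<pi> g)) \<longleftrightarrow> rep_iso H n \<rho> \<sigma>"
  unfolding rep_iso_def using all_image_iff by simp

lemma rep_inflate: "(\<lambda>g. \<rho> (\<pi> g)) \<in> hom G (GL_complex n) \<longleftrightarrow> \<rho> \<in> hom H (GL_complex n)"
proof -
  have "(\<forall>h\<in>carrier H. \<forall>h'\<in>carrier H. \<rho> (h \<otimes>\<^bsub>H\<^esub> h') = \<rho> h * \<rho> h') \<longleftrightarrow>
      (\<forall>g\<in>carrier G. \<forall>g'\<in>carrier G. \<rho> (\<pi> (g \<otimes>\<^bsub>G\<^esub> g')) = \<rho> (\<pi> g) * \<rho> (\<pi> g'))"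
    unfolding all_image_iff by (simp add: mult)
  thus ?thesis unfolding G.rep_iff H.rep_iff using all_image_iff[of "\<lambda>h. \<rho> h \<in> carrier_mat n n"] by (simp add: one)
qed

lemma irr_rep_inflate: "irr_rep G n (\<lambda>g. \<rho> (\<pi> g)) \<longleftrightarrow> irr_rep H n \<rho>"
  unfolding irr_rep_def rep_inflate all_image_iff by simp

lemma is_char_inflate: "is_char G (\<lambda>g. f (\<pi> g)) \<longleftrightarrow> is_char H f"
  unfolding is_char_def all_image_iff by (simp add: mult)

lemma same_image_iff:
  assumes "g \<in> carrier G" "g' \<in> carrier G" "\<pi> g = \<pi> g'"
  shows "\<pi> (inv\<^bsub>G\<^esub> g' \<otimes>\<^bsub>G\<^esub> g) = \<one>\<^bsub>H\<^esub>"
proof -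
  have "\<pi> (inv\<^bsub>G\<^esub> g' \<otimes>\<^bsub>G\<^esub> g) = \<pi> (inv\<^bsub>G\<^esub> g' \<otimes>\<^bsub>G\<^esub> g')" using assms by (simp only: mult G.inv_closed)
  thus ?thesis using assms(2) by (simp add: one)
qed

lemma deflate:
  assumes "\<And>g g'. g \<in> carrier G \<Longrightarrow> g' \<in> carrier G \<Longrightarrow> \<pi> g = \<pi> g' \<Longrightarrow> F g = F g'"
  obtains F' where "\<And>g. g \<in> carrier G \<Longrightarrow> F' (\<pi> g) = F g"
proof -
  define F' where "F' h = F (SOME g. g \<in> carrier G \<and> \<pi> g = h)" for h
  have "F' (\<pi> g) = F g" if g: "g \<in> carrier G" for g
  proof -
    have "(SOME g'. g' \<in> carrier G \<and> \<pi> g' = \<pi> g) \<in> carrier G \<and> \<pi> (SOME g'. g' \<in> carrier G \<and> \<pi> g' = \<pi> g) = \<pi> g"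
      by (rule someI[of "\<lambda>g'. g' \<in> carrier G \<and> \<pi> g' = \<pi> g" g]) (use g in simp)
    thus ?thesis unfolding F'_def using assms g by blast
  qed
  thus ?thesis using that by blast
qed

lemma irr_rep_cong: "(\<And>g. g \<in> carrier G \<Longrightarrow> \<rho> g = \<sigma> g) \<Longrightarrow> irr_rep G n \<rho> \<longleftrightarrow> irr_rep G n \<sigma>"
  unfolding irr_rep_def G.rep_iff by (auto cong: ball_cong)

lemma irr_rep_deflate:
  assumes irr: "irr_rep G n \<rho>" and ker: "\<And>g. g \<in> carrier G \<Longrightarrow> \<pi> g = \<one>\<^bsub>H\<^esub> \<Longrightarrow> \<rho> g = 1\<^sub>m n"
  obtains \<rho>' where "irr_rep H n \<rho>'" "\<And>g. g \<in> carrier G \<Longrightarrow> \<rho>' (\<pi> g) = \<rho> g"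
proof -
  note \<rho> = irr_repD(1)[OF irr]
  obtain \<rho>' where \<rho>': "\<And>g. g \<in> carrier G \<Longrightarrow> \<rho>' (\<pi> g) = \<rho> g"
  proof (rule deflate[of \<rho>])
    fix g g' assume g: "g \<in> carrier G" "g' \<in> carrier G" "\<pi> g = \<pi> g'"
    have "g = g' \<otimes>\<^bsub>G\<^esub> (inv\<^bsub>G\<^esub> g' \<otimes>\<^bsub>G\<^esub> g)" using g by (simp add: G.m_assoc[symmetric])
    hence "\<rho> g = \<rho> g' * \<rho> (inv\<^bsub>G\<^esub> g' \<otimes>\<^bsub>G\<^esub> g)" using G.rep_mult[OF \<rho> g(2)] g by (metis G.inv_closed G.m_closed)
    also have "\<rho> (inv\<^bsub>G\<^esub> g' \<otimes>\<^bsub>G\<^esub> g) = 1\<^sub>m n" by (rule ker) (use g same_image_iff in auto)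
    finally show "\<rho> g = \<rho> g'" using G.rep_carrier[OF \<rho> g(2)] by (simp add: right_mult_one_mat[of _ n n])
  qed blast
  have "irr_rep G n (\<lambda>g. \<rho>' (\<pi> g))" using irr irr_rep_cong[of "\<lambda>g. \<rho>' (\<pi> g)" \<rho>] \<rho>' by simp
  thus ?thesis using that \<rho>' irr_rep_inflate by blast
qed

lemma is_char_deflate:
  assumes f: "is_char G f" and ker: "\<And>g. g \<in> carrier G \<Longrightarrow> \<pi> g = \<one>\<^bsub>H\<^esub> \<Longrightarrow> f g = 1"
  obtains f' where "is_char H f'" "\<And>g. g \<in> carrier G \<Longrightarrow> f' (\<pi> g) = f g"
proof -
  obtain f' where f': "\<And>g. g \<in> carrier G \<Longrightarrow> f' (\<pi> g) = f g"
  proof (rule deflate[of f])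
    fix g g' assume g: "g \<in> carrier G" "g' \<in> carrier G" "\<pi> g = \<pi> g'"
    have "g = g' \<otimes>\<^bsub>G\<^esub> (inv\<^bsub>G\<^esub> g' \<otimes>\<^bsub>G\<^esub> g)" using g by (simp add: G.m_assoc[symmetric])
    hence "f g = f g' * f (inv\<^bsub>G\<^esub> g' \<otimes>\<^bsub>G\<^esub> g)" using f g unfolding is_char_def by (metis G.inv_closed G.m_closed)
    thus "f g = f g'" using ker[OF _ same_image_iff[OF g]] g by simp
  qed blast
  have "is_char G (\<lambda>g. f' (\<pi> g))" by (rule is_char_cong[OF f G.is_group]) (simp add: f')
  thus ?thesis using that f' is_char_inflate by blast
qed

end


section \<open>Quotients of a discrete valuation ring\<close>

lemma card_image_eq_of_same_fibres:
  assumes "\<And>x y. x \<in> A \<Longrightarrow> y \<in> A \<Longrightarrow> f x = f y \<longleftrightarrow> g x = g y"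
  shows "card (f ` A) = card (g ` A)"
proof (rule bij_betw_same_card)
  define h where "h z = g (inv_into A f z)" for z
  have h: "h (f x) = g x" if "x \<in> A" for x
    using assms[of "inv_into A f (f x)" x] that by (auto simp: h_def inv_into_into f_inv_into_f)
  show "bij_betw h (f ` A) (g ` A)"
    unfolding bij_betw_def using h assms by (auto simp: inj_on_def image_iff)
qed

locale dvr_ring = principal_domain R for R (structure) +
  fixes P :: "'a set" and \<omega> :: 'a and q :: nat
  assumes maximal_iff: "\<And>M. maximalideal M R \<longleftrightarrow> M = P"
    and unif_closed [simp]: "\<omega> \<in> carrier R" and P_eq: "P = PIdl \<omega>" and unif_nonzero: "\<omega> \<noteq> \<zero>"
    and finite_residue: "finite (carrier (R Quot P))" and card_residue: "card (carrier (R Quot P)) = q"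
begin

definition J :: "nat \<Rightarrow> 'a set" where "J n = PIdl (\<omega> [^] n)"

abbreviation S :: "nat \<Rightarrow> 'a set ring" where "S n \<equiv> R Quot (J n)"

definition c :: "nat \<Rightarrow> 'a \<Rightarrow> 'a set" where "c n x = J n +> x"

lemma ideal_J: "ideal (J n) R" unfolding J_def by (rule cgenideal_ideal) simp

lemma J_iff: "x \<in> J n \<longleftrightarrow> (\<exists>y\<in>carrier R. x = \<omega> [^] n \<otimes> y)"
  unfolding J_def cgenideal_def using m_comm[of _ "\<omega> [^] n"] by auto (metis nat_pow_closed unif_closed)

lemma J_closed: "x \<in> J n \<Longrightarrow> x \<in> carrier R" by (auto simp: J_iff)

lemma J_I: "y \<in> carrier R \<Longrightarrow> \<omega> [^] n \<otimes> y \<in> J n" by (auto simp: J_iff)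

lemma J_1: "J 1 = P" by (simp add: J_def P_eq)

lemma J_0: "J 0 = carrier R" by (auto simp: J_iff)

lemma J_antimono: "m \<le> n \<Longrightarrow> J n \<subseteq> J m"
proof
  fix x assume mn: "m \<le> n" and "x \<in> J n"
  then obtain y where y: "y \<in> carrier R" "x = \<omega> [^] n \<otimes> y" by (auto simp: J_iff)
  have "\<omega> [^] n = \<omega> [^] m \<otimes> \<omega> [^] (n - m)" using mn by (simp add: nat_pow_mult)
  hence "x = \<omega> [^] m \<otimes> (\<omega> [^] (n - m) \<otimes> y)" using y by (simp add: m_assoc)
  thus "x \<in> J m" using y by (auto simp: J_iff)
qed

lemma ideal_pow_eq: "ideal_pow R P n = J n"
proof (induction n)
  case 0 show ?case by (simp add: J_0 nat_pow_def ideals_set_def)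
next
  case (Suc n)
  have "ideal_pow R P (Suc n) = ideal_prod R (J n) P"
    using Suc by (simp add: nat_pow_def ideals_set_def)
  also have "\<dots> = J (Suc n)"
  proof
    show "ideal_prod R (J n) P \<subseteq> J (Suc n)"
    proof
      fix x assume "x \<in> ideal_prod R (J n) P"
      thus "x \<in> J (Suc n)"
      proof (induction rule: ideal_prod.induct)
        case (prod i j)
        then obtain a b where ab: "a \<in> carrier R" "b \<in> carrier R" "i = \<omega> [^] n \<otimes> a" "j = \<omega> [^] (1::nat) \<otimes> b"
          by (auto simp: J_iff simp flip: J_1)
        have "i \<otimes> j = \<omega> [^] Suc n \<otimes> (a \<otimes> b)" using ab by (simp add: m_ac)
        thus ?case using J_I[of "a \<otimes> b" "Suc n"] ab(1,2) by simp
      next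
        case (sum a b)
        thus ?case using additive_subgroup.a_closed[OF ideal.axioms(1)[OF ideal_J]] by blast
      qed
    qed
    show "J (Suc n) \<subseteq> ideal_prod R (J n) P"
    proof
      fix x assume "x \<in> J (Suc n)"
      then obtain y where y: "y \<in> carrier R" "x = \<omega> [^] Suc n \<otimes> y" by (auto simp: J_iff)
      have "x = (\<omega> [^] n \<otimes> \<one>) \<otimes> (\<omega> [^] (1::nat) \<otimes> y)" using y by (simp add: m_assoc)
      moreover have "\<omega> [^] (1::nat) \<otimes> y \<in> P" using J_I[OF y(1), of 1] unfolding J_1 .
      ultimately show "x \<in> ideal_prod R (J n) P" using J_I[OF one_closed, of n] by (simp only: ideal_prod.prod)
    qed
  qed
  finally show ?case .
qed

lemma P_maximal: "maximalideal P R" using maximal_iff by simp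

lemma one_notin_P: "\<one> \<notin> P"
proof
  assume 1: "\<one> \<in> P"
  interpret M: maximalideal P R by (rule P_maximal)
  have "P = carrier R" using 1 M.one_imp_carrier by blast
  thus False using M.I_notcarr by simp
qed

text \<open>Every irreducible element generates a maximal ideal, so it is associated to \<open>\<omega>\<close>.\<close>

lemma irreducible_assoc:
  assumes "a \<in> carrier R" "ring_irreducible a"
  shows "\<exists>u\<in>Units R. a = u \<otimes> \<omega>"
proof -
  have "PIdl a = P" using irreducible_imp_maximalideal[OF assms] maximal_iff by blast
  hence "a \<sim> \<omega>" using associated_iff_same_ideal[OF assms(1) unif_closed] P_eq by simp
  thus ?thesis using ring_associated_iff[OF assms(1) unif_closed] by simp
qed

lemma not_P_unit:
  assumes "x \<in> carrier R" "x \<notin> P"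
  shows "x \<in> Units R"
proof (rule ccontr)
  assume nu: "x \<notin> Units R"
  interpret M: ideal P R by (rule maximalideal.axioms(1)[OF P_maximal])
  have "x \<noteq> \<zero>" using assms(2) M.zero_closed by auto
  then obtain b where b: "b \<in> carrier R" "ring_irreducible b" "b divides x"
    using exists_irreducible_divisor[of x] assms(1) nu by blast
  obtain u where u: "u \<in> Units R" "b = u \<otimes> \<omega>" using irreducible_assoc[OF b(1,2)] by blast
  obtain y where y: "y \<in> carrier R" "x = b \<otimes> y" using b(3) by (auto simp: factor_def)
  have "x = \<omega> [^] (1::nat) \<otimes> (u \<otimes> y)" using u y by (simp add: m_ac Units_closed)
  hence "x \<in> P" using J_I[of "u \<otimes> y" 1] u y by (simp add: J_1[simplified] Units_closed)
  thus False using assms(2) by simp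
qed

text \<open>All irreducible factors of \<open>x\<close> are associated to \<open>\<omega>\<close>.\<close>

lemma unit_power_form:
  assumes "x \<in> carrier R" "x \<noteq> \<zero>"
  obtains u k where "u \<in> Units R" "x = u \<otimes> \<omega> [^] (k::nat)"
proof (cases "x \<in> Units R")
  case True
  thus ?thesis using that[of x 0] by (simp add: Units_closed)
next
  case False
  obtain fs where fs: "set fs \<subseteq> carrier (mult_of R)" "wfactors (mult_of R) fs x"
    using factorization_property[of x] assms False by auto
  have form: "\<exists>u\<in>Units R. foldr (\<otimes>\<^bsub>mult_of R\<^esub>) fs \<one>\<^bsub>mult_of R\<^esub> = u \<otimes> \<omega> [^] length fs"
    if "set fs \<subseteq> carrier (mult_of R)" "\<forall>f\<in>set fs. irreducible (mult_of R) f" for fs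
    using that
  proof (induction fs)
    case Nil
    show ?case by (rule bexI[of _ \<one>]) auto
  next
    case (Cons a fs)
    then obtain u where u: "u \<in> Units R" "foldr (\<otimes>\<^bsub>mult_of R\<^esub>) fs \<one>\<^bsub>mult_of R\<^esub> = u \<otimes> \<omega> [^] length fs" by auto
    have a: "a \<in> carrier R" "ring_irreducible a" using Cons.prems ring_irreducibleI'[of a] by auto
    obtain v where v: "v \<in> Units R" "a = v \<otimes> \<omega>" using irreducible_assoc[OF a] by blast
    have "foldr (\<otimes>\<^bsub>mult_of R\<^esub>) (a # fs) \<one>\<^bsub>mult_of R\<^esub> = (v \<otimes> \<omega>) \<otimes> (u \<otimes> \<omega> [^] length fs)"
      using u(2) v(2) by simp
    also have "\<dots> = (v \<otimes> u) \<otimes> \<omega> [^] length (a # fs)" using u v by (simp add: m_ac Units_closed)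
    finally show ?case using u v by (intro bexI[of _ "v \<otimes> u"]) auto
  qed
  have "\<forall>f\<in>set fs. irreducible (mult_of R) f" using fs(2) by (simp add: wfactors_def)
  from form[OF fs(1) this]
  obtain u where u: "u \<in> Units R" "foldr (\<otimes>\<^bsub>mult_of R\<^esub>) fs \<one>\<^bsub>mult_of R\<^esub> = u \<otimes> \<omega> [^] length fs"
    by blast
  have "(u \<otimes> \<omega> [^] length fs) \<sim>\<^bsub>mult_of R\<^esub> x" using fs(2) u(2) by (simp add: wfactors_def)
  hence "u \<otimes> \<omega> [^] length fs \<sim> x"
    using assms u(1) assoc_iff_assoc_mult[of "u \<otimes> \<omega> [^] length fs" x] by (simp add: Units_closed)
  then obtain v where v: "v \<in> Units R" "u \<otimes> \<omega> [^] length fs = v \<otimes> x"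
    using ring_associated_iff[of "u \<otimes> \<omega> [^] length fs" x] assms u(1) by (auto simp: Units_closed)
  have "x = inv v \<otimes> (v \<otimes> x)" using v(1) assms(1) by (simp add: m_assoc[symmetric] Units_closed)
  also have "\<dots> = (inv v \<otimes> u) \<otimes> \<omega> [^] length fs" unfolding v(2)[symmetric] using v(1) u(1) by (simp add: m_assoc Units_closed)
  finally show ?thesis using that[of "inv v \<otimes> u" "length fs"] u(1) v(1) by simp
qed

lemma c_eq_iff: "x \<in> carrier R \<Longrightarrow> y \<in> carrier R \<Longrightarrow> c n x = c n y \<longleftrightarrow> x \<ominus> y \<in> J n"
  unfolding c_def by (rule quotient_eq_iff_same_a_r_cos[OF ideal_J, symmetric])

lemma carrier_S: "carrier (S n) = c n ` carrier R"
  by (auto simp: FactRing_def A_RCOSETS_def' c_def)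

lemma c_hom: "ring_hom_cring R (S n) (c n)"
  unfolding c_def by (rule ideal.rcos_ring_hom_cring[OF ideal_J cring_axioms])

lemma c_simps:
  shows c_closed: "x \<in> carrier R \<Longrightarrow> c n x \<in> carrier (S n)"
    and c_mult: "x \<in> carrier R \<Longrightarrow> y \<in> carrier R \<Longrightarrow> c n (x \<otimes> y) = c n x \<otimes>\<^bsub>S n\<^esub> c n y"
    and c_add: "x \<in> carrier R \<Longrightarrow> y \<in> carrier R \<Longrightarrow> c n (x \<oplus> y) = c n x \<oplus>\<^bsub>S n\<^esub> c n y"
    and c_minus: "x \<in> carrier R \<Longrightarrow> y \<in> carrier R \<Longrightarrow> c n (x \<ominus> y) = c n x \<ominus>\<^bsub>S n\<^esub> c n y"
    and c_one: "c n \<one> = \<one>\<^bsub>S n\<^esub>" and c_zero: "c n \<zero> = \<zero>\<^bsub>S n\<^esub>"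
    and c_pow: "x \<in> carrier R \<Longrightarrow> c n (x [^] (k::nat)) = c n x [^]\<^bsub>S n\<^esub> k"
proof -
  interpret h: ring_hom_cring R "S n" "c n" by (rule c_hom)
  show "x \<in> carrier R \<Longrightarrow> c n x \<in> carrier (S n)"
    "x \<in> carrier R \<Longrightarrow> y \<in> carrier R \<Longrightarrow> c n (x \<otimes> y) = c n x \<otimes>\<^bsub>S n\<^esub> c n y"
    "x \<in> carrier R \<Longrightarrow> y \<in> carrier R \<Longrightarrow> c n (x \<oplus> y) = c n x \<oplus>\<^bsub>S n\<^esub> c n y"
    "c n \<one> = \<one>\<^bsub>S n\<^esub>" "c n \<zero> = \<zero>\<^bsub>S n\<^esub>"
    "x \<in> carrier R \<Longrightarrow> c n (x [^] (k::nat)) = c n x [^]\<^bsub>S n\<^esub> k" by simp_all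
  show "x \<in> carrier R \<Longrightarrow> y \<in> carrier R \<Longrightarrow> c n (x \<ominus> y) = c n x \<ominus>\<^bsub>S n\<^esub> c n y"
    by (simp add: minus_eq h.S.minus_eq)
qed

lemma unif_pow_nonzero: "\<omega> [^] (n::nat) \<noteq> \<zero>"
  by (induction n) (use unif_nonzero integral_iff in auto)

lemma J_cancel: "x \<in> carrier R \<Longrightarrow> \<omega> [^] k \<otimes> x \<in> J n \<longleftrightarrow> x \<in> J (n - k)"
proof (cases "k \<le> n")
  case False
  assume "x \<in> carrier R"
  thus ?thesis using False J_I[of x k] J_antimono[of n k] by (auto simp: J_0)
next
  case True
  assume x: "x \<in> carrier R"
  have e: "\<omega> [^] n \<otimes> y = \<omega> [^] k \<otimes> (\<omega> [^] (n - k) \<otimes> y)" if "y \<in> carrier R" for y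
    using that True by (simp add: m_assoc[symmetric] nat_pow_mult)
  have canc: "\<omega> [^] k \<otimes> x = \<omega> [^] k \<otimes> z \<longleftrightarrow> x = z" if "z \<in> carrier R" for z
    using m_lcancel[OF unif_pow_nonzero _ x that] by simp
  show ?thesis unfolding J_iff using e canc by auto
qed

text \<open>An element modulo \<open>\<omega>\<^sup>n\<^sup>+\<^sup>1\<close> is a residue plus \<open>\<omega>\<close> times an element modulo \<open>\<omega>\<^sup>n\<close>.\<close>

lemma finite_card_S: "finite (carrier (S n)) \<and> card (carrier (S n)) = q ^ n"
proof (induction n)
  case 0
  have "c 0 x = c 0 \<zero>" if "x \<in> carrier R" for x
    using that by (subst c_eq_iff) (simp_all add: J_0)
  hence "c 0 ` carrier R = {c 0 \<zero>}" using zero_closed by blast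
  thus ?case by (simp add: carrier_S)
next
  case (Suc n)
  define s where "s X = (SOME x. x \<in> carrier R \<and> c 1 x = X)" for X
  define s' where "s' X = (SOME x. x \<in> carrier R \<and> c n x = X)" for X
  have s: "s X \<in> carrier R \<and> c 1 (s X) = X" if "X \<in> carrier (S 1)" for X
    unfolding s_def by (rule someI_ex) (use that carrier_S[of 1] in auto)
  have s': "s' X \<in> carrier R \<and> c n (s' X) = X" if "X \<in> carrier (S n)" for X
    unfolding s'_def by (rule someI_ex) (use that carrier_S[of n] in auto)
  define f where "f = (\<lambda>(X, Y). c (Suc n) (s X \<oplus> \<omega> \<otimes> s' Y))"
  have J1: "\<omega> \<otimes> y \<in> J 1" if "y \<in> carrier R" for y using J_I[OF that, of 1] by simp
  have sub: "ideal (J k) R" for k by (rule ideal_J)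
  have "bij_betw f (carrier (S 1) \<times> carrier (S n)) (carrier (S (Suc n)))"
    unfolding bij_betw_def
  proof
    show "inj_on f (carrier (S 1) \<times> carrier (S n))"
    proof (rule inj_onI)
      fix A B assume "A \<in> carrier (S 1) \<times> carrier (S n)" "B \<in> carrier (S 1) \<times> carrier (S n)" and eq: "f A = f B"
      then obtain X Y X' Y' where A: "A = (X, Y)" "X \<in> carrier (S 1)" "Y \<in> carrier (S n)"
        and B: "B = (X', Y')" "X' \<in> carrier (S 1)" "Y' \<in> carrier (S n)" by auto
      note m = s[OF A(2)] s[OF B(2)] s'[OF A(3)] s'[OF B(3)]
      have d: "(s X \<oplus> \<omega> \<otimes> s' Y) \<ominus> (s X' \<oplus> \<omega> \<otimes> s' Y') \<in> J (Suc n)"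
        using eq m by (simp add: f_def A(1) B(1) c_eq_iff)
      hence d1: "(s X \<oplus> \<omega> \<otimes> s' Y) \<ominus> (s X' \<oplus> \<omega> \<otimes> s' Y') \<in> J 1" using J_antimono[of 1 "Suc n"] by auto
      have "s X \<ominus> s X' = ((s X \<oplus> \<omega> \<otimes> s' Y) \<ominus> (s X' \<oplus> \<omega> \<otimes> s' Y')) \<oplus> \<omega> \<otimes> (s' Y' \<ominus> s' Y)"
        using m unif_closed by algebra
      also have "\<dots> \<in> J 1"
        using additive_subgroup.a_closed[OF ideal.axioms(1)[OF sub] d1 J1] m by simp
      finally have "c 1 (s X) = c 1 (s X')" using c_eq_iff[of "s X" "s X'" 1] m by blast
      hence X: "X = X'" using m by simp
      have "(s X \<oplus> \<omega> \<otimes> s' Y) \<ominus> (s X \<oplus> \<omega> \<otimes> s' Y') = \<omega> [^] (1::nat) \<otimes> (s' Y \<ominus> s' Y')"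
        using m unif_closed by (simp only: nat_pow_eone) algebra
      hence "s' Y \<ominus> s' Y' \<in> J n" using d X J_cancel[of "s' Y \<ominus> s' Y'" 1 "Suc n"] m by simp
      hence "c n (s' Y) = c n (s' Y')" using c_eq_iff[of "s' Y" "s' Y'" n] m by blast
      thus "A = B" using A B X m by simp
    qed
    show "f ` (carrier (S 1) \<times> carrier (S n)) = carrier (S (Suc n))"
    proof
      show "f ` (carrier (S 1) \<times> carrier (S n)) \<subseteq> carrier (S (Suc n))"
        using s s' by (auto simp: f_def intro!: c_closed)
      show "carrier (S (Suc n)) \<subseteq> f ` (carrier (S 1) \<times> carrier (S n))"
      proof
        fix Z assume "Z \<in> carrier (S (Suc n))"
        then obtain x where x: "x \<in> carrier R" "Z = c (Suc n) x" by (auto simp: carrier_S)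
        define X where "X = c 1 x"
        have X: "X \<in> carrier (S 1)" using x c_closed by (simp add: X_def)
        note sX = s[OF X]
        have "x \<ominus> s X \<in> J 1" using c_eq_iff[of x "s X" 1] x sX by (simp add: X_def)
        then obtain y where y: "y \<in> carrier R" "x \<ominus> s X = \<omega> [^] (1::nat) \<otimes> y" by (auto simp: J_iff)
        define Y where "Y = c n y"
        have Y: "Y \<in> carrier (S n)" using y c_closed by (simp add: Y_def)
        note sY = s'[OF Y]
        have "y \<ominus> s' Y \<in> J (Suc n - 1)" using c_eq_iff[of y "s' Y" n] y sY by (simp add: Y_def)
        hence "\<omega> [^] (1::nat) \<otimes> (y \<ominus> s' Y) \<in> J (Suc n)" using J_cancel[of "y \<ominus> s' Y" 1 "Suc n"] y sY by simp
        moreover have "\<omega> [^] (1::nat) \<otimes> (y \<ominus> s' Y) = x \<ominus> (s X \<oplus> \<omega> \<otimes> s' Y)"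
        proof -
          have "\<omega> [^] (1::nat) \<otimes> (y \<ominus> s' Y) = (\<omega> [^] (1::nat) \<otimes> y) \<ominus> \<omega> \<otimes> s' Y"
            using y(1) sY unif_closed by (simp only: nat_pow_eone) algebra
          also have "\<dots> = x \<ominus> (s X \<oplus> \<omega> \<otimes> s' Y)" unfolding y(2)[symmetric] using x(1) sX sY unif_closed by algebra
          finally show ?thesis .
        qed
        ultimately have "c (Suc n) x = f (X, Y)" using x sX sY by (simp add: f_def c_eq_iff)
        thus "Z \<in> f ` (carrier (S 1) \<times> carrier (S n))" using x X Y by blast
      qed
    qed
  qed
  hence "card (carrier (S (Suc n))) = card (carrier (S 1) \<times> carrier (S n))"
    and fin: "finite (carrier (S 1) \<times> carrier (S n)) \<longleftrightarrow> finite (carrier (S (Suc n)))"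
    by (rule bij_betw_same_card[symmetric], rule bij_betw_finite)
  moreover have "finite (carrier (S 1))" "card (carrier (S 1)) = q"
    using finite_residue card_residue unfolding J_1 by blast+
  moreover from this fin Suc have "finite (carrier (S (Suc n)))" by simp
  ultimately show ?case using Suc by (simp add: card_cartesian_product)
qed

lemma q_ge: "q \<ge> 2"
proof -
  have "c 1 \<zero> \<noteq> c 1 \<one>"
  proof
    assume "c 1 \<zero> = c 1 \<one>"
    hence "\<one> \<ominus> \<zero> \<in> J 1" using c_eq_iff[of \<one> \<zero> 1] by simp
    thus False using one_notin_P J_1 by (simp add: minus_eq)
  qed
  moreover have "{c 1 \<zero>, c 1 \<one>} \<subseteq> carrier (S 1)" using c_closed by simp
  ultimately have "card {c 1 \<zero>, c 1 \<one>} \<le> card (carrier (S 1))" using finite_residue J_1 by (intro card_mono) auto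
  thus ?thesis using \<open>c 1 \<zero> \<noteq> c 1 \<one>\<close> card_residue J_1 by simp
qed

lemma c_unit: "u \<in> Units R \<Longrightarrow> c n u \<in> Units (S n)"
proof -
  assume u: "u \<in> Units R"
  have "c n u \<otimes>\<^bsub>S n\<^esub> c n (inv u) = \<one>\<^bsub>S n\<^esub>" "c n (inv u) \<otimes>\<^bsub>S n\<^esub> c n u = \<one>\<^bsub>S n\<^esub>"
    using u c_mult[of u "inv u" n] c_mult[of "inv u" u n] c_one by (simp_all add: Units_closed)
  thus ?thesis unfolding Units_def using c_closed u by (auto simp: Units_closed intro!: bexI[of _ "c n (inv u)"])
qed

text \<open>The ideal generated by \<open>\<omega>\<^sup>k\<close> in the quotient has as many elements as the quotient by
  \<open>\<omega>\<^sup>n\<^sup>-\<^sup>k\<close>, because multiplication by \<open>\<omega>\<^sup>k\<close> followed by reduction modulo \<open>\<omega>\<^sup>n\<close> has the same fibres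
  as reduction modulo \<open>\<omega>\<^sup>n\<^sup>-\<^sup>k\<close>.\<close>

lemma chain_ring_S: "chain_ring (S n) (c n \<omega>) n q"
proof -
  interpret Sn: cring "S n" using c_hom by (simp add: ring_hom_cring_def)
  show ?thesis
  proof
    show "finite (carrier (S n))" using finite_card_S by blast
    show "c n \<omega> \<in> carrier (S n)" by (simp add: c_closed)
    show "2 \<le> q" by (rule q_ge)
    have big: "c n (\<omega> [^] k) = \<zero>\<^bsub>S n\<^esub>" if "n \<le> k" for k
    proof -
      have "\<omega> [^] k \<ominus> \<zero> \<in> J n" using J_I[of \<one> k] J_antimono[OF that] by (auto simp: minus_eq)
      thus ?thesis using c_eq_iff[of "\<omega> [^] k" \<zero> n] by (simp add: c_zero)
    qed
    show z: "c n \<omega> [^]\<^bsub>S n\<^esub> n = \<zero>\<^bsub>S n\<^esub>" using big[of n] by (simp add: c_pow)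
    show "\<exists>u\<in>Units (S n). \<exists>k\<le>n. X = u \<otimes>\<^bsub>S n\<^esub> c n \<omega> [^]\<^bsub>S n\<^esub> k" if X: "X \<in> carrier (S n)" for X
    proof (cases "X = \<zero>\<^bsub>S n\<^esub>")
      case True
      thus ?thesis using z by (intro bexI[of _ "\<one>\<^bsub>S n\<^esub>"] exI[of _ n]) auto
    next
      case False
      obtain x where x: "x \<in> carrier R" "X = c n x" using X by (auto simp: carrier_S)
      have "x \<noteq> \<zero>" using False x c_zero by auto
      then obtain u k where uk: "u \<in> Units R" "x = u \<otimes> \<omega> [^] (k::nat)" by (rule unit_power_form[OF x(1)])
      have Xe: "X = c n u \<otimes>\<^bsub>S n\<^esub> c n \<omega> [^]\<^bsub>S n\<^esub> k" using x uk by (simp add: c_mult c_pow Units_closed)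
      have "k \<le> n"
      proof (rule ccontr)
        assume "\<not> k \<le> n"
        hence "X = \<zero>\<^bsub>S n\<^esub>" using Xe big[of k] c_closed[of u n] uk(1) by (simp add: c_pow Units_closed)
        thus False using False by simp
      qed
      thus ?thesis using Xe c_unit[OF uk(1)] by blast
    qed
    show "card ((\<otimes>\<^bsub>S n\<^esub>) (c n \<omega> [^]\<^bsub>S n\<^esub> k) ` carrier (S n)) = q ^ (n - k)" if "k \<le> n" for k
    proof -
      have "(\<otimes>\<^bsub>S n\<^esub>) (c n \<omega> [^]\<^bsub>S n\<^esub> k) ` carrier (S n) = (\<lambda>x. c n (\<omega> [^] k \<otimes> x)) ` carrier R"
        by (simp add: carrier_S image_image c_mult c_pow)
      also have "card \<dots> = card (c (n - k) ` carrier R)"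
      proof (rule card_image_eq_of_same_fibres)
        fix x y assume xy: "x \<in> carrier R" "y \<in> carrier R"
        have "\<omega> [^] k \<otimes> x \<ominus> \<omega> [^] k \<otimes> y = \<omega> [^] k \<otimes> (x \<ominus> y)"
          using xy nat_pow_closed[OF unif_closed, of k] by algebra
        thus "c n (\<omega> [^] k \<otimes> x) = c n (\<omega> [^] k \<otimes> y) \<longleftrightarrow> c (n - k) x = c (n - k) y"
          using xy J_cancel[of "x \<ominus> y" k n] by (simp add: c_eq_iff)
      qed
      also have "\<dots> = q ^ (n - k)" using finite_card_S[of "n - k"] carrier_S by simp
      finally show ?thesis .
    qed
  qed
qed

definition red :: "nat \<Rightarrow> 'a mat2 \<Rightarrow> 'a set mat2" where
  "red n = (\<lambda>(a, b, d, e). (c n a, c n b, c n d, c n e))"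

lemma red_surjection: "group_surjection (GL2 R) (GL2 (S n)) (red n)"
proof -
  interpret Sn: chain_ring "S n" "c n \<omega>" n q by (rule chain_ring_S)
  have cl: "red n g \<in> carrier (GL2 (S n))" if g: "g \<in> carrier (GL2 R)" for g
    using g
  proof (rule GL2_E)
    fix a b d e assume *: "g = (a, b, d, e)" "a \<in> carrier R" "b \<in> carrier R" "d \<in> carrier R" "e \<in> carrier R"
      "a \<otimes> e \<ominus> b \<otimes> d \<in> Units R"
    have "c n (a \<otimes> e \<ominus> b \<otimes> d) \<in> Units (S n)" by (rule c_unit[OF *(6)])
    thus ?thesis using * by (simp add: red_def Sn.GL2_mem_iff c_simps)
  qed
  have hom: "red n \<in> hom (GL2 R) (GL2 (S n))"
  proof (rule homI)
    fix g h assume "g \<in> carrier (GL2 R)" "h \<in> carrier (GL2 R)"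
    thus "red n (g \<otimes>\<^bsub>GL2 R\<^esub> h) = red n g \<otimes>\<^bsub>GL2 (S n)\<^esub> red n h"
      by (elim GL2_E) (simp add: red_def c_simps)
  qed (rule cl)
  have surj: "red n ` carrier (GL2 R) = carrier (GL2 (S n))"
  proof
    show "red n ` carrier (GL2 R) \<subseteq> carrier (GL2 (S n))" using cl by blast
    show "carrier (GL2 (S n)) \<subseteq> red n ` carrier (GL2 R)"
    proof
      fix g assume g: "g \<in> carrier (GL2 (S n))"
      show "g \<in> red n ` carrier (GL2 R)"
      proof (cases "n = 0")
        case True
        have all: "c n x = c n y" if "x \<in> carrier R" "y \<in> carrier R" for x y
          using that True by (subst c_eq_iff) (simp_all add: J_0)
        obtain A B D E where G: "g = (A, B, D, E)" "A \<in> carrier (S n)" "B \<in> carrier (S n)" "D \<in> carrier (S n)"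
          "E \<in> carrier (S n)" using g by (rule Sn.GL2_E)
        obtain a b d e where l: "a \<in> carrier R" "b \<in> carrier R" "d \<in> carrier R" "e \<in> carrier R"
          "A = c n a" "B = c n b" "D = c n d" "E = c n e" using G(2-5) unfolding carrier_S by blast
        have "g = red n (\<one>, \<zero>, \<zero>, \<one>)"
          using all[OF l(1) one_closed] all[OF l(2) zero_closed] all[OF l(3) zero_closed] all[OF l(4) one_closed]
          unfolding G(1) l red_def by simp
        moreover have "(\<one>, \<zero>, \<zero>, \<one>) \<in> carrier (GL2 R)" by (simp add: GL2_mem_iff minus_eq)
        ultimately show ?thesis by blast
      next
        case False
        hence n1: "1 \<le> n" by simp
        obtain A B D E where G: "g = (A, B, D, E)" "A \<in> carrier (S n)" "B \<in> carrier (S n)" "D \<in> carrier (S n)"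
          "E \<in> carrier (S n)" "A \<otimes>\<^bsub>S n\<^esub> E \<ominus>\<^bsub>S n\<^esub> B \<otimes>\<^bsub>S n\<^esub> D \<in> Units (S n)" using g by (rule Sn.GL2_E)
        obtain a b d e where l: "a \<in> carrier R" "b \<in> carrier R" "d \<in> carrier R" "e \<in> carrier R"
          "A = c n a" "B = c n b" "D = c n d" "E = c n e" using G(2-5) unfolding carrier_S by blast
        have u: "c n (a \<otimes> e \<ominus> b \<otimes> d) \<in> Units (S n)" using G(6) l by (simp add: c_simps)
        have "a \<otimes> e \<ominus> b \<otimes> d \<in> Units R"
        proof (rule not_P_unit)
          show "a \<otimes> e \<ominus> b \<otimes> d \<notin> P"
          proof
            assume "a \<otimes> e \<ominus> b \<otimes> d \<in> P"
            then obtain y where y: "y \<in> carrier R" "a \<otimes> e \<ominus> b \<otimes> d = \<omega> [^] (1::nat) \<otimes> y"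
              unfolding J_1[symmetric] J_iff by blast
            have "c n (a \<otimes> e \<ominus> b \<otimes> d) \<in> Sn.I 1"
              unfolding y(2) using Sn.I_I[of "c n y" 1] y(1) by (simp add: c_simps)
            thus False using Sn.unit_not_I[OF n1 u] by simp
          qed
        qed (use l in simp)
        hence "(a, b, d, e) \<in> carrier (GL2 R)" using l by (simp add: GL2_mem_iff)
        moreover have "red n (a, b, d, e) = g" using l G(1) by (simp add: red_def)
        ultimately show ?thesis by blast
      qed
    qed
  qed
  show ?thesis
    by (intro group_surjection.intro group_surjection_axioms.intro group_GL2 Sn.group_GL2 hom surj)
qed

lemma red_one_iff:
  assumes "g \<in> carrier (GL2 R)" "g = (a, b, d, e)"
  shows "red n g = \<one>\<^bsub>GL2 (S n)\<^esub> \<longleftrightarrow> a \<ominus> \<one> \<in> J n \<and> b \<in> J n \<and> d \<in> J n \<and> e \<ominus> \<one> \<in> J n"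
proof -
  have cl: "a \<in> carrier R" "b \<in> carrier R" "d \<in> carrier R" "e \<in> carrier R" using assms by (auto simp: GL2_mem_iff)
  have "c n a = \<one>\<^bsub>S n\<^esub> \<longleftrightarrow> a \<ominus> \<one> \<in> J n" "c n e = \<one>\<^bsub>S n\<^esub> \<longleftrightarrow> e \<ominus> \<one> \<in> J n"
    using c_eq_iff[of a \<one> n] c_eq_iff[of e \<one> n] cl by (simp_all add: c_one)
  moreover have "c n b = \<zero>\<^bsub>S n\<^esub> \<longleftrightarrow> b \<in> J n" "c n d = \<zero>\<^bsub>S n\<^esub> \<longleftrightarrow> d \<in> J n"
    using c_eq_iff[of b \<zero> n] c_eq_iff[of d \<zero> n] cl by (simp_all add: c_zero minus_eq)
  ultimately show ?thesis by (simp add: assms(2) red_def GL2_one)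
qed

lemma red_one_mono:
  assumes "m \<le> n" "g \<in> carrier (GL2 R)" "red n g = \<one>\<^bsub>GL2 (S n)\<^esub>"
  shows "red m g = \<one>\<^bsub>GL2 (S m)\<^esub>"
  using assms J_antimono[OF assms(1)] red_one_iff[OF assms(2)] by (cases g) blast

text \<open>This connects minimality of a level, which speaks of the kernel of reduction to level
  \<open>n - 1\<close>, with the hypothesis of \<open>dimension_ge\<close>, which speaks of matrices over the quotient of
  level \<open>n\<close>.\<close>

lemma red_kernel_elem:
  assumes g: "g \<in> carrier (GL2 R)" "red (n - 1) g = \<one>\<^bsub>GL2 (S (n - 1))\<^esub>" and n: "n \<ge> 1"
  shows "\<exists>x\<in>chain_ring.I (S n) (c n \<omega>) (n - 1). \<exists>y\<in>chain_ring.I (S n) (c n \<omega>) (n - 1).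
    \<exists>z\<in>chain_ring.I (S n) (c n \<omega>) (n - 1). \<exists>w\<in>chain_ring.I (S n) (c n \<omega>) (n - 1).
      red n g = chain_ring.kernel_elem (S n) x y z w"
proof -
  interpret Sn: chain_ring "S n" "c n \<omega>" n q by (rule chain_ring_S)
  obtain a b d e where abde: "g = (a, b, d, e)" by (cases g)
  have cl: "a \<in> carrier R" "b \<in> carrier R" "d \<in> carrier R" "e \<in> carrier R" using g abde by (auto simp: GL2_mem_iff)
  have m: "a \<ominus> \<one> \<in> J (n - 1)" "b \<in> J (n - 1)" "d \<in> J (n - 1)" "e \<ominus> \<one> \<in> J (n - 1)"
    using red_one_iff[OF g(1) abde] g(2) by auto
  have I: "c n x \<in> Sn.I (n - 1)" if "x \<in> J (n - 1)" for x
  proof -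
    obtain y where "y \<in> carrier R" "x = \<omega> [^] (n - 1) \<otimes> y" using \<open>x \<in> J (n - 1)\<close> by (auto simp: J_iff)
    thus ?thesis using Sn.I_I[of "c n y" "n - 1"] by (simp add: c_simps)
  qed
  have e1: "c n x = \<one>\<^bsub>S n\<^esub> \<oplus>\<^bsub>S n\<^esub> c n (x \<ominus> \<one>)" if x: "x \<in> carrier R" for x
  proof -
    have "x = \<one> \<oplus> (x \<ominus> \<one>)" using x by algebra
    thus ?thesis using x c_add[of \<one> "x \<ominus> \<one>" n] by (simp add: c_one)
  qed
  have "red n g = Sn.kernel_elem (c n (a \<ominus> \<one>)) (c n b) (c n d) (c n (e \<ominus> \<one>))"
    unfolding abde red_def Sn.kernel_elem_def using e1[OF cl(1)] e1[OF cl(4)] by simp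
  thus ?thesis using I m by blast
qed


subsection \<open>Continuity\<close>

lemma c_self: "x \<in> carrier R \<Longrightarrow> x \<in> c n x"
proof -
  interpret I: ideal "J n" R by (rule ideal_J)
  show "x \<in> carrier R \<Longrightarrow> x \<in> c n x" unfolding c_def by (rule I.a_rcos_self)
qed

lemma c_subset: "x \<in> carrier R \<Longrightarrow> c n x \<subseteq> carrier R"
  unfolding c_def by (rule a_r_coset_subset_G) (auto intro: J_closed)

lemma topspace_adic: "topspace (adic_topology R P) = carrier R"
proof -
  have "(\<Union>n. a_rcosets (ideal_pow R P n)) = (\<Union>n. c n ` carrier R)"
    using carrier_S by (simp add: ideal_pow_eq FactRing_def)
  moreover have "\<Union>(\<Union>n. c n ` carrier R) = carrier R"
  proof
    show "\<Union>(\<Union>n. c n ` carrier R) \<subseteq> carrier R" using c_subset by blast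
    show "carrier R \<subseteq> \<Union>(\<Union>n. c n ` carrier R)" using c_self by blast
  qed
  ultimately show ?thesis unfolding adic_topology_def by simp
qed

lemma mem_c_iff:
  assumes "x \<in> carrier R"
  shows "y \<in> c n x \<longleftrightarrow> y \<in> carrier R \<and> c n y = c n x"
proof
  interpret I: ideal "J n" R by (rule ideal_J)
  assume y: "y \<in> c n x"
  have "y \<in> carrier R" using y c_subset[OF assms] by blast
  moreover have "J n +> x = J n +> y" by (rule I.a_repr_independence'[OF y[unfolded c_def] assms])
  ultimately show "y \<in> carrier R \<and> c n y = c n x" by (simp add: c_def)
qed (use c_self[of y n] in auto)

lemma openin_adic_coset: "x \<in> carrier R \<Longrightarrow> openin (adic_topology R P) (c n x)"
  unfolding adic_topology_def
  by (rule topology_generated_by_Basis) (use carrier_S in \<open>auto simp: ideal_pow_eq FactRing_def\<close>)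

lemma openin_adic_contains_coset:
  assumes "openin (adic_topology R P) V" "x \<in> V"
  shows "\<exists>n. c n x \<subseteq> V"
proof -
  have "generate_topology_on (\<Union>n. a_rcosets (ideal_pow R P n)) V"
    using assms(1) unfolding adic_topology_def openin_topology_generated_by_iff .
  thus ?thesis using assms(2)
  proof (induction)
    case (Int A B)
    then obtain m n where mn: "c m x \<subseteq> A" "c n x \<subseteq> B" by auto
    have xc: "x \<in> carrier R"
      using Int.hyps Int.prems topspace_adic openin_subset unfolding adic_topology_def
      by (metis IntD1 openin_topology_generated_by_iff subsetD)
    have "c (max m n) x \<subseteq> c k x" if "k \<le> max m n" for k
    proof
      fix y assume "y \<in> c (max m n) x"
      hence y: "y \<in> carrier R" "y \<ominus> x \<in> J (max m n)" using xc by (auto simp: mem_c_iff c_eq_iff)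
      hence "y \<ominus> x \<in> J k" using J_antimono[OF that] by blast
      thus "y \<in> c k x" using y xc by (simp add: mem_c_iff c_eq_iff)
    qed
    hence "c (max m n) x \<subseteq> A \<inter> B" using mn by (meson Int_subset_iff max.cobounded1 max.cobounded2 subset_trans)
    thus ?case by blast
  next
    case (UN K)
    then obtain k where "k \<in> K" "x \<in> k" by blast
    thus ?case using UN.IH by blast
  next
    case (Basis s)
    then obtain n y where y: "y \<in> carrier R" "s = c n y" using carrier_S by (auto simp: ideal_pow_eq FactRing_def)
    hence "c n x = c n y" "x \<in> carrier R" using Basis.prems by (auto simp: mem_c_iff)
    thus ?case using y by auto
  qed simp
qed

lemma topspace_GL2: "topspace (GL2_topology R P) = carrier (GL2 R)"
proof -
  have "carrier (GL2 R) \<subseteq> carrier R \<times> carrier R \<times> carrier R \<times> carrier R" using GL2_mem_iff by auto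
  thus ?thesis unfolding GL2_topology_def by (auto simp: topspace_adic)
qed

text \<open>A neighbourhood of the identity contains a product of four cosets of powers of \<open>P\<close>; the
  largest of the four exponents works for all entries.\<close>

lemma open_neighbourhood_one:
  assumes "openin (GL2_topology R P) V" "\<one>\<^bsub>GL2 R\<^esub> \<in> V"
  shows "\<exists>n. \<forall>g\<in>carrier (GL2 R). red n g = \<one>\<^bsub>GL2 (S n)\<^esub> \<longrightarrow> g \<in> V"
proof -
  let ?A = "adic_topology R P"
  obtain W where W: "openin (prod_topology ?A (prod_topology ?A (prod_topology ?A ?A))) W" "V = W \<inter> carrier (GL2 R)"
    using assms(1) unfolding GL2_topology_def openin_subtopology by blast
  have m: "(\<one>, \<zero>, \<zero>, \<one>) \<in> W" using assms(2) W(2) by (simp add: GL2_one)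
  from openin_prod_topology_alt[THEN iffD1, OF W(1), rule_format, OF m]
  obtain A W1 where 1: "openin ?A A" "openin (prod_topology ?A (prod_topology ?A ?A)) W1" "\<one> \<in> A"
    "(\<zero>, \<zero>, \<one>) \<in> W1" "A \<times> W1 \<subseteq> W" by auto
  from openin_prod_topology_alt[THEN iffD1, OF 1(2), rule_format, OF 1(4)]
  obtain B W2 where 2: "openin ?A B" "openin (prod_topology ?A ?A) W2" "\<zero> \<in> B"
    "(\<zero>, \<one>) \<in> W2" "B \<times> W2 \<subseteq> W1" by auto
  from openin_prod_topology_alt[THEN iffD1, OF 2(2), rule_format, OF 2(4)]
  obtain C D where 3: "openin ?A C" "openin ?A D" "\<zero> \<in> C" "\<one> \<in> D" "C \<times> D \<subseteq> W2" by auto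
  obtain i j k l where n: "c i \<one> \<subseteq> A" "c j \<zero> \<subseteq> B" "c k \<zero> \<subseteq> C" "c l \<one> \<subseteq> D"
    using openin_adic_contains_coset[OF 1(1,3)] openin_adic_contains_coset[OF 2(1,3)]
      openin_adic_contains_coset[OF 3(1,3)] openin_adic_contains_coset[OF 3(2,4)] by blast
  define n where "n = Max {i, j, k, l}"
  have le: "i \<le> n" "j \<le> n" "k \<le> n" "l \<le> n" by (simp_all add: n_def)
  have "g \<in> V" if g: "g \<in> carrier (GL2 R)" "red n g = \<one>\<^bsub>GL2 (S n)\<^esub>" for g
  proof -
    obtain a b d e where abde: "g = (a, b, d, e)" by (cases g)
    have cl: "a \<in> carrier R" "b \<in> carrier R" "d \<in> carrier R" "e \<in> carrier R" using g abde by (auto simp: GL2_mem_iff)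
    have m: "a \<ominus> \<one> \<in> J n" "b \<in> J n" "d \<in> J n" "e \<ominus> \<one> \<in> J n"
      using red_one_iff[OF g(1) abde] g(2) by auto
    have "a \<in> c i \<one>" "b \<in> c j \<zero>" "d \<in> c k \<zero>" "e \<in> c l \<one>"
      using m cl J_antimono[OF le(1)] J_antimono[OF le(2)] J_antimono[OF le(3)] J_antimono[OF le(4)]
      by (auto simp: mem_c_iff c_eq_iff minus_eq)
    hence "a \<in> A" "b \<in> B" "d \<in> C" "e \<in> D" using n by auto
    hence "g \<in> W" using 1(5) 2(5) 3(5) abde by blast
    thus ?thesis using W(2) g by blast
  qed
  thus ?thesis by blast
qed

text \<open>Reduction is constant on products of cosets, which are open.\<close>

lemma continuous_inflation:
  "continuous_map (GL2_topology R P) euclidean (\<lambda>g. f (red n g) :: complex)"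
proof -
  let ?A = "adic_topology R P"
  have "openin (GL2_topology R P) {g \<in> carrier (GL2 R). f (red n g) \<in> V}" for V
  proof (subst openin_subopen, rule ballI)
    fix g assume g: "g \<in> {g \<in> carrier (GL2 R). f (red n g) \<in> V}"
    then obtain a b d e where abde: "g = (a, b, d, e)" "a \<in> carrier R" "b \<in> carrier R" "d \<in> carrier R" "e \<in> carrier R"
      by (auto elim: GL2_E)
    let ?W = "c n a \<times> c n b \<times> c n d \<times> c n e"
    have "openin (prod_topology ?A (prod_topology ?A (prod_topology ?A ?A))) ?W"
      by (intro openin_prod_Times_iff[THEN iffD2] disjI2 conjI openin_adic_coset abde)
    hence "openin (GL2_topology R P) (?W \<inter> carrier (GL2 R))"
      unfolding GL2_topology_def openin_subtopology by blast
    moreover have "g \<in> ?W \<inter> carrier (GL2 R)" using g abde by (simp add: mem_c_iff)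
    moreover have "red n h = red n g" if "h \<in> ?W" for h
      using that abde by (cases h) (auto simp: mem_c_iff red_def)
    hence "?W \<inter> carrier (GL2 R) \<subseteq> {g \<in> carrier (GL2 R). f (red n g) \<in> V}" using g by auto
    ultimately show "\<exists>T. openin (GL2_topology R P) T \<and> g \<in> T \<and> T \<subseteq> {g \<in> carrier (GL2 R). f (red n g) \<in> V}" by blast
  qed
  thus ?thesis by (simp add: continuous_map topspace_GL2)
qed

text \<open>The general linear group has no small subgroups. If all entries of \<open>\<rho> g - 1\<close> are at most
  \<open>b\<close> in absolute value for all \<open>g\<close> in a subgroup, and \<open>n b \<le> 1/3\<close>, then
  \<open>2 (\<rho> g - 1) = (\<rho> (g\<^sup>2) - 1) - (\<rho> g - 1)\<^sup>2\<close> shows that they are at most \<open>2b/3\<close>; iterating this,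
  they are zero.\<close>

lemma continuous_rep_trivial_on_kernel:
  assumes "cont_rep (GL2 R) (GL2_topology R P) n \<rho>"
  obtains r where "\<And>g. g \<in> carrier (GL2 R) \<Longrightarrow> red r g = \<one>\<^bsub>GL2 (S r)\<^esub> \<Longrightarrow> \<rho> g = 1\<^sub>m n"
proof -
  interpret G: group "GL2 R" by (rule group_GL2)
  have \<rho>: "\<rho> \<in> hom (GL2 R) (GL_complex n)" using assms by (simp add: cont_rep_def)
  \<comment> \<open>small enough for \<open>n \<epsilon> \<le> 1/3\<close>, and positive also for \<open>n = 0\<close>\<close>
  define \<epsilon> where "\<epsilon> = 1 / (3 * real (Suc n))"
  have \<epsilon>: "\<epsilon> > 0" "real n * \<epsilon> \<le> 1 / 3" by (auto simp: \<epsilon>_def field_simps)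
  define X where "X g i j = \<rho> g $$ (i, j) - (1\<^sub>m n :: complex mat) $$ (i, j)" for g i j
  have "\<exists>r. \<forall>g\<in>carrier (GL2 R). red r g = \<one>\<^bsub>GL2 (S r)\<^esub> \<longrightarrow> norm (X g i j) < \<epsilon>" if ij: "i < n" "j < n" for i j
  proof -
    define V where "V = {g \<in> topspace (GL2_topology R P). \<rho> g $$ (i, j) \<in> ball ((1\<^sub>m n :: complex mat) $$ (i, j)) \<epsilon>}"
    have "continuous_map (GL2_topology R P) euclidean (\<lambda>g. \<rho> g $$ (i, j))" using assms ij by (simp add: cont_rep_def)
    hence "openin (GL2_topology R P) V" unfolding V_def by (rule openin_continuous_map_preimage) simp
    moreover have "\<one>\<^bsub>GL2 R\<^esub> \<in> V" using \<epsilon>(1) by (simp add: V_def topspace_GL2 G.rep_one[OF \<rho>])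
    ultimately obtain r where "\<forall>g\<in>carrier (GL2 R). red r g = \<one>\<^bsub>GL2 (S r)\<^esub> \<longrightarrow> g \<in> V"
      using open_neighbourhood_one by blast
    thus ?thesis by (auto simp: V_def X_def dist_norm norm_minus_commute)
  qed
  then obtain rr where rr: "\<And>i j g. i < n \<Longrightarrow> j < n \<Longrightarrow> g \<in> carrier (GL2 R) \<Longrightarrow>
      red (rr i j) g = \<one>\<^bsub>GL2 (S (rr i j))\<^esub> \<Longrightarrow> norm (X g i j) < \<epsilon>" by metis
  define r where "r = Max (insert 0 ((\<lambda>(i, j). rr i j) ` ({..<n} \<times> {..<n})))"
  have r_ge: "rr i j \<le> r" if "i < n" "j < n" for i j
    unfolding r_def using that by (intro Max_ge) auto
  define K where "K = {g \<in> carrier (GL2 R). red r g = \<one>\<^bsub>GL2 (S r)\<^esub>}"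
  interpret h: group_surjection "GL2 R" "GL2 (S r)" "red r" by (rule red_surjection)
  have K2: "g \<otimes>\<^bsub>GL2 R\<^esub> g \<in> K" if "g \<in> K" for g using that by (simp add: K_def h.mult)
  have small: "norm (X g i j) \<le> (2 / 3) ^ k * \<epsilon>" if "g \<in> K" "i < n" "j < n" for g i j k
    using that
  proof (induction k arbitrary: g i j)
    case 0
    thus ?case using rr[OF 0(2,3), of g] red_one_mono[OF r_ge[OF 0(2,3)], of g] by (auto simp: K_def less_imp_le)
  next
    case (Suc k)
    define b where "b = (2 / 3) ^ k * \<epsilon>"
    have b: "0 \<le> b" "real n * b \<le> 1 / 3"
    proof -
      show "0 \<le> b" using \<epsilon> by (simp add: b_def)
      have "b \<le> 1 * \<epsilon>" unfolding b_def using \<epsilon>(1) by (intro mult_right_mono power_le_one) auto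
      hence "real n * b \<le> real n * \<epsilon>" by (intro mult_left_mono) auto
      thus "real n * b \<le> 1 / 3" using \<epsilon>(2) by linarith
    qed
    have IH: "norm (X h i j) \<le> b" if "h \<in> K" "i < n" "j < n" for h i j using Suc.IH that by (simp add: b_def)
    have gc: "g \<in> carrier (GL2 R)" using Suc.prems by (simp add: K_def)
    note R = G.rep_carrier[OF \<rho> gc]
    have "\<rho> (g \<otimes>\<^bsub>GL2 R\<^esub> g) $$ (i, j) = (\<Sum>l<n. \<rho> g $$ (i, l) * \<rho> g $$ (l, j))"
      unfolding G.rep_mult[OF \<rho> gc gc] by (rule mat_mult_entry[OF R R Suc.prems(2,3)])
    also have "\<dots> = (\<Sum>l<n. X g i l * X g l j + (if l = j then X g i j else 0) + (if l = i then X g i j else 0) +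
        (if l = j \<and> i = j then 1 else 0))"
      using Suc.prems by (intro sum.cong) (auto simp: X_def algebra_simps)
    also have "\<dots> = (\<Sum>l<n. X g i l * X g l j) + 2 * X g i j + (if i = j then 1 else 0)"
      using Suc.prems by (cases "i = j") (simp_all add: sum.distrib sum_distrib_left[symmetric])
    finally have "2 * X g i j = X (g \<otimes>\<^bsub>GL2 R\<^esub> g) i j - (\<Sum>l<n. X g i l * X g l j)"
      using Suc.prems by (auto simp: X_def)
    hence "2 * norm (X g i j) = norm (X (g \<otimes>\<^bsub>GL2 R\<^esub> g) i j - (\<Sum>l<n. X g i l * X g l j))"
      by (metis norm_mult norm_numeral)
    also have "\<dots> \<le> norm (X (g \<otimes>\<^bsub>GL2 R\<^esub> g) i j) + norm (\<Sum>l<n. X g i l * X g l j)" by (rule norm_triangle_ineq4)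
    also have "norm (\<Sum>l<n. X g i l * X g l j) \<le> (\<Sum>l<n. b * b)"
      using IH[OF Suc.prems(1)] Suc.prems b(1) by (intro sum_norm_le) (auto simp: norm_mult intro!: mult_mono)
    also have "(\<Sum>l<n. b * b) = (real n * b) * b" by simp
    also have "\<dots> \<le> 1 / 3 * b" using b by (intro mult_right_mono) auto
    also have "norm (X (g \<otimes>\<^bsub>GL2 R\<^esub> g) i j) \<le> b" by (rule IH[OF K2[OF Suc.prems(1)] Suc.prems(2,3)])
    finally have "norm (X g i j) \<le> 2 / 3 * b" by linarith
    thus ?case by (simp only: b_def power_Suc mult.assoc)
  qed
  have "\<rho> g = 1\<^sub>m n" if g: "g \<in> K" for g
  proof (rule eq_matI)
    have gc: "g \<in> carrier (GL2 R)" using g by (simp add: K_def)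
    show "dim_row (\<rho> g) = dim_row (1\<^sub>m n)" "dim_col (\<rho> g) = dim_col (1\<^sub>m n)" using G.rep_carrier[OF \<rho> gc] by auto
    fix i j assume "i < dim_row (1\<^sub>m n)" "j < dim_col (1\<^sub>m n)"
    hence ij: "i < n" "j < n" by auto
    have "(\<lambda>k. (2 / 3 :: real) ^ k * \<epsilon>) \<longlonglongrightarrow> 0 * \<epsilon>" by (intro tendsto_intros LIMSEQ_realpow_zero) auto
    hence "norm (X g i j) \<le> 0 * \<epsilon>"
      by (rule LIMSEQ_le_const) (use small[OF g ij] in auto)
    thus "\<rho> g $$ (i, j) = 1\<^sub>m n $$ (i, j)" by (simp add: X_def)
  qed
  thus ?thesis using that[of r] by (simp add: K_def)
qed

end

section \<open>Counting twist isoclasses by level\<close>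

context dvr_ring
begin

abbreviation \<Gamma> where "\<Gamma> \<equiv> GL2 R"
abbreviation T\<^sub>\<Gamma> where "T\<^sub>\<Gamma> \<equiv> GL2_topology R P"

definition trivial_at :: "nat \<Rightarrow> ('a mat2 \<Rightarrow> complex mat) \<Rightarrow> nat \<Rightarrow> bool" where
  "trivial_at n \<rho> r \<longleftrightarrow> (\<forall>g\<in>carrier \<Gamma>. red r g = \<one>\<^bsub>GL2 (S r)\<^esub> \<longrightarrow> \<rho> g = 1\<^sub>m n)"

lemma cont_rep_inflate:
  assumes "\<rho> \<in> hom (GL2 (S r)) (GL_complex n)"
  shows "cont_rep \<Gamma> T\<^sub>\<Gamma> n (\<lambda>g. \<rho> (red r g))"
proof -
  interpret h: group_surjection \<Gamma> "GL2 (S r)" "red r" by (rule red_surjection)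
  show ?thesis
    unfolding cont_rep_def h.rep_inflate
    using assms continuous_inflation[of "\<lambda>x. \<rho> x $$ (_, _)" r] by blast
qed

text \<open>Among the twists of \<open>\<rho>\<close> that factor through a finite level there is one of least level. No
  twist of it by a character of the same level factors through the preceding level, which is the
  hypothesis of \<open>dimension_ge\<close>.\<close>

lemma minimal_level:
  assumes \<rho>: "irreducible_rep \<Gamma> T\<^sub>\<Gamma> n \<rho>"
  shows "\<exists>r \<sigma>. irreducible_rep \<Gamma> T\<^sub>\<Gamma> n \<sigma> \<and> twist_equiv \<Gamma> T\<^sub>\<Gamma> n \<rho> \<sigma> \<and> trivial_at n \<sigma> r \<and> q ^ r \<le> 2 * q * n"
proof -
  define Q where "Q r \<longleftrightarrow> (\<exists>\<sigma>. irreducible_rep \<Gamma> T\<^sub>\<Gamma> n \<sigma> \<and> twist_equiv \<Gamma> T\<^sub>\<Gamma> n \<rho> \<sigma> \<and> trivial_at n \<sigma> r)" for r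
  have h\<rho>: "\<rho> \<in> hom \<Gamma> (GL_complex n)" using \<rho> by (simp add: irreducible_rep_def cont_rep_def)
  obtain r0 where "trivial_at n \<rho> r0"
    using continuous_rep_trivial_on_kernel[of n \<rho>] \<rho> unfolding irreducible_rep_def trivial_at_def by metis
  hence "Q r0" unfolding Q_def using \<rho> twist_equiv_refl[OF group_GL2 h\<rho>] by blast
  define r where "r = (LEAST r. Q r)"
  have "Q r" unfolding r_def by (rule LeastI[of Q r0]) fact
  then obtain \<sigma> where \<sigma>: "irreducible_rep \<Gamma> T\<^sub>\<Gamma> n \<sigma>" "twist_equiv \<Gamma> T\<^sub>\<Gamma> n \<rho> \<sigma>" "trivial_at n \<sigma> r"
    unfolding Q_def by blast
  have min: "\<not> Q k" if "k < r" for k using not_less_Least that unfolding r_def by blast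
  have n0: "n > 0" using \<rho> by (simp add: irreducible_rep_def)
  have "q ^ r \<le> 2 * q * n"
  proof (cases "r \<ge> 2")
    case False
    hence "q ^ r \<le> q ^ 1" using q_ge by (intro power_increasing) auto
    also have "\<dots> \<le> 2 * q * n" using n0 by simp
    finally show ?thesis .
  next
    case r: True
    interpret Sr: chain_ring "S r" "c r \<omega>" r q by (rule chain_ring_S)
    interpret h: group_surjection \<Gamma> "GL2 (S r)" "red r" by (rule red_surjection)
    have irr\<sigma>: "irr_rep \<Gamma> n \<sigma>" using \<sigma>(1) by (simp add: irreducible_rep_iff)
    have ker: "\<sigma> g = 1\<^sub>m n" if "g \<in> carrier \<Gamma>" "red r g = \<one>\<^bsub>GL2 (S r)\<^esub>" for g
      using \<sigma>(3) that by (simp add: trivial_at_def)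
    obtain \<sigma>' where \<sigma>': "irr_rep (GL2 (S r)) n \<sigma>'" "\<And>g. g \<in> carrier \<Gamma> \<Longrightarrow> \<sigma>' (red r g) = \<sigma> g"
      using h.irr_rep_deflate[OF irr\<sigma> ker] by blast
    show ?thesis
    proof (rule Sr.dimension_ge[OF r \<sigma>'(1)])
      fix f assume f: "is_char (GL2 (S r)) f"
      let ?f = "\<lambda>g. f (red r g)"
      have fc: "is_char \<Gamma> ?f" "continuous_map T\<^sub>\<Gamma> euclidean ?f"
        using f h.is_char_inflate continuous_inflation by auto
      have tw: "irreducible_rep \<Gamma> T\<^sub>\<Gamma> n (twist ?f \<sigma>)"
        using \<sigma>(1) irr_rep_twist[OF group_GL2 fc(1)] cont_rep_twist[OF group_GL2 fc _ topspace_GL2]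
        by (simp add: irreducible_rep_iff)
      have h\<sigma>: "\<sigma> \<in> hom \<Gamma> (GL_complex n)" "twist ?f \<sigma> \<in> hom \<Gamma> (GL_complex n)"
        using \<sigma>(1) tw by (auto simp: irreducible_rep_def cont_rep_def)
      have "twist_equiv \<Gamma> T\<^sub>\<Gamma> n (twist ?f \<sigma>) \<sigma>"
      proof -
        have "rep_iso \<Gamma> n (twist ?f \<sigma>) (twist ?f \<sigma>)"
          unfolding rep_iso_def
        proof (intro bexI[of _ "1\<^sub>m n"] ballI)
          show "1\<^sub>m n \<in> carrier (GL_complex n)" by (auto simp: GL_complex_carrier_iff intro!: bexI[of _ "1\<^sub>m n"])
          fix g assume "g \<in> carrier \<Gamma>"
          hence "twist ?f \<sigma> g \<in> carrier_mat n n" by (rule group.rep_carrier[OF group_GL2 h\<sigma>(2)])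
          thus "1\<^sub>m n * twist ?f \<sigma> g = twist ?f \<sigma> g * 1\<^sub>m n"
            by (simp add: left_mult_one_mat[of _ n n] right_mult_one_mat[of _ n n])
        qed
        thus ?thesis unfolding twist_equiv_iff[OF group_GL2] using fc by blast
      qed
      hence "twist_equiv \<Gamma> T\<^sub>\<Gamma> n \<sigma> (twist ?f \<sigma>)" by (rule twist_equiv_sym[OF group_GL2 h\<sigma>(2,1) topspace_GL2])
      hence "twist_equiv \<Gamma> T\<^sub>\<Gamma> n \<rho> (twist ?f \<sigma>)" by (rule twist_equiv_trans[OF group_GL2 h\<rho> h\<sigma> \<sigma>(2)])
      hence "\<not> trivial_at n (twist ?f \<sigma>) (r - 1)" using min[of "r - 1"] r tw unfolding Q_def by auto
      then obtain g where g: "g \<in> carrier \<Gamma>" "red (r - 1) g = \<one>\<^bsub>GL2 (S (r - 1))\<^esub>" "twist ?f \<sigma> g \<noteq> 1\<^sub>m n"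
        unfolding trivial_at_def by blast
      have ne: "twist f \<sigma>' (red r g) \<noteq> 1\<^sub>m n" using g(3) \<sigma>'(2)[OF g(1)] by (simp add: twist_def)
      have "1 \<le> r" using r by simp
      from red_kernel_elem[OF g(1,2) this] ne
      show "\<exists>a\<in>Sr.I (r - 1). \<exists>b\<in>Sr.I (r - 1). \<exists>c\<in>Sr.I (r - 1). \<exists>d\<in>Sr.I (r - 1).
          twist f \<sigma>' (Sr.kernel_elem a b c d) \<noteq> 1\<^sub>m n" by metis
    qed
  qed
  thus ?thesis using \<sigma> by blast
qed

lemma level_family_card_le:
  assumes u: "u \<in> Units R" "\<one> \<oplus> \<one> = u \<otimes> \<omega> [^] (e::nat)" and fF: "finite F"
    and irr: "\<And>i. i \<in> F \<Longrightarrow> irreducible_rep \<Gamma> T\<^sub>\<Gamma> (n i) (\<sigma> i)"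
    and triv: "\<And>i. i \<in> F \<Longrightarrow> trivial_at (n i) (\<sigma> i) r"
    and dim: "\<And>i. i \<in> F \<Longrightarrow> q ^ r \<le> 2 * q * n i"
    and non: "\<And>i j. i \<in> F \<Longrightarrow> j \<in> F \<Longrightarrow> n i = n j \<Longrightarrow> twist_equiv \<Gamma> T\<^sub>\<Gamma> (n i) (\<sigma> i) (\<sigma> j) \<Longrightarrow> i = j"
  shows "card F \<le> 16 * q ^ (e + 2) * q ^ r"
proof -
  interpret Sr: chain_ring "S r" "c r \<omega>" r q by (rule chain_ring_S)
  interpret h: group_surjection \<Gamma> "GL2 (S r)" "red r" by (rule red_surjection)
  have "\<exists>\<sigma>'. irr_rep (GL2 (S r)) (n i) \<sigma>' \<and> (\<forall>g\<in>carrier \<Gamma>. \<sigma>' (red r g) = \<sigma> i g)" if i: "i \<in> F" for i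
  proof -
    have "irr_rep \<Gamma> (n i) (\<sigma> i)" using irr[OF i] by (simp add: irreducible_rep_iff)
    thus ?thesis using h.irr_rep_deflate[of "n i" "\<sigma> i"] triv[OF i] unfolding trivial_at_def by metis
  qed
  then obtain \<sigma>' where \<sigma>': "\<And>i. i \<in> F \<Longrightarrow> irr_rep (GL2 (S r)) (n i) (\<sigma>' i)"
    "\<And>i g. i \<in> F \<Longrightarrow> g \<in> carrier \<Gamma> \<Longrightarrow> \<sigma>' i (red r g) = \<sigma> i g" by metis
  show ?thesis
  proof (rule Sr.twist_classes_card_le[OF fF c_unit[OF u(1)] _ \<sigma>'(1) dim])
    show "\<one>\<^bsub>S r\<^esub> \<oplus>\<^bsub>S r\<^esub> \<one>\<^bsub>S r\<^esub> = c r u \<otimes>\<^bsub>S r\<^esub> c r \<omega> [^]\<^bsub>S r\<^esub> e"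
      using arg_cong[OF u(2), of "c r"] u(1) by (simp add: c_simps Units_closed)
    fix i j f assume i: "i \<in> F" and j: "j \<in> F" and ij: "i \<noteq> j" "n i = n j" and f: "is_char (GL2 (S r)) f"
    show "\<not> rep_iso (GL2 (S r)) (n i) (\<sigma>' i) (twist f (\<sigma>' j))"
    proof
      assume "rep_iso (GL2 (S r)) (n i) (\<sigma>' i) (twist f (\<sigma>' j))"
      hence "rep_iso \<Gamma> (n i) (\<lambda>g. \<sigma>' i (red r g)) (\<lambda>g. twist f (\<sigma>' j) (red r g))" by (simp add: h.rep_iso_inflate)
      hence "rep_iso \<Gamma> (n i) (\<sigma> i) (twist (\<lambda>g. f (red r g)) (\<sigma> j))"
        using \<sigma>'(2)[OF i] \<sigma>'(2)[OF j] by (simp add: rep_iso_def twist_def)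
      hence "twist_equiv \<Gamma> T\<^sub>\<Gamma> (n i) (\<sigma> i) (\<sigma> j)"
        unfolding twist_equiv_iff[OF group_GL2] using f h.is_char_inflate continuous_inflation by blast
      thus False using non[OF i j ij(2)] ij(1) by simp
    qed
  qed
qed

lemma finite_level_isoclasses:
  assumes u: "u \<in> Units R" "\<one> \<oplus> \<one> = u \<otimes> \<omega> [^] (e::nat)" and d: "q ^ r \<le> 2 * q * d"
  defines "G \<equiv> GL2 (S r)"
  defines "T \<equiv> discrete_topology (carrier G)"
  shows "finite (twist_isoclasses G T d) \<and> card (twist_isoclasses G T d) \<le> 16 * q ^ (e + 2) * q ^ r"
proof -
  interpret Sr: chain_ring "S r" "c r \<omega>" r q by (rule chain_ring_S)
  have G: "group G" unfolding G_def by (rule Sr.group_GL2)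
  have T: "topspace T = carrier G" by (simp add: T_def)
  obtain rep where rep: "\<And>c. c \<in> twist_isoclasses G T d \<Longrightarrow> rep c \<in> c \<and> irreducible_rep G T d (rep c)"
    "\<And>c c'. c \<in> twist_isoclasses G T d \<Longrightarrow> c' \<in> twist_isoclasses G T d \<Longrightarrow>
      twist_equiv G T d (rep c) (rep c') \<Longrightarrow> c = c'"
    using twist_isoclass_representatives[OF G T] by metis
  have two: "\<one>\<^bsub>S r\<^esub> \<oplus>\<^bsub>S r\<^esub> \<one>\<^bsub>S r\<^esub> = c r u \<otimes>\<^bsub>S r\<^esub> c r \<omega> [^]\<^bsub>S r\<^esub> e"
    using arg_cong[OF u(2), of "c r"] u(1) by (simp add: c_simps Units_closed)
  show ?thesis
  proof (rule finite_if_finite_subsets_card_bdd)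
    fix F assume F: "F \<subseteq> twist_isoclasses G T d" "finite F"
    show "card F \<le> 16 * q ^ (e + 2) * q ^ r"
    proof (rule Sr.twist_classes_card_le[OF F(2) c_unit[OF u(1)] two, where n="\<lambda>_. d" and \<rho>=rep])
      fix c assume "c \<in> F"
      thus "irr_rep (GL2 (S r)) d (rep c)" using rep(1) F(1) by (auto simp: irreducible_rep_iff G_def)
    next
      fix c c' f assume c: "c \<in> F" "c' \<in> F" "c \<noteq> c'" and f: "is_char (GL2 (S r)) f"
      show "\<not> rep_iso (GL2 (S r)) d (rep c) (twist f (rep c'))"
      proof
        assume "rep_iso (GL2 (S r)) d (rep c) (twist f (rep c'))"
        moreover have "continuous_map T euclidean f" by (simp add: T_def)
        ultimately have "twist_equiv G T d (rep c) (rep c')"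
          unfolding twist_equiv_iff[OF G] using f by (auto simp: G_def)
        thus False using rep(2)[of c c'] c F(1) by auto
      qed
    qed (rule d)
  qed
qed

text \<open>Fixing representatives and their levels in all dimensions simultaneously makes it possible
  to count the classes of different dimensions together by their level.\<close>

lemma leveled_representatives:
  obtains \<sigma> lv where
    "\<And>n c. c \<in> twist_isoclasses \<Gamma> T\<^sub>\<Gamma> n \<Longrightarrow> irreducible_rep \<Gamma> T\<^sub>\<Gamma> n (\<sigma> n c)"
    "\<And>n c. c \<in> twist_isoclasses \<Gamma> T\<^sub>\<Gamma> n \<Longrightarrow> trivial_at n (\<sigma> n c) (lv n c)"
    "\<And>n c. c \<in> twist_isoclasses \<Gamma> T\<^sub>\<Gamma> n \<Longrightarrow> q ^ lv n c \<le> 2 * q * n"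
    "\<And>n c d. c \<in> twist_isoclasses \<Gamma> T\<^sub>\<Gamma> n \<Longrightarrow> d \<in> twist_isoclasses \<Gamma> T\<^sub>\<Gamma> n \<Longrightarrow>
      twist_equiv \<Gamma> T\<^sub>\<Gamma> n (\<sigma> n c) (\<sigma> n d) \<Longrightarrow> c = d"
proof -
  have "\<exists>rep. (\<forall>c\<in>twist_isoclasses \<Gamma> T\<^sub>\<Gamma> n. irreducible_rep \<Gamma> T\<^sub>\<Gamma> n (rep c)) \<and>
      (\<forall>c\<in>twist_isoclasses \<Gamma> T\<^sub>\<Gamma> n. \<forall>d\<in>twist_isoclasses \<Gamma> T\<^sub>\<Gamma> n. twist_equiv \<Gamma> T\<^sub>\<Gamma> n (rep c) (rep d) \<longrightarrow> c = d)" for n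
    using twist_isoclass_representatives[OF group_GL2 topspace_GL2, of n] by metis
  then obtain rep where rep: "\<And>n c. c \<in> twist_isoclasses \<Gamma> T\<^sub>\<Gamma> n \<Longrightarrow> irreducible_rep \<Gamma> T\<^sub>\<Gamma> n (rep n c)"
    "\<And>n c d. c \<in> twist_isoclasses \<Gamma> T\<^sub>\<Gamma> n \<Longrightarrow> d \<in> twist_isoclasses \<Gamma> T\<^sub>\<Gamma> n \<Longrightarrow>
      twist_equiv \<Gamma> T\<^sub>\<Gamma> n (rep n c) (rep n d) \<Longrightarrow> c = d" by metis
  define W where "W n c p \<longleftrightarrow> irreducible_rep \<Gamma> T\<^sub>\<Gamma> n (snd p) \<and> twist_equiv \<Gamma> T\<^sub>\<Gamma> n (rep n c) (snd p) \<and>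
      trivial_at n (snd p) (fst p) \<and> q ^ fst p \<le> 2 * q * n" for n c and p :: "nat \<times> ('a mat2 \<Rightarrow> complex mat)"
  have ex: "\<exists>p. W n c p" if "c \<in> twist_isoclasses \<Gamma> T\<^sub>\<Gamma> n" for n c
    using minimal_level[OF rep(1)[OF that]] by (auto simp: W_def)
  have W: "W n c (SOME p. W n c p)" if "c \<in> twist_isoclasses \<Gamma> T\<^sub>\<Gamma> n" for n c
    by (rule someI_ex[OF ex[OF that]])
  define \<sigma> where "\<sigma> n c = snd (SOME p. W n c p)" for n c
  define lv where "lv n c = fst (SOME p. W n c p)" for n c
  have s: "irreducible_rep \<Gamma> T\<^sub>\<Gamma> n (\<sigma> n c) \<and>
      twist_equiv \<Gamma> T\<^sub>\<Gamma> n (rep n c) (\<sigma> n c) \<and> trivial_at n (\<sigma> n c) (lv n c) \<and> q ^ lv n c \<le> 2 * q * n"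
    if "c \<in> twist_isoclasses \<Gamma> T\<^sub>\<Gamma> n" for n c
    using W[OF that] by (simp only: \<sigma>_def lv_def W_def)
  have h: "\<rho> \<in> hom \<Gamma> (GL_complex n)" if "irreducible_rep \<Gamma> T\<^sub>\<Gamma> n \<rho>" for n \<rho>
    using that by (simp add: irreducible_rep_def cont_rep_def)
  show ?thesis
  proof (rule that[of \<sigma> lv])
    fix n c d assume c: "c \<in> twist_isoclasses \<Gamma> T\<^sub>\<Gamma> n" and d: "d \<in> twist_isoclasses \<Gamma> T\<^sub>\<Gamma> n"
      and eq: "twist_equiv \<Gamma> T\<^sub>\<Gamma> n (\<sigma> n c) (\<sigma> n d)"
    note hc = h[OF rep(1)[OF c]] h[OF rep(1)[OF d]] h[OF conjunct1[OF s[OF c]]] h[OF conjunct1[OF s[OF d]]]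
    have sd: "twist_equiv \<Gamma> T\<^sub>\<Gamma> n (\<sigma> n d) (rep n d)"
      using twist_equiv_sym[OF group_GL2 hc(2,4) topspace_GL2] s[OF d] by blast
    have "twist_equiv \<Gamma> T\<^sub>\<Gamma> n (rep n c) (\<sigma> n d)"
      using twist_equiv_trans[OF group_GL2 hc(1,3,4)] s[OF c] eq by blast
    hence "twist_equiv \<Gamma> T\<^sub>\<Gamma> n (rep n c) (rep n d)" by (rule twist_equiv_trans[OF group_GL2 hc(1,4,2) _ sd])
    thus "c = d" by (rule rep(2)[OF c d])
  qed (use s in auto)
qed

text \<open>There are at most of order \<open>q\<^sup>r\<close> twist isoclasses of level \<open>r\<close>, all of dimension at least a
  constant times \<open>q\<^sup>r\<close>, so the series is dominated by a geometric series in \<open>q\<^sup>1\<^sup>-\<^sup>s\<close>.\<close>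

lemma zeta_converges:
  assumes two: "\<one> \<oplus> \<one> \<noteq> \<zero>" and s: "s > 1"
  shows "twist_zeta_converges \<Gamma> T\<^sub>\<Gamma> s"
proof -
  obtain u e where u: "u \<in> Units R" "\<one> \<oplus> \<one> = u \<otimes> \<omega> [^] (e::nat)" using unit_power_form[OF _ two] by auto
  define K where "K = 16 * q ^ (e + 2)"
  let ?cl = "twist_isoclasses \<Gamma> T\<^sub>\<Gamma>"
  obtain \<sigma> lv where \<sigma>:
    "\<And>n c. c \<in> ?cl n \<Longrightarrow> irreducible_rep \<Gamma> T\<^sub>\<Gamma> n (\<sigma> n c)"
    "\<And>n c. c \<in> ?cl n \<Longrightarrow> trivial_at n (\<sigma> n c) (lv n c)"
    "\<And>n c. c \<in> ?cl n \<Longrightarrow> q ^ lv n c \<le> 2 * q * n"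
    "\<And>n c d. c \<in> ?cl n \<Longrightarrow> d \<in> ?cl n \<Longrightarrow> twist_equiv \<Gamma> T\<^sub>\<Gamma> n (\<sigma> n c) (\<sigma> n d) \<Longrightarrow> c = d"
    using leveled_representatives by blast
  have count: "card F \<le> K * q ^ r"
    if F: "finite F" "\<And>n c. (n, c) \<in> F \<Longrightarrow> c \<in> ?cl n \<and> lv n c = r" for F r
    unfolding K_def
  proof (rule level_family_card_le[OF u F(1), where n=fst and \<sigma>="\<lambda>i. \<sigma> (fst i) (snd i)"])
    fix i assume "i \<in> F"
    hence "snd i \<in> ?cl (fst i)" "lv (fst i) (snd i) = r" using F(2)[of "fst i" "snd i"] by auto
    thus "irreducible_rep \<Gamma> T\<^sub>\<Gamma> (fst i) (\<sigma> (fst i) (snd i))" "trivial_at (fst i) (\<sigma> (fst i) (snd i)) r"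
      "q ^ r \<le> 2 * q * fst i" using \<sigma>(1-3) by blast+
  next
    fix i j assume "i \<in> F" "j \<in> F" "fst i = fst j" "twist_equiv \<Gamma> T\<^sub>\<Gamma> (fst i) (\<sigma> (fst i) (snd i)) (\<sigma> (fst j) (snd j))"
    then obtain n c d where cd: "i = (n, c)" "j = (n, d)" "(n, c) \<in> F" "(n, d) \<in> F"
        "twist_equiv \<Gamma> T\<^sub>\<Gamma> n (\<sigma> n c) (\<sigma> n d)" by (cases i; cases j) auto
    thus "i = j" using \<sigma>(4)[OF _ _ cd(5)] F(2) by simp
  qed
  have fin: "finite (?cl n)" for n
  proof (rule conjunct1[OF finite_if_finite_subsets_card_bdd])
    fix F assume F: "F \<subseteq> ?cl n" "finite F"
    have lv: "lv n c \<le> 2 * q * n" if "c \<in> F" for c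
    proof -
      have "lv n c < q ^ lv n c" by (rule power_gt_expt) (use q_ge in simp)
      thus ?thesis using \<sigma>(3)[of c n] F(1) that by fastforce
    qed
    have "card F = (\<Sum>r\<le>2 * q * n. card {c \<in> F. lv n c = r})"
      using sum.group[OF F(2), of "{..2 * q * n}" "lv n" "\<lambda>_. 1::nat"] lv by (simp add: image_subset_iff)
    also have "\<dots> \<le> (\<Sum>r\<le>2 * q * n. K * q ^ r)"
    proof (rule sum_mono)
      fix r
      have "card (Pair n ` {c \<in> F. lv n c = r}) \<le> K * q ^ r" by (rule count) (use F in auto)
      thus "card {c \<in> F. lv n c = r} \<le> K * q ^ r" by (simp add: card_image inj_on_def)
    qed
    finally show "card F \<le> (\<Sum>r\<le>2 * q * n. K * q ^ r)" .
  qed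
  define x where "x = real q powr (1 - s)"
  have q0: "real q > 1" using q_ge by simp
  have x: "0 \<le> x" "x < 1" using s q0 by (auto simp: x_def powr_less_one)
  define w where "w r = (real q ^ r / (2 * real q)) powr (- s)" for r
  have w: "real (K * q ^ r) * w r = real K * (2 * real q) powr s * x ^ r" for r
  proof -
    have "w r = (real q ^ r) powr (- s) * (2 * real q) powr s"
      using q0 by (simp add: w_def powr_divide powr_minus field_simps)
    moreover have "real q ^ r * (real q ^ r) powr (- s) = x ^ r"
      using q0 by (simp add: x_def powr_realpow[symmetric] powr_powr powr_add[symmetric] algebra_simps)
    ultimately show ?thesis by (simp add: mult_ac)
  qed
  have tm: "real (Suc j) powr (- s) \<le> w (lv (Suc j) c)" if "c \<in> ?cl (Suc j)" for j c
    unfolding w_def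
  proof (rule powr_mono2')
    have "real (q ^ lv (Suc j) c) \<le> real (2 * q * Suc j)" using \<sigma>(3)[OF that] by (simp only: of_nat_le_iff)
    thus "real q ^ lv (Suc j) c / (2 * real q) \<le> real (Suc j)" using q0 by (simp add: field_simps)
  qed (use s q0 in auto)
  have "summable (\<lambda>j. real (twist_count \<Gamma> T\<^sub>\<Gamma> (Suc j)) * real (Suc j) powr (- s))"
  proof (rule summableI_nonneg_bounded)
    fix M
    define F where "F = (SIGMA j:{..<M}. ?cl (Suc j))"
    define lv' where "lv' = (\<lambda>(j, c). lv (Suc j) c)"
    have Ff: "finite F" unfolding F_def using fin by blast
    obtain L where L: "lv' ` F \<subseteq> {..<L}" using Ff finite_nat_iff_bounded[of "lv' ` F"] by blast
    have "(\<Sum>j<M. real (twist_count \<Gamma> T\<^sub>\<Gamma> (Suc j)) * real (Suc j) powr (- s)) =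
        (\<Sum>j<M. \<Sum>c\<in>?cl (Suc j). real (Suc j) powr (- s))" by (simp add: twist_count_def)
    also have "\<dots> = (\<Sum>(j, c)\<in>F. real (Suc j) powr (- s))" unfolding F_def by (rule sum.Sigma) (use fin in auto)
    also have "\<dots> \<le> (\<Sum>i\<in>F. w (lv' i))" by (rule sum_mono) (use tm in \<open>auto simp: F_def lv'_def\<close>)
    also have "\<dots> = (\<Sum>r<L. \<Sum>i\<in>{i \<in> F. lv' i = r}. w (lv' i))"
      by (rule sum.group[OF Ff _ L, symmetric]) simp
    also have "\<dots> = (\<Sum>r<L. real (card {i \<in> F. lv' i = r}) * w r)" by (intro sum.cong) auto
    also have "\<dots> \<le> (\<Sum>r<L. real (K * q ^ r) * w r)"
    proof (intro sum_mono mult_right_mono)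
      fix r
      have "card ((\<lambda>(j, c). (Suc j, c)) ` {i \<in> F. lv' i = r}) \<le> K * q ^ r"
        by (rule count) (use Ff in \<open>auto simp: F_def lv'_def\<close>)
      moreover have "inj_on (\<lambda>(j, c). (Suc j, c)) {i \<in> F. lv' i = r}" by (auto simp: inj_on_def)
      ultimately show "real (card {i \<in> F. lv' i = r}) \<le> real (K * q ^ r)" by (simp add: card_image del: of_nat_mult)
      show "0 \<le> w r" by (simp add: w_def)
    qed
    also have "\<dots> = real K * (2 * real q) powr s * (\<Sum>r<L. x ^ r)" by (simp add: w sum_distrib_left del: of_nat_mult)
    also have "\<dots> \<le> real K * (2 * real q) powr s * (\<Sum>r. x ^ r)"
      using x by (intro mult_left_mono sum_le_suminf summable_geometric) auto
    finally show "(\<Sum>j<M. real (twist_count \<Gamma> T\<^sub>\<Gamma> (Suc j)) * real (Suc j) powr (- s)) \<le>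
        real K * (2 * real q) powr s * (\<Sum>r. x ^ r)" .
  qed simp
  thus ?thesis unfolding twist_zeta_converges_def using fin by blast
qed

text \<open>The classes come from inflating the principal series of level \<open>r\<close>, all of which have the
  same dimension, the index of the Borel subgroup. A character of the big group that relates two
  of them is trivial on the kernel of reduction, as both representations are, hence is inflated
  too.\<close>

lemma twist_count_ge:
  assumes r: "r \<ge> 2"
  obtains N where "N > 0" "N \<le> 2 * q ^ r"
    "finite (twist_isoclasses \<Gamma> T\<^sub>\<Gamma> N) \<Longrightarrow> q ^ (r - 2) \<le> 2 * twist_count \<Gamma> T\<^sub>\<Gamma> N"
proof -
  interpret Sr: chain_ring "S r" "c r \<omega>" r q by (rule chain_ring_S)
  interpret h: group_surjection \<Gamma> "GL2 (S r)" "red r" by (rule red_surjection)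
  obtain N Q \<rho> where N: "N > 0" "N \<le> 2 * q ^ r" and Q: "finite Q" "q ^ (r - 2) \<le> card Q"
    and irr: "\<And>s::'a set \<Rightarrow> complex. s \<in> Q \<Longrightarrow> irr_rep (GL2 (S r)) N (\<rho> s)"
    and few: "\<And>s. s \<in> Q \<Longrightarrow> card {s' \<in> Q. \<exists>f. is_char (GL2 (S r)) f \<and> rep_iso (GL2 (S r)) N (\<rho> s) (twist f (\<rho> s'))} \<le> 2"
    using Sr.principal_series_family[OF r] by blast
  let ?A = "{\<rho>. irreducible_rep \<Gamma> T\<^sub>\<Gamma> N \<rho>}"
  let ?r = "{(\<rho>, \<sigma>). irreducible_rep \<Gamma> T\<^sub>\<Gamma> N \<rho> \<and> irreducible_rep \<Gamma> T\<^sub>\<Gamma> N \<sigma> \<and> twist_equiv \<Gamma> T\<^sub>\<Gamma> N \<rho> \<sigma>}"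
  have eq: "equiv ?A ?r" by (rule equiv_twist_equiv[OF group_GL2 topspace_GL2])
  define \<rho>' where "\<rho>' s = (\<lambda>g. \<rho> s (red r g))" for s
  have irr': "\<rho>' s \<in> ?A" if "s \<in> Q" for s
    using irr[OF that] h.irr_rep_inflate cont_rep_inflate[OF irr_repD(1)[OF irr[OF that]]]
    by (simp add: \<rho>'_def irreducible_rep_iff)
  define cls where "cls s = ?r `` {\<rho>' s}" for s
  have cls: "cls ` Q \<subseteq> twist_isoclasses \<Gamma> T\<^sub>\<Gamma> N"
    unfolding twist_isoclasses_def cls_def by (rule image_subsetI) (rule quotientI[OF irr'])
  have fibre: "card {s' \<in> Q. cls s' = cls s} \<le> 2" if s: "s \<in> Q" for s
  proof -
    have "{s' \<in> Q. cls s' = cls s} \<subseteq>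
        {s' \<in> Q. \<exists>f. is_char (GL2 (S r)) f \<and> rep_iso (GL2 (S r)) N (\<rho> s) (twist f (\<rho> s'))}"
    proof
      fix s' assume "s' \<in> {s' \<in> Q. cls s' = cls s}"
      hence s': "s' \<in> Q" "cls s = cls s'" by auto
      have "(\<rho>' s, \<rho>' s') \<in> ?r" using eq_equiv_class[OF s'(2)[unfolded cls_def] eq irr'[OF s'(1)]] .
      then obtain f where f: "is_char \<Gamma> f" "rep_iso \<Gamma> N (\<rho>' s) (twist f (\<rho>' s'))"
        unfolding mem_Collect_eq case_prod_conv twist_equiv_iff[OF group_GL2] by blast
      obtain A where A: "A \<in> carrier (GL_complex N)"
        "\<And>g. g \<in> carrier \<Gamma> \<Longrightarrow> A * \<rho>' s g = twist f (\<rho>' s') g * A" using f(2) unfolding rep_iso_def by blast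
      obtain B where B: "B \<in> carrier_mat N N" "A * B = 1\<^sub>m N" and Ac: "A \<in> carrier_mat N N"
        using A(1) by (auto simp: GL_complex_carrier_iff)
      have ker: "f g = 1" if g: "g \<in> carrier \<Gamma>" "red r g = \<one>\<^bsub>GL2 (S r)\<^esub>" for g
      proof -
        have "\<rho>' s g = 1\<^sub>m N" "\<rho>' s' g = 1\<^sub>m N"
          unfolding \<rho>'_def g(2) by (rule group.rep_one[OF Sr.group_GL2 irr_repD(1)[OF irr]], fact)+
        hence "A = f g \<cdot>\<^sub>m A" using A(2)[OF g(1)] Ac
          by (simp add: twist_def mult_smult_assoc_mat[of _ N N _ N] left_mult_one_mat[of _ N N] right_mult_one_mat[of _ N N])
        hence "A * B = (f g \<cdot>\<^sub>m A) * B" by simp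
        hence "1\<^sub>m N = f g \<cdot>\<^sub>m (1\<^sub>m N :: complex mat)" using Ac B by (simp add: mult_smult_assoc_mat[of _ N N _ N])
        hence "(1\<^sub>m N :: complex mat) $$ (0, 0) = (f g \<cdot>\<^sub>m (1\<^sub>m N)) $$ (0, 0)" by (rule arg_cong)
        thus "f g = 1" using N(1) by simp
      qed
      obtain f' where f': "is_char (GL2 (S r)) f'" "\<And>g. g \<in> carrier \<Gamma> \<Longrightarrow> f' (red r g) = f g"
        using h.is_char_deflate[OF f(1) ker] by blast
      have "rep_iso \<Gamma> N (\<lambda>g. \<rho> s (red r g)) (\<lambda>g. twist f' (\<rho> s') (red r g))"
        using f(2) f'(2) by (simp add: rep_iso_def twist_def \<rho>'_def)
      hence "rep_iso (GL2 (S r)) N (\<rho> s) (twist f' (\<rho> s'))" by (simp add: h.rep_iso_inflate)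
      thus "s' \<in> {s' \<in> Q. \<exists>f. is_char (GL2 (S r)) f \<and> rep_iso (GL2 (S r)) N (\<rho> s) (twist f (\<rho> s'))}"
        using s'(1) f'(1) by blast
    qed
    hence "card {s' \<in> Q. cls s' = cls s} \<le>
        card {s' \<in> Q. \<exists>f. is_char (GL2 (S r)) f \<and> rep_iso (GL2 (S r)) N (\<rho> s) (twist f (\<rho> s'))}"
      by (rule card_mono[rotated]) (use Q(1) in simp)
    thus ?thesis using few[OF s] by linarith
  qed
  have "card Q = (\<Sum>k\<in>cls ` Q. card {s \<in> Q. cls s = k})"
    using sum.group[OF Q(1), of "cls ` Q" cls "\<lambda>_. 1::nat"] Q(1) by simp
  also have "\<dots> \<le> (\<Sum>k\<in>cls ` Q. 2)" by (rule sum_mono) (use fibre in auto)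
  finally have cQ: "card Q \<le> 2 * card (cls ` Q)" by simp
  show ?thesis
  proof (rule that[OF N])
    assume "finite (twist_isoclasses \<Gamma> T\<^sub>\<Gamma> N)"
    hence "card (cls ` Q) \<le> twist_count \<Gamma> T\<^sub>\<Gamma> N" unfolding twist_count_def by (rule card_mono[OF _ cls])
    thus "q ^ (r - 2) \<le> 2 * twist_count \<Gamma> T\<^sub>\<Gamma> N" using cQ Q(2) by linarith
  qed
qed

text \<open>At the dimensions of the principal series the terms of the series are at least a constant
  times the power of \<open>q\<^sup>r\<close> with exponent \<open>1 - max s 0 > 0\<close>, so they are unbounded.\<close>

lemma zeta_diverges:
  assumes s: "s < 1"
  shows "\<not> twist_zeta_converges \<Gamma> T\<^sub>\<Gamma> s"
proof
  assume conv: "twist_zeta_converges \<Gamma> T\<^sub>\<Gamma> s"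
  define t where "t j = real (twist_count \<Gamma> T\<^sub>\<Gamma> (Suc j)) * real (Suc j) powr (- s)" for j
  have fin: "finite (twist_isoclasses \<Gamma> T\<^sub>\<Gamma> N)" if "N > 0" for N
    using conv that by (auto simp: twist_zeta_converges_def)
  have "summable t" using conv unfolding twist_zeta_converges_def t_def[abs_def] by blast
  hence "Bseq t" by (intro convergent_imp_Bseq) (use summable_LIMSEQ_zero in \<open>auto simp: convergent_def\<close>)
  then obtain K where K: "K > 0" "\<And>j. norm (t j) \<le> K" by (auto simp: Bseq_def)
  \<comment> \<open>for negative \<open>s\<close> the factor \<open>N\<^sup>-\<^sup>s\<close> is at least \<open>1\<close>\<close>
  define s0 where "s0 = max s 0"
  have s0: "0 \<le> s0" "s \<le> s0" "s0 < 1" using s by (auto simp: s0_def)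
  define x where "x = real q powr (1 - s0)"
  have q0: "real q > 1" using q_ge by simp
  have x: "x > 1" using s0 q0 by (simp add: x_def)
  define A where "A = 1 / (2 * (real q)\<^sup>2) * 2 powr (- s0)"
  have A: "A > 0" using q0 by (simp add: A_def)
  have le: "A * x ^ r \<le> K" if r: "r \<ge> 2" for r
  proof -
    obtain N where N: "N > 0" "N \<le> 2 * q ^ r" "q ^ (r - 2) \<le> 2 * twist_count \<Gamma> T\<^sub>\<Gamma> N"
      using twist_count_ge[OF r] fin by metis
    have c: "real q ^ r / (2 * (real q)\<^sup>2) \<le> real (twist_count \<Gamma> T\<^sub>\<Gamma> N)"
    proof -
      have "r = (r - 2) + 2" using r by simp
      hence "real q ^ r = real q ^ (r - 2) * (real q)\<^sup>2" by (metis power_add)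
      moreover have "real q ^ (r - 2) \<le> 2 * real (twist_count \<Gamma> T\<^sub>\<Gamma> N)"
        using N(3) by (metis of_nat_le_iff of_nat_mult of_nat_numeral of_nat_power)
      ultimately show ?thesis using q0 by (simp add: field_simps)
    qed
    have "(2 * real q ^ r) powr (- s0) \<le> real N powr (- s0)"
    proof (rule powr_mono2')
      have "real N \<le> real (2 * q ^ r)" using N(2) by (simp only: of_nat_le_iff)
      thus "real N \<le> 2 * real q ^ r" by simp
    qed (use N(1) s0 in auto)
    also have "\<dots> \<le> real N powr (- s)" using N(1) s0(2) by (intro powr_mono) auto
    finally have p: "(2 * real q ^ r) powr (- s0) \<le> real N powr (- s)" .
    have "A * x ^ r = (real q ^ r / (2 * (real q)\<^sup>2)) * (2 * real q ^ r) powr (- s0)"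
    proof -
      have "x ^ r = real q ^ r * (real q ^ r) powr (- s0)"
        using q0 by (simp add: x_def powr_realpow[symmetric] powr_powr powr_add[symmetric] algebra_simps)
      thus ?thesis using q0 by (simp add: A_def powr_mult)
    qed
    also have "\<dots> \<le> real (twist_count \<Gamma> T\<^sub>\<Gamma> N) * real N powr (- s)" by (intro mult_mono c p) auto
    also have "\<dots> = t (N - 1)" using N(1) by (simp add: t_def)
    also have "\<dots> \<le> K" using K(2)[of "N - 1"] by simp
    finally show ?thesis .
  qed
  obtain m where m: "K / A < x ^ m" using real_arch_pow[OF x] by blast
  have "x ^ m \<le> x ^ (m + 2)" using x by (intro power_increasing) auto
  hence "A * x ^ m \<le> A * x ^ (m + 2)" using A by (intro mult_left_mono) auto
  moreover have "K < A * x ^ m" using m A by (simp add: field_simps)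
  ultimately have "K < A * x ^ (m + 2)" by linarith
  thus False using le[of "m + 2"] by simp
qed

end


section \<open>The abscissa of convergence\<close>

lemma dvr_ringI:
  assumes "dvr R P" "finite (carrier (R Quot P))" "card (carrier (R Quot P)) = q"
  obtains \<omega> where "dvr_ring R P \<omega> q"
proof -
  interpret principal_domain R using assms(1) by (simp add: dvr_def)
  have max: "\<And>M. maximalideal M R \<longleftrightarrow> M = P" and nf: "\<not> field R" using assms(1) by (auto simp: dvr_def)
  have "ideal P R" using max maximalideal.axioms(1) by blast
  then obtain a where a: "a \<in> carrier R" "P = PIdl\<^bsub>R\<^esub> a" using exists_gen by blast
  have "a \<noteq> \<zero>\<^bsub>R\<^esub>"
  proof
    assume "a = \<zero>\<^bsub>R\<^esub>"
    hence "P = {\<zero>\<^bsub>R\<^esub>}" using a by (simp add: cgenideal_eq_genideal genideal_zero)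
    hence "field R" using max zeromaximalideal_fieldI by blast
    thus False using nf by simp
  qed
  hence "dvr_ring R P a q"
    by (intro dvr_ring.intro dvr_ring_axioms.intro principal_domain_axioms max a assms(2,3))
  thus ?thesis using that by blast
qed

lemma two_nonzero:
  assumes "ring R" "ring_char R = 0"
  shows "\<one>\<^bsub>R\<^esub> \<oplus>\<^bsub>R\<^esub> \<one>\<^bsub>R\<^esub> \<noteq> \<zero>\<^bsub>R\<^esub>"
proof
  interpret ring R by fact
  assume "\<one>\<^bsub>R\<^esub> \<oplus>\<^bsub>R\<^esub> \<one>\<^bsub>R\<^esub> = \<zero>\<^bsub>R\<^esub>"
  hence "(2::nat) > 0 \<and> [(2::nat)] \<cdot>\<^bsub>R\<^esub> \<one>\<^bsub>R\<^esub> = \<zero>\<^bsub>R\<^esub>" by (simp add: numeral_2_eq_2)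
  hence ex: "\<exists>n::nat. n > 0 \<and> [n] \<cdot>\<^bsub>R\<^esub> \<one>\<^bsub>R\<^esub> = \<zero>\<^bsub>R\<^esub>" by blast
  have "(LEAST n::nat. n > 0 \<and> [n] \<cdot>\<^bsub>R\<^esub> \<one>\<^bsub>R\<^esub> = \<zero>\<^bsub>R\<^esub>) > 0" using LeastI_ex[OF ex] by blast
  thus False using assms(2) ex by (simp add: ring_char_def)
qed

lemma d_dim_ge:
  assumes "q \<ge> 2" "r \<ge> 2"
  shows "q ^ r \<le> 2 * q * d_dim q r i"
proof -
  have 1: "q ^ r = q * q ^ (r - 1)" "q ^ r = q * (q * q ^ (r - 2))"
    using assms(2) by (simp_all flip: power_Suc add: Suc_diff_Suc numeral_2_eq_2)
  obtain k where k: "q = Suc (Suc k)" using assms(1) by (metis Suc_1 add_2_eq_Suc le_Suc_ex)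
  have "q \<le> q\<^sup>2 - 1" unfolding k by (simp add: power2_eq_square)
  hence "q * (q * q ^ (r - 2)) \<le> 2 * q * ((q\<^sup>2 - 1) * q ^ (r - 2))" by (simp add: mult_le_mono)
  moreover have "q * q ^ (r - 1) \<le> 2 * q * ((q + 1) * q ^ (r - 1))" "q * q ^ (r - 1) \<le> 2 * q * ((q - 1) * q ^ (r - 1))"
    using assms(1) by simp_all
  ultimately show ?thesis using 1 unfolding d_dim_def by auto
qed

theorem theorem4p18:
  fixes R :: "('a, 'b) ring_scheme" and P :: "'a set" and q :: nat
    and G :: "nat \<Rightarrow> 'a set mat2 monoid"
    and T :: "nat \<Rightarrow> 'a set mat2 topology"
  assumes "complete_dvr R P"
    and "ring_char R = 0"
    and "finite (carrier (R Quot P))"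
    and "card (carrier (R Quot P)) = q"
    and "ring_char (R Quot P) = 2"
  defines "G \<equiv> \<lambda>r. GL2 (R Quot (ideal_pow R P r))"
    and "T \<equiv> \<lambda>r. discrete_topology (carrier (G r))"
  shows "(\<forall>i\<in>{1, 2, 3}. \<exists>C::real. \<forall>r\<ge>2.
            finite (twist_isoclasses (G r) (T r) (d_dim q r i)) \<and>
            real (twist_count (G r) (T r) (d_dim q r i)) \<le> C * real q ^ r)
         \<and> twist_zeta_abscissa (GL2 R) (GL2_topology R P) = 1"
proof -
  have dvr: "dvr R P" using assms(1) by (simp add: complete_dvr_def)
  obtain \<omega> where "dvr_ring R P \<omega> q" by (rule dvr_ringI[OF dvr assms(3,4)])
  then interpret dvr_ring R P \<omega> q .
  have two: "\<one>\<^bsub>R\<^esub> \<oplus>\<^bsub>R\<^esub> \<one>\<^bsub>R\<^esub> \<noteq> \<zero>\<^bsub>R\<^esub>" by (rule two_nonzero[OF ring_axioms assms(2)])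
  obtain u e where u: "u \<in> Units R" "\<one>\<^bsub>R\<^esub> \<oplus>\<^bsub>R\<^esub> \<one>\<^bsub>R\<^esub> = u \<otimes>\<^bsub>R\<^esub> \<omega> [^]\<^bsub>R\<^esub> (e::nat)"
    using unit_power_form[OF _ two] by auto
  have "\<exists>C::real. \<forall>r\<ge>2. finite (twist_isoclasses (G r) (T r) (d_dim q r i)) \<and>
      real (twist_count (G r) (T r) (d_dim q r i)) \<le> C * real q ^ r" for i
  proof (intro exI[of _ "real (16 * q ^ (e + 2))"] allI impI)
    fix r :: nat assume r: "2 \<le> r"
    have "finite (twist_isoclasses (G r) (T r) (d_dim q r i)) \<and>
        card (twist_isoclasses (G r) (T r) (d_dim q r i)) \<le> 16 * q ^ (e + 2) * q ^ r"
      unfolding T_def G_def ideal_pow_eq by (rule finite_level_isoclasses[OF u d_dim_ge[OF q_ge r]])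
    moreover from this have "real (card (twist_isoclasses (G r) (T r) (d_dim q r i))) \<le> real (16 * q ^ (e + 2) * q ^ r)"
      by (simp only: of_nat_le_iff)
    ultimately show "finite (twist_isoclasses (G r) (T r) (d_dim q r i)) \<and>
        real (twist_count (G r) (T r) (d_dim q r i)) \<le> real (16 * q ^ (e + 2)) * real q ^ r"
      by (simp add: twist_count_def)
  qed
  moreover have "twist_zeta_abscissa (GL2 R) (GL2_topology R P) = 1"
  proof (rule antisym)
    show "twist_zeta_abscissa (GL2 R) (GL2_topology R P) \<le> 1"
    proof (rule ereal_le_epsilon2)
      fix \<epsilon> :: real assume "0 < \<epsilon>"
      hence "twist_zeta_converges (GL2 R) (GL2_topology R P) (1 + \<epsilon>)" by (intro zeta_converges[OF two]) simp
      hence "twist_zeta_abscissa (GL2 R) (GL2_topology R P) \<le> ereal (1 + \<epsilon>)"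
        unfolding twist_zeta_abscissa_def by (intro Inf_lower) blast
      thus "twist_zeta_abscissa (GL2 R) (GL2_topology R P) \<le> 1 + ereal \<epsilon>" by (simp add: one_ereal_def)
    qed
    show "1 \<le> twist_zeta_abscissa (GL2 R) (GL2_topology R P)"
      unfolding twist_zeta_abscissa_def
    proof (rule Inf_greatest)
      fix y assume "y \<in> {ereal s | s. twist_zeta_converges (GL2 R) (GL2_topology R P) s}"
      then obtain s where s: "y = ereal s" "twist_zeta_converges (GL2 R) (GL2_topology R P) s" by blast
      have "1 \<le> s" using zeta_diverges[of s] s(2) by force
      thus "1 \<le> y" using s(1) by simp
    qed
  qed
  ultimately show ?thesis by blast
qed

end
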